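(* Assume that $\mathcal{C}$ is closed under images, that the convergence condition for intertwining maps in $\mathcal{C}$ holds, and that $|z_1|>|z_2|>|z_0|>0$, where $z_0=z_1-z_2$. Let $W_1,W_2,W_3,W_4,M_1$ be objects of $\mathcal{C}$ and let $I_1$ and $I_2$ be $P(z_1)$- and $P(z_2)$-intertwining maps of types $\binom{W_4}{W_1M_1}$ and $\binom{M_1}{W_2W_3}$, respectively. Set $G=(I_1\circ(1_{W_1}\otimes I_2))':W_4'\to(W_1\otimes W_2\otimes W_3)^*$. Suppose that $W_1\boxtimes_{P(z_0)}W_2$ exists in $\mathcal{C}$ and that for each $w'_{(4)}\in W_4'$, $G(w'_{(4)})$ satisfies the $P^{(2)}(z_0)$-local grading restriction condition (or the $L(0)$-semisimple $P^{(2)}(z_0)$-local grading restriction condition when $\mathcal{C}$ is in $\mathcal{M}_{sg}$). For $w'_{(4)}\in W_4'$ and $w_{(3)}\in W_3$ let $\sum_{n\in\mathbb{R}}\lambda^{(2)}_n(w'_{(4)},w_{(3)})$ be the (unique) series weakly absolutely convergent to $\mu^{(2)}_{G(w'_{(4)}),w_{(3)}}\in(W_1\otimes W_2)^*$ as indicated in that condition. Suppose further that for each $n\in\mathbb{R}$, $w'_{(4)}\in W_4'$ and $w_{(3)}\in W_3$, the generalized $V$-submodule of $W^{(2)}_{G(w'_{(4)}),w_{(3)}}$ generated by $\lambda_n^{(2)}(w'_{(4)},w_{(3)})$ is a generalized $V$-submodule of some object of $\mathcal{C}$ included in $(W_1\otimes W_2)^*$. Let $\widetilde G:W_1\boxtimes_{P(z_0)}W_2\to(W_4'\otimes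 W_3)^*$ be the linear map $$\widetilde G(w)(w'_{(4)}\otimes w_{(3)})=\sum_{n\in\mathbb{R}}\langle w,\lambda_n^{(2)}(w'_{(4)},w_{(3)})\rangle$$ (a finite sum for each $w$). Then $\widetilde G$ intertwines the actions $\tau_{W_1\boxtimes_{P(z_0)}W_2}$ and $\tau_{Q(z_2)}$ of $V\otimes\iota_+\mathbb{C}[t,t^{-1},(z_2+t)^{-1}]$, and also the corresponding $\mathfrak{sl}(2)$-actions, on $W_1\boxtimes_{P(z_0)}W_2$ and on $(W_4'\otimes W_3)^*$; that is, for all $v\in V$, $w\in W_1\boxtimes_{P(z_0)}W_2$, $w'_{(4)}\in W_4'$, $w_{(3)}\in W_3$, $$z_2^{-1}\delta\Bigl(\frac{x_1-x_0}{z_2}\Bigr)\widetilde G(Y_{P(z_0)}(v,x_0)w)=\tau_{Q(z_2)}\Bigl(z_2^{-1}\delta\Bigl(\frac{x_1-x_0}{z_2}\Bigr)Y_t(v,x_0)\Bigr)\widetilde G(w)$$ and $\widetilde G(L(j)w)=L'_{Q(z_2)}(j)\widetilde G(w)$ for $j=-1,0,1$.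
   Context: CONVENTIONS. Vector spaces are over $\mathbb{C}$, $\mathbb{N}=\{0,1,2,\dots\}$, $\delta(x)=\sum_{n\in\mathbb{Z}}x^n$; powers of binomials (also inside $\delta$) are expanded in nonnegative integral powers of the second term; $\mathrm{Res}_x$ is the coefficient of $x^{-1}$. Throughout $z_0=z_1-z_2$. ALGEBRA AND MODULES. $A$ is an abelian group and $\tilde A$ an abelian group containing $A$ as a subgroup. $V$ is a strongly $A$-graded Möbius or conformal vertex algebra: $V=\coprod_{n\in\mathbb{Z}}V_{(n)}$ is a vertex algebra (vertex operators $Y(v,x)=\sum_m v_mx^{-m-1}$, vacuum $\mathbf 1\in V_{(0)}$, with lower truncation, vacuum and creation properties, Jacobi identity) with operators $L(-1),L(0),L(1)$ satisfying $[L(m),L(n)]=(m-n)L(m+n)$, $L(0)|_{V_{(n)}}=n$, $Y(L(-1)v,x)=\frac{d}{dx}Y(v,x)$, $[L(j),Y(v,x)]=\sum_{i=0}^{j+1}\binom{j+1}{i}x^{j+1-i}Y(L(i-1)v,x)$ ($j=-1,0,1$); in the conformal case these come from a conformal vector $\omega\in V_{(2)}$ whose components $L(n)=\omega_{n+1}$ satisfy the Virasoro relations. Also $V=\coprod_{\alpha\in A}V^{(\alpha)}$ compatibly with the $\mathbb{Z}$-grading, $V^{(\alpha)}_{(n)}=V_{(n)}\cap V^{(\alpha)}$ is finite-dimensional and is $0$ for $n$ sufficiently negative ($\alpha$ fixed), $\mathbf 1\in V^{(0)}$ (and $\omega\in V^{(0)}$), $v_mV^{(\beta)}\subset V^{(\alpha+\beta)}$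 for $v\in V^{(\alpha)}$, and $L(j)V^{(\alpha)}\subset V^{(\alpha)}$. A generalized $V$-module is $W=\coprod_{n\in\mathbb{C}}W_{[n]}$ ($W_{[n]}$ the generalized $L(0)$-eigenspace for $n$) with vertex operators $Y_W(v,x)$, $Y_W(v,x)w\in W((x))$, $Y_W(\mathbf 1,x)=1$, Jacobi identity, and operators $L(j)$, $j=-1,0,1$, with the same bracket relations and $L(-1)$-derivative property (components of $Y_W(\omega,x)$ in the conformal case); it is a $V$-module if $L(0)$ is semisimple. All generalized modules are strongly $\tilde A$-graded: $W=\coprod_{\beta\in\tilde A}W^{(\beta)}$ compatibly with the weight grading, $\dim W^{(\beta)}_{[n]}<\infty$, $W^{(\beta)}_{[n+k]}=0$ for $k\in\mathbb{Z}$ sufficiently negative, $v_mW^{(\beta)}\subset W^{(\alpha+\beta)}$ for $v\in V^{(\alpha)}$, $L(j)W^{(\beta)}\subset W^{(\beta)}$. Module maps commute with all these operators and preserve the $\tilde A$-grading. $\overline W=\prod_nW_{[n]}$, with projections $\pi_n:\overline W\to W_{[n]}$. The contragredient is $W'=\coprod_{\beta,n}(W')^{(\beta)}_{[n]}$, $(W')^{(\beta)}_{[n]}=(W^{(-\beta)}_{[n]})^*$, with $\langle Y'(v,x)w',w\rangle=\langle w',Y^o_W(v,x)w\rangle$, $Y^o_W(v,x)=Y_W(e^{xL(1)}(-x^{-2})^{L(0)}v,x^{-1})$, $\langle L'(j)w',w\rangle=\langle w',L(-j)w\rangle$; $\langle\cdot,\cdot\rangle$ also pairs $W'$ with $\overline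 W$. CATEGORY. $\mathcal{M}_{sg}$ (resp. $\mathcal{GM}_{sg}$) is the category of strongly $\tilde A$-graded $V$-modules (resp. generalized $V$-modules). $\mathcal{C}$ is a full subcategory of $\mathcal{M}_{sg}$ or $\mathcal{GM}_{sg}$, closed under contragredients and finite direct sums; for each object the (generalized) weights are real and $(L(0)-L(0)_s)^K=0$ for some $K\in\mathbb{Z}_+$, where $L(0)_s$ is the semisimple part of $L(0)$. Closed under images means: the image of any module map from an object of $\mathcal{C}$ to a generalized module is in $\mathcal{C}$. INTERTWINING MAPS. A $P(z)$-intertwining map of type $\binom{W_3}{W_1W_2}$ ($z\in\mathbb{C}^\times$) is a linear map $I:W_1\otimes W_2\to\overline{W_3}$ with $I(W_1^{(\beta)}\otimes W_2^{(\gamma)})\subset\overline{W_3^{(\beta+\gamma)}}$; $\pi_{n-m}I(w_{(1)}\otimes w_{(2)})=0$ for $m\in\mathbb{N}$ sufficiently large (each $n,w_{(1)},w_{(2)}$); $x_0^{-1}\delta(\frac{x_1-z}{x_0})Y_3(v,x_1)I(w_{(1)}\otimes w_{(2)})=z^{-1}\delta(\frac{x_1-x_0}{z})I(Y_1(v,x_0)w_{(1)}\otimes w_{(2)})+x_0^{-1}\delta(\frac{z-x_1}{-x_0})I(w_{(1)}\otimes Y_2(v,x_1)w_{(2)})$; and $L(j)I(w_{(1)}\otimes w_{(2)})=I(w_{(1)}\otimes L(j)w_{(2)})+\sum_{i=0}^{j+1}\binom{j+1}{i}z^iI(L(j-i)w_{(1)}\otimes w_{(2)})$, $j=-1,0,1$.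 CONVERGENCE CONDITION. For all objects $W_1,\dots,W_4,M_1$ of $\mathcal{C}$, $|z_1|>|z_2|>0$, $P(z_1)$- and $P(z_2)$-intertwining maps $I_1,I_2$ of types $\binom{W_4}{W_1M_1},\binom{M_1}{W_2W_3}$, the series $\sum_n\langle w'_{(4)},I_1(w_{(1)}\otimes\pi_n(I_2(w_{(2)}\otimes w_{(3)})))\rangle$ converges absolutely for all vectors; equivalently, for $|z_2|>|z_0|>0$ and $P(z_2)$- and $P(z_0)$-intertwining maps $I^1,I^2$ of types $\binom{W_4}{M_2W_3},\binom{M_2}{W_1W_2}$, $\sum_n\langle w'_{(4)},I^1(\pi_n(I^2(w_{(1)}\otimes w_{(2)}))\otimes w_{(3)})\rangle$ converges absolutely. The first sums define the product $I_1\circ(1_{W_1}\otimes I_2):W_1\otimes W_2\otimes W_3\to\overline{W_4}$. For such a map $F$, $F':W_4'\to(W_1\otimes W_2\otimes W_3)^*$ is $F'(w')(u)=\langle w',F(u)\rangle$. DUAL SPACES. For generalized modules $U_1,U_2$ and $z\in\mathbb{C}^\times$, define on $\nu\in(U_1\otimes U_2)^*$: $(Y'_{P(z)}(v,x)\nu)(u_1\otimes u_2)=\nu(u_1\otimes Y^o_{U_2}(v,x)u_2)+\mathrm{Res}_{x_1}z^{-1}\delta(\frac{x^{-1}-x_1}{z})\nu(Y_{U_1}(e^{xL(1)}(-x^{-2})^{L(0)}v,x_1)u_1\otimes u_2)$ and, for $j=-1,0,1$, $(L'_{P(z)}(j)\nu)(u_1\otimes u_2)=\nu(u_1\otimes L(-j)u_2)+\sum_{i=0}^{1-j}\binom{1-j}{i}z^i\nu(L(-j-i)u_1\otimes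 u_2)$. $((U_1\otimes U_2)^* )^{(\beta)}$ is the set of $\nu$ vanishing on $U_1^{(\beta_1)}\otimes U_2^{(\beta_2)}$ whenever $\beta_1+\beta_2\ne-\beta$; the subscript $[n]$ (resp. $(n)$) denotes its subspace of generalized (resp. ordinary) eigenvectors of $L'_{P(z)}(0)$ with eigenvalue $n$. $\nu$ satisfies the $P(z)$-compatibility condition if (a) $Y'_{P(z)}(v,x)\nu$ has only finitely many negative powers of $x$ for each $v$, and (b) for all $v,u_1,u_2$: $z^{-1}\delta(\frac{x^{-1}-x_1}{z})\nu(Y_{U_1}(e^{xL(1)}(-x^{-2})^{L(0)}v,x_1)u_1\otimes u_2)+x_1^{-1}\delta(\frac{z-x^{-1}}{-x_1})\nu(u_1\otimes Y^o_{U_2}(v,x)u_2)=x_1^{-1}\delta(\frac{x^{-1}-z}{x_1})(Y'_{P(z)}(v,x)\nu)(u_1\otimes u_2)$. An object of $\mathcal{C}$ included in $(U_1\otimes U_2)^*$ is an object of $\mathcal{C}$ that is a doubly graded subspace of $\coprod_{n,\beta}((U_1\otimes U_2)^* )^{(\beta)}_{[n]}$, with structure given by restricting $Y'_{P(z)}$, $L'_{P(z)}(j)$, all of whose elements satisfy the $P(z)$-compatibility condition. $Q(z)$-ACTION. $Y_t(v,x)=\sum_{n\in\mathbb{Z}}(v\otimes t^n)x^{-n-1}$, and $\iota_+$ means expansion in nonnegative powers of $t$. The action $\tau_{Q(z)}$ of $V\otimes\iota_+\mathbb{C}[t,t^{-1},(z+t)^{-1}]$ on $(U_1\otimes U_2)^*$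 is given by $(\tau_{Q(z)}(z^{-1}\delta(\frac{x_1-x_0}{z})Y_t(v,x_0))\nu)(u_1\otimes u_2)=x_0^{-1}\delta(\frac{x_1-z}{x_0})\nu(Y^o_{U_1}(v,x_1)u_1\otimes u_2)-x_0^{-1}\delta(\frac{z-x_1}{-x_0})\nu(u_1\otimes Y_{U_2}(v,x_1)u_2)$, and $(L'_{Q(z)}(j)\nu)(u_1\otimes u_2)=\sum_{i=0}^{j+1}\binom{j+1}{i}(-z)^i[\nu(L(i-j)u_1\otimes u_2)-\nu(u_1\otimes L(j-i)u_2)]$, $j=-1,0,1$ (here $U_1=W_4'$, $U_2=W_3$). On a generalized module $W$, $\tau_W(z^{-1}\delta(\frac{x_1-x_0}{z})Y_t(v,x_0))=z^{-1}\delta(\frac{x_1-x_0}{z})Y_W(v,x_0)$. LOCAL GRADING RESTRICTION CONDITION. For $\lambda\in(W_1\otimes W_2\otimes W_3)^*$ put $\mu^{(2)}_{\lambda,w_{(3)}}=\lambda(\cdot\otimes\cdot\otimes w_{(3)})\in(W_1\otimes W_2)^*$. $\lambda$ satisfies the $P^{(2)}(z)$-local grading restriction condition if for every $w_{(3)}\in W_3$: (a) there are $\lambda^{(2)}_n\in\coprod_\beta((W_1\otimes W_2)^* )^{(\beta)}_{[n]}$ ($n\in\mathbb{R}$), an open neighborhood of $0\in\mathbb{C}$ and $N\in\mathbb{N}$ such that for all $w_{(1)},w_{(2)}$ the series $\sum_n(e^{z'L'_{P(z)}(0)}\lambda^{(2)}_n)(w_{(1)}\otimes w_{(2)})$ can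 be written as $\sum_ne^{nz'}\bigl(\sum_{i=0}^N\frac{(z')^i}{i!}((L'_{P(z)}(0)-n)^i\lambda^{(2)}_n)(w_{(1)}\otimes w_{(2)})\bigr)$, converges absolutely (as a series over $n$) for $z'$ in the neighborhood, and at $z'=0$ has sum $\mu^{(2)}_{\lambda,w_{(3)}}(w_{(1)}\otimes w_{(2)})$; (b) the smallest doubly graded (weight and $\tilde A$) subspace $W^{(2)}_{\lambda,w_{(3)}}$ of $\coprod_{n\in\mathbb{R},\beta}((W_1\otimes W_2)^* )^{(\beta)}_{[n]}$ containing all $\lambda^{(2)}_n$ and stable under the coefficients of all $Y'_{P(z)}(v,x)$ and under $L'_{P(z)}(j)$, $j=-1,0,1$, satisfies $\dim(W^{(2)}_{\lambda,w_{(3)}})^{(\beta)}_{[n]}<\infty$ and $(W^{(2)}_{\lambda,w_{(3)}})^{(\beta)}_{[n+k]}=0$ for $k\in\mathbb{Z}$ sufficiently negative. The $L(0)$-semisimple version replaces $[n]$ by $(n)$ (so $N=0$). TENSOR PRODUCT. A $P(z)$-tensor product of $W_1,W_2$ in $\mathcal{C}$ is an object $W_1\boxtimes_{P(z)}W_2$ of $\mathcal{C}$ with a $P(z)$-intertwining map $\boxtimes_{P(z)}$ of type $\binom{W_1\boxtimes_{P(z)}W_2}{W_1W_2}$ through which every $P(z)$-intertwining map of type $\binom{W}{W_1W_2}$, $W$ in $\mathcal{C}$, factors by a unique module map. Let $\mathcal{D}_{P(z)}(W_1,W_2)\subset(W_1\otimes W_2)^*$ be the union of the images $I'(W')$, $I'(w')(w_{(1)}\otimes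 w_{(2)})=\langle w',I(w_{(1)}\otimes w_{(2)})\rangle$, over objects $W$ of $\mathcal{C}$ and $P(z)$-intertwining maps $I$ of type $\binom{W}{W_1W_2}$. Since $\mathcal{C}$ is closed under images, if the tensor product exists then $\mathcal{D}_{P(z)}(W_1,W_2)$ with $Y'_{P(z)}$, $L'_{P(z)}(j)$ is an object of $\mathcal{C}$ and one takes $W_1\boxtimes_{P(z)}W_2=\mathcal{D}_{P(z)}(W_1,W_2)'$, with vertex operator map $Y_{P(z)}$ and $\langle\nu,\boxtimes_{P(z)}(w_{(1)}\otimes w_{(2)})\rangle=\nu(w_{(1)}\otimes w_{(2)})$ for $\nu\in\mathcal{D}_{P(z)}(W_1,W_2)$. Under the hypotheses of the claim each $\lambda_n^{(2)}(w'_{(4)},w_{(3)})$ lies in $\mathcal{D}_{P(z_0)}(W_1,W_2)$, has generalized weight $n$ and is bilinear in $(w'_{(4)},w_{(3)})$, and $\langle w,\lambda_n^{(2)}\rangle$ is the pairing of $W_1\boxtimes_{P(z_0)}W_2$ with $\mathcal{D}_{P(z_0)}(W_1,W_2)$. *)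

theory Defs
  imports
    "HOL-Analysis.Analysis"
    "HOL-Library.Function_Algebras"
    "HOL-Library.Groups_Big_Fun"
begin

section \<open>Complex vector spaces\<close>

class complex_vector = ab_group_add +
  fixes scaleC :: "complex \<Rightarrow> 'a \<Rightarrow> 'a" (infixr "*\<^sub>C" 75)
  assumes scaleC_add_right: "c *\<^sub>C (x + y) = c *\<^sub>C x + c *\<^sub>C y"
    and scaleC_add_left: "(b + c) *\<^sub>C x = b *\<^sub>C x + c *\<^sub>C x"
    and scaleC_scaleC: "b *\<^sub>C c *\<^sub>C x = (b * c) *\<^sub>C x"
    and scaleC_one: "1 *\<^sub>C x = x"

instantiation complex :: complex_vector
begin
definition scaleC_complex :: "complex \<Rightarrow> complex \<Rightarrow> complex" where
  "scaleC_complex c x = c * x"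
instance by standard (simp_all add: scaleC_complex_def algebra_simps)
end

instantiation "fun" :: (type, complex_vector) complex_vector
begin
definition scaleC_fun :: "complex \<Rightarrow> ('a \<Rightarrow> 'b) \<Rightarrow> 'a \<Rightarrow> 'b" where
  "scaleC_fun c f = (\<lambda>x. c *\<^sub>C f x)"
instance
  by standard (auto simp: scaleC_fun_def scaleC_add_right scaleC_add_left scaleC_scaleC scaleC_one)
end

instantiation prod :: (complex_vector, complex_vector) complex_vector
begin
definition scaleC_prod :: "complex \<Rightarrow> 'a \<times> 'b \<Rightarrow> 'a \<times> 'b" where
  "scaleC_prod c p = (c *\<^sub>C fst p, c *\<^sub>C snd p)"
instance
  by standard
    (auto simp: scaleC_prod_def scaleC_add_right scaleC_add_left scaleC_scaleC scaleC_one
       plus_prod_def)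
end

global_interpretation complex_vector: vector_space "scaleC :: complex \<Rightarrow> 'a \<Rightarrow> 'a::complex_vector"
  by unfold_locales (rule scaleC_add_right scaleC_add_left scaleC_scaleC scaleC_one)+

abbreviation csubspace :: "'a::complex_vector set \<Rightarrow> bool" where
  "csubspace \<equiv> module.subspace scaleC"

abbreviation cspan :: "'a::complex_vector set \<Rightarrow> 'a set" where
  "cspan \<equiv> module.span scaleC"

text \<open>
  Modules are carried by subspaces of a type, and so a map between them is a function on the
  ambient type of which only the values on the carrier matter.  Spaces of linear, bilinear and
  trilinear forms, on the other hand, are honest sets of functions: a form is required to vanish as
  soon as one of its arguments lies outside the carrier.
\<close>

definition linear_map_on ::
  "'a::complex_vector set \<Rightarrow> 'b::complex_vector set \<Rightarrow> ('a \<Rightarrow> 'b) \<Rightarrow> bool" where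
  "linear_map_on S T f \<longleftrightarrow>
     (\<forall>x\<in>S. f x \<in> T) \<and> (\<forall>x\<in>S. \<forall>y\<in>S. f (x + y) = f x + f y) \<and> (\<forall>c. \<forall>x\<in>S. f (c *\<^sub>C x) = c *\<^sub>C f x)"

definition fin_dim :: "'a::complex_vector set \<Rightarrow> bool" where
  "fin_dim S \<longleftrightarrow> (\<exists>B. finite B \<and> S \<subseteq> cspan B)"

definition decomposition :: "('i \<Rightarrow> 'a::complex_vector set) \<Rightarrow> 'a \<Rightarrow> ('i \<Rightarrow> 'a) \<Rightarrow> bool" where
  "decomposition F x c \<longleftrightarrow> (\<forall>i. c i \<in> F i) \<and> finite {i. c i \<noteq> 0} \<and> x = Sum_any c"

definition is_direct_sum :: "'a::complex_vector set \<Rightarrow> ('i \<Rightarrow> 'a set) \<Rightarrow> bool" where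
  "is_direct_sum S F \<longleftrightarrow> csubspace S \<and> (\<forall>i. csubspace (F i) \<and> F i \<subseteq> S) \<and>
     (\<forall>x\<in>S. \<exists>!c. decomposition F x c)"

definition component :: "('i \<Rightarrow> 'a::complex_vector set) \<Rightarrow> 'i \<Rightarrow> 'a \<Rightarrow> 'a" where
  "component F i x = (THE c. decomposition F x c) i"

definition shift_op :: "('a::complex_vector \<Rightarrow> 'a) \<Rightarrow> complex \<Rightarrow> 'a \<Rightarrow> 'a" where
  "shift_op T n x = T x - n *\<^sub>C x"

definition gen_eigenspace :: "'a::complex_vector set \<Rightarrow> ('a \<Rightarrow> 'a) \<Rightarrow> complex \<Rightarrow> 'a set" where
  "gen_eigenspace S T n = {x\<in>S. \<exists>k. (shift_op T n ^^ k) x = 0}"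

definition eigenspace :: "'a::complex_vector set \<Rightarrow> ('a \<Rightarrow> 'a) \<Rightarrow> complex \<Rightarrow> 'a set" where
  "eigenspace S T n = {x\<in>S. T x = n *\<^sub>C x}"

definition is_subgroup :: "'g::ab_group_add set \<Rightarrow> bool" where
  "is_subgroup A \<longleftrightarrow> 0 \<in> A \<and> (\<forall>a\<in>A. \<forall>b\<in>A. a + b \<in> A) \<and> (\<forall>a\<in>A. - a \<in> A)"


section \<open>Formal delta functions\<close>

text \<open>
  Formal series are given by their coefficients, and products of formal series by
  \<^const>\<open>Sum_any\<close>, the sum over the (finite) set of nonzero terms.

  \<^term>\<open>delta_coeff a b c\<close> is the coefficient of $x_0^a x_1^b x_2^c$ in
  $x_0^{-1}\delta((x_1-x_2)/x_0) = \sum_n x_0^{-n-1} \sum_{i\ge 0} \binom{n}{i} x_1^{n-i}(-x_2)^i$,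
  that is $n = -a-1$ and $i = c$, and \<^term>\<open>delta_neg_coeff a b c\<close> the one in
  $x_0^{-1}\delta((x_1-x_2)/(-x_0))$.
\<close>

definition delta_coeff :: "int \<Rightarrow> int \<Rightarrow> int \<Rightarrow> complex" where
  "delta_coeff a b c =
     (if 0 \<le> c \<and> b = (- a - 1) - c then (of_int (- a - 1) gchoose nat c) * (-1) ^ nat c else 0)"

definition delta_neg_coeff :: "int \<Rightarrow> int \<Rightarrow> int \<Rightarrow> complex" where
  "delta_neg_coeff a b c = (-1) powi (- a - 1) * delta_coeff a b c"

text \<open>
  One of the three variables replaced by a nonzero number; as the series is homogeneous of degree
  $-1$, the exponent of this number is determined by the other two:
  the coefficient of $y_1^b y_2^c$ in $z^{-1}\delta((y_1-y_2)/z)$,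
  the coefficient of $y_0^a y_1^b$ in $y_0^{-1}\delta((y_1-z)/y_0)$, and
  the coefficient of $y_0^a y_2^c$ in $y_0^{-1}\delta((z-y_2)/(-y_0))$.
\<close>

definition delta_den :: "complex \<Rightarrow> int \<Rightarrow> int \<Rightarrow> complex" where
  "delta_den z b c = z powi (- 1 - b - c) * delta_coeff (- 1 - b - c) b c"

definition delta_snd :: "complex \<Rightarrow> int \<Rightarrow> int \<Rightarrow> complex" where
  "delta_snd z a b = z powi (- 1 - a - b) * delta_coeff a b (- 1 - a - b)"

definition delta_fst_neg :: "complex \<Rightarrow> int \<Rightarrow> int \<Rightarrow> complex" where
  "delta_fst_neg z a c = z powi (- 1 - a - c) * delta_neg_coeff a (- 1 - a - c) c"

text \<open>The coefficient of $x_0^p x_1^q$ in $z^{-1}\delta((x_1-x_0)/z) \sum_m f_m x_0^{-m-1}$.\<close>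

definition delta_mult :: "complex \<Rightarrow> (int \<Rightarrow> 'a::complex_vector) \<Rightarrow> int \<Rightarrow> int \<Rightarrow> 'a" where
  "delta_mult z f p q = Sum_any (\<lambda>c. delta_den z q c *\<^sub>C f (c - p - 1))"


section \<open>Strongly graded vertex algebras and generalized modules\<close>

text \<open>
  The vertex algebra is carried by a whole type.  \<^term>\<open>vop V v m u\<close> is $v_m u$; the field
  \<^term>\<open>conf\<close> is \<^term>\<open>None\<close> for a Moebius vertex algebra and \<^term>\<open>Some \<omega>\<close> for a conformal one
  with conformal vector \<open>\<omega>\<close>.  Only the values of \<open>Lv\<close>, and of \<open>Lm\<close> below, at $-1,0,1$ matter.  The
  type \<open>'g\<close> is the big grading group, and the grading group of the algebra is a subgroup \<open>A\<close> of it.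
\<close>

record ('v, 'g) valg =
  vop :: "'v \<Rightarrow> int \<Rightarrow> 'v \<Rightarrow> 'v"
  vac :: 'v
  Lv :: "int \<Rightarrow> 'v \<Rightarrow> 'v"
  wtv :: "int \<Rightarrow> 'v set"
  grv :: "'g \<Rightarrow> 'v set"
  conf :: "'v option"

record ('v, 'g, 'w) vmod =
  carr :: "'w set"
  act :: "'v \<Rightarrow> int \<Rightarrow> 'w \<Rightarrow> 'w"
  Lm :: "int \<Rightarrow> 'w \<Rightarrow> 'w"
  grm :: "'g \<Rightarrow> 'w set"

text \<open>
  Jacobi identity: the coefficients of $x_0^p x_1^q x_2^r$ in
  $x_0^{-1}\delta((x_1-x_2)/x_0)Y(u,x_1)Y(v,x_2)w - x_0^{-1}\delta((x_2-x_1)/(-x_0))Y(v,x_2)Y(u,x_1)w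
   = x_2^{-1}\delta((x_1-x_0)/x_2)Y(Y(u,x_0)v,x_2)w$.
  The coefficient of $x^k$ in $Y(u,x)$ is $u_{-k-1}$.
\<close>

definition jacobi ::
  "('v::complex_vector, 'g) valg \<Rightarrow> 'w::complex_vector set \<Rightarrow> ('v \<Rightarrow> int \<Rightarrow> 'w \<Rightarrow> 'w) \<Rightarrow> bool" where
  "jacobi V S Y \<longleftrightarrow> (\<forall>u v. \<forall>w\<in>S. \<forall>p q r.
     Sum_any (\<lambda>(b, c). delta_coeff p b c *\<^sub>C Y u (b - q - 1) (Y v (c - r - 1) w)) -
     Sum_any (\<lambda>(b, c). delta_neg_coeff p b c *\<^sub>C Y v (b - r - 1) (Y u (c - q - 1) w)) =
     Sum_any (\<lambda>(a, c). delta_coeff a q c *\<^sub>C Y (vop V u (c - p - 1) v) (a - r - 1) w))"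

text \<open>
  The relations $[L(m),L(n)]=(m-n)L(m+n)$,
  $[L(j),Y(v,x)]=\sum_{i=0}^{j+1}\binom{j+1}{i}x^{j+1-i}Y(L(i-1)v,x)$ and
  $Y(L(-1)v,x)=\frac{d}{dx}Y(v,x)$ for $m,n,j\in\{-1,0,1\}$, the latter two by the coefficients of
  $x^{-m-1}$.
\<close>

definition sl2_relations ::
  "('v::complex_vector, 'g) valg \<Rightarrow> 'w::complex_vector set \<Rightarrow> ('v \<Rightarrow> int \<Rightarrow> 'w \<Rightarrow> 'w) \<Rightarrow>
   (int \<Rightarrow> 'w \<Rightarrow> 'w) \<Rightarrow> bool" where
  "sl2_relations V S Y L \<longleftrightarrow>
     (\<forall>m\<in>{-1,0,1}. \<forall>n\<in>{-1,0,1}. \<forall>w\<in>S.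
        L m (L n w) - L n (L m w) = of_int (m - n) *\<^sub>C L (m + n) w) \<and>
     (\<forall>j\<in>{-1,0,1}. \<forall>v m. \<forall>w\<in>S.
        L j (Y v m w) - Y v m (L j w) =
        (\<Sum>i = 0..nat (j + 1).
           of_nat (nat (j + 1) choose i) *\<^sub>C Y (Lv V (int i - 1) v) (m + j + 1 - int i) w)) \<and>
     (\<forall>v m. \<forall>w\<in>S. Y (Lv V (- 1) v) m w = of_int (- m) *\<^sub>C Y v (m - 1) w)"

definition virasoro_relations :: "(int \<Rightarrow> 'v::complex_vector \<Rightarrow> 'v) \<Rightarrow> bool" where
  "virasoro_relations L \<longleftrightarrow> (\<exists>c. \<forall>m n v.
     L m (L n v) - L n (L m v) =
     of_int (m - n) *\<^sub>C L (m + n) v +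
     (if m + n = 0 then (of_int (m ^ 3 - m) / 12 * c) *\<^sub>C v else 0))"

definition strongly_graded_vertex_algebra ::
  "'g::ab_group_add set \<Rightarrow> ('v::complex_vector, 'g) valg \<Rightarrow> bool" where
  "strongly_graded_vertex_algebra A V \<longleftrightarrow>
     (\<forall>u m. linear_map_on UNIV UNIV (vop V u m)) \<and>
     (\<forall>m w. linear_map_on UNIV UNIV (\<lambda>u. vop V u m w)) \<and>
     (\<forall>u w. \<exists>N. \<forall>m\<ge>N. vop V u m w = 0) \<and>
     (\<forall>m w. vop V (vac V) m w = (if m = - 1 then w else 0)) \<and>
     (\<forall>v. vop V v (- 1) (vac V) = v \<and> (\<forall>m\<ge>0. vop V v m (vac V) = 0)) \<and>
     jacobi V UNIV (vop V) \<and>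
     is_direct_sum UNIV (wtv V) \<and> vac V \<in> wtv V 0 \<and>
     (\<forall>j\<in>{-1,0,1}. linear_map_on UNIV UNIV (Lv V j)) \<and>
     sl2_relations V UNIV (vop V) (Lv V) \<and>
     (\<forall>n. \<forall>v\<in>wtv V n. Lv V 0 v = of_int n *\<^sub>C v) \<and>
     (\<forall>\<omega>. conf V = Some \<omega> \<longrightarrow>
        \<omega> \<in> wtv V 2 \<and> \<omega> \<in> grv V 0 \<and> virasoro_relations (\<lambda>n. vop V \<omega> (n + 1)) \<and>
        (\<forall>j\<in>{-1,0,1}. \<forall>v. Lv V j v = vop V \<omega> (j + 1) v)) \<and>
     is_subgroup A \<and> (\<forall>\<alpha>. \<alpha> \<notin> A \<longrightarrow> grv V \<alpha> = {0}) \<and>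
     is_direct_sum UNIV (grv V) \<and>
     (\<forall>\<alpha>. is_direct_sum (grv V \<alpha>) (\<lambda>n. grv V \<alpha> \<inter> wtv V n)) \<and>
     (\<forall>\<alpha> n. fin_dim (grv V \<alpha> \<inter> wtv V n)) \<and>
     (\<forall>\<alpha>. \<exists>K. \<forall>n<K. grv V \<alpha> \<inter> wtv V n = {0}) \<and>
     vac V \<in> grv V 0 \<and>
     (\<forall>\<alpha> \<beta> m. \<forall>u\<in>grv V \<alpha>. \<forall>v\<in>grv V \<beta>. vop V u m v \<in> grv V (\<alpha> + \<beta>)) \<and>
     (\<forall>j\<in>{-1,0,1}. \<forall>\<alpha>. \<forall>v\<in>grv V \<alpha>. Lv V j v \<in> grv V \<alpha>)"

definition wtm :: "('v, 'g, 'w::complex_vector) vmod \<Rightarrow> complex \<Rightarrow> 'w set" where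
  "wtm W = gen_eigenspace (carr W) (Lm W 0)"

definition generalized_module ::
  "('v::complex_vector, 'g::ab_group_add) valg \<Rightarrow> ('v, 'g, 'w::complex_vector) vmod \<Rightarrow> bool" where
  "generalized_module V W \<longleftrightarrow>
     csubspace (carr W) \<and>
     (\<forall>v m. linear_map_on (carr W) (carr W) (act W v m)) \<and>
     (\<forall>m. \<forall>w\<in>carr W. linear_map_on UNIV (carr W) (\<lambda>v. act W v m w)) \<and>
     (\<forall>j\<in>{-1,0,1}. linear_map_on (carr W) (carr W) (Lm W j)) \<and>
     (\<forall>v. \<forall>w\<in>carr W. \<exists>N. \<forall>m\<ge>N. act W v m w = 0) \<and>
     (\<forall>m. \<forall>w\<in>carr W. act W (vac V) m w = (if m = - 1 then w else 0)) \<and>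
     jacobi V (carr W) (act W) \<and>
     sl2_relations V (carr W) (act W) (Lm W) \<and>
     (\<forall>\<omega>. conf V = Some \<omega> \<longrightarrow> (\<forall>j\<in>{-1,0,1}. \<forall>w\<in>carr W. Lm W j w = act W \<omega> (j + 1) w)) \<and>
     is_direct_sum (carr W) (wtm W) \<and>
     is_direct_sum (carr W) (grm W) \<and>
     (\<forall>\<beta>. is_direct_sum (grm W \<beta>) (\<lambda>n. grm W \<beta> \<inter> wtm W n)) \<and>
     (\<forall>\<beta> n. fin_dim (grm W \<beta> \<inter> wtm W n)) \<and>
     (\<forall>\<beta> n. \<exists>K::int. \<forall>k<K. grm W \<beta> \<inter> wtm W (n + of_int k) = {0}) \<and>
     (\<forall>\<alpha> \<beta> m. \<forall>v\<in>grv V \<alpha>. \<forall>w\<in>grm W \<beta>. act W v m w \<in> grm W (\<alpha> + \<beta>)) \<and>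
     (\<forall>j\<in>{-1,0,1}. \<forall>\<beta>. \<forall>w\<in>grm W \<beta>. Lm W j w \<in> grm W \<beta>)"

text \<open>A module is a generalized module on which $L(0)$ is semisimple.\<close>

definition ordinary_module ::
  "('v::complex_vector, 'g::ab_group_add) valg \<Rightarrow> ('v, 'g, 'w::complex_vector) vmod \<Rightarrow> bool" where
  "ordinary_module V W \<longleftrightarrow>
     generalized_module V W \<and> (\<forall>n. \<forall>w\<in>wtm W n. Lm W 0 w = n *\<^sub>C w)"

definition module_map ::
  "('v, 'g, 'a::complex_vector) vmod \<Rightarrow> ('v, 'g, 'b::complex_vector) vmod \<Rightarrow> ('a \<Rightarrow> 'b) \<Rightarrow> bool" where
  "module_map W M f \<longleftrightarrow>
     linear_map_on (carr W) (carr M) f \<and>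
     (\<forall>v m. \<forall>w\<in>carr W. f (act W v m w) = act M v m (f w)) \<and>
     (\<forall>j\<in>{-1,0,1}. \<forall>w\<in>carr W. f (Lm W j w) = Lm M j (f w)) \<and>
     (\<forall>\<beta>. \<forall>w\<in>grm W \<beta>. f w \<in> grm M \<beta>)"

definition isomorphic_modules ::
  "('v, 'g, 'a::complex_vector) vmod \<Rightarrow> ('v, 'g, 'b::complex_vector) vmod \<Rightarrow> bool" where
  "isomorphic_modules W M \<longleftrightarrow> (\<exists>f. module_map W M f \<and> bij_betw f (carr W) (carr M))"

definition restrict_module :: "('v, 'g, 'w) vmod \<Rightarrow> 'w set \<Rightarrow> ('v, 'g, 'w) vmod" where
  "restrict_module W S = W\<lparr>carr := S, grm := \<lambda>\<beta>. S \<inter> grm W \<beta>\<rparr>"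

definition generalized_submodule ::
  "('v::complex_vector, 'g::ab_group_add) valg \<Rightarrow> ('v, 'g, 'w::complex_vector) vmod \<Rightarrow>
   ('v, 'g, 'w) vmod \<Rightarrow> bool" where
  "generalized_submodule V N M \<longleftrightarrow>
     generalized_module V N \<and> generalized_module V M \<and> carr N \<subseteq> carr M \<and>
     (\<forall>v m. \<forall>w\<in>carr N. act N v m w = act M v m w) \<and>
     (\<forall>j\<in>{-1,0,1}. \<forall>w\<in>carr N. Lm N j w = Lm M j w) \<and>
     (\<forall>\<beta>. grm N \<beta> = carr N \<inter> grm M \<beta>)"


section \<open>Contragredients, completions, direct sums\<close>

definition dual1 :: "'a::complex_vector set \<Rightarrow> ('a \<Rightarrow> complex) set" where
  "dual1 S = {f. linear_map_on S UNIV f \<and> (\<forall>x. x \<notin> S \<longrightarrow> f x = 0)}"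

definition dual2 ::
  "'a::complex_vector set \<Rightarrow> 'b::complex_vector set \<Rightarrow> ('a \<Rightarrow> 'b \<Rightarrow> complex) set" where
  "dual2 S T = {f. (\<forall>x\<in>S. f x \<in> dual1 T) \<and> (\<forall>y\<in>T. (\<lambda>x. f x y) \<in> dual1 S) \<and>
                   (\<forall>x y. x \<notin> S \<or> y \<notin> T \<longrightarrow> f x y = 0)}"

text \<open>
  The coefficient of $x^e$ in $e^{xL(1)}(-x^{-2})^{L(0)}v$, where
  $(-x^{-2})^{L(0)}v=(-1)^k x^{-2k}v$ for \<open>v\<close> of weight \<open>k\<close>.
\<close>

definition opp_vec ::
  "('v::complex_vector, 'g) valg \<Rightarrow> 'v \<Rightarrow> int \<Rightarrow> 'v" where
  "opp_vec V v e = Sum_any (\<lambda>(k::int, i::nat).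
     if int i - 2 * k = e
     then ((-1) powi k / fact i) *\<^sub>C (Lv V 1 ^^ i) (component (wtv V) k v) else 0)"

text \<open>The coefficient of $x^q$ in $Y^o_W(v,x)w$.\<close>

definition opp_coeff ::
  "('v::complex_vector, 'g) valg \<Rightarrow> ('v, 'g, 'w::complex_vector) vmod \<Rightarrow> 'v \<Rightarrow> int \<Rightarrow> 'w \<Rightarrow> 'w" where
  "opp_coeff V W v q w = Sum_any (\<lambda>m. act W (opp_vec V v (q - m - 1)) m w)"

text \<open>$(W^{(-\beta)}_{[n]})^*$ as a space of functionals on \<open>W\<close>.\<close>

definition contragredient_piece ::
  "('v, 'g::ab_group_add, 'w::complex_vector) vmod \<Rightarrow> 'g \<Rightarrow> complex \<Rightarrow> ('w \<Rightarrow> complex) set" where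
  "contragredient_piece W \<beta> n =
     {f \<in> dual1 (carr W). \<forall>\<gamma> m. (\<gamma>, m) \<noteq> (- \<beta>, n) \<longrightarrow> (\<forall>w \<in> grm W \<gamma> \<inter> wtm W m. f w = 0)}"

definition contragredient ::
  "('v::complex_vector, 'g::ab_group_add) valg \<Rightarrow> ('v, 'g, 'w::complex_vector) vmod \<Rightarrow>
   ('v, 'g, 'w \<Rightarrow> complex) vmod" where
  "contragredient V W = \<lparr>
     carr = cspan (\<Union>\<beta> n. contragredient_piece W \<beta> n),
     act = \<lambda>v m f w. if w \<in> carr W then f (opp_coeff V W v (- m - 1) w) else 0,
     Lm = \<lambda>j f w. if w \<in> carr W then f (Lm W (- j) w) else 0,
     grm = \<lambda>\<beta>. cspan (\<Union>n. contragredient_piece W \<beta> n) \<rparr>"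

text \<open>
  An element of $\overline W=\prod_n W_{[n]}$ is the family of its components; operators and
  functionals are extended to $\overline W$ componentwise.
\<close>

definition completion :: "('v, 'g, 'w::complex_vector) vmod \<Rightarrow> (complex \<Rightarrow> 'w) set" where
  "completion W = {u. \<forall>n. u n \<in> wtm W n}"

definition pairing :: "('w \<Rightarrow> complex) \<Rightarrow> (complex \<Rightarrow> 'w) \<Rightarrow> complex" where
  "pairing w' u = Sum_any (\<lambda>n. w' (u n))"

definition extend_op ::
  "('v, 'g, 'w::complex_vector) vmod \<Rightarrow> ('w \<Rightarrow> 'w) \<Rightarrow> (complex \<Rightarrow> 'w) \<Rightarrow> complex \<Rightarrow> 'w" where
  "extend_op W T u n = Sum_any (\<lambda>k. component (wtm W) n (T (u k)))"

definition direct_sum_module ::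
  "('v, 'g, 'a::complex_vector) vmod \<Rightarrow> ('v, 'g, 'b::complex_vector) vmod \<Rightarrow>
   ('v, 'g, 'a \<times> 'b) vmod" where
  "direct_sum_module W M = \<lparr>
     carr = carr W \<times> carr M,
     act = \<lambda>v m (x, y). (act W v m x, act M v m y),
     Lm = \<lambda>j (x, y). (Lm W j x, Lm M j y),
     grm = \<lambda>\<beta>. grm W \<beta> \<times> grm M \<beta> \<rparr>"


section \<open>The category\<close>

text \<open>
  A full subcategory is given by its set of objects, which are carried by subspaces of one fixed
  but arbitrary type.  As a contragredient, a direct sum or a space of forms lives on another type,
  being an object of the category is understood up to isomorphism.
\<close>

definition in_category ::
  "('v::complex_vector, 'g::ab_group_add) valg \<Rightarrow> ('v, 'g, 'u::complex_vector) vmod set \<Rightarrow>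
   ('v, 'g, 'w::complex_vector) vmod \<Rightarrow> bool" where
  "in_category V C W \<longleftrightarrow> generalized_module V W \<and> (\<exists>M\<in>C. isomorphic_modules W M)"

text \<open>The operator $L(0)_s$.\<close>

definition L0_semisimple_part :: "('v, 'g, 'w::complex_vector) vmod \<Rightarrow> 'w \<Rightarrow> 'w" where
  "L0_semisimple_part W w = Sum_any (\<lambda>n. n *\<^sub>C component (wtm W) n w)"

text \<open>
  The flag \<open>ss\<close> selects the ambient category: all strongly graded modules if it is true, and all
  strongly graded generalized modules if it is false.
\<close>

definition module_category ::
  "bool \<Rightarrow> ('v::complex_vector, 'g::ab_group_add) valg \<Rightarrow> ('v, 'g, 'u::complex_vector) vmod set \<Rightarrow>
   bool" where
  "module_category ss V C \<longleftrightarrow>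
     (\<forall>W\<in>C.
        (if ss then ordinary_module V W else generalized_module V W) \<and>
        (\<forall>n. wtm W n \<noteq> {0} \<longrightarrow> n \<in> \<real>) \<and>
        (\<exists>K>0. \<forall>w\<in>carr W. ((\<lambda>x. Lm W 0 x - L0_semisimple_part W x) ^^ K) w = 0)) \<and>
     (\<forall>W\<in>C. in_category V C (contragredient V W)) \<and>
     (\<forall>W\<in>C. \<forall>M\<in>C. in_category V C (direct_sum_module W M))"

definition closed_under_images ::
  "('v::complex_vector, 'g::ab_group_add) valg \<Rightarrow> ('v, 'g, 'u::complex_vector) vmod set \<Rightarrow> bool" where
  "closed_under_images V C \<longleftrightarrow>
     (\<forall>W\<in>C. \<forall>M :: ('v, 'g, 'u) vmod. \<forall>f. generalized_module V M \<and> module_map W M f \<longrightarrow>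
        in_category V C (restrict_module M (f ` carr W)))"


section \<open>Intertwining maps\<close>

text \<open>
  A linear map from a tensor product is given as a bilinear map.  The Jacobi identity is stated for
  the component of weight \<open>n\<close> and the coefficient of $x_0^p x_1^q$.
\<close>

definition intertwining_map ::
  "('v::complex_vector, 'g::ab_group_add) valg \<Rightarrow> complex \<Rightarrow> ('v, 'g, 'c::complex_vector) vmod \<Rightarrow>
   ('v, 'g, 'a::complex_vector) vmod \<Rightarrow> ('v, 'g, 'b::complex_vector) vmod \<Rightarrow>
   ('a \<Rightarrow> 'b \<Rightarrow> complex \<Rightarrow> 'c) \<Rightarrow> bool" where
  "intertwining_map V z W3 W1 W2 I \<longleftrightarrow>
     (\<forall>w2\<in>carr W2. linear_map_on (carr W1) (completion W3) (\<lambda>w1. I w1 w2)) \<and>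
     (\<forall>w1\<in>carr W1. linear_map_on (carr W2) (completion W3) (I w1)) \<and>
     (\<forall>\<beta> \<gamma> n. \<forall>w1\<in>grm W1 \<beta>. \<forall>w2\<in>grm W2 \<gamma>. I w1 w2 n \<in> grm W3 (\<beta> + \<gamma>)) \<and>
     (\<forall>n. \<forall>w1\<in>carr W1. \<forall>w2\<in>carr W2. \<exists>N::nat. \<forall>m\<ge>N. I w1 w2 (n - of_nat m) = 0) \<and>
     (\<forall>v. \<forall>w1\<in>carr W1. \<forall>w2\<in>carr W2. \<forall>n p q.
        Sum_any (\<lambda>b. delta_snd z p b *\<^sub>C extend_op W3 (act W3 v (b - q - 1)) (I w1 w2) n) =
        Sum_any (\<lambda>c. delta_den z q c *\<^sub>C I (act W1 v (c - p - 1) w1) w2 n) +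
        Sum_any (\<lambda>c. delta_fst_neg z p c *\<^sub>C I w1 (act W2 v (c - q - 1) w2) n)) \<and>
     (\<forall>j\<in>{-1,0,1}. \<forall>w1\<in>carr W1. \<forall>w2\<in>carr W2. \<forall>n.
        extend_op W3 (Lm W3 j) (I w1 w2) n =
        I w1 (Lm W2 j w2) n +
        (\<Sum>i = 0..nat (j + 1).
           (of_nat (nat (j + 1) choose i) * z ^ i) *\<^sub>C I (Lm W1 (j - int i) w1) w2 n))"

text \<open>
  The condition is the one on products, which is equivalent to the one on iterates.
\<close>

definition convergence_condition ::
  "('v::complex_vector, 'g::ab_group_add) valg \<Rightarrow> ('v, 'g, 'u::complex_vector) vmod set \<Rightarrow> bool" where
  "convergence_condition V C \<longleftrightarrow>
     (\<forall>W1\<in>C. \<forall>W2\<in>C. \<forall>W3\<in>C. \<forall>W4\<in>C. \<forall>M1\<in>C. \<forall>z1 z2 I1 I2.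
        norm z1 > norm z2 \<and> norm z2 > 0 \<and>
        intertwining_map V z1 W4 W1 M1 I1 \<and> intertwining_map V z2 M1 W2 W3 I2 \<longrightarrow>
        (\<forall>w4'\<in>carr (contragredient V W4). \<forall>w1\<in>carr W1. \<forall>w2\<in>carr W2. \<forall>w3\<in>carr W3.
           (\<lambda>n. norm (pairing w4' (I1 w1 (I2 w2 w3 n)))) summable_on UNIV))"

text \<open>The product $I_1\circ(1_{W_1}\otimes I_2)$ with values in $\overline{W_4}$.\<close>

definition product_map ::
  "('v::complex_vector, 'g::ab_group_add) valg \<Rightarrow> ('v, 'g, 'd::complex_vector) vmod \<Rightarrow>
   ('a \<Rightarrow> 'm \<Rightarrow> complex \<Rightarrow> 'd) \<Rightarrow> ('b \<Rightarrow> 'c \<Rightarrow> complex \<Rightarrow> 'm) \<Rightarrow> 'a \<Rightarrow> 'b \<Rightarrow> 'c \<Rightarrow> complex \<Rightarrow> 'd" where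
  "product_map V W4 I1 I2 w1 w2 w3 =
     (THE u. u \<in> completion W4 \<and>
        (\<forall>w4'\<in>carr (contragredient V W4).
           pairing w4' u = (\<Sum>\<^sub>\<infinity>n. pairing w4' (I1 w1 (I2 w2 w3 n)))))"

text \<open>$F'(w')$ for $F:W_1\otimes W_2\otimes W_3\to\overline{W_4}$, and $I'(w')$ likewise.\<close>

definition transpose3 ::
  "('v, 'g, 'a) vmod \<Rightarrow> ('v, 'g, 'b) vmod \<Rightarrow> ('v, 'g, 'c) vmod \<Rightarrow> ('a \<Rightarrow> 'b \<Rightarrow> 'c \<Rightarrow> complex \<Rightarrow> 'd) \<Rightarrow>
   ('d \<Rightarrow> complex) \<Rightarrow> 'a \<Rightarrow> 'b \<Rightarrow> 'c \<Rightarrow> complex" where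
  "transpose3 W1 W2 W3 F w' w1 w2 w3 =
     (if w1 \<in> carr W1 \<and> w2 \<in> carr W2 \<and> w3 \<in> carr W3 then pairing w' (F w1 w2 w3) else 0)"

definition transpose2 ::
  "('v, 'g, 'a) vmod \<Rightarrow> ('v, 'g, 'b) vmod \<Rightarrow> ('a \<Rightarrow> 'b \<Rightarrow> complex \<Rightarrow> 'd) \<Rightarrow>
   ('d \<Rightarrow> complex) \<Rightarrow> 'a \<Rightarrow> 'b \<Rightarrow> complex" where
  "transpose2 W1 W2 I w' w1 w2 =
     (if w1 \<in> carr W1 \<and> w2 \<in> carr W2 then pairing w' (I w1 w2) else 0)"


section \<open>The space $(U_1\otimes U_2)^*$\<close>

text \<open>
  The coefficient of $x^q x_1^r$ in
  $z^{-1}\delta((x^{-1}-x_1)/z)\,\nu(Y_{U_1}(e^{xL(1)}(-x^{-2})^{L(0)}v,x_1)u_1\otimes u_2)$;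
  the coefficient of $x_1^{-1}$ is its residue.
\<close>

definition P_first_term ::
  "('v::complex_vector, 'g) valg \<Rightarrow> complex \<Rightarrow> ('v, 'g, 'a::complex_vector) vmod \<Rightarrow> 'v \<Rightarrow>
   ('a \<Rightarrow> 'b \<Rightarrow> complex) \<Rightarrow> 'a \<Rightarrow> 'b \<Rightarrow> int \<Rightarrow> int \<Rightarrow> complex" where
  "P_first_term V z U1 v \<nu> u1 u2 q r =
     Sum_any (\<lambda>(e, c). delta_den z (e - q) c * \<nu> (act U1 (opp_vec V v e) (c - r - 1) u1) u2)"

text \<open>The coefficient of $x^{-m-1}$ in $Y'_{P(z)}(v,x)\nu$.\<close>

definition P_act ::
  "('v::complex_vector, 'g) valg \<Rightarrow> complex \<Rightarrow> ('v, 'g, 'a::complex_vector) vmod \<Rightarrow>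
   ('v, 'g, 'b::complex_vector) vmod \<Rightarrow> 'v \<Rightarrow> int \<Rightarrow> ('a \<Rightarrow> 'b \<Rightarrow> complex) \<Rightarrow> 'a \<Rightarrow> 'b \<Rightarrow> complex" where
  "P_act V z U1 U2 v m \<nu> u1 u2 =
     (if u1 \<in> carr U1 \<and> u2 \<in> carr U2
      then \<nu> u1 (opp_coeff V U2 v (- m - 1) u2) + P_first_term V z U1 v \<nu> u1 u2 (- m - 1) (- 1)
      else 0)"

definition P_L ::
  "complex \<Rightarrow> ('v, 'g, 'a) vmod \<Rightarrow> ('v, 'g, 'b) vmod \<Rightarrow> int \<Rightarrow> ('a \<Rightarrow> 'b \<Rightarrow> complex) \<Rightarrow>
   'a \<Rightarrow> 'b \<Rightarrow> complex" where
  "P_L z U1 U2 j \<nu> u1 u2 =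
     (if u1 \<in> carr U1 \<and> u2 \<in> carr U2
      then \<nu> u1 (Lm U2 (- j) u2) +
           (\<Sum>i = 0..nat (1 - j). of_nat (nat (1 - j) choose i) * z ^ i * \<nu> (Lm U1 (- j - int i) u1) u2)
      else 0)"

definition tensor_dual ::
  "('v, 'g, 'a::complex_vector) vmod \<Rightarrow> ('v, 'g, 'b::complex_vector) vmod \<Rightarrow>
   ('a \<Rightarrow> 'b \<Rightarrow> complex) set" where
  "tensor_dual U1 U2 = dual2 (carr U1) (carr U2)"

definition tensor_dual_gr ::
  "('v, 'g::ab_group_add, 'a::complex_vector) vmod \<Rightarrow> ('v, 'g, 'b::complex_vector) vmod \<Rightarrow> 'g \<Rightarrow>
   ('a \<Rightarrow> 'b \<Rightarrow> complex) set" where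
  "tensor_dual_gr U1 U2 \<beta> =
     {\<nu> \<in> tensor_dual U1 U2.
        \<forall>\<beta>1 \<beta>2. \<beta>1 + \<beta>2 \<noteq> - \<beta> \<longrightarrow> (\<forall>u1\<in>grm U1 \<beta>1. \<forall>u2\<in>grm U2 \<beta>2. \<nu> u1 u2 = 0)}"

text \<open>
  $((U_1\otimes U_2)^*)^{(\beta)}_{[n]}$, and $((U_1\otimes U_2)^*)^{(\beta)}_{(n)}$ if the flag
  \<open>ss\<close> is set.
\<close>

definition tensor_dual_piece ::
  "bool \<Rightarrow> complex \<Rightarrow> ('v, 'g::ab_group_add, 'a::complex_vector) vmod \<Rightarrow>
   ('v, 'g, 'b::complex_vector) vmod \<Rightarrow> 'g \<Rightarrow> complex \<Rightarrow> ('a \<Rightarrow> 'b \<Rightarrow> complex) set" where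
  "tensor_dual_piece ss z U1 U2 \<beta> n =
     (if ss then eigenspace (tensor_dual_gr U1 U2 \<beta>) (P_L z U1 U2 0) n
      else gen_eigenspace (tensor_dual_gr U1 U2 \<beta>) (P_L z U1 U2 0) n)"

text \<open>Condition (b) of compatibility is stated for the coefficients of $x^q x_1^r$.\<close>

definition P_compatible ::
  "('v::complex_vector, 'g) valg \<Rightarrow> complex \<Rightarrow> ('v, 'g, 'a::complex_vector) vmod \<Rightarrow>
   ('v, 'g, 'b::complex_vector) vmod \<Rightarrow> ('a \<Rightarrow> 'b \<Rightarrow> complex) \<Rightarrow> bool" where
  "P_compatible V z U1 U2 \<nu> \<longleftrightarrow>
     (\<forall>v. \<exists>N. \<forall>m\<ge>N. P_act V z U1 U2 v m \<nu> = 0) \<and>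
     (\<forall>v. \<forall>u1\<in>carr U1. \<forall>u2\<in>carr U2. \<forall>q r.
        P_first_term V z U1 v \<nu> u1 u2 q r +
        Sum_any (\<lambda>c. delta_fst_neg z r c * \<nu> u1 (opp_coeff V U2 v (q + c) u2)) =
        Sum_any (\<lambda>b. delta_snd z r b * P_act V z U1 U2 v (- (q + b) - 1) \<nu> u1 u2))"

definition doubly_graded_subspace ::
  "bool \<Rightarrow> complex \<Rightarrow> ('v, 'g::ab_group_add, 'a::complex_vector) vmod \<Rightarrow>
   ('v, 'g, 'b::complex_vector) vmod \<Rightarrow> ('a \<Rightarrow> 'b \<Rightarrow> complex) set \<Rightarrow> bool" where
  "doubly_graded_subspace ss z U1 U2 S \<longleftrightarrow>
     is_direct_sum S (\<lambda>(\<beta>, n). S \<inter> tensor_dual_piece ss z U1 U2 \<beta> n)"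

definition P_module ::
  "('v::complex_vector, 'g::ab_group_add) valg \<Rightarrow> complex \<Rightarrow> ('v, 'g, 'a::complex_vector) vmod \<Rightarrow>
   ('v, 'g, 'b::complex_vector) vmod \<Rightarrow> ('a \<Rightarrow> 'b \<Rightarrow> complex) set \<Rightarrow>
   ('v, 'g, 'a \<Rightarrow> 'b \<Rightarrow> complex) vmod" where
  "P_module V z U1 U2 S =
     \<lparr>carr = S, act = P_act V z U1 U2, Lm = P_L z U1 U2, grm = \<lambda>\<beta>. S \<inter> tensor_dual_gr U1 U2 \<beta>\<rparr>"

definition included_object ::
  "('v::complex_vector, 'g::ab_group_add) valg \<Rightarrow> ('v, 'g, 'u::complex_vector) vmod set \<Rightarrow> complex \<Rightarrow>
   ('v, 'g, 'a::complex_vector) vmod \<Rightarrow> ('v, 'g, 'b::complex_vector) vmod \<Rightarrow>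
   ('a \<Rightarrow> 'b \<Rightarrow> complex) set \<Rightarrow> bool" where
  "included_object V C z U1 U2 S \<longleftrightarrow>
     doubly_graded_subspace False z U1 U2 S \<and>
     in_category V C (P_module V z U1 U2 S) \<and>
     (\<forall>\<nu>\<in>S. P_compatible V z U1 U2 \<nu>)"

text \<open>
  The smallest doubly graded subspace of \<open>E\<close> that contains \<open>X\<close> and is stable under $Y'_{P(z)}$ and
  $L'_{P(z)}(j)$.
\<close>

definition P_generated ::
  "bool \<Rightarrow> ('v::complex_vector, 'g::ab_group_add) valg \<Rightarrow> complex \<Rightarrow>
   ('v, 'g, 'a::complex_vector) vmod \<Rightarrow> ('v, 'g, 'b::complex_vector) vmod \<Rightarrow>
   ('a \<Rightarrow> 'b \<Rightarrow> complex) set \<Rightarrow> ('a \<Rightarrow> 'b \<Rightarrow> complex) set \<Rightarrow> ('a \<Rightarrow> 'b \<Rightarrow> complex) set" where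
  "P_generated ss V z U1 U2 E X =
     \<Inter>{S. S \<subseteq> E \<and> X \<subseteq> S \<and> doubly_graded_subspace ss z U1 U2 S \<and>
          (\<forall>v m. \<forall>\<nu>\<in>S. P_act V z U1 U2 v m \<nu> \<in> S) \<and>
          (\<forall>j\<in>{-1,0,1}. \<forall>\<nu>\<in>S. P_L z U1 U2 j \<nu> \<in> S)}"


section \<open>The local grading restriction condition\<close>

definition exp_P_L0 ::
  "complex \<Rightarrow> ('v, 'g, 'a) vmod \<Rightarrow> ('v, 'g, 'b) vmod \<Rightarrow> complex \<Rightarrow> ('a \<Rightarrow> 'b \<Rightarrow> complex) \<Rightarrow>
   'a \<Rightarrow> 'b \<Rightarrow> complex" where
  "exp_P_L0 z U1 U2 t \<nu> u1 u2 = suminf (\<lambda>k. t ^ k / fact k * (P_L z U1 U2 0 ^^ k) \<nu> u1 u2)"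

definition lgr_term ::
  "complex \<Rightarrow> ('v, 'g, 'a) vmod \<Rightarrow> ('v, 'g, 'b) vmod \<Rightarrow> nat \<Rightarrow> complex \<Rightarrow>
   (real \<Rightarrow> 'a \<Rightarrow> 'b \<Rightarrow> complex) \<Rightarrow> 'a \<Rightarrow> 'b \<Rightarrow> real \<Rightarrow> complex" where
  "lgr_term z U1 U2 N t lam u1 u2 n =
     exp (of_real n * t) *
     (\<Sum>i = 0..N. t ^ i / fact i *
        (shift_op (P_L z U1 U2 0) (of_real n) ^^ i) (lam n) u1 u2)"

text \<open>Part (a) of the condition: \<open>\<Sigma> lam n\<close> is the series attached to the form \<open>\<mu>\<close>.\<close>

definition lgr_series ::
  "bool \<Rightarrow> complex \<Rightarrow> ('v, 'g::ab_group_add, 'a::complex_vector) vmod \<Rightarrow>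
   ('v, 'g, 'b::complex_vector) vmod \<Rightarrow> ('a \<Rightarrow> 'b \<Rightarrow> complex) \<Rightarrow> (real \<Rightarrow> 'a \<Rightarrow> 'b \<Rightarrow> complex) \<Rightarrow> bool"
where
  "lgr_series ss z U1 U2 \<mu> lam \<longleftrightarrow>
     (\<forall>n. lam n \<in> cspan (\<Union>\<beta>. tensor_dual_piece ss z U1 U2 \<beta> (of_real n))) \<and>
     (\<exists>D N. open D \<and> 0 \<in> D \<and>
        (\<forall>u1\<in>carr U1. \<forall>u2\<in>carr U2.
           (\<forall>t\<in>D. (\<forall>n. exp_P_L0 z U1 U2 t (lam n) u1 u2 = lgr_term z U1 U2 N t lam u1 u2 n) \<and>
                  (\<lambda>n. norm (lgr_term z U1 U2 N t lam u1 u2 n)) summable_on UNIV) \<and>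
           (lgr_term z U1 U2 N 0 lam u1 u2 has_sum \<mu> u1 u2) UNIV))"

text \<open>The space $W^{(2)}_{\lambda,w_{(3)}}$ determined by the series.\<close>

definition lgr_space ::
  "bool \<Rightarrow> ('v::complex_vector, 'g::ab_group_add) valg \<Rightarrow> complex \<Rightarrow>
   ('v, 'g, 'a::complex_vector) vmod \<Rightarrow> ('v, 'g, 'b::complex_vector) vmod \<Rightarrow>
   (real \<Rightarrow> 'a \<Rightarrow> 'b \<Rightarrow> complex) \<Rightarrow> ('a \<Rightarrow> 'b \<Rightarrow> complex) set" where
  "lgr_space ss V z U1 U2 lam =
     P_generated ss V z U1 U2
       (cspan (\<Union>\<beta>. \<Union>n::real. tensor_dual_piece ss z U1 U2 \<beta> (of_real n))) (range lam)"

definition grading_restricted ::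
  "bool \<Rightarrow> complex \<Rightarrow> ('v, 'g::ab_group_add, 'a::complex_vector) vmod \<Rightarrow>
   ('v, 'g, 'b::complex_vector) vmod \<Rightarrow> ('a \<Rightarrow> 'b \<Rightarrow> complex) set \<Rightarrow> bool" where
  "grading_restricted ss z U1 U2 S \<longleftrightarrow>
     (\<forall>\<beta>. \<forall>n::real.
        fin_dim (S \<inter> tensor_dual_piece ss z U1 U2 \<beta> (of_real n)) \<and>
        (\<exists>K::int. \<forall>k<K. S \<inter> tensor_dual_piece ss z U1 U2 \<beta> (of_real n + of_int k) = {0}))"

text \<open>
  The $P^{(2)}(z)$-local grading restriction condition for a form \<open>\<tau>\<close> on
  $W_1\otimes W_2\otimes W_3$, and its $L(0)$-semisimple version if the flag \<open>ss\<close> is set.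
\<close>

definition local_grading_restriction ::
  "bool \<Rightarrow> ('v::complex_vector, 'g::ab_group_add) valg \<Rightarrow> complex \<Rightarrow>
   ('v, 'g, 'a::complex_vector) vmod \<Rightarrow> ('v, 'g, 'b::complex_vector) vmod \<Rightarrow>
   ('v, 'g, 'c) vmod \<Rightarrow> ('a \<Rightarrow> 'b \<Rightarrow> 'c \<Rightarrow> complex) \<Rightarrow> bool" where
  "local_grading_restriction ss V z W1 W2 W3 \<tau> \<longleftrightarrow>
     (\<forall>w3\<in>carr W3. \<exists>lam.
        lgr_series ss z W1 W2 (\<lambda>w1 w2. \<tau> w1 w2 w3) lam \<and>
        grading_restricted ss z W1 W2 (lgr_space ss V z W1 W2 lam))"


section \<open>Tensor products\<close>

definition is_tensor_product ::
  "('v::complex_vector, 'g::ab_group_add) valg \<Rightarrow> ('v, 'g, 'u::complex_vector) vmod set \<Rightarrow> complex \<Rightarrow>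
   ('v, 'g, 'u) vmod \<Rightarrow> ('v, 'g, 'u) vmod \<Rightarrow> ('v, 'g, 'u) vmod \<Rightarrow> ('u \<Rightarrow> 'u \<Rightarrow> complex \<Rightarrow> 'u) \<Rightarrow> bool"
where
  "is_tensor_product V C z W1 W2 T B \<longleftrightarrow>
     T \<in> C \<and> intertwining_map V z T W1 W2 B \<and>
     (\<forall>W\<in>C. \<forall>I. intertwining_map V z W W1 W2 I \<longrightarrow>
        (\<exists>\<eta>. (module_map T W \<eta> \<and>
              (\<forall>w1\<in>carr W1. \<forall>w2\<in>carr W2. \<forall>n. I w1 w2 n = \<eta> (B w1 w2 n))) \<and>
             (\<forall>\<theta>. module_map T W \<theta> \<and>
                  (\<forall>w1\<in>carr W1. \<forall>w2\<in>carr W2. \<forall>n. I w1 w2 n = \<theta> (B w1 w2 n)) \<longrightarrow>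
                  (\<forall>t\<in>carr T. \<theta> t = \<eta> t))))"

text \<open>$\mathcal{D}_{P(z)}(W_1,W_2)$ and the concrete tensor product $\mathcal{D}_{P(z)}(W_1,W_2)'$.\<close>

definition D_space ::
  "('v::complex_vector, 'g::ab_group_add) valg \<Rightarrow> ('v, 'g, 'u::complex_vector) vmod set \<Rightarrow> complex \<Rightarrow>
   ('v, 'g, 'u) vmod \<Rightarrow> ('v, 'g, 'u) vmod \<Rightarrow> ('u \<Rightarrow> 'u \<Rightarrow> complex) set" where
  "D_space V C z W1 W2 =
     {transpose2 W1 W2 I w' | W I w'.
        W \<in> C \<and> intertwining_map V z W W1 W2 I \<and> w' \<in> carr (contragredient V W)}"

definition boxtimes ::
  "('v::complex_vector, 'g::ab_group_add) valg \<Rightarrow> ('v, 'g, 'u::complex_vector) vmod set \<Rightarrow> complex \<Rightarrow>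
   ('v, 'g, 'u) vmod \<Rightarrow> ('v, 'g, 'u) vmod \<Rightarrow> ('v, 'g, ('u \<Rightarrow> 'u \<Rightarrow> complex) \<Rightarrow> complex) vmod" where
  "boxtimes V C z W1 W2 = contragredient V (P_module V z W1 W2 (D_space V C z W1 W2))"


section \<open>The actions on $(U_1\otimes U_2)^*$ of type $Q(z)$\<close>

text \<open>
  The coefficient of $x_0^p x_1^q$ in
  $\tau_{Q(z)}(z^{-1}\delta((x_1-x_0)/z)Y_t(v,x_0))\nu$.
\<close>

definition tau_Q ::
  "('v::complex_vector, 'g) valg \<Rightarrow> complex \<Rightarrow> ('v, 'g, 'a::complex_vector) vmod \<Rightarrow>
   ('v, 'g, 'b) vmod \<Rightarrow> 'v \<Rightarrow> int \<Rightarrow> int \<Rightarrow> ('a \<Rightarrow> 'b \<Rightarrow> complex) \<Rightarrow> 'a \<Rightarrow> 'b \<Rightarrow> complex" where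
  "tau_Q V z U1 U2 v p q \<nu> u1 u2 =
     (if u1 \<in> carr U1 \<and> u2 \<in> carr U2
      then Sum_any (\<lambda>b. delta_snd z p b * \<nu> (opp_coeff V U1 v (q - b) u1) u2) -
           Sum_any (\<lambda>c. delta_fst_neg z p c * \<nu> u1 (act U2 v (c - q - 1) u2))
      else 0)"

definition Q_L ::
  "complex \<Rightarrow> ('v, 'g, 'a) vmod \<Rightarrow> ('v, 'g, 'b) vmod \<Rightarrow> int \<Rightarrow> ('a \<Rightarrow> 'b \<Rightarrow> complex) \<Rightarrow>
   'a \<Rightarrow> 'b \<Rightarrow> complex" where
  "Q_L z U1 U2 j \<nu> u1 u2 =
     (if u1 \<in> carr U1 \<and> u2 \<in> carr U2
      then (\<Sum>i = 0..nat (j + 1). of_nat (nat (j + 1) choose i) * (- z) ^ i *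
              (\<nu> (Lm U1 (int i - j) u1) u2 - \<nu> u1 (Lm U2 (j - int i) u2)))
      else 0)"

text \<open>The map $\widetilde G$ defined by the family $\lambda^{(2)}_n(w'_{(4)},w_{(3)})$.\<close>

definition G_tilde ::
  "('v, 'g, 'd) vmod \<Rightarrow> ('v, 'g, 'c) vmod \<Rightarrow> ('d \<Rightarrow> 'c \<Rightarrow> real \<Rightarrow> 'f) \<Rightarrow> ('f \<Rightarrow> complex) \<Rightarrow>
   'd \<Rightarrow> 'c \<Rightarrow> complex" where
  "G_tilde W4' W3 lam w w4' w3 =
     (if w4' \<in> carr W4' \<and> w3 \<in> carr W3 then Sum_any (\<lambda>n. w (lam w4' w3 n)) else 0)"

end

theory Submission
 imports Defs "HOL-Complex_Analysis.Cauchy_Integral_Formula"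
begin

text \<open>
  Write $\Phi(x,w_1,w_2,w_3)$ for the matrix coefficient of the product of $I_1$ and $I_2$, and
  $v^*_s$ for the coefficient of $x^{-s-1}$ in the opposite vertex operator of \<open>v\<close>.  For
  $a=-q-1$, $b=-p-1$ the coefficient identity of the theorem is an identity $J(a,b)$: the sum of
  $\binom{a}{c}z_2^{a-c}\,\widetilde G(v_{b+c}w)(x,w_3)$ over \<open>c\<close> equals
  \[\sum_c\binom{b}{c}(-z_2)^c\,\widetilde G(w)(v^*_{a+b-c}x,w_3)
    -\sum_c\binom{b}{c}(-z_2)^{b-c}\,\widetilde G(w)(x,v_{a+c}w_3).\]
  It is the identity attached to the test function $\xi^a(\xi-z_2)^b$.  As
  $\xi=(\xi-z_2)+z_2$, all terms satisfy the recursion $J(a+1,b)=J(a,b+1)+z_2J(a,b)$, so only the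
  rows $J(a,0)$ and the columns $J(0,b)$ have to be proved (\<open>pascal_identity\<close>).  This avoids any
  rearrangement of doubly infinite formal series.

  Both are first proved for $\Phi$.  The row comes from the commutator formulas of $I_1$ and $I_2$
  (\<open>prod_value_row\<close>).  The column comes from the residue of the Jacobi identity of $I_2$, into which
  the commutator formula of $I_1$ is inserted; the double series so obtained converges because
  $|z_2|<|z_1|$ (\<open>prod_value_column\<close>).

  They are then transferred to the homogeneous pieces $\lambda_n$ of $\Phi(x,\cdot,\cdot,w_3)$.  A
  form has at most one expansion $\sum_n\lambda_n$ for which $\sum_n e^{tL'(0)}\lambda_n$ converges
  absolutely near $t=0$ (\<open>expansion_unique\<close>): the sum of the series is a holomorphic function of
  \<open>t\<close> all of whose derivatives vanish at \<open>0\<close>, so it vanishes on the imaginary axis, and a Cesaro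
  mean along an arithmetic progression isolates each exponential.  Uniqueness makes $\lambda_n$
  bilinear and compatible with the $\tilde A$-grading, and it turns an identity between forms into
  identities between the pieces as soon as both sides are written as such expansions.  On the row
  side this requires the expansion of $(z_2+z_0)^a$, and uses $|z_0|<|z_2|$ (\<open>expands_row\<close>).  As
  the spaces of fixed degree are bounded below in weight, the identities between pieces have
  finitely many terms, and applying \<open>w\<close> and summing over the weights gives $J(a,0)$ and $J(0,b)$
  (\<open>G_row\<close>, \<open>G_column\<close>).

  That $\lambda_n$ lies in $\mathcal{D}_{P(z_0)}(W_1,W_2)$ holds because an object \<open>S\<close> of the category
  included in $(W_1\otimes W_2)^*$ is contained in $\mathcal{D}_{P(z_0)}(W_1,W_2)$
  (\<open>included_object_subset_D_space\<close>): evaluation is an intertwining map from $W_1\otimes W_2$ to the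
  completion of \<open>S'\<close>, its Jacobi identity being the compatibility condition, and its transpose
  has all of \<open>S\<close> in its image.
\<close>

section \<open>Series of exponential polynomials\<close>

text \<open>
  A series of polynomials of bounded degree that converges absolutely at infinitely many points
  converges absolutely coefficient by coefficient: divide by $X-x_0$ and induct on the degree.
\<close>

lemma coeff_summable_of_values:
 fixes p :: "'i => complex poly" and w :: "'i => real"
 assumes "infinite X"
  and "\<And>x. x \<in> X ==> (\<lambda>n. w n * norm (poly (p n) x)) summable_on UNIV"
  and "\<And>n j. j \<ge> K ==> coeff (p n) j = 0" and "\<And>n. w n \<ge> 0"
 shows "(\<lambda>n. w n * norm (coeff (p n) i)) summable_on UNIV"
 using assms(1-3)
proof (induction K arbitrary: p X i)
 case 0
 then show ?case by simp
next
 case (Suc K)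
 obtain x0 where x0: "x0 \<in> X" using Suc.prems(1) by (metis finite.emptyI ex_in_conv)
 define q where "q = (\<lambda>n. synthetic_div (p n) x0)"
 have q: "p n = pCons (poly (p n) x0) 0 + [:- x0, 1:] * q n" for n
  using synthetic_div_correct'[of x0 "p n"] by (simp add: q_def add.commute)
 have cq: "coeff (q n) j = 0" if "j \<ge> K" for n j
 proof -
  have "degree (p n) < Suc K"
   using Suc.prems(3) by (metis degree_0 leading_coeff_0_iff not_less zero_less_Suc)
  then have d: "degree (q n) \<le> K - 1" by (simp add: q_def degree_synthetic_div)
  show ?thesis
  proof (cases "K = 0")
   case True
   with \<open>degree (p n) < Suc K\<close> have "degree (p n) = 0" by simp
   then show ?thesis unfolding q_def by (metis synthetic_div_eq_0_iff coeff_0)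
  next
   case False
   with d that show ?thesis by (intro coeff_eq_0) linarith
  qed
 qed
 have sq: "(\<lambda>n. w n * norm (poly (q n) x)) summable_on UNIV" if "x \<in> X - {x0}" for x
 proof -
  have "(\<lambda>n. (w n * norm (poly (p n) x) + w n * norm (poly (p n) x0)) * inverse (norm (x - x0)))
      summable_on UNIV"
   using that x0 by (intro summable_on_cmult_left summable_on_add Suc.prems(2)) auto
  then show ?thesis
  proof (rule summable_on_comparison_test)
   fix n
   have "poly (p n) x - poly (p n) x0 = (x - x0) * poly (q n) x"
    by (subst (1) q) (simp add: algebra_simps)
   then have "norm (x - x0) * norm (poly (q n) x) \<le> norm (poly (p n) x) + norm (poly (p n) x0)"
    by (metis norm_mult norm_triangle_ineq4)
   then have "norm (poly (q n) x) \<le> (norm (poly (p n) x) + norm (poly (p n) x0)) * inverse (norm (x - x0))"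
    using that by (simp add: field_simps)
   then show "w n * norm (poly (q n) x) \<le>
     (w n * norm (poly (p n) x) + w n * norm (poly (p n) x0)) * inverse (norm (x - x0))"
    using mult_left_mono[OF _ assms(4)[of n]] by (fastforce simp: algebra_simps)
  qed (use assms(4) in auto)
 qed
 have IH: "(\<lambda>n. w n * norm (coeff (q n) i)) summable_on UNIV" for i
  by (rule Suc.IH[of "X - {x0}"]) (use Suc.prems(1) sq cq in auto)
 show ?case
 proof (cases i)
  case 0
  have "(\<lambda>n. w n * norm (poly (p n) x0) + norm x0 * (w n * norm (coeff (q n) 0))) summable_on UNIV"
   using x0 by (intro summable_on_add Suc.prems(2) summable_on_cmult_right IH) auto
  then show ?thesis
  proof (rule summable_on_comparison_test)
   fix n
   have "coeff (p n) 0 = poly (p n) x0 - x0 * coeff (q n) 0"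
    by (subst (1) q) (simp add: coeff_pCons)
   then have "norm (coeff (p n) 0) \<le> norm (poly (p n) x0) + norm x0 * norm (coeff (q n) 0)"
    by (metis norm_mult norm_triangle_ineq4)
   from mult_left_mono[OF this assms(4)[of n]]
   show "w n * norm (coeff (p n) i) \<le>
     w n * norm (poly (p n) x0) + norm x0 * (w n * norm (coeff (q n) 0))"
    by (simp add: 0 algebra_simps)
  qed (use assms(4) in auto)
 next
  case (Suc j)
  have "(\<lambda>n. w n * norm (coeff (q n) j) + norm x0 * (w n * norm (coeff (q n) (Suc j)))) summable_on UNIV"
   by (intro summable_on_add summable_on_cmult_right IH)
  then show ?thesis
  proof (rule summable_on_comparison_test)
   fix n
   have "coeff (p n) (Suc j) = coeff (q n) j - x0 * coeff (q n) (Suc j)"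
    by (subst (1) q) (simp add: coeff_pCons)
   then have "norm (coeff (p n) (Suc j)) \<le> norm (coeff (q n) j) + norm x0 * norm (coeff (q n) (Suc j))"
    by (metis norm_mult norm_triangle_ineq4)
   from mult_left_mono[OF this assms(4)[of n]]
   show "w n * norm (coeff (p n) i) \<le>
     w n * norm (coeff (q n) j) + norm x0 * (w n * norm (coeff (q n) (Suc j)))"
    by (simp add: Suc algebra_simps)
  qed (use assms(4) in auto)
 qed
qed

lemma summable_on_sum:
 fixes f :: "'j => 'i => 'b::topological_comm_monoid_add"
 assumes "\<And>j. j \<in> J ==> f j summable_on A"
 shows "(\<lambda>n. \<Sum>j\<in>J. f j n) summable_on A"
 using assms by (induction J rule: infinite_finite_induct) (auto intro: summable_on_add)

lemma has_sum_sum: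
 fixes f :: "'j => 'i => 'b::topological_comm_monoid_add"
 assumes "\<And>j. j \<in> J ==> (f j has_sum s j) A"
 shows "((\<lambda>n. \<Sum>j\<in>J. f j n) has_sum (\<Sum>j\<in>J. s j)) A"
 using assms by (induction J rule: infinite_finite_induct) (auto intro: has_sum_add)

text \<open>
  Absolute convergence near \<open>0\<close> is used at the points $r+iy$ with fixed \<open>r\<close>, at which the
  exponential factor has the constant absolute value $e^{nr}$.
\<close>

lemma exp_poly_coeff_summable:
 fixes a :: "nat => real => complex"
 assumes "\<And>t. norm t < \<delta> ==>
   (\<lambda>n. norm (exp (of_real n * t) * (\<Sum>i<K. t ^ i * a i n))) summable_on UNIV"
  and "i < K" and "\<bar>r\<bar> < \<delta>"
 shows "(\<lambda>n. exp (n * r) * norm (a i n)) summable_on UNIV"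
proof -
 define p where "p = (\<lambda>n. \<Sum>i<K. monom (a i n) i)"
 have c: "coeff (p n) j = (if j < K then a j n else 0)" for n j
  by (simp add: p_def coeff_sum)
 have ev: "poly (p n) t = (\<Sum>i<K. t ^ i * a i n)" for n t
  by (simp add: p_def poly_sum poly_monom mult.commute)
 have "(\<lambda>n. exp (n * r) * norm (coeff (p n) i)) summable_on UNIV"
 proof (rule coeff_summable_of_values)
  have "inj_on (Complex r) {0<..<\<delta> - \<bar>r\<bar>}" by (auto simp: inj_on_def)
  then show "infinite (Complex r ` {0<..<\<delta> - \<bar>r\<bar>})"
   using assms(3) by (simp add: finite_image_iff infinite_Ioo)
 next
  fix x assume "x \<in> Complex r ` {0<..<\<delta> - \<bar>r\<bar>}"
  then obtain y where y: "x = Complex r y" "0 < y" "y < \<delta> - \<bar>r\<bar>" by auto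
  then have "norm x < \<delta>" using cmod_le[of x] by simp
  from assms(1)[OF this] show "(\<lambda>n. exp (n * r) * cmod (poly (p n) x)) summable_on UNIV"
   by (simp add: norm_mult y(1) ev)
 next
  show "coeff (p n) j = 0" if "j \<ge> K" for n j using that by (simp add: c)
 qed auto
 then show ?thesis using assms(2) by (simp add: c)
qed

text \<open>
  Termwise differentiation.  The hypotheses on \<open>a\<close> and \<open>b\<close> dominate both series uniformly near
  each point of the strip $|\mathrm{Re}\,t|<\delta$.
\<close>

lemma exp_poly_series_deriv:
 fixes a b :: "nat => real => complex"
 assumes a: "\<And>i r. i < K ==> \<bar>r\<bar> < \<delta> ==> (\<lambda>n. exp (n * r) * norm (a i n)) summable_on UNIV"
  and b: "\<And>i r. i < K ==> \<bar>r\<bar> < \<delta> ==> (\<lambda>n. exp (n * r) * norm (b i n)) summable_on UNIV"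
  and der: "\<And>n t. ((\<lambda>t. exp (of_real n * t) * (\<Sum>i<K. t ^ i * a i n)) has_field_derivative
         exp (of_real n * t) * (\<Sum>i<K. t ^ i * b i n)) (at t)"
  and z: "\<bar>Re z\<bar> < \<delta>"
 shows "((\<lambda>t. \<Sum>\<^sub>\<infinity>n. exp (of_real n * t) * (\<Sum>i<K. t ^ i * a i n)) has_field_derivative
      (\<Sum>\<^sub>\<infinity>n. exp (of_real n * z) * (\<Sum>i<K. z ^ i * b i n))) (at z)"
proof -
 define r where "r = (\<delta> - \<bar>Re z\<bar>) / 2"
 define r1 where "r1 = \<bar>Re z\<bar> + r"
 have r: "r > 0" "r1 < \<delta>" "r1 \<ge> 0" using z by (auto simp: r_def r1_def field_simps)
 define R where "R = norm z + r"
 have in_ball: "norm t \<le> R \<and> \<bar>Re t\<bar> \<le> r1" if "t \<in> cball z r" for t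
 proof -
  have n: "norm (t - z) \<le> r" using that by (simp add: dist_norm norm_minus_commute)
  then have "norm t \<le> norm z + r" using norm_triangle_sub[of t z] by linarith
  moreover have "\<bar>Re (t - z)\<bar> \<le> r" using n abs_Re_le_cmod order_trans by blast
  ultimately show ?thesis by (auto simp: R_def r1_def)
 qed
 have M: "norm (exp (of_real n * t) * (\<Sum>i<K. t ^ i * c i n)) \<le>
    (\<Sum>i<K. R ^ i * (exp (n * r1) * norm (c i n)) + R ^ i * (exp (n * (-r1)) * norm (c i n)))"
  if "t \<in> cball z r" for c :: "nat => real => complex" and n t
 proof -
  have 1: "exp (n * Re t) \<le> exp (n * r1) + exp (n * (- r1))"
  proof (cases "n \<ge> 0")
   case True
   then have "n * Re t \<le> n * r1" using in_ball[OF that] by (intro mult_left_mono) auto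
   then have "exp (n * Re t) \<le> exp (n * r1)" by simp
   then show ?thesis by (smt (verit) exp_gt_zero)
  next
   case False
   then have "n * Re t \<le> n * (-r1)" using in_ball[OF that] by (intro mult_left_mono_neg) auto
   then have "exp (n * Re t) \<le> exp (n * (-r1))" by simp
   then show ?thesis by (smt (verit) exp_gt_zero)
  qed
  have "norm (\<Sum>i<K. t ^ i * c i n) \<le> (\<Sum>i<K. R ^ i * norm (c i n))"
   by (rule sum_norm_le) (use in_ball[OF that] in \<open>auto simp: norm_mult norm_power intro!: mult_right_mono power_mono\<close>)
  then have "norm (exp (of_real n * t) * (\<Sum>i<K. t ^ i * c i n)) \<le>
    (exp (n * r1) + exp (n * (- r1))) * (\<Sum>i<K. R ^ i * norm (c i n))"
   unfolding norm_mult using 1 by (intro mult_mono) auto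
  also have "\<dots> = (\<Sum>i<K. R ^ i * (exp (n * r1) * norm (c i n)) + R ^ i * (exp (n * (-r1)) * norm (c i n)))"
   by (simp add: sum_distrib_left algebra_simps)
  finally show ?thesis .
 qed
 have Ms: "(\<lambda>n. (\<Sum>i<K. R ^ i * (exp (n * r1) * norm (c i n)) + R ^ i * (exp (n * (-r1)) * norm (c i n)))) summable_on UNIV"
  if "\<And>i r. i < K ==> \<bar>r\<bar> < \<delta> ==> (\<lambda>n. exp (n * r) * norm (c i n)) summable_on UNIV"
  for c :: "nat => real => complex"
  by (intro summable_on_sum summable_on_add summable_on_cmult_right that) (use r in auto)
 let ?f = "\<lambda>n t. exp (of_real n * t) * (\<Sum>i<K. t ^ i * a i n)"
 let ?f' = "\<lambda>n t. exp (of_real n * t) * (\<Sum>i<K. t ^ i * b i n)"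
 have ul: "uniform_limit (cball z r) (\<lambda>X t. \<Sum>n\<in>X. ?f n t) (\<lambda>t. \<Sum>\<^sub>\<infinity>n. ?f n t) (finite_subsets_at_top UNIV)"
  by (rule Weierstrass_m_test_general[OF M[where c = a] Ms[of a]]) (use a in auto)
 have ul': "uniform_limit (cball z r) (\<lambda>X t. \<Sum>n\<in>X. ?f' n t) (\<lambda>t. \<Sum>\<^sub>\<infinity>n. ?f' n t) (finite_subsets_at_top UNIV)"
  by (rule Weierstrass_m_test_general[OF M[where c = b] Ms[of b]]) (use b in auto)
 have "((\<lambda>X. \<Sum>n\<in>X. ?f' n z) \<longlongrightarrow> (\<Sum>\<^sub>\<infinity>n. ?f' n z)) (finite_subsets_at_top UNIV)"
  by (rule tendsto_uniform_limitI[OF ul']) (use r in auto)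
 moreover obtain g' where g': "\<And>w. w \<in> ball z r ==>
   ((\<lambda>t. \<Sum>\<^sub>\<infinity>n. ?f n t) has_field_derivative (g' w)) (at w) \<and>
   ((\<lambda>X. \<Sum>n\<in>X. ?f' n w) \<longlongrightarrow> g' w) (finite_subsets_at_top UNIV)"
 proof (rule has_complex_derivative_uniform_limit[OF _ ul])
  show "\<forall>\<^sub>F X in finite_subsets_at_top UNIV. continuous_on (cball z r) (\<lambda>t. \<Sum>n\<in>X. ?f n t) \<and>
    (\<forall>w\<in>ball z r. ((\<lambda>t. \<Sum>n\<in>X. ?f n t) has_field_derivative (\<Sum>n\<in>X. ?f' n w)) (at w))"
   by (intro always_eventually allI conjI ballI DERIV_sum der continuous_intros)
 qed (use r in auto)
 moreover have z_in: "z \<in> ball z r" using r(1) by simp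
 ultimately have "g' z = (\<Sum>\<^sub>\<infinity>n. ?f' n z)"
  using tendsto_unique[OF finite_subsets_at_top_neq_bot] by blast
 then show ?thesis using g'[OF z_in] by simp
qed

lemma geometric_mean_bound:
 fixes x :: complex
 assumes "norm x = 1" "x \<noteq> 1" "M > 0"
 shows "norm ((\<Sum>j\<in>{M..<2*M}. x ^ j) / of_nat M) \<le> 2 / (norm (1 - x) * M)"
proof -
 have "norm ((1 - x) * (\<Sum>j\<in>{M..<2*M}. x ^ j)) = norm (x ^ M - x ^ (2*M))"
  using sum_gp_multiplied[of M "2*M-1" x] assms
  by (simp add: atLeastLessThanSuc_atLeastAtMost[symmetric])
 moreover have "norm (x ^ M - x ^ (2*M)) \<le> 2"
  using norm_triangle_ineq4[of "x^M" "x^(2*M)"] assms by (simp add: norm_power)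
 ultimately have "norm (1 - x) * norm (\<Sum>j\<in>{M..<2*M}. x ^ j) \<le> 2"
  by (simp add: norm_mult)
 then show ?thesis
  using assms by (simp add: norm_divide divide_simps mult_ac)
qed

text \<open>
  After division by the \<open>K\<close>-th power of the variable, the almost periodic function
  $\sum_n a_{K,n}e^{iny}$ tends to \<open>0\<close> for $y\to\infty$, and so do its means against $e^{-imy}$, which
  also tend to $a_{K,m}$.
\<close>

lemma exp_poly_top_coeff_zero:
 fixes a :: "nat => real => complex"
 assumes sm: "\<And>i. i \<le> K ==> (\<lambda>n. norm (a i n)) summable_on UNIV"
  and zero: "\<And>y::real. ((\<lambda>n. exp (of_real n * (\<i> * of_real y)) *
         (\<Sum>i\<le>K. (\<i> * of_real y) ^ i * a i n)) has_sum 0) UNIV"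
 shows "a K m = 0"
proof -
 define e where "e = (\<lambda>n y::real. exp (of_real n * (\<i> * of_real y)))"
 have e1: "norm (e n y) = 1" for n y by (simp add: e_def)
 define g where "g = (\<lambda>i y. \<Sum>\<^sub>\<infinity>n. e n y * a i n)"
 define B where "B = (\<lambda>i. \<Sum>\<^sub>\<infinity>n. norm (a i n))"
 have hs: "((\<lambda>n. e n y * a i n) has_sum g i y) UNIV" if "i \<le> K" for i y
  unfolding g_def by (rule has_sum_infsum[OF abs_summable_summable]) (use sm[OF that] in \<open>simp add: norm_mult e1\<close>)
 have gB: "norm (g i y) \<le> B i" if "i \<le> K" for i y
  unfolding B_def by (rule norm_infsum_le[OF hs[OF that] has_sum_infsum[OF sm[OF that]]])
    (simp add: norm_mult e1)
 have B0: "B i \<ge> 0" for i unfolding B_def by (rule infsum_nonneg) auto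
 have rel: "(\<Sum>i\<le>K. (\<i> * of_real y) ^ i * g i y) = 0" for y
 proof -
  have "((\<lambda>n. \<Sum>i\<le>K. (\<i> * of_real y) ^ i * (e n y * a i n)) has_sum (\<Sum>i\<le>K. (\<i> * of_real y) ^ i * g i y)) UNIV"
   by (intro has_sum_sum has_sum_cmult_right hs) auto
  moreover have "(\<lambda>n. \<Sum>i\<le>K. (\<i> * of_real y) ^ i * (e n y * a i n)) =
    (\<lambda>n. exp (of_real n * (\<i> * of_real y)) * (\<Sum>i\<le>K. (\<i> * of_real y) ^ i * a i n))"
   by (simp add: e_def sum_distrib_left mult_ac)
  ultimately show ?thesis using zero[of y] has_sum_unique by fastforce
 qed
 define BB where "BB = (\<Sum>i<K. B i)"
 have gK: "norm (g K y) \<le> BB / y" if "y \<ge> 1" for y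
 proof -
  have "(\<i> * of_real y) ^ K * g K y = - (\<Sum>i<K. (\<i> * of_real y) ^ i * g i y)"
   using rel[of y] by (simp add: lessThan_Suc_atMost[symmetric] eq_neg_iff_add_eq_0 add.commute)
  then have "norm ((\<i> * of_real y) ^ K * g K y) = norm (\<Sum>i<K. (\<i> * of_real y) ^ i * g i y)"
   by (simp only: norm_minus_cancel)
  then have "y ^ K * norm (g K y) = norm (\<Sum>i<K. (\<i> * of_real y) ^ i * g i y)"
   using that by (simp add: norm_mult norm_power)
  also have "\<dots> \<le> (\<Sum>i<K. y ^ K / y * B i)"
  proof (rule sum_norm_le)
   fix i assume i: "i \<in> {..<K}"
   have "y ^ i \<le> y ^ (K - 1)" using i that by (intro power_increasing) auto
   also have "\<dots> = y ^ K / y" using i that by (cases K) auto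
   finally have "y ^ i * norm (g i y) \<le> y ^ K / y * B i"
    using i gB[of i y] that by (intro mult_mono) auto
   then show "norm ((\<i> * of_real y) ^ i * g i y) \<le> y ^ K / y * B i"
    using that by (simp add: norm_mult norm_power)
  qed
  also have "\<dots> = y ^ K * (BB / y)" by (simp add: BB_def sum_distrib_left sum_divide_distrib)
  finally have "y ^ K * norm (g K y) \<le> y ^ K * (BB / y)" .
  then show ?thesis using that by (subst (asm) mult_le_cancel_left_pos) auto
 qed
 \<comment> \<open>a step length for which none of the countably many other frequencies aliases to \<open>m\<close>\<close>
 obtain y0 where y0: "y0 \<ge> 1" "\<And>n. a K n \<noteq> 0 ==> n \<noteq> m ==> e (n - m) y0 \<noteq> 1"
 proof -
  have "countable {n\<in>UNIV. a K n \<noteq> 0}" using abs_summable_countable sm by blast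
  then have "countable ((\<lambda>(k::int, n). 2 * pi * k / (n - m)) ` (UNIV \<times> {n\<in>UNIV. a K n \<noteq> 0}))" (is "countable ?B")
   by (intro countable_image countable_SIGMA) auto
  moreover have "uncountable {1<..<2::real}" by (simp add: uncountable_open_interval)
  ultimately obtain y0 where y0: "y0 \<in> {1<..<2}" "y0 \<notin> ?B"
   by (meson countable_subset subsetI)
  show ?thesis
  proof (rule that)
   show "y0 \<ge> 1" using y0 by simp
   fix n assume n: "a K n \<noteq> 0" "n \<noteq> m"
   show "e (n - m) y0 \<noteq> 1"
   proof
    assume "e (n - m) y0 = 1"
    then obtain k :: int where "(n - m) * y0 = of_int (2 * k) * pi"
     unfolding e_def by (auto simp: exp_eq_1)
    then have "y0 = (\<lambda>(k::int, n). 2 * pi * k / (n - m)) (k, n)"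
     using n by (simp add: field_simps)
    then show False using y0(2) n(1) by (metis (mono_tags, lifting) UNIV_I image_eqI mem_Collect_eq mem_Sigma_iff)
   qed
  qed
 qed
 define c where "c = (\<lambda>n M. (\<Sum>j\<in>{M..<2*M}. e (n - m) y0 ^ j) / of_nat M)"
 define h where "h = (\<lambda>M. (\<Sum>j\<in>{M..<2*M}. e m (- (real j * y0)) * g K (real j * y0)) / of_nat M)"
 have ee: "e (n - m) y0 ^ j = e m (- (real j * y0)) * e n (real j * y0)" for n j
  unfolding e_def by (simp add: exp_of_nat_mult[symmetric] exp_add[symmetric] algebra_simps)
 have hsum: "((\<lambda>n. a K n * c n M) has_sum h M) UNIV" for M
 proof -
  have "((\<lambda>n. (\<Sum>j\<in>{M..<2*M}. e m (- (real j * y0)) * (e n (real j * y0) * a K n)) * inverse (of_nat M)) has_sum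
    (\<Sum>j\<in>{M..<2*M}. e m (- (real j * y0)) * g K (real j * y0)) * inverse (of_nat M)) UNIV"
   by (intro has_sum_cmult_left has_sum_sum has_sum_cmult_right hs) auto
  then show ?thesis
   unfolding h_def c_def ee divide_inverse
   by (rule back_subst[of "\<lambda>f. (f has_sum _) UNIV"]) (auto simp: sum_distrib_left sum_distrib_right mult_ac)
 qed
 have c1: "norm (c n M) \<le> 1" for n M
 proof -
  have "norm (\<Sum>j\<in>{M..<2*M}. e (n - m) y0 ^ j) \<le> (\<Sum>j\<in>{M..<2*M}. 1)"
   by (rule sum_norm_le) (simp add: norm_power e1)
  then show ?thesis by (simp add: c_def norm_divide divide_simps)
 qed
 have ul: "uniform_limit UNIV (\<lambda>X M. \<Sum>n\<in>X. a K n * c n M) h (finite_subsets_at_top UNIV)"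
  by (rule Weierstrass_m_test_general'[OF _ hsum sm[of K]])
    (auto simp: norm_mult intro: mult_left_le[OF c1])
 have "((\<lambda>n. if n = m then a K m else 0) has_sum a K m) UNIV"
  by (rule has_sum_finite_neutralI[of "{m}"]) auto
 then have lim: "((\<lambda>X. \<Sum>n\<in>X. if n = m then a K m else 0) \<longlongrightarrow> a K m) (finite_subsets_at_top UNIV)"
  by (simp add: has_sum_def)
 have "(\<lambda>M. a K n * c n M) \<longlonglongrightarrow> (if n = m then a K m else 0)" for n
 proof (cases "n = m \<or> a K n = 0")
  case True
  have "c m M = 1" if "M > 0" for M using that by (simp add: c_def e_def)
  then have "\<forall>\<^sub>F M in sequentially. a K n * c n M = (if n = m then a K m else 0)"
   using True by (auto intro!: eventually_mono[OF eventually_gt_at_top[of 0]])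
  then show ?thesis by (rule tendsto_eventually)
 next
  case False
  then have ne: "e (n - m) y0 \<noteq> 1" using y0 by auto
  have "(\<lambda>M. c n M) \<longlonglongrightarrow> 0"
  proof (rule Lim_null_comparison)
   show "\<forall>\<^sub>F M in sequentially. norm (c n M) \<le> 2 / norm (1 - e (n - m) y0) * (1 / real M)"
    unfolding c_def using geometric_mean_bound[OF e1 ne]
    by (intro eventually_mono[OF eventually_gt_at_top[of 0]]) simp
   show "(\<lambda>M. 2 / norm (1 - e (n - m) y0) * (1 / real M)) \<longlonglongrightarrow> 0"
    by (intro tendsto_mult_right_zero lim_1_over_n)
  qed
  then show ?thesis using False by (auto intro: tendsto_mult_right_zero)
 qed
 then have ev: "\<forall>\<^sub>F X in finite_subsets_at_top UNIV. (\<lambda>M. \<Sum>n\<in>X. a K n * c n M)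
   \<longlonglongrightarrow> (\<Sum>n\<in>X. if n = m then a K m else 0)"
  by (intro always_eventually allI tendsto_sum)
 have "h \<longlonglongrightarrow> a K m"
  by (rule swap_uniform_limit'[OF ev lim ul]) auto
 moreover have "h \<longlonglongrightarrow> 0"
 proof (rule Lim_null_comparison)
  show "\<forall>\<^sub>F M in sequentially. norm (h M) \<le> BB * (1 / real M)"
  proof (rule eventually_mono[OF eventually_gt_at_top[of 0]])
   fix M :: nat assume M: "0 < M"
   have "norm (\<Sum>j\<in>{M..<2*M}. e m (- (real j * y0)) * g K (real j * y0)) \<le> (\<Sum>j\<in>{M..<2*M}. BB / real M)"
   proof (rule sum_norm_le)
    fix j assume j: "j \<in> {M..<2*M}"
    have jy: "real M \<le> real j * y0" 
     using mult_mono[of "real M" "real j" 1 y0] j y0(1) by simp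
    then have "norm (g K (real j * y0)) \<le> BB / (real j * y0)" using M by (intro gK) linarith
    also have "\<dots> \<le> BB / real M" using jy M B0 by (intro divide_left_mono) (auto simp: BB_def sum_nonneg)
    finally show "norm (e m (- (real j * y0)) * g K (real j * y0)) \<le> BB / real M"
     by (simp add: norm_mult e1)
   qed
   then have "norm (\<Sum>j\<in>{M..<2*M}. e m (- (real j * y0)) * g K (real j * y0)) \<le> BB" using M by simp
   then show "norm (h M) \<le> BB * (1 / real M)"
    using M by (simp add: h_def norm_divide divide_right_mono)
  qed
  show "(\<lambda>M. BB * (1 / real M)) \<longlonglongrightarrow> 0"
   by (intro tendsto_mult_right_zero lim_1_over_n)
 qed
 ultimately show ?thesis using LIMSEQ_unique by blast
qed

lemma exp_poly_coeffs_zero: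
 fixes a :: "nat => real => complex"
 assumes "\<And>i. i < K ==> (\<lambda>n. norm (a i n)) summable_on UNIV"
  and "\<And>y::real. ((\<lambda>n. exp (of_real n * (\<i> * of_real y)) *
         (\<Sum>i<K. (\<i> * of_real y) ^ i * a i n)) has_sum 0) UNIV"
  and "i < K"
 shows "a i m = 0"
 using assms
proof (induction K)
 case (Suc K)
 have top: "a K n = 0" for n
  by (rule exp_poly_top_coeff_zero)
    (use Suc.prems(1,2) in \<open>auto simp: lessThan_Suc_atMost[symmetric] simp del: sum.lessThan_Suc\<close>)
 show ?case
 proof (cases "i = K")
  case False
  show ?thesis
   by (rule Suc.IH) (use Suc.prems False top in auto)
 qed (use top in simp)
qed simp

lemma scaleC_fun_apply [simp]: "(c *\<^sub>C f) x = c *\<^sub>C (f x)"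
 by (simp add: scaleC_fun_def)

lemma scaleC_complex [simp]: "c *\<^sub>C (x::complex) = c * x"
 by (simp add: scaleC_complex_def)

text \<open>
  The action of $e^{tL}$ on a form annihilated by $(L-n)^K$, evaluated at $(u_1,u_2)$.
\<close>

definition exp_act ::
 "(('a => 'b => complex) => 'a => 'b => complex) => nat => complex => complex =>
  ('a => 'b => complex) => 'a => 'b => complex" where
 "exp_act L K n t \<nu> u1 u2 =
   exp (n * t) * (\<Sum>i<K. t ^ i * ((shift_op L n ^^ i) \<nu> u1 u2 / fact i))"

lemma exp_act_0: "K > 0 ==> exp_act L K n 0 \<nu> u1 u2 = \<nu> u1 u2"
 by (cases K) (simp_all add: exp_act_def sum.lessThan_Suc_shift del: sum.lessThan_Suc)

lemma truncated_exp_deriv: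
 fixes c :: "nat => complex"
 shows "((\<lambda>t. \<Sum>i<Suc K. t ^ i * (c i / fact i)) has_field_derivative
      (\<Sum>i<K. t ^ i * (c (Suc i) / fact i))) (at t)"
proof (induction K)
 case (Suc K)
 have "((\<lambda>t. t ^ Suc K * (c (Suc K) / fact (Suc K))) has_field_derivative
     (t ^ K * (c (Suc K) / fact K))) (at t)"
  by (rule derivative_eq_intros refl)+ (simp add: divide_simps del: of_nat_Suc)
 from DERIV_add[OF Suc this] show ?case by simp
qed auto

text \<open>
  A linear operator on forms on a pair of spaces, for example $L'_{P(z)}(0)$.
\<close>

locale form_operator =
 fixes L :: "('a => 'b => complex) => 'a => 'b => complex"
 assumes L_add: "L (x + y) = L x + L y" and L_scale: "L (c *\<^sub>C x) = c *\<^sub>C L x"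
begin

lemma L_diff: "L (x - y) = L x - L y"
 using L_add[of "x - y" y] by (simp add: algebra_simps)

lemma shift_add: "shift_op L n (x + y) = shift_op L n x + shift_op L n y"
 by (simp add: shift_op_def L_add complex_vector.scale_right_distrib)

lemma shift_scale: "shift_op L n (c *\<^sub>C x) = c *\<^sub>C shift_op L n x"
 by (simp add: shift_op_def L_scale complex_vector.scale_right_diff_distrib mult.commute)

lemma shift_pow_add: "(shift_op L n ^^ i) (x + y) = (shift_op L n ^^ i) x + (shift_op L n ^^ i) y"
 by (induction i) (simp_all only: funpow.simps id_apply o_apply shift_add)

lemma shift_pow_scale: "(shift_op L n ^^ i) (c *\<^sub>C x) = c *\<^sub>C (shift_op L n ^^ i) x"
 by (induction i) (simp_all only: funpow.simps id_apply o_apply shift_scale)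

lemma shift_zero: "shift_op L n 0 = 0"
 using shift_scale[of n 0 0] by simp

lemma shift_pow_zero: "(shift_op L n ^^ i) 0 = 0"
 by (induction i) (simp_all only: funpow.simps id_apply o_apply shift_zero)

lemma shift_pow_mono: "(shift_op L n ^^ i) x = 0 ==> i \<le> j ==> (shift_op L n ^^ j) x = 0"
 by (metis le_add_diff_inverse2 funpow_add o_apply shift_pow_zero)

lemma shift_L: "shift_op L n (L x) = L (shift_op L n x)"
 by (simp add: shift_op_def L_diff L_scale)

lemma shift_pow_L: "(shift_op L n ^^ i) (L x) = L ((shift_op L n ^^ i) x)"
 by (induction i) (simp_all add: shift_L)

lemma shift_pow_L': "(shift_op L n ^^ i) (L x) = (shift_op L n ^^ Suc i) x + n *\<^sub>C (shift_op L n ^^ i) x"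
 unfolding shift_pow_L by (simp add: shift_op_def)

lemma exp_act_add: "exp_act L K n t (x + y) u1 u2 = exp_act L K n t x u1 u2 + exp_act L K n t y u1 u2"
 by (simp add: exp_act_def shift_pow_add algebra_simps sum.distrib add_divide_distrib)

lemma exp_act_scale: "exp_act L K n t (c *\<^sub>C x) u1 u2 = c * exp_act L K n t x u1 u2"
 by (simp add: exp_act_def shift_pow_scale sum_distrib_left mult_ac)

lemma exp_act_deriv:
 assumes "(shift_op L n ^^ K) \<nu> = 0"
 shows "((\<lambda>t. exp_act L K n t \<nu> u1 u2) has_field_derivative exp_act L K n t (L \<nu>) u1 u2) (at t)"
proof -
 define c where "c = (\<lambda>i. (shift_op L n ^^ i) \<nu> u1 u2)"
 have cK: "c K = 0" using assms by (simp add: c_def)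
 have "((\<lambda>t. \<Sum>i<K. t ^ i * (c i / fact i)) has_field_derivative
      (\<Sum>i<K. t ^ i * (c (Suc i) / fact i))) (at t)"
  using truncated_exp_deriv[of c K t] cK by simp
 from DERIV_mult[OF DERIV_fun_exp[OF DERIV_cmult[OF DERIV_ident], of n] this]
 have "((\<lambda>t. exp (n * t) * (\<Sum>i<K. t ^ i * (c i / fact i))) has_field_derivative
   exp (n * t) * n * (\<Sum>i<K. t ^ i * (c i / fact i)) +
   (\<Sum>i<K. t ^ i * (c (Suc i) / fact i)) * exp (n * t)) (at t)" by (simp add: mult.assoc)
 moreover have "exp (n * t) * n * (\<Sum>i<K. t ^ i * (c i / fact i)) +
   (\<Sum>i<K. t ^ i * (c (Suc i) / fact i)) * exp (n * t) = exp_act L K n t (L \<nu>) u1 u2"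
  unfolding exp_act_def shift_pow_L'
  by (simp add: c_def algebra_simps sum.distrib add_divide_distrib sum_distrib_left)
 ultimately show ?thesis by (simp add: exp_act_def c_def)
qed

lemma shift_pow_nil_L: "(shift_op L n ^^ K) \<nu> = 0 ==> (shift_op L n ^^ K) ((L ^^ k) \<nu>) = 0"
proof (induction k)
 case (Suc k)
 have "L 0 = 0" using L_scale[of 0 0] by simp
 with Suc show ?case by (simp only: funpow.simps o_apply shift_pow_L)
qed simp


lemma exp_series_sums:
 assumes "(shift_op L n ^^ K) \<nu> = 0" "K > 0"
 shows "(\<lambda>k. t ^ k / fact k * (L ^^ k) \<nu> u1 u2) sums exp_act L K n t \<nu> u1 u2"
proof -
 let ?f = "\<lambda>t. exp_act L K n t \<nu> u1 u2"
 have D: "(deriv ^^ k) ?f = (\<lambda>t. exp_act L K n t ((L ^^ k) \<nu>) u1 u2)" for k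
 proof (induction k)
  case (Suc k)
  have "deriv (\<lambda>t. exp_act L K n t ((L ^^ k) \<nu>) u1 u2) = (\<lambda>t. exp_act L K n t ((L ^^ Suc k) \<nu>) u1 u2)"
   using exp_act_deriv[OF shift_pow_nil_L[OF assms(1), of k]] by (auto intro!: DERIV_imp_deriv)
  then show ?case by (simp add: Suc)
 qed simp
 have "?f holomorphic_on ball 0 (norm t + 1)"
  using exp_act_deriv[OF assms(1)] by (auto simp: holomorphic_on_open)
 from holomorphic_power_series[OF this, of t]
 show ?thesis by (simp add: D exp_act_0 assms(2) field_simps)
qed

text \<open>
  The uniqueness of expansions.  The operator is assumed to be given by operators on the arguments
  that preserve \<open>P1\<close> and \<open>P2\<close>; so the derivatives of the sum of the series at \<open>0\<close>, which are the values
  of the form $L^k\sum_n\lambda_n$, vanish on these spaces.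
\<close>

lemma expansion_unique:
 fixes lam :: "real => 'a => 'b => complex"
 assumes P1: "\<And>u. u \<in> P1 ==> A u \<in> P1" "\<And>u. u \<in> P1 ==> A' u \<in> P1" and P2: "\<And>u. u \<in> P2 ==> B u \<in> P2"
  and Lf: "\<And>\<nu> u1 u2. u1 \<in> P1 ==> u2 \<in> P2 ==> L \<nu> u1 u2 = \<nu> u1 (B u2) + \<nu> (A u1) u2 + z * \<nu> (A' u1) u2"
  and "K > 0" "\<delta> > 0"
  and nil: "\<And>n. (shift_op L (of_real n) ^^ K) (lam n) = 0"
  and sm: "\<And>u1 u2 t. u1 \<in> P1 ==> u2 \<in> P2 ==> norm t < \<delta> ==>
    (\<lambda>n. norm (exp_act L K (of_real n) t (lam n) u1 u2)) summable_on UNIV"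
  and zero: "\<And>u1 u2. u1 \<in> P1 ==> u2 \<in> P2 ==> ((\<lambda>n. lam n u1 u2) has_sum 0) UNIV"
  and u: "u1 \<in> P1" "u2 \<in> P2"
 shows "lam n u1 u2 = 0"
proof -
 define H where "H = (\<lambda>lam::real => 'a => 'b => complex. (\<forall>n. (shift_op L (of_real n) ^^ K) (lam n) = 0) \<and>
   (\<forall>u1\<in>P1. \<forall>u2\<in>P2. (\<forall>t. norm t < \<delta> -->
    (\<lambda>n. norm (exp_act L K (of_real n) t (lam n) u1 u2)) summable_on UNIV) \<and>
    ((\<lambda>n. lam n u1 u2) has_sum 0) UNIV))"
 have HL: "H (\<lambda>n. L (lam n))" if H: "H lam" for lam
  unfolding H_def
 proof (intro conjI allI ballI impI)
  show "(shift_op L (of_real n) ^^ K) (L (lam n)) = 0" for n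
   using H shift_pow_nil_L[of K "of_real n" "lam n" 1] by (simp add: H_def)
  fix u1 u2 assume u: "u1 \<in> P1" "u2 \<in> P2"
  have e: "exp_act L K (of_real n) t (L (lam n)) u1 u2 = exp_act L K (of_real n) t (lam n) u1 (B u2) +
    exp_act L K (of_real n) t (lam n) (A u1) u2 + z * exp_act L K (of_real n) t (lam n) (A' u1) u2" for n t
   unfolding exp_act_def shift_pow_L Lf[OF u]
   by (simp add: sum_distrib_left algebra_simps sum.distrib add_divide_distrib)
  show "(\<lambda>n. norm (exp_act L K (of_real n) t (L (lam n)) u1 u2)) summable_on UNIV" if "norm t < \<delta>" for t
  proof (rule Infinite_Sum.abs_summable_on_comparison_test')
   show "(\<lambda>n. norm (exp_act L K (of_real n) t (lam n) u1 (B u2)) +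
     norm (exp_act L K (of_real n) t (lam n) (A u1) u2) +
     norm z * norm (exp_act L K (of_real n) t (lam n) (A' u1) u2)) summable_on UNIV"
    using H u that P1 P2 unfolding H_def by (intro summable_on_add summable_on_cmult_right) auto
   show "norm (exp_act L K (of_real n) t (L (lam n)) u1 u2) \<le> norm (exp_act L K (of_real n) t (lam n) u1 (B u2)) +
     norm (exp_act L K (of_real n) t (lam n) (A u1) u2) +
     norm z * norm (exp_act L K (of_real n) t (lam n) (A' u1) u2)" for n
    unfolding e norm_mult[symmetric]
    by (rule order_trans[OF norm_triangle_ineq add_right_mono[OF norm_triangle_ineq]])
  qed
  have "((\<lambda>n. lam n u1 (B u2) + lam n (A u1) u2 + z * lam n (A' u1) u2) has_sum (0 + 0 + z * 0)) UNIV"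
   using H u P1 P2 unfolding H_def by (intro has_sum_add has_sum_cmult_right) auto
  then show "((\<lambda>n. L (lam n) u1 u2) has_sum 0) UNIV" by (simp add: Lf[OF u])
 qed
 have H: "H lam" using nil sm zero by (simp add: H_def)
 have HLk: "H (\<lambda>n. (L ^^ k) (lam n))" for k
 proof (induction k)
  case (Suc k)
  from HL[OF Suc] show ?case by simp
 qed (use H in simp)
 define a where "a = (\<lambda>(lam::real => 'a => 'b => complex) i n. (shift_op L (of_real n) ^^ i) (lam n) u1 u2 / fact i)"
 have ea: "exp_act L K (of_real n) t (lam n) u1 u2 = exp (of_real n * t) * (\<Sum>i<K. t ^ i * a lam i n)" for lam n t
  by (simp add: exp_act_def a_def)
 have coef: "(\<lambda>n. exp (n * r) * norm (a lam i n)) summable_on UNIV" if "H lam" "i < K" "\<bar>r\<bar> < \<delta>" for lam i r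
  by (rule exp_poly_coeff_summable[OF _ that(2,3)]) (use that(1) u in \<open>auto simp: H_def ea[symmetric]\<close>)
 define F where "F = (\<lambda>lam t. \<Sum>\<^sub>\<infinity>n. exp_act L K (of_real n) t (lam n) u1 u2)"
 have dF: "(F lam has_field_derivative F (\<lambda>n. L (lam n)) t) (at t)" if "H lam" "\<bar>Re t\<bar> < \<delta>" for lam t
  unfolding F_def ea
 proof (rule exp_poly_series_deriv[OF coef[OF that(1)] coef[OF HL[OF that(1)]] _ that(2)])
  show "((\<lambda>t. exp (complex_of_real n * t) * (\<Sum>i<K. t ^ i * a lam i n)) has_field_derivative
     exp (complex_of_real n * t) * (\<Sum>i<K. t ^ i * a (\<lambda>n. L (lam n)) i n)) (at t)" for n t
   using exp_act_deriv[of K "of_real n" "lam n" u1 u2 t] that(1)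
   by (simp add: ea ea[of n _ "\<lambda>n. L (lam n)"] H_def)
 qed
 let ?S = "{t::complex. \<bar>Re t\<bar> < \<delta>}"
 have "?S = {t. Re t < \<delta>} \<inter> {t. Re t > - \<delta>}" by auto
 then have S: "open ?S" "connected ?S"
  by (auto intro!: convex_connected convex_Int convex_halfspace_Re_lt convex_halfspace_Re_gt
     open_Int open_halfspace_Re_lt open_halfspace_Re_gt)
 have Dk: "(deriv ^^ k) (F lam) t = F (\<lambda>n. (L ^^ k) (lam n)) t" if "t \<in> ?S" for k t
  using that
 proof (induction k arbitrary: t)
  case (Suc k)
  have "\<forall>\<^sub>F s in nhds t. (deriv ^^ k) (F lam) s = F (\<lambda>n. (L ^^ k) (lam n)) s"
   using eventually_nhds_in_open[OF S(1) Suc.prems] by (rule eventually_mono) (rule Suc.IH)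
  then have "(deriv ^^ Suc k) (F lam) t = deriv (F (\<lambda>n. (L ^^ k) (lam n))) t"
   by (simp add: deriv_cong_ev)
  also have "\<dots> = F (\<lambda>n. (L ^^ Suc k) (lam n)) t"
   using DERIV_imp_deriv[OF dF[OF HLk]] Suc.prems by simp
  finally show ?case .
 qed simp
 have "(deriv ^^ k) (F lam) 0 = 0" for k
 proof -
  have "((\<lambda>n. (L ^^ k) (lam n) u1 u2) has_sum 0) UNIV" using HLk u unfolding H_def by blast
  then show ?thesis using \<open>\<delta> > 0\<close> \<open>K > 0\<close> by (subst Dk) (auto simp: F_def exp_act_0 infsumI)
 qed
 moreover have "F lam holomorphic_on ?S"
  using dF[OF H] S(1) by (auto simp: holomorphic_on_open)
 ultimately have F0: "F lam t = 0" if "t \<in> ?S" for t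
  using that holomorphic_fun_eq_0_on_connected[OF _ S, of "F lam" 0 t] \<open>\<delta> > 0\<close> by auto
 have "a lam 0 n = 0"
 proof (rule exp_poly_coeffs_zero)
  show "0 < K" by fact
  show sa: "(\<lambda>n. norm (a lam i n)) summable_on UNIV" if "i < K" for i
   using coef[OF H that, of 0] \<open>\<delta> > 0\<close> by simp
  show "((\<lambda>n. exp (complex_of_real n * (\<i> * of_real y)) * (\<Sum>i<K. (\<i> * of_real y) ^ i * a lam i n)) has_sum 0) UNIV" for y
  proof -
   have "(\<lambda>n. norm (exp (complex_of_real n * (\<i> * of_real y)) * (\<Sum>i<K. (\<i> * of_real y) ^ i * a lam i n))) summable_on UNIV"
   proof (rule Infinite_Sum.abs_summable_on_comparison_test')
    show "(\<lambda>n. \<Sum>i<K. \<bar>y\<bar> ^ i * norm (a lam i n)) summable_on UNIV"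
     by (intro summable_on_sum summable_on_cmult_right sa) auto
    show "norm (exp (complex_of_real n * (\<i> * of_real y)) * (\<Sum>i<K. (\<i> * of_real y) ^ i * a lam i n))
     \<le> (\<Sum>i<K. \<bar>y\<bar> ^ i * norm (a lam i n))" for n
     by (simp add: norm_mult) (rule sum_norm_le, simp add: norm_mult norm_power)
   qed
   from has_sum_infsum[OF abs_summable_summable[OF this]] show ?thesis
    using F0[of "\<i> * of_real y"] \<open>\<delta> > 0\<close> by (simp add: F_def ea)
  qed
 qed
 then show ?thesis by (simp add: a_def)
qed

end

section \<open>Linear algebra on subspaces of a type\<close>

lemmas csub_add = complex_vector.subspace_add and csub_scale = complex_vector.subspace_scale
 and csub_sum = complex_vector.subspace_sum and csub_diff = complex_vector.subspace_diff

lemma sum_fun_apply: "(\<Sum>i\<in>I. f i) x = (\<Sum>i\<in>I. f i x)"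
 by (induction I rule: infinite_finite_induct) auto

lemma lin_in: "linear_map_on S T f ==> x \<in> S ==> f x \<in> T"
 and lin_add: "linear_map_on S T f ==> x \<in> S ==> y \<in> S ==> f (x + y) = f x + f y"
 and lin_scale: "linear_map_on S T f ==> x \<in> S ==> f (c *\<^sub>C x) = c *\<^sub>C f x"
 by (auto simp: linear_map_on_def)

lemma lin_zero: "linear_map_on S T f ==> 0 \<in> S ==> f 0 = 0"
 using lin_scale[of S T f 0 0] by simp

lemma lin_diff:
 assumes "linear_map_on S T f" "csubspace S" "x \<in> S" "y \<in> S"
 shows "f (x - y) = f x - f y"
 using lin_add[OF assms(1) csub_diff[OF assms(2-4)] assms(4)]
 by (simp add: algebra_simps)

lemma lin_sum:
 assumes "linear_map_on S T f" "csubspace S" "\<And>i. i \<in> I ==> g i \<in> S"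
 shows "f (\<Sum>i\<in>I. g i) = (\<Sum>i\<in>I. f (g i))"
 using assms(3)
proof (induction I rule: infinite_finite_induct)
 case (insert i I)
 then have "(\<Sum>i\<in>I. g i) \<in> S" using assms(2) by (intro complex_vector.subspace_sum) auto
 then show ?case using insert lin_add[OF assms(1)] by simp
qed (use lin_zero[OF assms(1)] assms(2) complex_vector.subspace_0 in auto)

lemma Sum_any_superset: "finite A ==> (\<And>i. i \<notin> A ==> g i = 0) ==> Sum_any g = sum g A"
 by (rule Sum_any.expand_superset) auto

lemma Sum_any_single: "(\<And>j. j \<noteq> i ==> g j = 0) ==> Sum_any g = g i"
 by (subst Sum_any_superset[of "{i}"]) auto

context
 fixes S :: "'a::complex_vector set" and F :: "'i => 'a set"
 assumes ds: "is_direct_sum S F"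
begin

lemma ds_subspace: "csubspace S" and ds_summand: "csubspace (F i)" and ds_subset: "F i \<subseteq> S"
 using ds by (auto simp: is_direct_sum_def)

lemma ds_decomposition: "x \<in> S ==> decomposition F x (\<lambda>i. component F i x)"
 using ds theI'[of "decomposition F x"] unfolding is_direct_sum_def component_def by simp

lemma component_in: "x \<in> S ==> component F i x \<in> F i"
 and component_finite: "x \<in> S ==> finite {i. component F i x \<noteq> 0}"
 and component_Sum_any: "x \<in> S ==> x = Sum_any (\<lambda>i. component F i x)"
 using ds_decomposition[of x] unfolding decomposition_def by blast+

lemma component_sum:
 "x \<in> S ==> finite I ==> (\<And>i. i \<notin> I ==> component F i x = 0) ==> x = (\<Sum>i\<in>I. component F i x)"
 using component_Sum_any[of x] Sum_any_superset[of I "\<lambda>i. component F i x"] by simp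

lemma component_unique: "x \<in> S ==> decomposition F x c ==> component F i x = c i"
 using ds ds_decomposition[of x] unfolding is_direct_sum_def by metis

lemma component_of_sum:
 assumes "finite I" "\<And>i. i \<in> I ==> g i \<in> F i"
 shows "component F j (\<Sum>i\<in>I. g i) = (if j \<in> I then g j else 0)"
proof (rule component_unique)
 show "(\<Sum>i\<in>I. g i) \<in> S"
  using ds_subspace ds_subset assms(2) by (intro complex_vector.subspace_sum) auto
 have "finite {i. (if i \<in> I then g i else 0) \<noteq> 0}"
  using assms(1) by (rule rev_finite_subset) auto
 moreover have "(if i \<in> I then g i else 0) \<in> F i" for i
  using assms(2) complex_vector.subspace_0[OF ds_summand] by auto
 ultimately show "decomposition F (\<Sum>i\<in>I. g i) (\<lambda>j. if j \<in> I then g j else 0)"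
  unfolding decomposition_def using assms(1)
  by (subst Sum_any_superset[of I]) auto
qed

lemma component_of_summand: "x \<in> F i ==> component F j x = (if j = i then x else 0)"
 using component_of_sum[of "{i}" "\<lambda>_. x" j] by simp

lemma ds_independent:
 "finite I ==> (\<And>i. i \<in> I ==> g i \<in> F i) ==> (\<Sum>i\<in>I. g i) = 0 ==> i \<in> I ==> g i = 0"
 using component_of_sum[of I g i] component_of_sum[of "{}" g i] by simp

lemma component_linear: "linear_map_on S (F i) (component F i)"
 unfolding linear_map_on_def
proof (intro conjI ballI allI)
 show "component F i x \<in> F i" if "x \<in> S" for x using component_in that .
next
 fix x y assume xy: "x \<in> S" "y \<in> S"
 show "component F i (x + y) = component F i x + component F i y"
 proof (rule component_unique)
  show "x + y \<in> S" using xy ds_subspace complex_vector.subspace_add by blast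
  have "finite {i. component F i x + component F i y \<noteq> 0}"
   by (rule finite_subset[OF _ finite_UnI[OF component_finite[OF xy(1)] component_finite[OF xy(2)]]]) auto
  then show "decomposition F (x + y) (\<lambda>i. component F i x + component F i y)"
   unfolding decomposition_def
   using component_in[OF xy(1)] component_in[OF xy(2)] ds_summand complex_vector.subspace_add
    Sum_any.distrib[OF component_finite[OF xy(1)] component_finite[OF xy(2)]]
    component_Sum_any[OF xy(1)] component_Sum_any[OF xy(2)] by metis
 qed
next
 fix c x assume x: "x \<in> S"
 define I where "I = {i. component F i x \<noteq> 0}"
 have I: "finite I" using component_finite[OF x] by (simp add: I_def)
 have "c *\<^sub>C x = (\<Sum>i\<in>I. c *\<^sub>C component F i x)"
  using component_sum[OF x I] by (simp add: I_def complex_vector.scale_sum_right[symmetric])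
 then have "component F i (c *\<^sub>C x) = (if i \<in> I then c *\<^sub>C component F i x else 0)"
  using component_of_sum[OF I, of "\<lambda>i. c *\<^sub>C component F i x" i] component_in[OF x]
   ds_summand complex_vector.subspace_scale by metis
 then show "component F i (c *\<^sub>C x) = c *\<^sub>C component F i x" by (auto simp: I_def)
qed

lemma ds_induct [consumes 1, case_names summand add]:
 assumes "x \<in> S" and P: "\<And>i x. x \<in> F i ==> P x"
  and add: "\<And>x y. x \<in> S ==> y \<in> S ==> P x ==> P y ==> P (x + y)"
 shows "P x"
proof -
 have "P (\<Sum>i\<in>I. component F i x)" if "finite I" for I
  using that
 proof (induction I)
  case empty
  then show ?case using P[of 0] complex_vector.subspace_0[OF ds_summand] by auto
 next
  case (insert i I)
  have "(\<Sum>i\<in>I. component F i x) \<in> S"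
   using ds_subspace ds_subset component_in[OF assms(1)] by (intro complex_vector.subspace_sum) auto
  then have "P (component F i x + (\<Sum>i\<in>I. component F i x))"
   using insert P component_in[OF assms(1)] ds_subset by (intro add) blast+
  then show ?case using insert.hyps by simp
 qed
 from this[OF component_finite[OF assms(1)]] show ?thesis
  using component_sum[OF assms(1) component_finite[OF assms(1)]] by simp
qed

end


lemma (in form_operator) gen_eigenvectors_independent:
 assumes "finite I" "\<And>n. n \<in> I ==> \<exists>k. (shift_op L n ^^ k) (g n) = 0" "(\<Sum>n\<in>I. g n) = 0" "n \<in> I"
 shows "g n = 0"
 using assms
proof (induction I arbitrary: g n rule: finite_induct)
 case (insert m I)
 have inj: "y = 0" if "shift_op L m y = 0" "(shift_op L n ^^ k) y = 0" "n \<noteq> m" for n k y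
 proof -
  have "shift_op L n y = (m - n) *\<^sub>C y"
   using that(1) by (simp add: shift_op_def complex_vector.scale_left_diff_distrib)
  then have "(shift_op L n ^^ k) y = (m - n) ^ k *\<^sub>C y"
   by (induction k) (simp_all only: funpow.simps id_apply o_apply shift_scale scaleC_scaleC scaleC_one power.simps mult.commute)
  then show ?thesis using that(2,3) by simp
 qed
 have commute: "shift_op L n (shift_op L m x) = shift_op L m (shift_op L n x)" for n m x
  unfolding shift_op_def
  by (simp add: L_diff L_scale complex_vector.scale_right_diff_distrib algebra_simps)
 have commute': "(shift_op L n ^^ k) (shift_op L m x) = shift_op L m ((shift_op L n ^^ k) x)" for n k x
  by (induction k) (simp_all only: funpow.simps id_apply o_apply commute)
 have inj': "y = 0" if "(shift_op L m ^^ j) y = 0" "(shift_op L n ^^ k) y = 0" "n \<noteq> m" for n j k y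
  using that(1,2)
 proof (induction j arbitrary: y)
  case (Suc j)
  have "(shift_op L m ^^ j) (shift_op L m y) = 0" using Suc.prems(1) by (simp only: funpow_Suc_right o_apply)
  moreover have "(shift_op L n ^^ k) (shift_op L m y) = 0"
   unfolding commute' using Suc.prems(2) shift_zero by (simp only:)
  ultimately have "shift_op L m y = 0" by (rule Suc.IH)
  then show ?case using inj Suc.prems(2) that(3) by blast
 qed simp
 have sum: "(shift_op L m ^^ j) (\<Sum>n\<in>J. h n) = (\<Sum>n\<in>J. (shift_op L m ^^ j) (h n))" for j J and h :: "complex => _"
  by (induction J rule: infinite_finite_induct) (simp_all only: sum.infinite sum.empty shift_pow_zero sum.insert shift_pow_add not_False_eq_True)
 have commute2: "(shift_op L n ^^ k) ((shift_op L m ^^ j) x) = (shift_op L m ^^ j) ((shift_op L n ^^ k) x)" for n k j x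
  by (induction j) (simp_all only: funpow.simps id_apply o_apply commute')
 obtain j where j: "(shift_op L m ^^ j) (g m) = 0" using insert.prems(1) by blast
 have z: "g n = 0" if n: "n \<in> I" for n
 proof -
  have "(shift_op L m ^^ j) (g n) = 0"
  proof (rule insert.IH[OF _ _ n])
   fix n assume "n \<in> I"
   then obtain k where "(shift_op L n ^^ k) (g n) = 0" using insert.prems(1) by blast
   then have "(shift_op L n ^^ k) ((shift_op L m ^^ j) (g n)) = 0" by (simp only: commute2 shift_pow_zero)
   then show "\<exists>k. (shift_op L n ^^ k) ((shift_op L m ^^ j) (g n)) = 0" by blast
  next
   have "(shift_op L m ^^ j) (g m + (\<Sum>n\<in>I. g n)) = 0"
    using insert.prems(2) insert.hyps by (simp only: sum.insert shift_pow_zero not_False_eq_True)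
   then show "(\<Sum>n\<in>I. (shift_op L m ^^ j) (g n)) = 0"
    by (simp only: shift_pow_add sum j add_0_left)
  qed
  moreover obtain k where "(shift_op L n ^^ k) (g n) = 0" using insert.prems(1) n by blast
  ultimately show ?thesis using inj' n insert.hyps by metis
 qed
 moreover have "g m = 0" using insert.prems(2) insert.hyps sum.neutral[of I g] z by (metis add_0_right sum.insert)
 ultimately show ?case using insert.prems(3) by auto
qed simp

section \<open>Coefficients of delta functions\<close>

text \<open>
  The coefficient $\binom{a}{i}z^{a-i}$ of $y^i$ in $(z+y)^a$.
\<close>

definition bin :: "complex => int => nat => complex" where
 "bin z a i = (of_int a gchoose i) * z powi (a - int i)"

lemma delta_den_nat: "delta_den z b (int i) = bin z (- b - 1) i"
proof -
 have "(of_int (- b - 1) gchoose i :: complex) = (- 1) ^ i * (of_int (b + int i) gchoose i)"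
  by (subst gbinomial_negated_upper) (simp add: algebra_simps)
 moreover have e: "- 1 - b - int i = - b - 1 - int i" by simp
 have "delta_den z b (int i) = z powi (- b - 1 - int i) * ((of_int (b + int i) gchoose i) * (- 1) ^ i)"
  unfolding delta_den_def delta_coeff_def e by (simp add: add.commute)
 ultimately show ?thesis unfolding bin_def by (simp only: mult_ac)
qed

lemma delta_den_neg: "c < 0 ==> delta_den z b c = 0"
 by (simp add: delta_den_def delta_coeff_def)

lemma delta_fst_neg_nat: "delta_fst_neg z a (int i) = bin (- z) (- a - 1) i"
proof -
 have powi: "(- z) powi (- a - 1 - int i) = (-1) powi (- a - 1) * (-1) ^ i * z powi (- a - 1 - int i)"
 proof -
  have "(- z) powi (- a - 1 - int i) = (-1) powi (- a - 1 - int i) * z powi (- a - 1 - int i)"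
   using power_int_mult_distrib[of "-1" z "- a - 1 - int i"] by simp
  moreover have "((-1)::complex) powi (- a - 1 - int i) = (-1) powi (- a - 1) * (-1) powi (- int i)"
   using power_int_add[of "-1::complex" "- a - 1" "- int i"] by simp
  moreover have "((-1)::complex) powi (- int i) = (-1) ^ i"
   by (simp add: power_int_minus power_inverse[symmetric])
  ultimately show ?thesis by simp
 qed
 have e: "- 1 - a - int i = - a - 1 - int i" by simp
 show ?thesis
  unfolding delta_fst_neg_def delta_neg_coeff_def delta_coeff_def bin_def powi e by simp
qed

lemma delta_fst_neg_neg: "c < 0 ==> delta_fst_neg z a c = 0"
 by (simp add: delta_fst_neg_def delta_neg_coeff_def delta_coeff_def)

lemma delta_snd_nat: "delta_snd z a (- a - 1 - int i) = (of_int (- a - 1) gchoose i) * (- z) ^ i"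
 by (simp add: delta_snd_def delta_coeff_def power_minus[of z] mult_ac)

lemma delta_snd_neg: "b > - a - 1 ==> delta_snd z a b = 0"
 by (simp add: delta_snd_def delta_coeff_def)

lemma Sum_any_int_nat:
 fixes f :: "int => 'a::comm_monoid_add"
 assumes "\<And>c. c < 0 ==> f c = 0" "\<And>c. c \<ge> int N ==> f c = 0"
 shows "Sum_any f = (\<Sum>i<N. f (int i))"
proof -
 have "Sum_any f = sum f (int ` {..<N})"
 proof (rule Sum_any_superset)
  show "f i = 0" if "i \<notin> int ` {..<N}" for i
  proof -
   have "i < 0 \<or> i \<ge> int N"
   proof (rule ccontr)
    assume "\<not> (i < 0 \<or> i \<ge> int N)"
    then have "i = int (nat i)" "nat i < N" by auto
    then show False using that by blast
   qed
   then show ?thesis using assms by blast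
  qed
 qed simp
 then show ?thesis by (simp add: sum.reindex)
qed

lemma Sum_any_delta_den:
 assumes "\<And>c. c \<ge> int N ==> g c = 0"
 shows "Sum_any (\<lambda>c. delta_den z b c *\<^sub>C g c) = (\<Sum>i<N. bin z (- b - 1) i *\<^sub>C g (int i))"
 using assms by (subst Sum_any_int_nat[of _ N]) (auto simp: delta_den_nat delta_den_neg)

lemma Sum_any_delta_fst_neg:
 assumes "\<And>c. c \<ge> int N ==> g c = 0"
 shows "Sum_any (\<lambda>c. delta_fst_neg z a c *\<^sub>C g c) = (\<Sum>i<N. bin (- z) (- a - 1) i *\<^sub>C g (int i))"
 using assms by (subst Sum_any_int_nat[of _ N]) (auto simp: delta_fst_neg_nat delta_fst_neg_neg)

lemma Sum_any_delta_snd: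
 assumes "\<And>b. b \<le> - a - 1 - int N ==> g b = 0"
 shows "Sum_any (\<lambda>b. delta_snd z a b *\<^sub>C g b) =
  (\<Sum>i<N. ((of_int (- a - 1) gchoose i) * (- z) ^ i) *\<^sub>C g (- a - 1 - int i))"
proof -
 have "Sum_any (\<lambda>b. delta_snd z a b *\<^sub>C g b) =
   Sum_any (\<lambda>c. delta_snd z a (- a - 1 - c) *\<^sub>C g (- a - 1 - c))"
 proof (rule Sum_any.reindex_cong)
  show "bij (\<lambda>c. - a - 1 - c)" by (rule bij_betw_byWitness[where f' = "\<lambda>c. - a - 1 - c"]) auto
 next
  show "(\<lambda>b. delta_snd z a b *\<^sub>C g b) \<circ> (\<lambda>c. - a - 1 - c) = (\<lambda>c. delta_snd z a (- a - 1 - c) *\<^sub>C g (- a - 1 - c))"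
   unfolding o_def ..
 qed
 also have "\<dots> = (\<Sum>i<N. delta_snd z a (- a - 1 - int i) *\<^sub>C g (- a - 1 - int i))"
  by (rule Sum_any_int_nat) (simp_all add: delta_snd_neg assms)
 finally show ?thesis by (simp only: delta_snd_nat)
qed

section \<open>Opposite vectors in a vertex algebra\<close>

text \<open>
  A strongly graded vertex algebra.
\<close>

locale sgva =
 fixes A :: "'g::ab_group_add set" and V :: "('v::complex_vector, 'g) valg"
 assumes V: "strongly_graded_vertex_algebra A V"
begin

lemma va_wt_ds: "is_direct_sum UNIV (wtv V)"
 and va_gr_ds: "is_direct_sum UNIV (grv V)"
 using V by (simp_all add: strongly_graded_vertex_algebra_def)

lemma va_grwt_ds: "is_direct_sum (grv V \<alpha>) (\<lambda>n. grv V \<alpha> \<inter> wtv V n)"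
 using V by (simp add: strongly_graded_vertex_algebra_def)

lemma va_L: "j \<in> {-1,0,1} ==> linear_map_on UNIV UNIV (Lv V j)"
 using V unfolding strongly_graded_vertex_algebra_def by (elim conjE) (erule bspec, assumption)

lemma va_L0: "v \<in> wtv V n ==> Lv V 0 v = of_int n *\<^sub>C v"
 using V by (simp add: strongly_graded_vertex_algebra_def)

lemma va_L_gr: "j \<in> {-1,0,1} ==> v \<in> grv V \<alpha> ==> Lv V j v \<in> grv V \<alpha>"
proof -
 have "\<forall>j\<in>{-1,0,1}. \<forall>\<alpha>. \<forall>v\<in>grv V \<alpha>. Lv V j v \<in> grv V \<alpha>"
  using V unfolding strongly_graded_vertex_algebra_def by (elim conjE)
 then show "j \<in> {-1,0,1} ==> v \<in> grv V \<alpha> ==> Lv V j v \<in> grv V \<alpha>" by blast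
qed

lemma va_bound: "\<exists>K. \<forall>n<K. grv V \<alpha> \<inter> wtv V n = {0}"
 using V unfolding strongly_graded_vertex_algebra_def by (elim conjE) (erule spec)

lemma va_sl2: "m \<in> {-1,0,1} ==> n \<in> {-1,0,1} ==>
   Lv V m (Lv V n v) - Lv V n (Lv V m v) = of_int (m - n) *\<^sub>C Lv V (m + n) v"
proof -
 have "sl2_relations V UNIV (vop V) (Lv V)"
  using V unfolding strongly_graded_vertex_algebra_def by (elim conjE)
 then show "m \<in> {-1,0,1} ==> n \<in> {-1,0,1} ==>
   Lv V m (Lv V n v) - Lv V n (Lv V m v) = of_int (m - n) *\<^sub>C Lv V (m + n) v"
  unfolding sl2_relations_def by blast
qed

lemma va_hom_induct [case_names hom add]:
 assumes "\<And>\<alpha> h v. v \<in> grv V \<alpha> \<inter> wtv V h ==> P v" "\<And>v w. P v ==> P w ==> P (v + w)"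
 shows "P v"
proof (induction v rule: ds_induct[OF va_gr_ds UNIV_I])
 case (1 \<alpha> x)
 show ?case
  by (rule ds_induct[OF va_grwt_ds 1]) (use assms in blast)+
qed (use assms in blast)

text \<open>
  Weights are integers, so an eigenvector of $L(0)$ with eigenvalue \<open>n\<close> lies in $V_{(n)}$.
\<close>

lemma va_wtI:
 assumes "Lv V 0 v = of_int n *\<^sub>C v"
 shows "v \<in> wtv V n"
proof -
 define I where "I = {i. component (wtv V) i v \<noteq> 0}"
 have I: "finite I" using component_finite[OF va_wt_ds UNIV_I] by (simp add: I_def)
 have v: "v = (\<Sum>i\<in>I. component (wtv V) i v)"
  by (rule component_sum[OF va_wt_ds UNIV_I I]) (simp add: I_def)
 have comp: "component (wtv V) i v \<in> wtv V i" for i by (rule component_in[OF va_wt_ds UNIV_I])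
 have "(\<Sum>i\<in>I. of_int (i - n) *\<^sub>C component (wtv V) i v) = 0"
 proof -
  have "Lv V 0 v = (\<Sum>i\<in>I. of_int i *\<^sub>C component (wtv V) i v)"
   by (subst v, subst lin_sum[OF va_L[of 0] complex_vector.subspace_UNIV])
     (auto simp: va_L0[OF comp])
  moreover have "of_int n *\<^sub>C v = (\<Sum>i\<in>I. of_int n *\<^sub>C component (wtv V) i v)"
   by (subst v) (rule complex_vector.scale_sum_right)
  ultimately show ?thesis
   using assms by (simp add: complex_vector.scale_left_diff_distrib sum_subtractf)
 qed
 then have z: "of_int (i - n) *\<^sub>C component (wtv V) i v = 0" if "i \<in> I" for i
  using ds_independent[OF va_wt_ds I, of "\<lambda>i. of_int (i - n) *\<^sub>C component (wtv V) i v" i] that comp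
   csub_scale[OF ds_summand[OF va_wt_ds]] by blast
 then have "component (wtv V) i v = 0" if "i \<noteq> n" for i
  using that by (cases "i \<in> I") (fastforce simp: I_def)+
 then have "v = component (wtv V) n v"
  using component_sum[OF va_wt_ds UNIV_I, of "{n}" v] by simp
 then show ?thesis using comp[of n] by simp
qed

lemma va_L1_wt: "v \<in> wtv V n ==> Lv V 1 v \<in> wtv V (n - 1)"
proof (rule va_wtI)
 assume v: "v \<in> wtv V n"
 have "Lv V 0 (Lv V 1 v) = Lv V 1 (of_int n *\<^sub>C v) - Lv V 1 v"
  using va_sl2[of 0 1 v] va_L0[OF v] by (simp add: algebra_simps)
 also have "Lv V 1 (of_int n *\<^sub>C v) = of_int n *\<^sub>C Lv V 1 v"
  using lin_scale[OF va_L[of 1]] by simp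
 finally show "Lv V 0 (Lv V 1 v) = of_int (n - 1) *\<^sub>C Lv V 1 v"
  by (simp add: complex_vector.scale_left_diff_distrib)
qed

lemma va_L1_pow_hom: "v \<in> grv V \<alpha> \<inter> wtv V h ==> (Lv V 1 ^^ i) v \<in> grv V \<alpha> \<inter> wtv V (h - int i)"
proof (induction i)
 case (Suc i)
 then show ?case using va_L1_wt[of "(Lv V 1 ^^ i) v" "h - int i"] va_L_gr[of 1] by (simp add: diff_diff_eq add.commute)
qed simp

text \<open>
  $L(1)$ lowers the weight and preserves the degree, and the weights of a given degree are bounded
  below.
\<close>

lemma va_L1_nilpotent:
 assumes "v \<in> grv V \<alpha> \<inter> wtv V h"
 shows "\<exists>N. \<forall>i\<ge>N. (Lv V 1 ^^ i) v = 0"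
proof -
 obtain K where K: "\<forall>n<K. grv V \<alpha> \<inter> wtv V n = {0}" using va_bound by blast
 have "(Lv V 1 ^^ i) v = 0" if "i \<ge> nat (h - K + 1)" for i
 proof -
  have "h - int i < K" using that by linarith
  with K va_L1_pow_hom[OF assms, of i] show ?thesis by auto
 qed
 then show ?thesis by blast
qed

lemma va_L1_pow_linear: "linear_map_on UNIV UNIV (Lv V 1 ^^ i)"
proof (induction i)
 case (Suc i)
 then show ?case using va_L[of 1] by (simp add: linear_map_on_def)
qed (simp add: linear_map_on_def)

lemma opp_vec_eq:
 assumes "finite H" "\<And>k. k \<notin> H ==> component (wtv V) k v = 0"
 shows "opp_vec V v e = (\<Sum>k\<in>H. if 0 \<le> e + 2 * k then
   ((-1) powi k / fact (nat (e + 2 * k))) *\<^sub>C (Lv V 1 ^^ nat (e + 2 * k)) (component (wtv V) k v) else 0)"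
proof -
 let ?g = "\<lambda>(k::int, i::nat). if int i - 2 * k = e
   then ((-1) powi k / fact i) *\<^sub>C (Lv V 1 ^^ i) (component (wtv V) k v) else 0"
 have L0: "(Lv V 1 ^^ i) 0 = 0" for i
  using lin_zero[OF va_L1_pow_linear] by simp
 have "opp_vec V v e = (\<Sum>p\<in>(\<lambda>k. (k, nat (e + 2 * k))) ` H. ?g p)"
  unfolding opp_vec_def
 proof (rule Sum_any_superset)
  fix p assume p: "p \<notin> (\<lambda>k. (k, nat (e + 2 * k))) ` H"
  obtain k i where [simp]: "p = (k, i)" by force
  show "?g p = 0"
  proof (cases "int i - 2 * k = e")
   case True
   then have "i = nat (e + 2 * k)" by linarith
   then have "k \<notin> H" using p by auto
   then show ?thesis using assms(2) L0 by simp
  qed simp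
 qed (use assms in simp)
 also have "\<dots> = (\<Sum>k\<in>H. ?g (k, nat (e + 2 * k)))"
  by (rule sum.reindex_cong[of "\<lambda>k. (k, nat (e + 2 * k))"]) (auto simp: inj_on_def)
 also have "\<dots> = (\<Sum>k\<in>H. if 0 \<le> e + 2 * k then
   ((-1) powi k / fact (nat (e + 2 * k))) *\<^sub>C (Lv V 1 ^^ nat (e + 2 * k)) (component (wtv V) k v) else 0)"
  by (rule sum.cong) auto
 finally show ?thesis .
qed

lemma opp_vec_hom:
 assumes "v \<in> wtv V h"
 shows "opp_vec V v e = (if 0 \<le> e + 2 * h then
   ((-1) powi h / fact (nat (e + 2 * h))) *\<^sub>C (Lv V 1 ^^ nat (e + 2 * h)) v else 0)"
 using assms by (subst opp_vec_eq[of "{h}"]) (auto simp: component_of_summand[OF va_wt_ds])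

lemma opp_vec_add: "opp_vec V (v + w) e = opp_vec V v e + opp_vec V w e"
proof -
 let ?H = "{k. component (wtv V) k v \<noteq> 0} \<union> {k. component (wtv V) k w \<noteq> 0}"
 have fin: "finite ?H" using component_finite[OF va_wt_ds UNIV_I] by blast
 have add: "component (wtv V) k (v + w) = component (wtv V) k v + component (wtv V) k w" for k
  using lin_add[OF component_linear[OF va_wt_ds]] by simp
 have v: "component (wtv V) k (v + w) = 0" "component (wtv V) k v = 0" "component (wtv V) k w = 0" if "k \<notin> ?H" for k
  using that by (auto simp: add)
 let ?T = "\<lambda>x k. if 0 \<le> e + 2 * k then
   ((-1) powi k / fact (nat (e + 2 * k))) *\<^sub>C (Lv V 1 ^^ nat (e + 2 * k)) (component (wtv V) k x) else 0"
 have "opp_vec V (v + w) e = (\<Sum>k\<in>?H. ?T (v + w) k)" by (rule opp_vec_eq[OF fin v(1)])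
 also have "\<dots> = (\<Sum>k\<in>?H. ?T v k + ?T w k)"
  by (rule sum.cong) (simp_all add: add lin_add[OF va_L1_pow_linear] complex_vector.scale_right_distrib)
 also have "\<dots> = (\<Sum>k\<in>?H. ?T v k) + (\<Sum>k\<in>?H. ?T w k)" by (rule sum.distrib)
 also have "(\<Sum>k\<in>?H. ?T v k) = opp_vec V v e" by (rule opp_vec_eq[OF fin v(2), symmetric])
 also have "(\<Sum>k\<in>?H. ?T w k) = opp_vec V w e" by (rule opp_vec_eq[OF fin v(3), symmetric])
 finally show ?thesis .
qed

lemma opp_vec_0: "opp_vec V 0 e = 0"
 using opp_vec_add[of 0 0 e] by simp

lemma opp_vec_scale: "opp_vec V (c *\<^sub>C v) e = c *\<^sub>C opp_vec V v e"
proof -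
 let ?H = "{k. component (wtv V) k v \<noteq> 0}"
 have fin: "finite ?H" using component_finite[OF va_wt_ds UNIV_I] by blast
 have sc: "component (wtv V) k (c *\<^sub>C v) = c *\<^sub>C component (wtv V) k v" for k
  using lin_scale[OF component_linear[OF va_wt_ds]] by simp
 let ?T = "\<lambda>x k. if 0 \<le> e + 2 * k then
   ((-1) powi k / fact (nat (e + 2 * k))) *\<^sub>C (Lv V 1 ^^ nat (e + 2 * k)) (component (wtv V) k x) else 0"
 have "opp_vec V (c *\<^sub>C v) e = (\<Sum>k\<in>?H. ?T (c *\<^sub>C v) k)" by (rule opp_vec_eq[OF fin]) (simp add: sc)
 also have "\<dots> = (\<Sum>k\<in>?H. c *\<^sub>C ?T v k)"
 proof (rule sum.cong)
  fix k
  have "(Lv V 1 ^^ i) (c *\<^sub>C x) = c *\<^sub>C (Lv V 1 ^^ i) x" for i x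
   by (rule lin_scale[OF va_L1_pow_linear UNIV_I])
  then show "?T (c *\<^sub>C v) k = c *\<^sub>C ?T v k"
   by (cases "0 \<le> e + 2 * k") (simp_all only: sc complex_vector.scale_left_commute[of c] complex_vector.scale_zero_right simp_thms if_True if_False)
 qed simp
 also have "\<dots> = c *\<^sub>C (\<Sum>k\<in>?H. ?T v k)" by (rule complex_vector.scale_sum_right[symmetric])
 also have "(\<Sum>k\<in>?H. ?T v k) = opp_vec V v e" by (rule opp_vec_eq[OF fin, symmetric]) simp
 finally show ?thesis .
qed

lemma opp_vec_in:
 assumes "v \<in> grv V \<alpha> \<inter> wtv V h"
 shows "opp_vec V v e \<in> grv V \<alpha> \<inter> wtv V (- h - e)"
proof (cases "0 \<le> e + 2 * h")
 case True
 then have "(Lv V 1 ^^ nat (e + 2 * h)) v \<in> grv V \<alpha> \<inter> wtv V (- h - e)"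
  using va_L1_pow_hom[OF assms, of "nat (e + 2 * h)"] by simp
 moreover have "csubspace (grv V \<alpha> \<inter> wtv V (- h - e))"
  using ds_summand[OF va_grwt_ds] .
 moreover have "opp_vec V v e = ((-1) powi h / fact (nat (e + 2 * h))) *\<^sub>C (Lv V 1 ^^ nat (e + 2 * h)) v"
  using assms opp_vec_hom[of v h e] True by (simp only: Int_iff if_True)
 ultimately show ?thesis by (simp only: complex_vector.subspace_scale)
next
 case False
 then show ?thesis using assms opp_vec_hom[of v h e] complex_vector.subspace_0[OF ds_summand[OF va_grwt_ds]] by simp
qed

lemma opp_vec_finite: "finite {e. opp_vec V v e \<noteq> 0}"
proof (induction v rule: va_hom_induct)
 case (hom \<alpha> h v)
 obtain N where N: "\<forall>i\<ge>N. (Lv V 1 ^^ i) v = 0" using va_L1_nilpotent[OF hom] by blast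
 have "{e. opp_vec V v e \<noteq> 0} \<subseteq> {- 2 * h..<int N - 2 * h}"
 proof
  fix e assume "e \<in> {e. opp_vec V v e \<noteq> 0}"
  then have "0 \<le> e + 2 * h" "(Lv V 1 ^^ nat (e + 2 * h)) v \<noteq> 0"
   using opp_vec_hom[of v h e] hom by (auto split: if_splits)
  moreover from this N have "nat (e + 2 * h) < N" by (meson not_le)
  ultimately show "e \<in> {- 2 * h..<int N - 2 * h}" by auto
 qed
 then show ?case by (rule finite_subset) simp
next
 case (add v w)
 then show ?case
  by (rule_tac finite_subset[OF _ finite_UnI[OF add]]) (auto simp: opp_vec_add)
qed

text \<open>
  The operator $e^{xL(1)}(-x^{-2})^{L(0)}$ becomes its own inverse when \<open>x\<close> is replaced by $x^{-1}$
  in the second application.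
\<close>

lemma opp_vec_involution:
 assumes "finite E" "\<And>e. e \<notin> E ==> opp_vec V v e = 0"
 shows "(\<Sum>e\<in>E. opp_vec V (opp_vec V v e) (e + d)) = (if d = 0 then v else 0)"
proof -
 have "Sum_any (\<lambda>e. opp_vec V (opp_vec V v e) (e + d)) = (if d = 0 then v else 0)"
 proof (induction v rule: va_hom_induct)
  case (hom \<alpha> h v)
  have opp2: "opp_vec V (opp_vec V v (int i - 2 * h)) (int i - 2 * h + d) =
    (if int i \<le> d then ((-1) ^ i / (fact i * fact (nat d - i))) *\<^sub>C (Lv V 1 ^^ nat d) v else 0)" for i
  proof -
   have v1: "opp_vec V v (int i - 2 * h) = ((-1) powi h / fact i) *\<^sub>C (Lv V 1 ^^ i) v"
    using opp_vec_hom[of v h "int i - 2 * h"] hom by simp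
   have w: "(Lv V 1 ^^ i) v \<in> wtv V (h - int i)" using va_L1_pow_hom[OF hom] by blast
   show ?thesis
   proof (cases "int i \<le> d")
    case True
    have p: "(Lv V 1 ^^ nat (d - int i)) ((Lv V 1 ^^ i) v) = (Lv V 1 ^^ nat d) v"
     using True funpow_add[of "nat (d - int i)" i "Lv V 1", THEN fun_cong, of v]
     by (simp add: nat_diff_distrib')
    have s: "((-1) powi h / fact i) * ((-1) powi (h - int i) / fact (nat d - i)) = ((-1) ^ i / (fact i * fact (nat d - i)) :: complex)"
    proof -
     have "((-1) powi h * (-1) powi (h - int i) :: complex) = (-1) powi (2 * h - int i)"
      by (simp add: power_int_add[symmetric])
     also have "\<dots> = (-1) powi (2 * h) * (-1) powi (- int i)"
      using power_int_add[of "-1::complex" "2 * h" "- int i"] by simp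
     also have "\<dots> = (-1) ^ i"
      by (simp add: power_int_mult power_int_minus power_inverse[symmetric])
     finally show ?thesis by simp
    qed
    have nd: "nat (d - int i) = nat d - i" using True by linarith
    have w2: "opp_vec V ((Lv V 1 ^^ i) v) (int i - 2 * h + d) =
      ((-1) powi (h - int i) / fact (nat d - i)) *\<^sub>C (Lv V 1 ^^ nat d) v"
     using True opp_vec_hom[OF w, of "int i - 2 * h + d"] p by (simp add: nd algebra_simps)
    show ?thesis unfolding v1 opp_vec_scale w2 scaleC_scaleC s using True by simp
   next
    case False
    then show ?thesis using opp_vec_hom[OF w, of "int i - 2 * h + d"] by (simp add: v1 opp_vec_scale)
   qed
  qed
  have "Sum_any (\<lambda>e. opp_vec V (opp_vec V v e) (e + d)) =
    sum (\<lambda>e. opp_vec V (opp_vec V v e) (e + d)) ((\<lambda>i. int i - 2 * h) ` {..nat d})"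
  proof (rule Sum_any_superset)
   fix e assume e: "e \<notin> (\<lambda>i. int i - 2 * h) ` {..nat d}"
   show "opp_vec V (opp_vec V v e) (e + d) = 0"
   proof (cases "0 \<le> e + 2 * h")
    case True
    then obtain i where i: "e = int i - 2 * h" by (metis add_diff_cancel_right' nonneg_int_cases)
    with e have "\<not> int i \<le> d" by auto
    then show ?thesis using opp2[of i] i by simp
   next
    case False
    then show ?thesis using opp_vec_hom[of v h e] hom by (simp add: opp_vec_0)
   qed
  qed simp
  also have "\<dots> = (\<Sum>i\<le>nat d. opp_vec V (opp_vec V v (int i - 2 * h)) (int i - 2 * h + d))"
   by (subst sum.reindex) (auto simp: inj_on_def)
  also have "\<dots> = (if d = 0 then v else 0)"
  proof (cases "d > 0")
   case True
   have "(\<Sum>i\<le>nat d. opp_vec V (opp_vec V v (int i - 2 * h)) (int i - 2 * h + d)) =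
     (\<Sum>i\<le>nat d. ((-1) ^ i / (fact i * fact (nat d - i))) *\<^sub>C (Lv V 1 ^^ nat d) v)"
    using True by (intro sum.cong) (auto simp: opp2)
   also have "\<dots> = (\<Sum>i\<le>nat d. (-1) ^ i * of_nat (nat d choose i) / fact (nat d)) *\<^sub>C (Lv V 1 ^^ nat d) v"
    by (subst complex_vector.scale_sum_left) (auto intro!: sum.cong simp: binomial_fact)
   also have "(\<Sum>i\<le>nat d. (-1) ^ i * of_nat (nat d choose i) / fact (nat d) :: complex) = 0"
    using choose_alternating_sum[of "nat d", where 'a = complex] True
    by (simp add: sum_divide_distrib[symmetric])
   finally show ?thesis using True by simp
  next
   case False
   then show ?thesis using opp2[of 0] by (cases "d = 0") auto
  qed
  finally show ?case .
 next
  case (add v w)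
  have fin: "finite {e. opp_vec V (opp_vec V v e) (e + d) \<noteq> 0}" for v
   by (rule finite_subset[OF _ opp_vec_finite[of v]]) (auto simp: opp_vec_0)
  show ?case unfolding opp_vec_add Sum_any.distrib[OF fin fin] add by simp
 qed
 then show ?thesis
  using Sum_any_superset[OF assms(1), of "\<lambda>e. opp_vec V (opp_vec V v e) (e + d)"] assms(2)
  by (simp add: opp_vec_0)
qed

text \<open>
  Sums over opposite vectors, for a function \<open>a\<close> that is additive in its first argument.
\<close>

lemma Sum_any_opp:
 fixes a :: "'v => int => 'x::ab_group_add"
 assumes "\<And>m. a 0 m = 0" "finite E" "\<And>e. e \<notin> E ==> opp_vec V v e = 0"
 shows "Sum_any (\<lambda>m. a (opp_vec V v (q - m - 1)) m) = (\<Sum>e\<in>E. a (opp_vec V v e) (q - e - 1))"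
proof -
 have "Sum_any (\<lambda>m. a (opp_vec V v (q - m - 1)) m) =
   sum (\<lambda>m. a (opp_vec V v (q - m - 1)) m) ((\<lambda>e. q - e - 1) ` E)"
 proof (rule Sum_any_superset)
  fix m assume m: "m \<notin> (\<lambda>e. q - e - 1) ` E"
  have "q - m - 1 \<notin> E"
  proof
   assume "q - m - 1 \<in> E"
   then have "q - (q - m - 1) - 1 \<in> (\<lambda>e. q - e - 1) ` E" by blast
   then show False using m by simp
  qed
  then show "a (opp_vec V v (q - m - 1)) m = 0" using assms by simp
 qed (use assms in simp)
 also have "\<dots> = (\<Sum>e\<in>E. a (opp_vec V v e) (q - e - 1))"
  by (subst sum.reindex) (auto simp: inj_on_def)
 finally show ?thesis .
qed

lemma sum_opp_opp:
 fixes a :: "'v => int => 'x::ab_group_add"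
 assumes add: "\<And>v w m. a (v + w) m = a v m + a w m" and E: "finite E" "\<And>e. e \<notin> E ==> opp_vec V v e = 0"
 shows "(\<Sum>e\<in>E. Sum_any (\<lambda>f. a (opp_vec V (opp_vec V v e) f) (f - e))) = a v 0"
proof -
 have a0: "a 0 m = 0" for m using add[of 0 0 m] by simp
 have asum: "a (\<Sum>i\<in>I. f i) m = (\<Sum>i\<in>I. a (f i) m)" for I m and f :: "int => 'v"
  by (induction I rule: infinite_finite_induct) (simp_all add: a0 add)
 define F where "F = (\<Union>e\<in>E. {f. opp_vec V (opp_vec V v e) f \<noteq> 0})"
 have F: "finite F" using E(1) opp_vec_finite by (simp add: F_def)
 define D where "D = (\<lambda>(f, e). f - e) ` (F \<times> E)"
 have D: "finite D" using F E by (simp add: D_def)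
 have "(\<Sum>e\<in>E. Sum_any (\<lambda>f. a (opp_vec V (opp_vec V v e) f) (f - e))) =
   (\<Sum>e\<in>E. \<Sum>d\<in>D. a (opp_vec V (opp_vec V v e) (e + d)) d)"
 proof (rule sum.cong)
  fix e assume e: "e \<in> E"
  have "Sum_any (\<lambda>f. a (opp_vec V (opp_vec V v e) f) (f - e)) =
    sum (\<lambda>f. a (opp_vec V (opp_vec V v e) f) (f - e)) ((\<lambda>d. e + d) ` D)"
  proof (rule Sum_any_superset)
   fix f assume f: "f \<notin> (\<lambda>d. e + d) ` D"
   have "f \<notin> F"
   proof
    assume "f \<in> F"
    then have "f - e \<in> D" using e by (force simp: D_def)
    then have "e + (f - e) \<in> (\<lambda>d. e + d) ` D" by blast
    then show False using f by simp
   qed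
   then show "a (opp_vec V (opp_vec V v e) f) (f - e) = 0" using e by (auto simp: F_def a0)
  qed (use D in simp)
  also have "\<dots> = (\<Sum>d\<in>D. a (opp_vec V (opp_vec V v e) (e + d)) d)"
   by (subst sum.reindex) (auto simp: inj_on_def)
  finally show "Sum_any (\<lambda>f. a (opp_vec V (opp_vec V v e) f) (f - e)) =
   (\<Sum>d\<in>D. a (opp_vec V (opp_vec V v e) (e + d)) d)" .
 qed simp
 also have "\<dots> = (\<Sum>d\<in>D. a (\<Sum>e\<in>E. opp_vec V (opp_vec V v e) (e + d)) d)"
  by (subst sum.swap) (simp add: asum)
 also have "\<dots> = (\<Sum>d\<in>D. if d = 0 then a v 0 else 0)"
  by (rule sum.cong) (auto simp: opp_vec_involution[OF E] a0)
 also have "\<dots> = a v 0"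
 proof (cases "0 \<in> D")
  case False
  then have "(\<Sum>e\<in>E. opp_vec V (opp_vec V v e) (e + 0)) = 0"
  proof (intro sum.neutral ballI)
   fix e assume "e \<in> E"
   then have "e \<notin> F" using False by (force simp: D_def)
   then show "opp_vec V (opp_vec V v e) (e + 0) = 0" using \<open>e \<in> E\<close> by (auto simp: F_def)
  qed
  then have "v = 0" using opp_vec_involution[OF E, of 0] by simp
  then have av: "a v 0 = 0" by (simp add: a0)
  then have "(\<Sum>d\<in>D. if d = 0 then a v 0 else 0) = 0" by (intro sum.neutral) auto
  then show ?thesis by (simp only: av)
 qed (use D in simp)
 finally show ?thesis .
qed

end

section \<open>Generalized modules\<close>

context
 fixes V :: "('v::complex_vector, 'g::ab_group_add) valg" and W :: "('v, 'g, 'w::complex_vector) vmod"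
 assumes W: "generalized_module V W"
begin

lemma gm_subspace: "csubspace (carr W)"
 and gm_act_linear: "linear_map_on (carr W) (carr W) (act W v m)"
 and gm_act_vlinear: "w \<in> carr W ==> linear_map_on UNIV (carr W) (\<lambda>v. act W v m w)"
 and gm_wt_ds: "is_direct_sum (carr W) (wtm W)"
 and gm_gr_ds: "is_direct_sum (carr W) (grm W)"
 and gm_grwt_ds: "is_direct_sum (grm W \<beta>) (\<lambda>n. grm W \<beta> \<inter> wtm W n)"
 and gm_fin_dim: "fin_dim (grm W \<beta> \<inter> wtm W n)"
 using W by (simp_all add: generalized_module_def)

lemma gm_trunc: "w \<in> carr W ==> \<exists>N. \<forall>m\<ge>N. act W v m w = 0"
 using W by (simp add: generalized_module_def)

lemma gm_bound: "\<exists>K::int. \<forall>k<K. grm W \<beta> \<inter> wtm W (n + of_int k) = {0}"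
 using W unfolding generalized_module_def by (elim conjE) (erule spec2)

lemma gm_L_linear: "j \<in> {-1,0,1} ==> linear_map_on (carr W) (carr W) (Lm W j)"
 using W unfolding generalized_module_def by (elim conjE) (erule bspec, assumption)

lemma gm_act_gr: "v \<in> grv V \<alpha> ==> w \<in> grm W \<beta> ==> act W v m w \<in> grm W (\<alpha> + \<beta>)"
 using W by (simp add: generalized_module_def)

lemma gm_L_gr: "j \<in> {-1,0,1} ==> w \<in> grm W \<beta> ==> Lm W j w \<in> grm W \<beta>"
proof -
 have "\<forall>j\<in>{-1,0,1}. \<forall>\<beta>. \<forall>w\<in>grm W \<beta>. Lm W j w \<in> grm W \<beta>"
  using W unfolding generalized_module_def by (elim conjE)
 then show "j \<in> {-1,0,1} ==> w \<in> grm W \<beta> ==> Lm W j w \<in> grm W \<beta>" by blast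
qed

lemma gm_sl2: "sl2_relations V (carr W) (act W) (Lm W)"
 using W by (simp add: generalized_module_def)

lemma gm_L_bracket: "m \<in> {-1,0,1} ==> n \<in> {-1,0,1} ==> w \<in> carr W ==>
    Lm W m (Lm W n w) - Lm W n (Lm W m w) = of_int (m - n) *\<^sub>C Lm W (m + n) w"
 using gm_sl2 unfolding sl2_relations_def by blast

lemma gm_L0_act: "w \<in> carr W ==> Lm W 0 (act W v m w) - act W v m (Lm W 0 w) =
   act W (Lv V (- 1) v) (m + 1) w + act W (Lv V 0 v) m w"
proof -
 have "\<forall>j\<in>{-1,0,1}. \<forall>v m. \<forall>w\<in>carr W.
    Lm W j (act W v m w) - act W v m (Lm W j w) =
    (\<Sum>i = 0..nat (j + 1).
      of_nat (nat (j + 1) choose i) *\<^sub>C act W (Lv V (int i - 1) v) (m + j + 1 - int i) w)"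
  using gm_sl2 unfolding sl2_relations_def by (elim conjE)
 then have "\<forall>v m. \<forall>w\<in>carr W. Lm W 0 (act W v m w) - act W v m (Lm W 0 w) =
    (\<Sum>i = 0..nat (0 + 1).
      of_nat (nat (0 + 1) choose i) *\<^sub>C act W (Lv V (int i - 1) v) (m + 0 + 1 - int i) w)" by simp
 moreover have "{0..nat (0 + 1)} = {0, 1}" by auto
 ultimately show "w \<in> carr W ==> ?thesis" by (simp add: scaleC_one)
qed

lemma gm_L1_deriv: "w \<in> carr W ==> act W (Lv V (- 1) v) m w = of_int (- m) *\<^sub>C act W v (m - 1) w"
 using gm_sl2 unfolding sl2_relations_def by blast

lemma gm_act_in: "w \<in> carr W ==> act W v m w \<in> carr W"
 using gm_act_linear lin_in by blast

lemma gm_L_in: "j \<in> {-1,0,1} ==> w \<in> carr W ==> Lm W j w \<in> carr W"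
 using gm_L_linear lin_in by blast

lemma gm_act_v_add: "w \<in> carr W ==> act W (v + v') m w = act W v m w + act W v' m w"
 using lin_add[OF gm_act_vlinear] by simp

lemma gm_act_v_0: "w \<in> carr W ==> act W 0 m w = 0"
 using lin_zero[OF gm_act_vlinear] by simp

lemma gm_zero: "0 \<in> carr W" using gm_subspace complex_vector.subspace_0 by blast

lemma gm_act_0: "act W v m 0 = 0" using lin_zero[OF gm_act_linear gm_zero] .

lemma gm_wt_subset: "w \<in> wtm W n ==> w \<in> carr W" and gm_gr_subset: "w \<in> grm W \<beta> ==> w \<in> carr W"
 using ds_subset[OF gm_wt_ds] ds_subset[OF gm_gr_ds] by blast+

lemma gm_add: "x \<in> carr W ==> y \<in> carr W ==> x + y \<in> carr W"
 and gm_diff: "x \<in> carr W ==> y \<in> carr W ==> x - y \<in> carr W"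
 and gm_scale: "x \<in> carr W ==> c *\<^sub>C x \<in> carr W"
 and gm_sum: "(\<And>i. i \<in> I ==> f i \<in> carr W) ==> (\<Sum>i\<in>I. f i) \<in> carr W"
 using gm_subspace complex_vector.subspace_add complex_vector.subspace_diff complex_vector.subspace_scale
  complex_vector.subspace_sum by blast+

lemma gm_shift_in: "x \<in> carr W ==> shift_op (Lm W 0) n x \<in> carr W"
 unfolding shift_op_def by (intro gm_diff gm_scale gm_L_in) auto

lemma gm_shift_linear: "linear_map_on (carr W) (carr W) (shift_op (Lm W 0) n)"
 unfolding linear_map_on_def
proof (intro conjI ballI allI gm_shift_in)
 note L = gm_L_linear[of 0, simplified]
 fix x y c assume x: "x \<in> carr W"
 show "shift_op (Lm W 0) n (c *\<^sub>C x) = c *\<^sub>C shift_op (Lm W 0) n x"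
  using lin_scale[OF L x]
  by (simp add: shift_op_def complex_vector.scale_right_diff_distrib complex_vector.scale_left_commute[of n])
 assume y: "y \<in> carr W"
 show "shift_op (Lm W 0) n (x + y) = shift_op (Lm W 0) n x + shift_op (Lm W 0) n y"
  using lin_add[OF L x y] by (simp add: shift_op_def complex_vector.scale_right_distrib)
qed

lemma gm_shift_pow_in: "x \<in> carr W ==> (shift_op (Lm W 0) n ^^ k) x \<in> carr W"
 by (induction k) (simp_all add: gm_shift_in)

lemma gm_shift_pow_linear: "linear_map_on (carr W) (carr W) (shift_op (Lm W 0) n ^^ k)"
proof (induction k)
 case (Suc k)
 then show ?case using gm_shift_linear[of n] unfolding linear_map_on_def by simp
qed (simp add: linear_map_on_def)

lemma gm_act_shift:
 assumes v: "Lv V 0 v = of_int h *\<^sub>C v" and x: "x \<in> carr W"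
 shows "shift_op (Lm W 0) (n + of_int (h - m - 1)) (act W v m x) = act W v m (shift_op (Lm W 0) n x)"
proof -
 have "Lm W 0 (act W v m x) = act W v m (Lm W 0 x) + (of_int (- m - 1) *\<^sub>C act W v m x + of_int h *\<^sub>C act W v m x)"
  using gm_L0_act[OF x, of v m] gm_L1_deriv[OF x, of v "m + 1"] lin_scale[OF gm_act_vlinear[OF x]] v
  by (simp add: algebra_simps)
 also have "\<dots> = act W v m (Lm W 0 x) + of_int (h - m - 1) *\<^sub>C act W v m x"
  by (simp add: complex_vector.scale_left_distrib[symmetric])
 moreover have "act W v m (shift_op (Lm W 0) n x) = act W v m (Lm W 0 x) - n *\<^sub>C act W v m x"
  unfolding shift_op_def
  using lin_diff[OF gm_act_linear gm_subspace gm_L_in[OF _ x] csub_scale[OF gm_subspace x]]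
   lin_scale[OF gm_act_linear x] by simp
 ultimately show ?thesis by (simp add: shift_op_def complex_vector.scale_left_distrib algebra_simps)
qed

lemma gm_act_shift_pow:
 assumes v: "Lv V 0 v = of_int h *\<^sub>C v" and x: "x \<in> carr W"
 shows "(shift_op (Lm W 0) (n + of_int (h - m - 1)) ^^ k) (act W v m x) = act W v m ((shift_op (Lm W 0) n ^^ k) x)"
 by (induction k) (simp_all only: funpow.simps id_apply o_apply gm_act_shift[OF v] gm_shift_pow_in x)

lemma gm_act_wt:
 assumes v: "Lv V 0 v = of_int h *\<^sub>C v" and w: "w \<in> wtm W n"
 shows "act W v m w \<in> wtm W (n + of_int (h - m - 1))"
proof -
 obtain k where k: "(shift_op (Lm W 0) n ^^ k) w = 0" and wc: "w \<in> carr W"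
  using w unfolding wtm_def gen_eigenspace_def by blast
 have "(shift_op (Lm W 0) (n + of_int (h - m - 1)) ^^ k) (act W v m w) = 0"
  unfolding gm_act_shift_pow[OF v wc] k by (rule gm_act_0)
 then show ?thesis
  using gm_act_in[OF wc] unfolding wtm_def gen_eigenspace_def by blast
qed

lemma gm_L_shift:
 assumes j: "j \<in> {-1,0,1}" and x: "x \<in> carr W"
 shows "shift_op (Lm W 0) (n - of_int j) (Lm W j x) = Lm W j (shift_op (Lm W 0) n x)"
proof -
 note lin = gm_L_linear[OF j]
 have "Lm W 0 (Lm W j x) = Lm W j (Lm W 0 x) - of_int j *\<^sub>C Lm W j x"
  using gm_L_bracket[OF _ j x, of 0] by (simp add: algebra_simps)
 moreover have "Lm W j (shift_op (Lm W 0) n x) = Lm W j (Lm W 0 x) - n *\<^sub>C Lm W j x"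
  unfolding shift_op_def
  using lin_diff[OF lin gm_subspace gm_L_in[OF _ x] csub_scale[OF gm_subspace x]]
   lin_scale[OF lin x] by simp
 ultimately show ?thesis by (simp add: shift_op_def complex_vector.scale_left_diff_distrib algebra_simps)
qed

lemma gm_L_shift_pow:
 assumes j: "j \<in> {-1,0,1}" and x: "x \<in> carr W"
 shows "(shift_op (Lm W 0) (n - of_int j) ^^ k) (Lm W j x) = Lm W j ((shift_op (Lm W 0) n ^^ k) x)"
 by (induction k) (simp_all only: funpow.simps id_apply o_apply gm_L_shift[OF j] gm_shift_pow_in x)

lemma gm_L_wt:
 assumes j: "j \<in> {-1,0,1}" and w: "w \<in> wtm W n"
 shows "Lm W j w \<in> wtm W (n - of_int j)"
proof -
 obtain k where k: "(shift_op (Lm W 0) n ^^ k) w = 0" and wc: "w \<in> carr W"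
  using w unfolding wtm_def gen_eigenspace_def by blast
 have "(shift_op (Lm W 0) (n - of_int j) ^^ k) (Lm W j w) = 0"
  unfolding gm_L_shift_pow[OF j wc] k by (rule lin_zero[OF gm_L_linear[OF j] gm_zero])
 then show ?thesis
  using gm_L_in[OF j wc] unfolding wtm_def gen_eigenspace_def by blast
qed

lemma gm_hom_induct [consumes 1, case_names hom add]:
 assumes "w \<in> carr W" "\<And>\<beta> n w. w \<in> grm W \<beta> ==> w \<in> wtm W n ==> P w"
  "\<And>v w. v \<in> carr W ==> w \<in> carr W ==> P v ==> P w ==> P (v + w)"
 shows "P w"
proof (rule ds_induct[OF gm_gr_ds assms(1)])
 fix \<beta> x assume x: "x \<in> grm W \<beta>"
 show "P x" by (rule ds_induct[OF gm_grwt_ds x]) (use assms gm_gr_subset in blast)+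
qed (use assms in blast)

lemma gm_wt_gr_component:
 assumes w: "w \<in> wtm W n"
 shows "component (grm W) \<beta> w \<in> wtm W n"
proof -
 have wc: "w \<in> carr W" using w gm_wt_subset by blast
 define B where "B = {\<beta>. component (grm W) \<beta> w \<noteq> 0}"
 have B: "finite B" using component_finite[OF gm_gr_ds wc] by (simp add: B_def)
 have gr: "component (grm W) \<beta> w \<in> grm W \<beta>" for \<beta> by (rule component_in[OF gm_gr_ds wc])
 define c where "c = (\<lambda>\<beta> k. component (\<lambda>n. grm W \<beta> \<inter> wtm W n) k (component (grm W) \<beta> w))"
 have c: "c \<beta> k \<in> grm W \<beta>" "c \<beta> k \<in> wtm W k" for \<beta> k
  using component_in[OF gm_grwt_ds gr] by (auto simp: c_def)
 have wt_comp: "component (wtm W) k (component (grm W) \<beta> w) = c \<beta> k" for \<beta> k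
 proof -
  let ?I = "{k. c \<beta> k \<noteq> 0}"
  have fin: "finite ?I" using component_finite[OF gm_grwt_ds gr] by (simp add: c_def)
  have "component (grm W) \<beta> w = (\<Sum>k\<in>?I. c \<beta> k)"
   using component_sum[OF gm_grwt_ds gr fin] by (simp add: c_def)
  then show ?thesis using component_of_sum[OF gm_wt_ds fin, of "c \<beta>" k] c by simp
 qed
 have "w = (\<Sum>\<beta>\<in>B. component (grm W) \<beta> w)"
  using component_sum[OF gm_gr_ds wc B] by (simp add: B_def)
 then have "component (wtm W) k w = component (wtm W) k (\<Sum>\<beta>\<in>B. component (grm W) \<beta> w)" for k
  by (rule arg_cong)
 also have "component (wtm W) k (\<Sum>\<beta>\<in>B. component (grm W) \<beta> w) = (\<Sum>\<beta>\<in>B. c \<beta> k)" for k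
  unfolding wt_comp[symmetric]
  by (rule lin_sum[OF component_linear[OF gm_wt_ds] gm_subspace gm_gr_subset[OF gr]])
 finally have wk: "component (wtm W) k w = (\<Sum>\<beta>\<in>B. c \<beta> k)" for k .
 have "(\<Sum>\<beta>\<in>B. c \<beta> k) = 0" if "k \<noteq> n" for k
  using component_of_summand[OF gm_wt_ds w, of k] that by (simp add: wk)
 then have z: "c \<beta> k = 0" if "k \<noteq> n" "\<beta> \<in> B" for k \<beta>
  using ds_independent[OF gm_gr_ds B, of "\<lambda>\<beta>. c \<beta> k" \<beta>] that c by blast
 show ?thesis
 proof (cases "\<beta> \<in> B")
  case True
  have "component (grm W) \<beta> w = (\<Sum>k\<in>{n}. c \<beta> k)"
   unfolding c_def by (rule component_sum[OF gm_grwt_ds gr]) (use z True in \<open>auto simp: c_def\<close>)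
  then show ?thesis using c by simp
 next
  case False
  then show ?thesis using complex_vector.subspace_0[OF ds_summand[OF gm_wt_ds]] by (simp add: B_def)
 qed
qed

text \<open>
  $L(0)-n$ is invertible on $W_{[m]}$ for $m\neq n$.
\<close>

lemma gm_shift_surj:
 assumes "w \<in> wtm W m" "m \<noteq> n"
 shows "\<exists>u\<in>wtm W m. w = (shift_op (Lm W 0) n ^^ k) u"
proof -
 have sub: "csubspace (wtm W m)" by (rule ds_summand[OF gm_wt_ds])
 have stable: "shift_op (Lm W 0) l x \<in> wtm W m" if "x \<in> wtm W m" for x l
  using gm_L_wt[of 0 x m] that sub by (simp add: shift_op_def complex_vector.subspace_diff complex_vector.subspace_scale)
 have diff: "shift_op (Lm W 0) l (x - y) = shift_op (Lm W 0) l x - shift_op (Lm W 0) l y"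
  if "x \<in> carr W" "y \<in> carr W" for x y l
  using lin_diff[OF gm_L_linear[of 0] gm_subspace that]
  by (simp add: shift_op_def complex_vector.scale_right_diff_distrib)
 have scale: "shift_op (Lm W 0) l (c *\<^sub>C x) = c *\<^sub>C shift_op (Lm W 0) l x" if "x \<in> carr W" for x l c
  using lin_scale[OF gm_L_linear[of 0] that]
  by (simp add: shift_op_def complex_vector.scale_right_diff_distrib mult.commute)
 have one: "\<exists>u\<in>wtm W m. w = shift_op (Lm W 0) n u" if "w \<in> wtm W m" "(shift_op (Lm W 0) m ^^ j) w = 0" for j w
  using that
 proof (induction j arbitrary: w)
  case 0
  have "shift_op (Lm W 0) n 0 = 0" using scale[OF gm_zero, of n 0] by simp
  with 0 show ?case by (intro bexI[of _ 0]) auto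
 next
  case (Suc j)
  have "(shift_op (Lm W 0) m ^^ j) (shift_op (Lm W 0) m w) = 0"
   using Suc.prems(2) by (simp only: funpow_Suc_right o_apply)
  then obtain u where u: "u \<in> wtm W m" "shift_op (Lm W 0) m w = shift_op (Lm W 0) n u"
   using Suc.IH[OF stable[OF Suc.prems(1)]] by blast
  have "shift_op (Lm W 0) n w = shift_op (Lm W 0) m w + (m - n) *\<^sub>C w"
   by (simp add: shift_op_def complex_vector.scale_left_diff_distrib)
  then have "(m - n) *\<^sub>C w = shift_op (Lm W 0) n (w - u)"
   using diff[of w u n] u Suc.prems(1) gm_wt_subset by simp
  then have "inverse (m - n) *\<^sub>C (m - n) *\<^sub>C w = shift_op (Lm W 0) n (inverse (m - n) *\<^sub>C (w - u))"
   using scale[of "w - u" n] u Suc.prems(1) gm_wt_subset csub_diff[OF gm_subspace] by simp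
  then have "w = shift_op (Lm W 0) n (inverse (m - n) *\<^sub>C (w - u))"
   using assms(2) by (simp add: scaleC_scaleC scaleC_one)
  moreover have "inverse (m - n) *\<^sub>C (w - u) \<in> wtm W m"
   using u Suc.prems(1) sub by (simp add: complex_vector.subspace_diff complex_vector.subspace_scale)
  ultimately show ?case by blast
 qed
 have one': "\<exists>u\<in>wtm W m. w = shift_op (Lm W 0) n u" if w: "w \<in> wtm W m" for w
 proof -
  obtain j where "(shift_op (Lm W 0) m ^^ j) w = 0" using w unfolding wtm_def gen_eigenspace_def by blast
  then show ?thesis using one w by blast
 qed
 show ?thesis
 proof (induction k)
  case 0
  then show ?case using assms(1) by auto
 next
  case (Suc k)
  then obtain u where u: "u \<in> wtm W m" "w = (shift_op (Lm W 0) n ^^ k) u" by blast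
  obtain u' where u': "u' \<in> wtm W m" "u = shift_op (Lm W 0) n u'" using one' u(1) by blast
  have "w = (shift_op (Lm W 0) n ^^ Suc k) u'" unfolding funpow_Suc_right o_apply u'(2)[symmetric] by (rule u(2))
  then show ?case using u'(1) by blast
 qed
qed

end

section \<open>Contragredients\<close>

lemma dual1_linear: "f \<in> dual1 S ==> linear_map_on S UNIV f" and dual1_outside: "f \<in> dual1 S ==> x \<notin> S ==> f x = 0"
 by (auto simp: dual1_def)

lemma csubspace_dual1: "csubspace (dual1 S)"
 by (auto simp: complex_vector.subspace_def dual1_def linear_map_on_def algebra_simps)

lemma csubspace_vanish: "csubspace {f :: 'a => complex. \<forall>x\<in>X. f x = 0}"
 by (auto simp: complex_vector.subspace_def)

lemma csubspace_contragredient_piece: "csubspace (contragredient_piece W \<beta> n)"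
proof -
 have "contragredient_piece W \<beta> n = dual1 (carr W) \<inter>
   {f. \<forall>x\<in>(\<Union>(\<gamma>, m)\<in>UNIV - {(- \<beta>, n)}. grm W \<gamma> \<inter> wtm W m). f x = 0}"
  by (auto simp: contragredient_piece_def)
 then show ?thesis by (simp only: complex_vector.subspace_inter csubspace_dual1 csubspace_vanish)
qed

lemma piece_dual1: "f \<in> contragredient_piece W \<beta> n ==> f \<in> dual1 (carr W)"
 and piece_vanish: "f \<in> contragredient_piece W \<beta> n ==> w \<in> grm W \<gamma> ==> w \<in> wtm W m ==>
  (\<gamma>, m) \<noteq> (- \<beta>, n) ==> f w = 0"
 unfolding contragredient_piece_def by blast+

lemma contragredient_carr: "carr (contragredient V W) = cspan (\<Union>\<beta> n. contragredient_piece W \<beta> n)"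
 and contragredient_grm: "grm (contragredient V W) \<beta> = cspan (\<Union>n. contragredient_piece W \<beta> n)"
 and contragredient_act: "act (contragredient V W) v m f w = (if w \<in> carr W then f (opp_coeff V W v (- m - 1) w) else 0)"
 and contragredient_Lm: "Lm (contragredient V W) j f w = (if w \<in> carr W then f (Lm W (- j) w) else 0)"
 by (simp_all add: contragredient_def)

lemma piece_subset: "contragredient_piece W \<beta> n \<subseteq> carr (contragredient V W)"
 "contragredient_piece W \<beta> n \<subseteq> grm (contragredient V W) \<beta>"
 unfolding contragredient_carr contragredient_grm by (auto intro: complex_vector.span_base)

lemma contragredient_dual1: "f \<in> carr (contragredient V W) ==> f \<in> dual1 (carr W)"
proof -
 have "cspan (\<Union>\<beta> n. contragredient_piece W \<beta> n) \<subseteq> dual1 (carr W)"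
  by (rule complex_vector.span_minimal[OF _ csubspace_dual1]) (auto simp: contragredient_piece_def)
 then show "f \<in> carr (contragredient V W) ==> f \<in> dual1 (carr W)" by (auto simp: contragredient_carr)
qed

lemma contragredient_linear: "f \<in> carr (contragredient V W) ==> linear_map_on (carr W) UNIV f"
 using contragredient_dual1 dual1_linear by blast

lemma span_Union_induct:
 assumes "f \<in> cspan (\<Union>i. X i)" "\<And>i. csubspace (X i)" "P 0"
  "\<And>i f g. f \<in> X i ==> g \<in> cspan (\<Union>i. X i) ==> P g ==> P (f + g)"
 shows "P f"
proof -
 have "f \<in> cspan (\<Union>i. X i) \<and> P f"
  using assms(1)
 proof (induction rule: complex_vector.span_induct_alt)
  case base
  then show ?case using assms(3) complex_vector.span_zero by blast
 next
  case (step c x y)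
  obtain i where "x \<in> X i" using step(1) by blast
  then have i: "c *\<^sub>C x \<in> X i" by (rule csub_scale[OF assms(2)])
  then have "c *\<^sub>C x \<in> cspan (\<Union>i. X i)" by (intro complex_vector.span_base UN_I[OF UNIV_I])
  moreover from step have y: "y \<in> cspan (\<Union>i. X i)" "P y" by auto
  ultimately show ?case using assms(4)[OF i y] complex_vector.span_add[of "c *\<^sub>C x" _ y] by simp
 qed
 then show ?thesis by blast
qed

lemma contragredient_induct [consumes 1, case_names zero add]:
 assumes f: "f \<in> carr (contragredient V W)" and "P 0"
  and add: "\<And>\<beta> n f g. f \<in> contragredient_piece W \<beta> n ==> g \<in> carr (contragredient V W) ==> P g ==> P (f + g)"
 shows "P f"
proof -
 let ?X = "\<lambda>p. contragredient_piece W (fst p) (snd p)"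
 have U: "(\<Union>\<beta> n. contragredient_piece W \<beta> n) = (\<Union>p. ?X p)"
 proof (intro equalityI subsetI)
  fix x assume "x \<in> (\<Union>\<beta> n. contragredient_piece W \<beta> n)"
  then obtain \<beta> n where "x \<in> ?X (\<beta>, n)" by auto
  then show "x \<in> (\<Union>p. ?X p)" by blast
 qed blast
 show ?thesis
 proof (rule span_Union_induct[where X = ?X])
  show "f \<in> cspan (\<Union>p. ?X p)" using f unfolding contragredient_carr U .
  show "csubspace (?X p)" for p by (rule csubspace_contragredient_piece)
  show "P 0" by fact
  show "P (f + g)" if "f \<in> ?X p" "g \<in> cspan (\<Union>p. ?X p)" "P g" for p f g
   using that add unfolding contragredient_carr U by blast
 qed
qed

lemma contragredient_gr_finite_support:
 assumes "f \<in> carr (contragredient V W)"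
 shows "\<exists>F. finite F \<and> (\<forall>n. n \<notin> F --> (\<forall>\<gamma>. \<forall>w\<in>grm W \<gamma> \<inter> wtm W n. f w = 0))"
 using assms
proof (induction rule: contragredient_induct)
 case (add \<beta> n f g)
 then obtain F where "finite F" "\<forall>n. n \<notin> F --> (\<forall>\<gamma>. \<forall>w\<in>grm W \<gamma> \<inter> wtm W n. g w = 0)" by blast
 with add(1) show ?case
  by (intro exI[of _ "insert n F"]) (auto dest: piece_vanish)
qed auto

context
 fixes V :: "('v::complex_vector, 'g::ab_group_add) valg" and W :: "('v, 'g, 'w::complex_vector) vmod"
 assumes W: "generalized_module V W"
begin

lemma linear_zero_on_wt:
 assumes "linear_map_on (carr W) UNIV f" "\<And>\<gamma> w. w \<in> grm W \<gamma> ==> w \<in> wtm W n ==> f w = (0::'x::complex_vector)" "w \<in> wtm W n"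
 shows "f w = 0"
proof -
 have wc: "w \<in> carr W" using assms(3) gm_wt_subset[OF W] by blast
 let ?B = "{\<beta>. component (grm W) \<beta> w \<noteq> 0}"
 have B: "finite ?B" using component_finite[OF gm_gr_ds[OF W] wc] .
 have gr: "component (grm W) \<beta> w \<in> grm W \<beta>" for \<beta> by (rule component_in[OF gm_gr_ds[OF W] wc])
 have "w = (\<Sum>\<beta>\<in>?B. component (grm W) \<beta> w)" by (rule component_sum[OF gm_gr_ds[OF W] wc B]) simp
 then have "f w = f (\<Sum>\<beta>\<in>?B. component (grm W) \<beta> w)" by (rule arg_cong)
 also have "\<dots> = (\<Sum>\<beta>\<in>?B. f (component (grm W) \<beta> w))"
  by (rule lin_sum[OF assms(1) gm_subspace[OF W]]) (rule gm_gr_subset[OF W gr])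
 also have "\<dots> = 0"
  using assms(2)[OF gr gm_wt_gr_component[OF W assms(3)]] by simp
 finally show ?thesis .
qed

lemma contragredient_finite_support:
 assumes "f \<in> carr (contragredient V W)"
 shows "\<exists>F. finite F \<and> (\<forall>n. n \<notin> F --> (\<forall>w\<in>wtm W n. f w = 0))"
proof -
 obtain F where F: "finite F" "\<forall>n. n \<notin> F --> (\<forall>\<gamma>. \<forall>w\<in>grm W \<gamma> \<inter> wtm W n. f w = 0)"
  using contragredient_gr_finite_support[OF assms] by blast
 have "f w = 0" if "n \<notin> F" "w \<in> wtm W n" for n w
  by (rule linear_zero_on_wt[OF contragredient_linear[OF assms] _ that(2)]) (use F that in auto)
 then show ?thesis using F(1) by blast
qed

lemma contragredient_gr_vanish:
 assumes "f \<in> grm (contragredient V W) \<beta>" "w \<in> grm W \<gamma>" "\<gamma> \<noteq> - \<beta>"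
 shows "f w = 0"
proof -
 have "cspan (\<Union>n. contragredient_piece W \<beta> n) \<subseteq> {f. \<forall>w\<in>(\<Union>n. grm W \<gamma> \<inter> wtm W n). f w = 0}"
  by (rule complex_vector.span_minimal[OF _ csubspace_vanish]) (use assms(3) in \<open>auto simp: contragredient_piece_def\<close>)
 then have hom: "f w = 0" if "w \<in> grm W \<gamma> \<inter> wtm W n" for w n
  using assms(1) that by (auto simp: contragredient_grm)
 have "f \<in> carr (contragredient V W)"
  using assms(1) complex_vector.span_mono[of "\<Union>n. contragredient_piece W \<beta> n" "\<Union>\<beta> n. contragredient_piece W \<beta> n"]
  by (auto simp: contragredient_grm contragredient_carr)
 note lin = contragredient_linear[OF this]
 show ?thesis
  by (rule ds_induct[OF gm_grwt_ds[OF W] assms(2)])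
    (use hom lin_add[OF lin] gm_gr_subset[OF W] in auto)
qed

lemma contragredient_shift:
 assumes "w \<in> carr W" "f \<in> dual1 (carr W)"
 shows "(shift_op (Lm (contragredient V W) 0) n ^^ k) f w = f ((shift_op (Lm W 0) n ^^ k) w)"
proof -
 have in_dual: "(shift_op (Lm (contragredient V W) 0) n ^^ k) f \<in> dual1 (carr W)" for k
 proof (induction k)
  case (Suc k)
  let ?g = "(shift_op (Lm (contragredient V W) 0) n ^^ k) f"
  have g: "linear_map_on (carr W) UNIV ?g" using Suc dual1_linear by blast
  have "Lm (contragredient V W) 0 ?g \<in> dual1 (carr W)"
   using lin_add[OF g] lin_scale[OF g] gm_L_in[OF W, of 0]
    lin_add[OF gm_L_linear[OF W, of 0]] lin_scale[OF gm_L_linear[OF W, of 0]]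
    gm_add[OF W] gm_scale[OF W]
   by (simp add: dual1_def linear_map_on_def contragredient_Lm)
  then have "Lm (contragredient V W) 0 ?g - n *\<^sub>C ?g \<in> dual1 (carr W)"
   using Suc csub_diff[OF csubspace_dual1] csub_scale[OF csubspace_dual1]
   by blast
  then show ?case unfolding funpow.simps o_apply shift_op_def[of "Lm (contragredient V W) 0" n ?g] .
 qed (use assms in simp)
 have one: "shift_op (Lm (contragredient V W) 0) n g x = g (shift_op (Lm W 0) n x)"
  if "x \<in> carr W" "g \<in> dual1 (carr W)" for x g
  using that lin_diff[OF dual1_linear[OF that(2)] gm_subspace[OF W] gm_L_in[OF W, of 0 x]
    csub_scale[OF gm_subspace[OF W] that(1)]]
   lin_scale[OF dual1_linear[OF that(2)] that(1)]
  by (simp add: shift_op_def contragredient_Lm)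
 show ?thesis using assms
 proof (induction k arbitrary: w)
  case (Suc k)
  have s: "shift_op (Lm W 0) n w \<in> carr W" using gm_shift_in[OF W Suc.prems(1)] .
  have "(shift_op (Lm (contragredient V W) 0) n ^^ Suc k) f w = (shift_op (Lm (contragredient V W) 0) n ^^ k) f (shift_op (Lm W 0) n w)"
   using one[OF Suc.prems(1) in_dual[of k]] by simp
  also have "\<dots> = f ((shift_op (Lm W 0) n ^^ Suc k) w)"
   using Suc.IH[OF s assms(2)] by (simp only: funpow_Suc_right o_apply)
  finally show ?case .
 qed simp
qed

lemma contragredient_wt_vanish:
 assumes "f \<in> wtm (contragredient V W) n" "w \<in> wtm W m" "m \<noteq> n"
 shows "f w = 0"
proof -
 obtain k where k: "(shift_op (Lm (contragredient V W) 0) n ^^ k) f = 0" and f: "f \<in> carr (contragredient V W)"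
  using assms(1) by (auto simp: wtm_def gen_eigenspace_def)
 obtain u where u: "u \<in> wtm W m" "w = (shift_op (Lm W 0) n ^^ k) u"
  using gm_shift_surj[OF W assms(2,3)] by blast
 have "f w = (shift_op (Lm (contragredient V W) 0) n ^^ k) f u"
  using contragredient_shift[OF gm_wt_subset[OF W u(1)] contragredient_dual1[OF f]] u(2) by simp
 then show ?thesis using k by simp
qed

lemma linear_eq_on_hom:
 assumes "linear_map_on (carr W) UNIV f" "linear_map_on (carr W) UNIV g"
  "\<And>\<gamma> n w. w \<in> grm W \<gamma> ==> w \<in> wtm W n ==> f w = g w" "w \<in> carr W"
 shows "f w = (g w :: 'x::complex_vector)"
proof (rule gm_hom_induct[OF W assms(4)])
 fix x y assume "x \<in> carr W" "y \<in> carr W" "f x = g x" "f y = g y"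
 then show "f (x + y) = g (x + y)" using lin_add[OF assms(1)] lin_add[OF assms(2)] by simp
qed (use assms in blast)

text \<open>
  A bound on the nilpotency of $L(0)-n$ is needed for the functionals on $W_{[n]}$ to have
  generalized weight \<open>n\<close>.
\<close>

lemma contragredient_piece_wt:
 assumes K: "\<And>n w. w \<in> wtm W n ==> (shift_op (Lm W 0) n ^^ K) w = 0" and f: "f \<in> contragredient_piece W \<beta> n"
 shows "f \<in> wtm (contragredient V W) n"
proof -
 have fd: "f \<in> dual1 (carr W)" using f by (simp add: contragredient_piece_def)
 have fc: "f \<in> carr (contragredient V W)" using f piece_subset by blast
 have hom: "(shift_op (Lm (contragredient V W) 0) n ^^ K) f w = 0" if w: "w \<in> grm W \<gamma>" "w \<in> wtm W m" for w \<gamma> m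
 proof -
  have wc: "w \<in> carr W" using w gm_gr_subset[OF W] by blast
  have st: "(shift_op (Lm W 0) n ^^ k) w \<in> grm W \<gamma> \<inter> wtm W m" for k
  proof (induction k)
   case (Suc k)
   let ?x = "(shift_op (Lm W 0) n ^^ k) w"
   have "Lm W 0 ?x \<in> grm W \<gamma> \<inter> wtm W m"
    using Suc gm_L_wt[OF W, of 0 ?x m] gm_L_gr[OF W, of 0 ?x \<gamma>] by simp
   moreover have "n *\<^sub>C ?x \<in> grm W \<gamma> \<inter> wtm W m"
    using Suc ds_summand[OF gm_grwt_ds[OF W]] complex_vector.subspace_scale by metis
   ultimately have "Lm W 0 ?x - n *\<^sub>C ?x \<in> grm W \<gamma> \<inter> wtm W m"
    using ds_summand[OF gm_grwt_ds[OF W]] complex_vector.subspace_diff by metis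
   then show ?case unfolding funpow.simps o_apply shift_op_def[of "Lm W 0" n ?x] .
  qed (use w in simp)
  show ?thesis
  proof (cases "m = n")
   case True
   then show ?thesis using contragredient_shift[OF wc fd] K[of w n] w lin_zero[OF dual1_linear[OF fd] gm_zero[OF W]] by simp
  next
   case False
   then show ?thesis using contragredient_shift[OF wc fd] st[of K] piece_vanish[OF f] by auto
  qed
 qed
 have "(shift_op (Lm (contragredient V W) 0) n ^^ K) f = 0"
 proof
  fix w
  show "(shift_op (Lm (contragredient V W) 0) n ^^ K) f w = 0 w"
  proof (cases "w \<in> carr W")
   case True
   have lin: "linear_map_on (carr W) UNIV (\<lambda>w. f ((shift_op (Lm W 0) n ^^ K) w))"
    using gm_shift_pow_linear[OF W] dual1_linear[OF fd] unfolding linear_map_on_def by simp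
   have "f ((shift_op (Lm W 0) n ^^ K) w) = 0"
   proof (rule linear_eq_on_hom[OF lin _ _ True])
    show "linear_map_on (carr W) UNIV (\<lambda>_. 0 :: complex)" by (simp add: linear_map_on_def)
    show "f ((shift_op (Lm W 0) n ^^ K) w) = 0" if "w \<in> grm W \<gamma>" "w \<in> wtm W m" for \<gamma> m w
     using hom[OF that] contragredient_shift[OF gm_wt_subset[OF W that(2)] fd] by simp
   qed
   then show ?thesis using contragredient_shift[OF True fd] by simp
  next
   case False
   have "(shift_op (Lm (contragredient V W) 0) n ^^ k) f w = 0" for k
   proof (induction k)
    case (Suc k)
    have "Lm (contragredient V W) 0 g w = 0" for g using False by (simp only: contragredient_Lm if_False)
    with Suc show ?case
     unfolding funpow.simps o_apply shift_op_def[of "Lm (contragredient V W) 0" n "(_ ^^ k) f"] by simp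
   qed (use False dual1_outside[OF fd] in simp)
   then show ?thesis by simp
  qed
 qed
 then show ?thesis using fc by (auto simp: wtm_def gen_eigenspace_def)
qed

end

context sgva
begin

lemma opp_coeff_sum:
 assumes "generalized_module V W" "w \<in> carr W" "finite E" "\<And>e. e \<notin> E ==> opp_vec V v e = 0"
 shows "opp_coeff V W v q w = (\<Sum>e\<in>E. act W (opp_vec V v e) (q - e - 1) w)"
 unfolding opp_coeff_def by (rule Sum_any_opp) (use assms gm_act_v_0 in auto)

lemma opp_coeff_eq:
 assumes "generalized_module V W" "w \<in> carr W"
 shows "opp_coeff V W v q w = (\<Sum>e\<in>{e. opp_vec V v e \<noteq> 0}. act W (opp_vec V v e) (q - e - 1) w)"
 by (rule opp_coeff_sum[OF assms opp_vec_finite]) simp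

lemma opp_coeff_in:
 assumes "generalized_module V W" "w \<in> carr W"
 shows "opp_coeff V W v q w \<in> carr W"
proof -
 have "opp_coeff V W v q w = (\<Sum>e | opp_vec V v e \<noteq> 0. act W (opp_vec V v e) (q - e - 1) w)"
  by (rule opp_coeff_sum[OF assms opp_vec_finite]) simp
 also have "\<dots> \<in> carr W" by (rule gm_sum[OF assms(1)]) (rule gm_act_in[OF assms])
 finally show ?thesis .
qed

lemma opp_coeff_v_add:
 assumes "generalized_module V W" "w \<in> carr W"
 shows "opp_coeff V W (v + v') q w = opp_coeff V W v q w + opp_coeff V W v' q w"
proof -
 let ?E = "{e. opp_vec V v e \<noteq> 0} \<union> {e. opp_vec V v' e \<noteq> 0}"
 have E: "finite ?E" using opp_vec_finite by simp
 show ?thesis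
  using opp_coeff_sum[OF assms E, of v q] opp_coeff_sum[OF assms E, of v' q] opp_coeff_sum[OF assms E, of "v + v'" q]
  by (simp add: opp_vec_add gm_act_v_add[OF assms] sum.distrib)
qed

lemma opp_coeff_opp:
 assumes "generalized_module V W" "w \<in> carr W" "finite E" "\<And>e. e \<notin> E ==> opp_vec V v e = 0"
 shows "(\<Sum>e\<in>E. opp_coeff V W (opp_vec V v e) (e + s) w) = act W v (s - 1) w"
proof -
 have "opp_coeff V W (opp_vec V v e) (e + s) w =
   Sum_any (\<lambda>f. act W (opp_vec V (opp_vec V v e) f) (s - 1 - (f - e)) w)" for e
 proof -
  have "opp_coeff V W (opp_vec V v e) (e + s) w =
    (\<Sum>f | opp_vec V (opp_vec V v e) f \<noteq> 0. act W (opp_vec V (opp_vec V v e) f) (s - 1 - (f - e)) w)"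
   by (subst opp_coeff_sum[OF assms(1,2) opp_vec_finite]) (auto simp: algebra_simps)
  then show ?thesis
   using Sum_any_superset[OF opp_vec_finite, of "opp_vec V v e" "\<lambda>f. act W (opp_vec V (opp_vec V v e) f) (s - 1 - (f - e)) w"]
    gm_act_v_0[OF assms(1,2)] by simp
 qed
 then show ?thesis
  using sum_opp_opp[OF _ assms(3,4), of "\<lambda>v d. act W v (s - 1 - d) w"] gm_act_v_add[OF assms(1,2)] by simp
qed


lemma opp_coeff_linear:
 assumes W: "generalized_module V W"
 shows "linear_map_on (carr W) (carr W) (opp_coeff V W v q)"
proof -
 note l = gm_act_linear[OF W] and eq = opp_coeff_eq[OF W]
 show ?thesis unfolding linear_map_on_def
 proof (intro conjI ballI allI)
  show "opp_coeff V W v q x \<in> carr W" if "x \<in> carr W" for x by (rule opp_coeff_in[OF W that])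
  show "opp_coeff V W v q (x + y) = opp_coeff V W v q x + opp_coeff V W v q y" if "x \<in> carr W" "y \<in> carr W" for x y
   unfolding eq[OF that(1)] eq[OF that(2)] eq[OF gm_add[OF W that]] sum.distrib[symmetric]
   by (rule sum.cong[OF refl]) (rule lin_add[OF l that])
  show "opp_coeff V W v q (c *\<^sub>C x) = c *\<^sub>C opp_coeff V W v q x" if "x \<in> carr W" for c x
   unfolding eq[OF that] eq[OF gm_scale[OF W that]] complex_vector.scale_sum_right
   by (rule sum.cong[OF refl]) (rule lin_scale[OF l that])
 qed
qed

lemma opp_coeff_trunc:
 assumes W: "generalized_module V W" and w: "w \<in> carr W"
 shows "\<exists>N. \<forall>q\<ge>N. opp_coeff V W v q w = 0"
proof -
 let ?E = "{e. opp_vec V v e \<noteq> 0}"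
 have "\<exists>M. \<forall>m\<ge>M. act W (opp_vec V v e) m w = 0" for e by (rule gm_trunc[OF W w])
 then obtain M where M: "\<And>e m. m \<ge> M e ==> act W (opp_vec V v e) m w = 0" by metis
 let ?N = "Max (insert 0 ((\<lambda>e. M e + e + 1) ` ?E))"
 have "opp_coeff V W v q w = 0" if q: "q \<ge> ?N" for q
  unfolding opp_coeff_eq[OF W w]
 proof (rule sum.neutral, rule ballI)
  fix e assume e: "e \<in> ?E"
  have "M e + e + 1 \<le> ?N" by (rule Max_ge) (use e opp_vec_finite in auto)
  then show "act W (opp_vec V v e) (q - e - 1) w = 0" using q by (intro M) linarith
 qed
 then show ?thesis by blast
qed

text \<open>
  The opposite of the contragredient action is the transpose of the original action.
\<close>

lemma contragredient_opp_coeff: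
 assumes W: "generalized_module V W" and N: "generalized_module V (contragredient V W)" and f: "f \<in> carr (contragredient V W)"
 shows "opp_coeff V (contragredient V W) v (- s - 1) f w = (if w \<in> carr W then f (act W v s w) else 0)"
proof -
 let ?E = "{e. opp_vec V v e \<noteq> 0}"
 have eq: "opp_coeff V (contragredient V W) v (- s - 1) f w =
   (\<Sum>e\<in>?E. act (contragredient V W) (opp_vec V v e) (- s - 1 - e - 1) f w)"
  by (subst opp_coeff_sum[OF N f opp_vec_finite]) (auto simp: sum_fun_apply)
 show ?thesis
 proof (cases "w \<in> carr W")
  case True
  have "(\<Sum>e\<in>?E. act (contragredient V W) (opp_vec V v e) (- s - 1 - e - 1) f w) =
    (\<Sum>e\<in>?E. f (opp_coeff V W (opp_vec V v e) (e + (s + 1)) w))"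
   using True by (intro sum.cong) (auto simp: contragredient_act algebra_simps)
  also have "\<dots> = f (\<Sum>e\<in>?E. opp_coeff V W (opp_vec V v e) (e + (s + 1)) w)"
   by (rule lin_sum[OF contragredient_linear[OF f] gm_subspace[OF W], symmetric]) (rule opp_coeff_in[OF W True])
  also have "\<dots> = f (act W v s w)" by (subst opp_coeff_opp[OF W True opp_vec_finite]) auto
  finally show ?thesis using eq True by simp
 qed (simp add: eq contragredient_act)
qed

end

section \<open>Completions and pairings\<close>

lemma csubspace_completion: "generalized_module V W ==> csubspace (completion W)"
proof -
 assume W: "generalized_module V W"
 have "csubspace (wtm W n)" for n by (rule ds_summand[OF gm_wt_ds[OF W]])
 then show ?thesis
  unfolding complex_vector.subspace_def completion_def by simp
qed

lemma completion_wt: "u \<in> completion W ==> u n \<in> wtm W n"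
 by (simp add: completion_def)

lemma completion_carr: "generalized_module V W ==> u \<in> completion W ==> u n \<in> carr W"
 using completion_wt gm_wt_subset by blast

lemma pairing_sum: "finite F ==> (\<And>n. n \<notin> F ==> f (u n) = 0) ==> pairing f u = (\<Sum>n\<in>F. f (u n))"
 unfolding pairing_def by (rule Sum_any_superset)

lemma contragredient_support_on_completion:
 assumes "generalized_module V W" "f \<in> carr (contragredient V W)"
 shows "\<exists>F. finite F \<and> (\<forall>u\<in>completion W. \<forall>n. n \<notin> F --> f (u n) = 0)"
 using contragredient_finite_support[OF assms] completion_wt by meson

lemma pairing_linear:
 assumes W: "generalized_module V W" and f: "f \<in> carr (contragredient V W)"
 shows "linear_map_on (completion W) UNIV (pairing f)"
proof -
 obtain F where F: "finite F" "\<forall>u\<in>completion W. \<forall>n. n \<notin> F --> f (u n) = 0"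
  using contragredient_support_on_completion[OF assms] by blast
 have eq: "pairing f u = (\<Sum>n\<in>F. f (u n))" if "u \<in> completion W" for u
  using pairing_sum[OF F(1)] F(2) that by blast
 note lin = contragredient_linear[OF f]
 show ?thesis unfolding linear_map_on_def
 proof (intro conjI ballI allI)
  fix u u' assume u: "u \<in> completion W" "u' \<in> completion W"
  then have "u + u' \<in> completion W" using csub_add[OF csubspace_completion[OF W]] by blast
  then show "pairing f (u + u') = pairing f u + pairing f u'"
   using u eq lin_add[OF lin completion_carr[OF W u(1)] completion_carr[OF W u(2)]]
   by (simp add: sum.distrib)
 next
  fix c u assume u: "u \<in> completion W"
  then have "c *\<^sub>C u \<in> completion W" using csub_scale[OF csubspace_completion[OF W]] by blast
  then show "pairing f (c *\<^sub>C u) = c *\<^sub>C pairing f u"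
   using u eq lin_scale[OF lin completion_carr[OF W u]]
   by (simp add: sum_distrib_left)
 qed simp
qed

lemma pairing_linear_left:
 assumes W: "generalized_module V W" and u: "u \<in> completion W"
 shows "linear_map_on (carr (contragredient V W)) UNIV (\<lambda>f. pairing f u)"
 unfolding linear_map_on_def
proof (intro conjI ballI allI)
 have fin: "finite {n. f (u n) \<noteq> 0}" if f: "f \<in> carr (contragredient V W)" for f
 proof -
  obtain F where "finite F" "\<forall>u\<in>completion W. \<forall>n. n \<notin> F --> f (u n) = 0"
   using contragredient_support_on_completion[OF W f] by blast
  then have "{n. f (u n) \<noteq> 0} \<subseteq> F" using u by blast
  then show ?thesis using \<open>finite F\<close> by (rule finite_subset)
 qed
 show "pairing (f + g) u = pairing f u + pairing g u"
  if "f \<in> carr (contragredient V W)" "g \<in> carr (contragredient V W)" for f g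
  unfolding pairing_def plus_fun_apply by (rule Sum_any.distrib[OF fin[OF that(1)] fin[OF that(2)]])
 show "pairing (c *\<^sub>C f) u = c *\<^sub>C pairing f u" if "f \<in> carr (contragredient V W)" for c f
  unfolding pairing_def scaleC_fun_apply scaleC_complex
  by (rule Sum_any_right_distrib[OF fin[OF that], symmetric])
qed simp

lemma pairing_cong:
 assumes "\<And>n. f (u n) = g (u' n)" shows "pairing f u = pairing g u'"
 unfolding pairing_def assms ..

context sgva
begin

lemma extend_op_act_component:
 assumes W: "generalized_module V W" and u: "u \<in> completion W" and v: "Lv V 0 v = of_int h *\<^sub>C v"
 shows "component (wtm W) n (act W v s (u k)) = (if k = n - of_int (h - s - 1) then act W v s (u k) else 0)"
 using component_of_summand[OF gm_wt_ds[OF W] gm_act_wt[OF W v completion_wt[OF u], where n = k and m = s], of n]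
 by (auto simp: algebra_simps)

text \<open>
  For homogeneous \<open>v\<close> the sum that defines the extended operator has a single term.
\<close>

lemma extend_op_act_hom:
 assumes W: "generalized_module V W" and u: "u \<in> completion W" and v: "Lv V 0 v = of_int h *\<^sub>C v"
 shows "extend_op W (act W v s) u n = act W v s (u (n - of_int (h - s - 1)))"
 unfolding extend_op_def extend_op_act_component[OF assms]
 by (subst Sum_any_single[of "n - of_int (h - s - 1)"]) auto

lemma hom_L0: "v \<in> grv V \<alpha> \<inter> wtv V h ==> Lv V 0 v = of_int h *\<^sub>C v"
 using va_L0 by blast

lemma extend_op_act_finite:
 assumes W: "generalized_module V W" and u: "u \<in> completion W"
 shows "finite {k. component (wtm W) n (act W v s (u k)) \<noteq> 0}"
proof (induction v rule: va_hom_induct)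
 case (hom \<alpha> h v)
 show ?case
  by (rule finite_subset[of _ "{n - of_int (h - s - 1)}"])
    (auto simp: extend_op_act_component[OF W u hom_L0[OF hom]])
next
 case (add v w)
 have "component (wtm W) n (act W (v + w) s (u k)) =
   component (wtm W) n (act W v s (u k)) + component (wtm W) n (act W w s (u k))" for k
  using lin_add[OF component_linear[OF gm_wt_ds[OF W]]] gm_act_in[OF W completion_carr[OF W u]]
  by (simp add: gm_act_v_add[OF W completion_carr[OF W u]])
 then show ?case by (intro finite_subset[OF _ finite_UnI[OF add]]) auto
qed

lemma extend_op_act_v_add:
 assumes W: "generalized_module V W" and u: "u \<in> completion W"
 shows "extend_op W (act W (v + w) s) u n = extend_op W (act W v s) u n + extend_op W (act W w s) u n"
proof -
 have "component (wtm W) n (act W (v + w) s (u k)) =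
   component (wtm W) n (act W v s (u k)) + component (wtm W) n (act W w s (u k))" for k
  using lin_add[OF component_linear[OF gm_wt_ds[OF W]]] gm_act_in[OF W completion_carr[OF W u]]
  by (simp add: gm_act_v_add[OF W completion_carr[OF W u]])
 then show ?thesis
  unfolding extend_op_def
  by (simp only: Sum_any.distrib[OF extend_op_act_finite[OF assms] extend_op_act_finite[OF assms]])
qed

lemma extend_op_act_completion:
 assumes W: "generalized_module V W" and u: "u \<in> completion W"
 shows "extend_op W (act W v s) u \<in> completion W"
proof -
 have "extend_op W (act W v s) u n \<in> wtm W n" for n
 proof (induction v rule: va_hom_induct)
  case (hom \<alpha> h v)
  have "act W v s (u (n - of_int (h - s - 1))) \<in> wtm W (n - of_int (h - s - 1) + of_int (h - s - 1))"
   by (rule gm_act_wt[OF W hom_L0[OF hom] completion_wt[OF u]])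
  then show ?case unfolding extend_op_act_hom[OF W u hom_L0[OF hom]] by simp
 next
  case (add v w)
  then show ?case unfolding extend_op_act_v_add[OF assms]
   by (rule csub_add[OF ds_summand[OF gm_wt_ds[OF W]]])
 qed
 then show ?thesis by (simp add: completion_def)
qed

lemma extend_op_L:
 assumes W: "generalized_module V W" and u: "u \<in> completion W" and j: "j \<in> {-1,0,1}"
 shows "extend_op W (Lm W j) u n = Lm W j (u (n + of_int j))"
proof -
 have "component (wtm W) n (Lm W j (u k)) = (if k = n + of_int j then Lm W j (u k) else 0)" for k
  using component_of_summand[OF gm_wt_ds[OF W] gm_L_wt[OF W j completion_wt[OF u]], of n k] by auto
 then show ?thesis unfolding extend_op_def by (subst Sum_any_single[of "n + of_int j"]) auto
qed

lemma extend_op_L_completion: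
 assumes W: "generalized_module V W" and u: "u \<in> completion W" and j: "j \<in> {-1,0,1}"
 shows "extend_op W (Lm W j) u \<in> completion W"
 unfolding completion_def mem_Collect_eq
proof
 fix n
 have "Lm W j (u (n + of_int j)) \<in> wtm W (n + of_int j - of_int j)" by (rule gm_L_wt[OF W j completion_wt[OF u]])
 then show "extend_op W (Lm W j) u n \<in> wtm W n" unfolding extend_op_L[OF assms] by simp
qed

lemma pairing_extend_L:
 assumes W: "generalized_module V W" and u: "u \<in> completion W" and j: "j \<in> {-1,0,1}"
 shows "pairing f (extend_op W (Lm W j) u) = pairing (Lm (contragredient V W) (- j) f) u"
proof -
 have "pairing f (extend_op W (Lm W j) u) = Sum_any (\<lambda>n. f (Lm W j (u (n + of_int j))))"
  by (simp only: pairing_def extend_op_L[OF assms])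
 also have "\<dots> = Sum_any (\<lambda>n. f (Lm W j (u n)))"
 proof (rule Sum_any.reindex_cong)
  show "bij (\<lambda>n::complex. n - of_int j)" by (rule bij_betw_byWitness[where f' = "\<lambda>n. n + of_int j"]) auto
  show "(\<lambda>n. f (Lm W j (u (n + of_int j)))) \<circ> (\<lambda>n. n - of_int j) = (\<lambda>n. f (Lm W j (u n)))"
   by (rule ext) (simp only: o_apply diff_add_cancel)
 qed
 also have "\<dots> = pairing (Lm (contragredient V W) (- j) f) u"
  using completion_carr[OF W u] by (simp add: pairing_def contragredient_Lm)
 finally show ?thesis .
qed

lemma pairing_act_finite:
 assumes W: "generalized_module V W" and u: "u \<in> completion W" and f: "f \<in> carr (contragredient V W)"
 shows "finite {n. f (act W v s (u n)) \<noteq> 0}"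
proof (induction v rule: va_hom_induct)
 case (hom \<alpha> h v)
 obtain F where F: "finite F" "\<forall>n. n \<notin> F --> (\<forall>w\<in>wtm W n. f w = 0)"
  using contragredient_finite_support[OF W f] by blast
 have "{n. f (act W v s (u n)) \<noteq> 0} \<subseteq> (\<lambda>n. n - of_int (h - s - 1)) ` F"
 proof
  fix n assume "n \<in> {n. f (act W v s (u n)) \<noteq> 0}"
  then have "n + of_int (h - s - 1) \<in> F"
   using F(2) gm_act_wt[OF W hom_L0[OF hom] completion_wt[OF u], where n = n and m = s] by blast
  then have "n + of_int (h - s - 1) - of_int (h - s - 1) \<in> (\<lambda>n. n - of_int (h - s - 1)) ` F" by (rule imageI)
  then show "n \<in> (\<lambda>n. n - of_int (h - s - 1)) ` F" by simp
 qed
 then show ?case using F(1) by (rule finite_subset[OF _ finite_imageI])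
next
 case (add v w)
 have "f (act W (v + w) s (u n)) = f (act W v s (u n)) + f (act W w s (u n))" for n
  unfolding gm_act_v_add[OF W completion_carr[OF W u]]
  by (rule lin_add[OF contragredient_linear[OF f] gm_act_in[OF W completion_carr[OF W u]] gm_act_in[OF W completion_carr[OF W u]]])
 then show ?case by (intro finite_subset[OF _ finite_UnI[OF add]]) auto
qed

lemma pairing_extend_act_aux:
 assumes W: "generalized_module V W" and u: "u \<in> completion W" and f: "f \<in> carr (contragredient V W)"
 shows "pairing f (extend_op W (act W v s) u) = Sum_any (\<lambda>n. f (act W v s (u n)))"
proof (induction v rule: va_hom_induct)
 case (hom \<alpha> h v)
 have "pairing f (extend_op W (act W v s) u) = Sum_any (\<lambda>n. f (act W v s (u (n - of_int (h - s - 1)))))"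
  by (simp only: pairing_def extend_op_act_hom[OF W u hom_L0[OF hom]])
 also have "\<dots> = Sum_any (\<lambda>n. f (act W v s (u n)))"
 proof (rule Sum_any.reindex_cong)
  show "bij (\<lambda>n::complex. n + of_int (h - s - 1))" by (rule bij_betw_byWitness[where f' = "\<lambda>n. n - of_int (h - s - 1)"]) auto
  show "(\<lambda>n. f (act W v s (u (n - of_int (h - s - 1))))) \<circ> (\<lambda>n. n + of_int (h - s - 1)) = (\<lambda>n. f (act W v s (u n)))"
   by (rule ext) (simp only: o_apply add_diff_cancel)
 qed
 finally show ?case .
next
 case (add v w)
 have fadd: "f (act W (v + w) s (u n)) = f (act W v s (u n)) + f (act W w s (u n))" for n
  unfolding gm_act_v_add[OF W completion_carr[OF W u]]
  by (rule lin_add[OF contragredient_linear[OF f] gm_act_in[OF W completion_carr[OF W u]] gm_act_in[OF W completion_carr[OF W u]]])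
 have "extend_op W (act W (v + w) s) u = extend_op W (act W v s) u + extend_op W (act W w s) u"
  by (rule ext) (simp only: plus_fun_apply extend_op_act_v_add[OF W u])
 then have "pairing f (extend_op W (act W (v + w) s) u) = pairing f (extend_op W (act W v s) u) + pairing f (extend_op W (act W w s) u)"
  by (simp only: lin_add[OF pairing_linear[OF W f] extend_op_act_completion[OF W u] extend_op_act_completion[OF W u]])
 also have "\<dots> = Sum_any (\<lambda>n. f (act W (v + w) s (u n)))"
  unfolding fadd add by (rule Sum_any.distrib[OF pairing_act_finite[OF assms] pairing_act_finite[OF assms], symmetric])
 finally show ?case .
qed

lemma pairing_extend_act:
 assumes W: "generalized_module V W" and N: "generalized_module V (contragredient V W)"
  and u: "u \<in> completion W" and f: "f \<in> carr (contragredient V W)"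
 shows "pairing f (extend_op W (act W v s) u) = pairing (opp_coeff V (contragredient V W) v (- s - 1) f) u"
proof -
 have "opp_coeff V (contragredient V W) v (- s - 1) f (u n) = f (act W v s (u n))" for n
  unfolding contragredient_opp_coeff[OF W N f] using completion_carr[OF W u] by simp
 then show ?thesis unfolding pairing_extend_act_aux[OF W u f] by (simp only: pairing_def)
qed

lemma pairing_contragredient_act:
 assumes W: "generalized_module V W" and u: "u \<in> completion W" and f: "f \<in> carr (contragredient V W)"
  and E: "finite E" "\<And>e. e \<notin> E ==> opp_vec V v e = 0"
 shows "pairing (act (contragredient V W) v m f) u =
  (\<Sum>e\<in>E. pairing f (extend_op W (act W (opp_vec V v e) (- m - e - 2)) u))"
proof -
 have uc: "u n \<in> carr W" for n by (rule completion_carr[OF W u])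
 have "act (contragredient V W) v m f (u n) = (\<Sum>e\<in>E. f (act W (opp_vec V v e) (- m - e - 2) (u n)))" for n
 proof -
  have "act (contragredient V W) v m f (u n) = f (\<Sum>e\<in>E. act W (opp_vec V v e) (- m - 1 - e - 1) (u n))"
   using uc opp_coeff_sum[OF W uc E] by (simp add: contragredient_act)
  also have "\<dots> = (\<Sum>e\<in>E. f (act W (opp_vec V v e) (- m - 1 - e - 1) (u n)))"
   by (rule lin_sum[OF contragredient_linear[OF f] gm_subspace[OF W] gm_act_in[OF W uc]])
  finally show ?thesis by (simp add: algebra_simps)
 qed
 then have "pairing (act (contragredient V W) v m f) u = Sum_any (\<lambda>n. \<Sum>e\<in>E. f (act W (opp_vec V v e) (- m - e - 2) (u n)))"
  by (simp only: pairing_def)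
 also have "\<dots> = (\<Sum>e\<in>E. Sum_any (\<lambda>n. f (act W (opp_vec V v e) (- m - e - 2) (u n))))"
 proof -
  let ?g = "\<lambda>e n. f (act W (opp_vec V v e) (- m - e - 2) (u n))"
  let ?F = "\<Union>e\<in>E. {n. ?g e n \<noteq> 0}"
  have F: "finite ?F" using E(1) pairing_act_finite[OF W u f] by blast
  have "Sum_any (\<lambda>n. \<Sum>e\<in>E. ?g e n) = (\<Sum>n\<in>?F. \<Sum>e\<in>E. ?g e n)"
   by (rule Sum_any_superset[OF F]) (rule sum.neutral, blast)
  also have "\<dots> = (\<Sum>e\<in>E. \<Sum>n\<in>?F. ?g e n)" by (rule sum.swap)
  also have "\<dots> = (\<Sum>e\<in>E. Sum_any (?g e))"
   by (rule sum.cong[OF refl], rule Sum_any_superset[OF F, symmetric]) blast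
  finally show ?thesis .
 qed
 also have "\<dots> = (\<Sum>e\<in>E. pairing f (extend_op W (act W (opp_vec V v e) (- m - e - 2)) u))"
  by (simp only: pairing_extend_act_aux[OF W u f])
 finally show ?thesis .
qed

end

section \<open>Intertwining maps\<close>

context
 fixes V :: "('v::complex_vector, 'g::ab_group_add) valg" and z :: complex
  and W3 :: "('v, 'g, 'c::complex_vector) vmod" and W1 :: "('v, 'g, 'a::complex_vector) vmod"
  and W2 :: "('v, 'g, 'b::complex_vector) vmod" and I
 assumes I: "intertwining_map V z W3 W1 W2 I"
begin

lemma im_linear1: "w2 \<in> carr W2 ==> linear_map_on (carr W1) (completion W3) (\<lambda>w1. I w1 w2)"
 and im_linear2: "w1 \<in> carr W1 ==> linear_map_on (carr W2) (completion W3) (I w1)"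
 and im_gr: "w1 \<in> grm W1 \<beta> ==> w2 \<in> grm W2 \<gamma> ==> I w1 w2 n \<in> grm W3 (\<beta> + \<gamma>)"
 and im_trunc: "w1 \<in> carr W1 ==> w2 \<in> carr W2 ==> \<exists>N::nat. \<forall>m\<ge>N. I w1 w2 (n - of_nat m) = 0"
 and im_jacobi: "w1 \<in> carr W1 ==> w2 \<in> carr W2 ==>
   Sum_any (\<lambda>b. delta_snd z p b *\<^sub>C extend_op W3 (act W3 v (b - q - 1)) (I w1 w2) n) =
    Sum_any (\<lambda>c. delta_den z q c *\<^sub>C I (act W1 v (c - p - 1) w1) w2 n) +
    Sum_any (\<lambda>c. delta_fst_neg z p c *\<^sub>C I w1 (act W2 v (c - q - 1) w2) n)"
 using I by (simp_all add: intertwining_map_def)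

lemma im_L: "j \<in> {-1,0,1} ==> w1 \<in> carr W1 ==> w2 \<in> carr W2 ==>
    extend_op W3 (Lm W3 j) (I w1 w2) n =
    I w1 (Lm W2 j w2) n +
    (\<Sum>i = 0..nat (j + 1).
      (of_nat (nat (j + 1) choose i) * z ^ i) *\<^sub>C I (Lm W1 (j - int i) w1) w2 n)"
 using I unfolding intertwining_map_def by blast

lemma im_completion: "w1 \<in> carr W1 ==> w2 \<in> carr W2 ==> I w1 w2 \<in> completion W3"
 using lin_in[OF im_linear2] .

lemma im_zero1: "w2 \<in> carr W2 ==> 0 \<in> carr W1 ==> I 0 w2 = 0"
 using lin_zero[OF im_linear1] .

lemma im_zero2: "w1 \<in> carr W1 ==> 0 \<in> carr W2 ==> I w1 0 = 0"
 using lin_zero[OF im_linear2] .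

context
 assumes W1: "generalized_module V W1" and W2: "generalized_module V W2"
begin

text \<open>
  The residue in $x_0$ of the Jacobi identity.
\<close>

lemma im_commutator:
 assumes w: "w1 \<in> carr W1" "w2 \<in> carr W2" and M: "\<And>c. c \<ge> int M ==> act W1 v c w1 = 0"
 shows "extend_op W3 (act W3 v a) (I w1 w2) n =
   (\<Sum>i<M. bin z a i *\<^sub>C I (act W1 v (int i) w1) w2 n) + I w1 (act W2 v a w2) n"
proof -
 have 1: "Sum_any (\<lambda>b. delta_snd z (-1) b *\<^sub>C extend_op W3 (act W3 v (b - (- a - 1) - 1)) (I w1 w2) n) =
   extend_op W3 (act W3 v a) (I w1 w2) n"
 proof -
  have "delta_snd z (-1) b = (if b = 0 then 1 else 0)" for b
  proof (cases "b > 0")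
   case True
   then show ?thesis using delta_snd_neg[of "-1" b z] by simp
  next
   case False
   then obtain i where "b = - int i" by (metis int_nat_eq minus_minus neg_0_le_iff_le not_le)
   then show ?thesis using delta_snd_nat[of z "-1" i] by (cases i) (auto simp: gbinomial_0)
  qed
  then show ?thesis by (subst Sum_any_single[of 0]) (simp_all add: scaleC_one)
 qed
 have 2: "Sum_any (\<lambda>c. delta_den z (- a - 1) c *\<^sub>C I (act W1 v (c - (-1) - 1) w1) w2 n) =
   (\<Sum>i<M. bin z a i *\<^sub>C I (act W1 v (int i) w1) w2 n)"
  using im_zero1[OF w(2) gm_zero[OF W1]] M by (subst Sum_any_delta_den[of M]) simp_all
 have 3: "Sum_any (\<lambda>c. delta_fst_neg z (-1) c *\<^sub>C I w1 (act W2 v (c - (- a - 1) - 1) w2) n) = I w1 (act W2 v a w2) n"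
 proof -
  have "delta_fst_neg z (-1) c = (if c = 0 then 1 else 0)" for c
  proof (cases "c < 0")
   case True
   then show ?thesis using delta_fst_neg_neg[of c z "-1"] by simp
  next
   case False
   then obtain i where "c = int i" by (metis nonneg_int_cases not_le)
   then show ?thesis using delta_fst_neg_nat[of z "-1" i] by (cases i) (auto simp: bin_def gbinomial_0)
  qed
  then show ?thesis by (subst Sum_any_single[of 0]) (simp_all add: scaleC_one)
 qed
 show ?thesis using im_jacobi[OF w, of "-1" v "- a - 1" n] unfolding 1 2 3 .
qed

end

end

context sgva
begin

context
 fixes z :: complex
  and W3 :: "('v, 'g, 'c::complex_vector) vmod" and W1 :: "('v, 'g, 'a::complex_vector) vmod"
  and W2 :: "('v, 'g, 'b::complex_vector) vmod" and I
 assumes I: "intertwining_map V z W3 W1 W2 I"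
  and W1: "generalized_module V W1" and W2: "generalized_module V W2" and W3: "generalized_module V W3"
begin

text \<open>
  The residue in $x_1$ of the Jacobi identity.
\<close>

lemma im_column:
 assumes w: "w1 \<in> carr W1" "w2 \<in> carr W2" and v: "Lv V 0 v = of_int h *\<^sub>C v"
  and M: "\<And>c. c \<ge> int M ==> act W2 v c w2 = 0"
  and M': "\<And>i. i \<ge> M' ==> I w1 w2 (n - of_int (h - (b - int i) - 1)) = 0"
 shows "(\<Sum>i<M'. ((of_int b gchoose i) * (- z) ^ i) *\<^sub>C
      act W3 v (b - int i) (I w1 w2 (n - of_int (h - (b - int i) - 1)))) =
   I (act W1 v b w1) w2 n + (\<Sum>i<M. bin (- z) b i *\<^sub>C I w1 (act W2 v (int i) w2) n)"
proof -
 note u = im_completion[OF I w]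
 have 1: "Sum_any (\<lambda>c. delta_snd z (- b - 1) c *\<^sub>C extend_op W3 (act W3 v (c - (-1) - 1)) (I w1 w2) n) =
   (\<Sum>i<M'. ((of_int b gchoose i) * (- z) ^ i) *\<^sub>C
      act W3 v (b - int i) (I w1 w2 (n - of_int (h - (b - int i) - 1))))"
 proof (subst Sum_any_delta_snd[of _ M'])
  fix c assume c: "c \<le> - (- b - 1) - 1 - int M'"
  define i where "i = nat (b - c)"
  have i: "c = b - int i" "i \<ge> M'" using c by (auto simp: i_def)
  show "extend_op W3 (act W3 v (c - (-1) - 1)) (I w1 w2) n = 0"
   using M'[OF i(2)] gm_act_0[OF W3] unfolding extend_op_act_hom[OF W3 u v] i(1) by simp
 qed (simp add: extend_op_act_hom[OF W3 u v])
 have 2: "Sum_any (\<lambda>c. delta_den z (-1) c *\<^sub>C I (act W1 v (c - (- b - 1) - 1) w1) w2 n) = I (act W1 v b w1) w2 n"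
 proof -
  have "delta_den z (-1) c = (if c = 0 then 1 else 0)" for c
  proof (cases "c < 0")
   case True
   then show ?thesis using delta_den_neg[of c z "-1"] by simp
  next
   case False
   then obtain i where "c = int i" by (metis nonneg_int_cases not_le)
   then show ?thesis using delta_den_nat[of z "-1" i] by (cases i) (auto simp: bin_def gbinomial_0)
  qed
  then show ?thesis by (subst Sum_any_single[of 0]) (simp_all add: scaleC_one)
 qed
 have 3: "Sum_any (\<lambda>c. delta_fst_neg z (- b - 1) c *\<^sub>C I w1 (act W2 v (c - (-1) - 1) w2) n) =
   (\<Sum>i<M. bin (- z) b i *\<^sub>C I w1 (act W2 v (int i) w2) n)"
  using im_zero2[OF I w(1) gm_zero[OF W2]] M by (subst Sum_any_delta_fst_neg[of M]) simp_all
 show ?thesis using im_jacobi[OF I w, of "- b - 1" v "-1" n] unfolding 1 2 3 .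
qed

lemma im_commutator_pairing:
 assumes N: "generalized_module V (contragredient V W3)"
  and w: "w1 \<in> carr W1" "w2 \<in> carr W2" and x: "x \<in> carr (contragredient V W3)"
  and M: "\<And>c. c \<ge> int M ==> act W1 v c w1 = 0"
 shows "pairing x (extend_op W3 (act W3 v a) (I w1 w2)) =
   (\<Sum>i<M. bin z a i * pairing x (I (act W1 v (int i) w1) w2)) + pairing x (I w1 (act W2 v a w2))"
proof -
 note c = csubspace_completion[OF W3]
 note lin = pairing_linear[OF W3 x]
 have c1: "I (act W1 v (int i) w1) w2 \<in> completion W3" for i by (rule im_completion[OF I gm_act_in[OF W1 w(1)] w(2)])
 have c1': "bin z a i *\<^sub>C I (act W1 v (int i) w1) w2 \<in> completion W3" for i by (rule csub_scale[OF c c1])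
 have c2: "I w1 (act W2 v a w2) \<in> completion W3" by (rule im_completion[OF I w(1) gm_act_in[OF W2 w(2)]])
 have "extend_op W3 (act W3 v a) (I w1 w2) =
   (\<Sum>i<M. bin z a i *\<^sub>C I (act W1 v (int i) w1) w2) + I w1 (act W2 v a w2)"
  by (rule ext) (simp only: plus_fun_apply sum_fun_apply scaleC_fun_apply im_commutator[OF I W1 W2 w M])
 then have "pairing x (extend_op W3 (act W3 v a) (I w1 w2)) =
   pairing x ((\<Sum>i<M. bin z a i *\<^sub>C I (act W1 v (int i) w1) w2) + I w1 (act W2 v a w2))" by (rule arg_cong)
 also have "\<dots> = pairing x (\<Sum>i<M. bin z a i *\<^sub>C I (act W1 v (int i) w1) w2) + pairing x (I w1 (act W2 v a w2))"
  by (rule lin_add[OF lin csub_sum[OF c c1'] c2])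
 also have "pairing x (\<Sum>i<M. bin z a i *\<^sub>C I (act W1 v (int i) w1) w2) = (\<Sum>i<M. bin z a i * pairing x (I (act W1 v (int i) w1) w2))"
  unfolding lin_sum[OF lin c c1'] lin_scale[OF lin c1] scaleC_complex ..
 finally show ?thesis .
qed

lemma im_L_pairing:
 assumes j: "j \<in> {-1,0,1}" and w: "w1 \<in> carr W1" "w2 \<in> carr W2" and x: "x \<in> carr (contragredient V W3)"
 shows "pairing (Lm (contragredient V W3) (- j) x) (I w1 w2) =
   pairing x (I w1 (Lm W2 j w2)) +
   (\<Sum>i = 0..nat (j + 1). (of_nat (nat (j + 1) choose i) * z ^ i) * pairing x (I (Lm W1 (j - int i) w1) w2))"
proof -
 note c = csubspace_completion[OF W3]
 note lin = pairing_linear[OF W3 x]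
 have ji: "j - int i \<in> {-1,0,1}" if "i \<in> {0..nat (j + 1)}" for i using that j by auto
 have c1: "I (Lm W1 (j - int i) w1) w2 \<in> completion W3" if "i \<in> {0..nat (j + 1)}" for i
  by (rule im_completion[OF I gm_L_in[OF W1 ji[OF that] w(1)] w(2)])
 have c1': "(of_nat (nat (j + 1) choose i) * z ^ i) *\<^sub>C I (Lm W1 (j - int i) w1) w2 \<in> completion W3"
  if "i \<in> {0..nat (j + 1)}" for i by (rule csub_scale[OF c c1[OF that]])
 have c2: "I w1 (Lm W2 j w2) \<in> completion W3" by (rule im_completion[OF I w(1) gm_L_in[OF W2 j w(2)]])
 have "extend_op W3 (Lm W3 j) (I w1 w2) = I w1 (Lm W2 j w2) +
   (\<Sum>i = 0..nat (j + 1). (of_nat (nat (j + 1) choose i) * z ^ i) *\<^sub>C I (Lm W1 (j - int i) w1) w2)"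
  by (rule ext) (simp only: plus_fun_apply sum_fun_apply scaleC_fun_apply im_L[OF I j w])
 then have "pairing x (extend_op W3 (Lm W3 j) (I w1 w2)) = pairing x (I w1 (Lm W2 j w2) +
   (\<Sum>i = 0..nat (j + 1). (of_nat (nat (j + 1) choose i) * z ^ i) *\<^sub>C I (Lm W1 (j - int i) w1) w2))" by (rule arg_cong)
 also have "\<dots> = pairing x (I w1 (Lm W2 j w2)) +
   pairing x (\<Sum>i = 0..nat (j + 1). (of_nat (nat (j + 1) choose i) * z ^ i) *\<^sub>C I (Lm W1 (j - int i) w1) w2)"
  by (rule lin_add[OF lin c2 csub_sum[OF c c1']])
 also have "pairing x (\<Sum>i = 0..nat (j + 1). (of_nat (nat (j + 1) choose i) * z ^ i) *\<^sub>C I (Lm W1 (j - int i) w1) w2) =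
   (\<Sum>i = 0..nat (j + 1). pairing x ((of_nat (nat (j + 1) choose i) * z ^ i) *\<^sub>C I (Lm W1 (j - int i) w1) w2))"
  by (rule lin_sum[OF lin c c1'])
 also have "\<dots> = (\<Sum>i = 0..nat (j + 1). (of_nat (nat (j + 1) choose i) * z ^ i) * pairing x (I (Lm W1 (j - int i) w1) w2))"
  by (rule sum.cong[OF refl]) (simp only: lin_scale[OF lin c1] scaleC_complex)
 finally show ?thesis unfolding pairing_extend_L[OF W3 im_completion[OF I w] j] .
qed

end

end

section \<open>Forms on a tensor product\<close>

lemma dual2_linear1: "\<nu> \<in> dual2 S T ==> y \<in> T ==> linear_map_on S UNIV (\<lambda>x. \<nu> x y)"
 and dual2_linear2: "\<nu> \<in> dual2 S T ==> x \<in> S ==> linear_map_on T UNIV (\<nu> x)"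
 and dual2_outside: "\<nu> \<in> dual2 S T ==> x \<notin> S \<or> y \<notin> T ==> \<nu> x y = 0"
 unfolding dual2_def dual1_def by blast+

lemma dual2I:
 assumes "\<And>y. y \<in> T ==> linear_map_on S UNIV (\<lambda>x. \<nu> x y)" "\<And>x. x \<in> S ==> linear_map_on T UNIV (\<nu> x)"
  "\<And>x y. x \<notin> S \<or> y \<notin> T ==> \<nu> x y = 0"
 shows "\<nu> \<in> dual2 S T"
 using assms unfolding dual2_def dual1_def by auto

lemma csubspace_dual2: "csubspace (dual2 S T)"
 unfolding complex_vector.subspace_def
proof (intro conjI ballI allI)
 show "0 \<in> dual2 S T" by (rule dual2I) (auto simp: linear_map_on_def)
 show "f + g \<in> dual2 S T" if "f \<in> dual2 S T" "g \<in> dual2 S T" for f g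
 proof (rule dual2I)
  show "linear_map_on S UNIV (\<lambda>x. (f + g) x y)" if "y \<in> T" for y
   using dual2_linear1[OF \<open>f \<in> _\<close> that] dual2_linear1[OF \<open>g \<in> _\<close> that] unfolding linear_map_on_def
   by (simp add: algebra_simps)
  show "linear_map_on T UNIV ((f + g) x)" if "x \<in> S" for x
   using dual2_linear2[OF \<open>f \<in> _\<close> that] dual2_linear2[OF \<open>g \<in> _\<close> that] unfolding linear_map_on_def
   by (simp add: algebra_simps)
  show "(f + g) x y = 0" if "x \<notin> S \<or> y \<notin> T" for x y
   using dual2_outside[OF \<open>f \<in> _\<close> that] dual2_outside[OF \<open>g \<in> _\<close> that] by simp
 qed
 show "c *\<^sub>C f \<in> dual2 S T" if "f \<in> dual2 S T" for c f
 proof (rule dual2I)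
  show "linear_map_on S UNIV (\<lambda>x. (c *\<^sub>C f) x y)" if "y \<in> T" for y
   using dual2_linear1[OF \<open>f \<in> _\<close> that] unfolding linear_map_on_def by (simp add: algebra_simps)
  show "linear_map_on T UNIV ((c *\<^sub>C f) x)" if "x \<in> S" for x
   using dual2_linear2[OF \<open>f \<in> _\<close> that] unfolding linear_map_on_def by (simp add: algebra_simps)
  show "(c *\<^sub>C f) x y = 0" if "x \<notin> S \<or> y \<notin> T" for x y
   using dual2_outside[OF \<open>f \<in> _\<close> that] by simp
 qed
qed

lemma form_operator_P_L: "form_operator (P_L z U1 U2 j)"
proof
 show "P_L z U1 U2 j (x + y) = P_L z U1 U2 j x + P_L z U1 U2 j y" for x y
  by (rule ext, rule ext) (simp add: P_L_def sum.distrib algebra_simps)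
 show "P_L z U1 U2 j (c *\<^sub>C x) = c *\<^sub>C P_L z U1 U2 j x" for c x
  by (rule ext, rule ext) (simp add: P_L_def sum_distrib_left algebra_simps)
qed

text \<open>
  The opposite of the action $Y'_{P(z)}$: the value at $(u_1,u_2)$ of the coefficient of $x^{-s-1}$
  applied to \<open>\<nu>\<close>.  It involves neither $L(1)$ nor opposite vectors.
\<close>

definition P_opp ::
 "complex => ('v, 'g, 'a) vmod => ('v, 'g, 'b) vmod => ('a => 'b => complex) => 'a => 'b => 'v => int => complex" where
 "P_opp z U1 U2 \<nu> u1 u2 v s =
   \<nu> u1 (act U2 v s u2) + Sum_any (\<lambda>c. delta_den z (- s - 1) c * \<nu> (act U1 v c u1) u2)"

lemma gm_trunc_finite:
 assumes "generalized_module V W" "w \<in> carr W" "finite X"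
 shows "\<exists>M::nat. \<forall>v\<in>X. \<forall>c\<ge>int M. act W v c w = 0"
 using assms(3)
proof (induction X)
 case (insert v X)
 then obtain M where M: "\<forall>v\<in>X. \<forall>c\<ge>int M. act W v c w = 0" by blast
 obtain M' where M': "\<forall>c\<ge>M'. act W v c w = 0" using gm_trunc[OF assms(1,2)] by blast
 have "\<forall>v'\<in>insert v X. \<forall>c\<ge>int (M + nat M'). act W v' c w = 0"
  using M M' by auto
 then show ?case by blast
qed auto

context sgva
begin

context
 fixes z :: complex and U1 :: "('v, 'g, 'a::complex_vector) vmod" and U2 :: "('v, 'g, 'b::complex_vector) vmod" and \<nu> u1 u2
 assumes U1: "generalized_module V U1" and U2: "generalized_module V U2"
  and \<nu>: "\<nu> \<in> dual2 (carr U1) (carr U2)" and u: "u1 \<in> carr U1" "u2 \<in> carr U2"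
begin

lemma \<nu>_zero1: "\<nu> 0 u2 = 0" using lin_zero[OF dual2_linear1[OF \<nu> u(2)] gm_zero[OF U1]] .

lemma \<nu>_add1: "x \<in> carr U1 ==> y \<in> carr U1 ==> \<nu> (x + y) u2 = \<nu> x u2 + \<nu> y u2"
 by (rule lin_add[OF dual2_linear1[OF \<nu> u(2)]])

lemma \<nu>_add2: "x \<in> carr U2 ==> y \<in> carr U2 ==> \<nu> u1 (x + y) = \<nu> u1 x + \<nu> u1 y"
 by (rule lin_add[OF dual2_linear2[OF \<nu> u(1)]])

lemma P_opp_eq:
 assumes "\<And>c. c \<ge> int M ==> act U1 v c u1 = 0"
 shows "P_opp z U1 U2 \<nu> u1 u2 v s = \<nu> u1 (act U2 v s u2) + (\<Sum>i<M. bin z s i * \<nu> (act U1 v (int i) u1) u2)"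
 using Sum_any_delta_den[of M "\<lambda>c. \<nu> (act U1 v c u1) u2" z "- s - 1"] assms \<nu>_zero1
 by (simp add: P_opp_def)

lemma P_opp_add: "P_opp z U1 U2 \<nu> u1 u2 (v + w) s = P_opp z U1 U2 \<nu> u1 u2 v s + P_opp z U1 U2 \<nu> u1 u2 w s"
proof -
 obtain M where M: "\<forall>x\<in>{v, w, v + w}. \<forall>c\<ge>int M. act U1 x c u1 = 0"
  using gm_trunc_finite[OF U1 u(1), of "{v, w, v + w}"] by auto
 show ?thesis
  using M by (simp add: P_opp_eq[of M] gm_act_v_add[OF U2 u(2)] gm_act_v_add[OF U1 u(1)]
   \<nu>_add2 \<nu>_add1 gm_act_in[OF U1 u(1)] gm_act_in[OF U2 u(2)] sum.distrib algebra_simps)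
qed

lemma P_opp_0: "P_opp z U1 U2 \<nu> u1 u2 0 s = 0"
 using P_opp_add[of 0 0 s] by simp

lemma P_first_term_eq:
 assumes E: "finite E" "\<And>e. e \<notin> E ==> opp_vec V v e = 0"
 shows "P_first_term V z U1 v \<nu> u1 u2 q r =
  (\<Sum>e\<in>E. Sum_any (\<lambda>c. delta_den z (e - q) c * \<nu> (act U1 (opp_vec V v e) (c - r - 1) u1) u2))"
proof -
 obtain M0 where M0: "\<forall>x\<in>opp_vec V v ` E. \<forall>c\<ge>int M0. act U1 x c u1 = 0"
  using gm_trunc_finite[OF U1 u(1), of "opp_vec V v ` E"] E(1) by auto
 define M where "M = nat (int M0 + r + 1)"
 have z: "delta_den z (e - q) c * \<nu> (act U1 (opp_vec V v e) (c - r - 1) u1) u2 = 0"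
  if "e \<notin> E \<or> c \<notin> int ` {..<M}" for e c
 proof (cases "e \<in> E")
  case True
  show ?thesis
  proof (cases "c < 0")
   case False
   then have "c \<ge> int M" using that True by (metis image_eqI lessThan_iff nat_eq_iff2 not_le of_nat_less_iff zero_le)
   then have "c - r - 1 \<ge> int M0" unfolding M_def by linarith
   then show ?thesis using M0 True \<nu>_zero1 by simp
  qed (simp add: delta_den_neg)
 qed (simp add: E(2) gm_act_v_0[OF U1 u(1)] \<nu>_zero1)
 have "P_first_term V z U1 v \<nu> u1 u2 q r =
   (\<Sum>(e, c)\<in>E \<times> int ` {..<M}. delta_den z (e - q) c * \<nu> (act U1 (opp_vec V v e) (c - r - 1) u1) u2)"
  unfolding P_first_term_def
 proof (rule Sum_any_superset)
  fix p assume "p \<notin> E \<times> int ` {..<M}"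
  then have "fst p \<notin> E \<or> snd p \<notin> int ` {..<M}" by (metis mem_Times_iff)
  from z[OF this] show "(case p of (e, c) => delta_den z (e - q) c * \<nu> (act U1 (opp_vec V v e) (c - r - 1) u1) u2) = 0"
   by (simp only: case_prod_beta)
 qed (use E(1) in simp)
 also have "\<dots> = (\<Sum>e\<in>E. \<Sum>c\<in>int ` {..<M}. delta_den z (e - q) c * \<nu> (act U1 (opp_vec V v e) (c - r - 1) u1) u2)"
  by (rule sum.cartesian_product[symmetric])
 also have "\<dots> = (\<Sum>e\<in>E. Sum_any (\<lambda>c. delta_den z (e - q) c * \<nu> (act U1 (opp_vec V v e) (c - r - 1) u1) u2))"
  by (rule sum.cong[OF refl], rule Sum_any_superset[symmetric]) (use z in blast)+
 finally show ?thesis .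
qed

lemma P_act_eq:
 assumes E: "finite E" "\<And>e. e \<notin> E ==> opp_vec V v e = 0"
 shows "P_act V z U1 U2 v m \<nu> u1 u2 = (\<Sum>e\<in>E. P_opp z U1 U2 \<nu> u1 u2 (opp_vec V v e) (- m - e - 2))"
proof -
 have "\<nu> u1 (opp_coeff V U2 v (- m - 1) u2) = \<nu> u1 (\<Sum>e\<in>E. act U2 (opp_vec V v e) (- m - 1 - e - 1) u2)"
  by (subst opp_coeff_sum[OF U2 u(2) E]) simp_all
 also have "\<dots> = (\<Sum>e\<in>E. \<nu> u1 (act U2 (opp_vec V v e) (- m - 1 - e - 1) u2))"
  by (rule lin_sum[OF dual2_linear2[OF \<nu> u(1)] gm_subspace[OF U2] gm_act_in[OF U2 u(2)]])
 finally have "P_act V z U1 U2 v m \<nu> u1 u2 = (\<Sum>e\<in>E. \<nu> u1 (act U2 (opp_vec V v e) (- m - 1 - e - 1) u2) +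
   Sum_any (\<lambda>c. delta_den z (e - (- m - 1)) c * \<nu> (act U1 (opp_vec V v e) (c - (-1) - 1) u1) u2))"
  using u by (simp add: P_act_def P_first_term_eq[OF E] sum.distrib)
 also have "\<dots> = (\<Sum>e\<in>E. P_opp z U1 U2 \<nu> u1 u2 (opp_vec V v e) (- m - e - 2))"
 proof (rule sum.cong[OF refl])
  fix e
  have e: "- m - 1 - e - 1 = - m - e - 2" "e - (- m - 1) = - (- m - e - 2) - 1" "\<And>c. c - (-1) - 1 = (c::int)" by simp_all
  show "\<nu> u1 (act U2 (opp_vec V v e) (- m - 1 - e - 1) u2) +
    Sum_any (\<lambda>c. delta_den z (e - (- m - 1)) c * \<nu> (act U1 (opp_vec V v e) (c - (-1) - 1) u1) u2) =
    P_opp z U1 U2 \<nu> u1 u2 (opp_vec V v e) (- m - e - 2)" unfolding P_opp_def e ..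
 qed
 finally show ?thesis .
qed

lemma opp_sum_P_act:
 assumes E: "finite E" "\<And>e. e \<notin> E ==> opp_vec V v e = 0"
 shows "(\<Sum>e\<in>E. P_act V z U1 U2 (opp_vec V v e) (- s - e - 2) \<nu> u1 u2) = P_opp z U1 U2 \<nu> u1 u2 v s"
proof -
 have "P_act V z U1 U2 (opp_vec V v e) (- s - e - 2) \<nu> u1 u2 =
   Sum_any (\<lambda>f. P_opp z U1 U2 \<nu> u1 u2 (opp_vec V (opp_vec V v e) f) (s - (f - e)))" for e
 proof -
  have "P_act V z U1 U2 (opp_vec V v e) (- s - e - 2) \<nu> u1 u2 =
   (\<Sum>f | opp_vec V (opp_vec V v e) f \<noteq> 0. P_opp z U1 U2 \<nu> u1 u2 (opp_vec V (opp_vec V v e) f) (- (- s - e - 2) - f - 2))"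
   by (rule P_act_eq[OF opp_vec_finite]) simp
  also have "\<dots> = (\<Sum>f | opp_vec V (opp_vec V v e) f \<noteq> 0. P_opp z U1 U2 \<nu> u1 u2 (opp_vec V (opp_vec V v e) f) (s - (f - e)))"
   by (rule sum.cong[OF refl], rule arg_cong) simp
  also have "\<dots> = Sum_any (\<lambda>f. P_opp z U1 U2 \<nu> u1 u2 (opp_vec V (opp_vec V v e) f) (s - (f - e)))"
   by (rule Sum_any_superset[OF opp_vec_finite, symmetric]) (simp add: P_opp_0)
  finally show ?thesis .
 qed
 then show ?thesis
  using sum_opp_opp[of "\<lambda>v d. P_opp z U1 U2 \<nu> u1 u2 v (s - d)", OF P_opp_add E] by simp
qed

lemma opp_coeff_P_module:
 "opp_coeff V (P_module V z U1 U2 S) v (- s - 1) \<nu> u1 u2 = P_opp z U1 U2 \<nu> u1 u2 v s"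
proof -
 let ?E = "{e. opp_vec V v e \<noteq> 0}"
 have P0: "P_act V z U1 U2 0 m \<nu> = 0" for m
 proof (rule ext, rule ext)
  fix x y
  show "P_act V z U1 U2 0 m \<nu> x y = 0 x y"
  proof (cases "x \<in> carr U1 \<and> y \<in> carr U2")
   case True
   have "opp_vec V 0 e = 0" for e by (rule opp_vec_0)
   then show ?thesis
    using True lin_zero[OF dual2_linear2[OF \<nu>, of x] gm_zero[OF U2]] lin_zero[OF dual2_linear1[OF \<nu>, of y] gm_zero[OF U1]]
     opp_coeff_sum[OF U2, of y "{}" 0 "- m - 1"]
    by (simp add: P_act_def P_first_term_def gm_act_v_0[OF U1])
  qed (auto simp: P_act_def)
 qed
 have "opp_coeff V (P_module V z U1 U2 S) v (- s - 1) \<nu> = Sum_any (\<lambda>m. P_act V z U1 U2 (opp_vec V v (- s - 1 - m - 1)) m \<nu>)"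
  by (simp add: opp_coeff_def P_module_def)
 also have "\<dots> = (\<Sum>e\<in>?E. P_act V z U1 U2 (opp_vec V v e) (- s - 1 - e - 1) \<nu>)"
  by (rule Sum_any_opp[where a = "\<lambda>v m. P_act V z U1 U2 v m \<nu>", OF P0 opp_vec_finite]) simp
 finally have "opp_coeff V (P_module V z U1 U2 S) v (- s - 1) \<nu> u1 u2 =
   (\<Sum>e\<in>?E. P_act V z U1 U2 (opp_vec V v e) (- s - 1 - e - 1) \<nu>) u1 u2" by simp
 also have "\<dots> = (\<Sum>e\<in>?E. P_act V z U1 U2 (opp_vec V v e) (- s - e - 2) \<nu> u1 u2)"
  by (simp only: sum_fun_apply) (rule sum.cong[OF refl], simp add: algebra_simps)
 also have "\<dots> = P_opp z U1 U2 \<nu> u1 u2 v s" by (rule opp_sum_P_act[OF opp_vec_finite]) simp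
 finally show ?thesis .
qed

end

end

section \<open>Transposes of intertwining maps\<close>

lemma tensor_dual_gr_dual2: "\<nu> \<in> tensor_dual_gr U1 U2 \<beta> ==> \<nu> \<in> dual2 (carr U1) (carr U2)"
 and tensor_dual_gr_vanish: "\<nu> \<in> tensor_dual_gr U1 U2 \<beta> ==> u1 \<in> grm U1 \<beta>1 ==> u2 \<in> grm U2 \<beta>2 ==>
   \<beta>1 + \<beta>2 \<noteq> - \<beta> ==> \<nu> u1 u2 = 0"
 unfolding tensor_dual_gr_def tensor_dual_def by blast+

lemma tensor_dual_grI:
 assumes "\<nu> \<in> dual2 (carr U1) (carr U2)"
  "\<And>\<beta>1 \<beta>2 u1 u2. \<beta>1 + \<beta>2 \<noteq> - \<beta> ==> u1 \<in> grm U1 \<beta>1 ==> u2 \<in> grm U2 \<beta>2 ==> \<nu> u1 u2 = 0"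
 shows "\<nu> \<in> tensor_dual_gr U1 U2 \<beta>"
 using assms unfolding tensor_dual_gr_def tensor_dual_def by blast


lemma form_eq_on_gr:
 assumes U1: "generalized_module V U1" and U2: "generalized_module V U2"
  and f: "f \<in> dual2 (carr U1) (carr U2)" and g: "g \<in> dual2 (carr U1) (carr U2)"
  and eq: "\<And>\<beta>1 \<beta>2 u1 u2. u1 \<in> grm U1 \<beta>1 ==> u2 \<in> grm U2 \<beta>2 ==> f u1 u2 = g u1 u2"
 shows "f = g"
proof (rule ext, rule ext)
 fix x y
 show "f x y = g x y"
 proof (cases "x \<in> carr U1 \<and> y \<in> carr U2")
  case True
  then have x: "x \<in> carr U1" and y: "y \<in> carr U2" by auto
  have 1: "f x u2 = g x u2" if u2: "u2 \<in> grm U2 \<beta>2" for u2 \<beta>2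
  proof -
   note u2c = gm_gr_subset[OF U2 u2]
   show ?thesis
   proof (rule ds_induct[OF gm_gr_ds[OF U1] x])
    fix x y assume "x \<in> carr U1" "y \<in> carr U1" "f x u2 = g x u2" "f y u2 = g y u2"
    then show "f (x + y) u2 = g (x + y) u2"
     using lin_add[OF dual2_linear1[OF f u2c]] lin_add[OF dual2_linear1[OF g u2c]] by simp
   qed (rule eq[OF _ u2])
  qed
  show ?thesis
  proof (rule ds_induct[OF gm_gr_ds[OF U2] y])
   fix y y' assume "y \<in> carr U2" "y' \<in> carr U2" "f x y = g x y" "f x y' = g x y'"
   then show "f x (y + y') = g x (y + y')"
    using lin_add[OF dual2_linear2[OF f x]] lin_add[OF dual2_linear2[OF g x]] by simp
  qed (rule 1)
 next
  case False
  then have "x \<notin> carr U1 \<or> y \<notin> carr U2" by blast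
  then show ?thesis using dual2_outside[OF f] dual2_outside[OF g] by simp
 qed
qed

lemma tensor_dual_gr_component:
 assumes U1: "generalized_module V U1" and U2: "generalized_module V U2"
  and B: "finite B" and g: "\<And>\<beta>. \<beta> \<in> B ==> g \<beta> \<in> tensor_dual_gr U1 U2 \<beta>"
  and s: "(\<Sum>\<beta>\<in>B. g \<beta>) \<in> tensor_dual_gr U1 U2 \<beta>0"
 shows "(\<Sum>\<beta>\<in>B. g \<beta>) = (if \<beta>0 \<in> B then g \<beta>0 else 0)"
proof (rule form_eq_on_gr[OF U1 U2 tensor_dual_gr_dual2[OF s]])
 show "(if \<beta>0 \<in> B then g \<beta>0 else 0) \<in> dual2 (carr U1) (carr U2)"
  using tensor_dual_gr_dual2[OF g] complex_vector.subspace_0[OF csubspace_dual2] by auto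
 fix \<beta>1 \<beta>2 u1 u2 assume u: "u1 \<in> grm U1 \<beta>1" "u2 \<in> grm U2 \<beta>2"
 show "(\<Sum>\<beta>\<in>B. g \<beta>) u1 u2 = (if \<beta>0 \<in> B then g \<beta>0 else 0) u1 u2"
 proof (cases "\<beta>1 + \<beta>2 = - \<beta>0")
  case True
  have "(\<Sum>\<beta>\<in>B. g \<beta>) u1 u2 = (\<Sum>\<beta>\<in>B. if \<beta> = \<beta>0 then g \<beta>0 u1 u2 else 0)"
   unfolding sum_fun_apply
  proof (rule sum.cong[OF refl])
   fix \<beta> assume "\<beta> \<in> B"
   then show "g \<beta> u1 u2 = (if \<beta> = \<beta>0 then g \<beta>0 u1 u2 else 0)"
    using tensor_dual_gr_vanish[OF g u, of \<beta>] True by auto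
  qed
  then show ?thesis using B by simp
 next
  case False
  have "(\<Sum>\<beta>\<in>B. g \<beta>) u1 u2 = 0" by (rule tensor_dual_gr_vanish[OF s u False])
  moreover have "(if \<beta>0 \<in> B then g \<beta>0 else 0) u1 u2 = 0"
   using tensor_dual_gr_vanish[OF g u False] by simp
  ultimately show ?thesis by simp
 qed
qed

lemma transpose2_apply: "w1 \<in> carr W1 ==> w2 \<in> carr W2 ==> transpose2 W1 W2 I x w1 w2 = pairing x (I w1 w2)"
 by (simp add: transpose2_def)

lemma transpose2_outside: "w1 \<notin> carr W1 \<or> w2 \<notin> carr W2 ==> transpose2 W1 W2 I x w1 w2 = 0"
 by (auto simp: transpose2_def)

lemma P_act_outside: "u1 \<notin> carr U1 \<or> u2 \<notin> carr U2 ==> P_act V z U1 U2 v m \<nu> u1 u2 = 0"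
 by (auto simp: P_act_def)

lemma P_L_outside: "u1 \<notin> carr U1 \<or> u2 \<notin> carr U2 ==> P_L z U1 U2 j \<nu> u1 u2 = 0"
 by (auto simp: P_L_def)

context sgva
begin

context
 fixes z :: complex
  and W3 :: "('v, 'g, 'c::complex_vector) vmod" and W1 :: "('v, 'g, 'a::complex_vector) vmod"
  and W2 :: "('v, 'g, 'b::complex_vector) vmod" and I
 assumes I: "intertwining_map V z W3 W1 W2 I"
  and W1: "generalized_module V W1" and W2: "generalized_module V W2" and W3: "generalized_module V W3"
  and N: "generalized_module V (contragredient V W3)"
begin

lemma transpose2_dual2:
 assumes x: "x \<in> carr (contragredient V W3)"
 shows "transpose2 W1 W2 I x \<in> dual2 (carr W1) (carr W2)"
proof (rule dual2I)
 note lin = pairing_linear[OF W3 x]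
 show "linear_map_on (carr W1) UNIV (\<lambda>w1. transpose2 W1 W2 I x w1 w2)" if w2: "w2 \<in> carr W2" for w2
  using lin_add[OF lin] lin_scale[OF lin] lin_in[OF im_linear1[OF I w2]]
   lin_add[OF im_linear1[OF I w2]] lin_scale[OF im_linear1[OF I w2]]
   gm_add[OF W1] gm_scale[OF W1] w2
  unfolding linear_map_on_def by (simp add: transpose2_apply del: plus_fun_apply scaleC_fun_apply)
 show "linear_map_on (carr W2) UNIV (transpose2 W1 W2 I x w1)" if w1: "w1 \<in> carr W1" for w1
  using lin_add[OF lin] lin_scale[OF lin] lin_in[OF im_linear2[OF I w1]]
   lin_add[OF im_linear2[OF I w1]] lin_scale[OF im_linear2[OF I w1]]
   gm_add[OF W2] gm_scale[OF W2] w1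
  unfolding linear_map_on_def by (simp add: transpose2_apply del: plus_fun_apply scaleC_fun_apply)
qed (rule transpose2_outside)

lemma transpose2_linear: "linear_map_on (carr (contragredient V W3)) (dual2 (carr W1) (carr W2)) (transpose2 W1 W2 I)"
 unfolding linear_map_on_def
proof (intro conjI ballI allI transpose2_dual2)
 fix x y c assume x: "x \<in> carr (contragredient V W3)"
 show "transpose2 W1 W2 I (c *\<^sub>C x) = c *\<^sub>C transpose2 W1 W2 I x"
 proof (rule ext, rule ext)
  fix w1 w2
  show "transpose2 W1 W2 I (c *\<^sub>C x) w1 w2 = (c *\<^sub>C transpose2 W1 W2 I x) w1 w2"
   using lin_scale[OF pairing_linear_left[OF W3 im_completion[OF I]] x]
   by (simp add: transpose2_def del: plus_fun_apply)
 qed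
 assume y: "y \<in> carr (contragredient V W3)"
 show "transpose2 W1 W2 I (x + y) = transpose2 W1 W2 I x + transpose2 W1 W2 I y"
 proof (rule ext, rule ext)
  fix w1 w2
  show "transpose2 W1 W2 I (x + y) w1 w2 = (transpose2 W1 W2 I x + transpose2 W1 W2 I y) w1 w2"
   using lin_add[OF pairing_linear_left[OF W3 im_completion[OF I]] x y]
   by (simp add: transpose2_def)
 qed
qed

lemma transpose2_gr:
 assumes x: "x \<in> grm (contragredient V W3) \<beta>"
 shows "transpose2 W1 W2 I x \<in> tensor_dual_gr W1 W2 \<beta>"
proof (rule tensor_dual_grI[OF transpose2_dual2[OF gm_gr_subset[OF N x]]])
 fix \<beta>1 \<beta>2 u1 u2 assume b: "\<beta>1 + \<beta>2 \<noteq> - \<beta>" and u: "u1 \<in> grm W1 \<beta>1" "u2 \<in> grm W2 \<beta>2"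
 have "x (I u1 u2 n) = 0" for n by (rule contragredient_gr_vanish[OF W3 x im_gr[OF I u] b])
 then show "transpose2 W1 W2 I x u1 u2 = 0"
  using gm_gr_subset[OF W1 u(1)] gm_gr_subset[OF W2 u(2)] by (simp add: transpose2_apply pairing_def)
qed

text \<open>
  Here the contragredient action is compared with $Y'_{P(z)}$ by the commutator formula.
\<close>

lemma transpose2_act:
 assumes x: "x \<in> carr (contragredient V W3)"
 shows "transpose2 W1 W2 I (act (contragredient V W3) v m x) = P_act V z W1 W2 v m (transpose2 W1 W2 I x)"
proof (rule ext, rule ext)
 fix w1 w2
 show "transpose2 W1 W2 I (act (contragredient V W3) v m x) w1 w2 = P_act V z W1 W2 v m (transpose2 W1 W2 I x) w1 w2"
 proof (cases "w1 \<in> carr W1 \<and> w2 \<in> carr W2")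
  case True
  then have w: "w1 \<in> carr W1" "w2 \<in> carr W2" by auto
  let ?E = "{e. opp_vec V v e \<noteq> 0}"
  have E: "finite ?E" "\<And>e. e \<notin> ?E ==> opp_vec V v e = 0" by (rule opp_vec_finite) simp
  have "transpose2 W1 W2 I (act (contragredient V W3) v m x) w1 w2 =
   (\<Sum>e\<in>?E. pairing x (extend_op W3 (act W3 (opp_vec V v e) (- m - e - 2)) (I w1 w2)))"
   unfolding transpose2_apply[OF w] by (rule pairing_contragredient_act[OF W3 im_completion[OF I w] x E])
  also have "\<dots> = (\<Sum>e\<in>?E. P_opp z W1 W2 (transpose2 W1 W2 I x) w1 w2 (opp_vec V v e) (- m - e - 2))"
  proof (rule sum.cong[OF refl])
   fix e
   obtain M where "\<forall>u\<in>{opp_vec V v e}. \<forall>c\<ge>int M. act W1 u c w1 = 0"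
    using gm_trunc_finite[OF W1 w(1), of "{opp_vec V v e}"] by blast
   then have M: "\<And>c. c \<ge> int M ==> act W1 (opp_vec V v e) c w1 = 0" by blast
   show "pairing x (extend_op W3 (act W3 (opp_vec V v e) (- m - e - 2)) (I w1 w2)) =
    P_opp z W1 W2 (transpose2 W1 W2 I x) w1 w2 (opp_vec V v e) (- m - e - 2)"
    by (simp add: im_commutator_pairing[OF I W1 W2 W3 N w x M] P_opp_eq[OF W1 W2 transpose2_dual2[OF x] w M]
     transpose2_apply w gm_act_in[OF W1 w(1)] gm_act_in[OF W2 w(2)])
  qed
  also have "\<dots> = P_act V z W1 W2 v m (transpose2 W1 W2 I x) w1 w2"
   by (rule P_act_eq[OF W1 W2 transpose2_dual2[OF x] w E, symmetric])
  finally show ?thesis .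
 next
  case False
  then have "w1 \<notin> carr W1 \<or> w2 \<notin> carr W2" by blast
  then show ?thesis by (simp only: transpose2_outside P_act_outside)
 qed
qed

lemma transpose2_L:
 assumes j: "j \<in> {-1,0,1}" and x: "x \<in> carr (contragredient V W3)"
 shows "transpose2 W1 W2 I (Lm (contragredient V W3) j x) = P_L z W1 W2 j (transpose2 W1 W2 I x)"
proof (rule ext, rule ext)
 fix w1 w2
 show "transpose2 W1 W2 I (Lm (contragredient V W3) j x) w1 w2 = P_L z W1 W2 j (transpose2 W1 W2 I x) w1 w2"
 proof (cases "w1 \<in> carr W1 \<and> w2 \<in> carr W2")
  case True
  then have w: "w1 \<in> carr W1" "w2 \<in> carr W2" by auto
  have j': "- j \<in> {-1,0,1}" using j by auto
  have ji: "- j - int i \<in> {-1,0,1}" if "i \<in> {0..nat (1 - j)}" for i using that j by auto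
  have jj: "- (- j) = j" "- j + 1 = 1 - j" by simp_all
  show ?thesis
   using im_L_pairing[OF I W1 W2 W3 j' w x] gm_L_in[OF W2 j' w(2)] gm_L_in[OF W1 ji w(1)] w
   unfolding jj by (simp add: P_L_def transpose2_apply)
 next
  case False
  then have "w1 \<notin> carr W1 \<or> w2 \<notin> carr W2" by blast
  then show ?thesis by (simp only: transpose2_outside P_L_outside)
 qed
qed

end

end

section \<open>Module maps\<close>

lemma mm_linear: "module_map W M f ==> linear_map_on (carr W) (carr M) f"
 and module_map_act: "module_map W M f ==> w \<in> carr W ==> f (act W v m w) = act M v m (f w)"
 and module_map_gr: "module_map W M f ==> w \<in> grm W \<beta> ==> f w \<in> grm M \<beta>"
 and module_map_L: "module_map W M f ==> j \<in> {-1,0,1} ==> w \<in> carr W ==> f (Lm W j w) = Lm M j (f w)"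
 by (simp_all only: module_map_def)

lemma module_map_shift_pow:
 assumes f: "module_map W M f" and W: "generalized_module V W" and w: "w \<in> carr W"
 shows "f ((shift_op (Lm W 0) n ^^ k) w) = (shift_op (Lm M 0) n ^^ k) (f w)"
proof -
 have one: "f (shift_op (Lm W 0) n x) = shift_op (Lm M 0) n (f x)" if x: "x \<in> carr W" for x
  unfolding shift_op_def
  using lin_diff[OF mm_linear[OF f] gm_subspace[OF W] gm_L_in[OF W _ x] gm_scale[OF W x]]
   module_map_L[OF f _ x] lin_scale[OF mm_linear[OF f] x] by simp
 show ?thesis
  by (induction k) (simp_all only: funpow.simps id_apply o_apply one gm_shift_pow_in[OF W w])
qed

lemma module_map_wt:
 assumes f: "module_map W M f" and W: "generalized_module V W" and w: "w \<in> wtm W n"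
 shows "f w \<in> wtm M n"
proof -
 obtain k where k: "(shift_op (Lm W 0) n ^^ k) w = 0" and wc: "w \<in> carr W"
  using w unfolding wtm_def gen_eigenspace_def by blast
 have "(shift_op (Lm M 0) n ^^ k) (f w) = 0"
  unfolding module_map_shift_pow[OF f W wc, symmetric] k
  by (rule lin_zero[OF mm_linear[OF f] gm_zero[OF W]])
 then show ?thesis
  using lin_in[OF mm_linear[OF f] wc] unfolding wtm_def gen_eigenspace_def by blast
qed

lemma L0_semisimple_part_eq:
 assumes W: "generalized_module V W" and w: "w \<in> wtm W n"
 shows "L0_semisimple_part W w = n *\<^sub>C w"
 unfolding L0_semisimple_part_def
 by (subst Sum_any_single[of n]) (auto simp: component_of_summand[OF gm_wt_ds[OF W] w])

lemma category_generalized_module: "module_category ss V C ==> W \<in> C ==> generalized_module V W"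
 unfolding module_category_def ordinary_module_def by (cases ss) auto

lemma category_contragredient: "module_category ss V C ==> W \<in> C ==> in_category V C (contragredient V W)"
 unfolding module_category_def by blast

lemma category_nilpotent:
 assumes C: "module_category ss V C" and W: "W \<in> C"
 shows "\<exists>K>0. \<forall>n. \<forall>w\<in>wtm W n. (shift_op (Lm W 0) n ^^ K) w = 0"
proof -
 note gm = category_generalized_module[OF assms]
 obtain K where K: "K > 0" "\<forall>w\<in>carr W. ((\<lambda>x. Lm W 0 x - L0_semisimple_part W x) ^^ K) w = 0"
  using C W unfolding module_category_def by (elim conjE) (drule (1) bspec, elim conjE exE, rule that)
 have "(shift_op (Lm W 0) n ^^ k) w = ((\<lambda>x. Lm W 0 x - L0_semisimple_part W x) ^^ k) w \<and>
    (shift_op (Lm W 0) n ^^ k) w \<in> wtm W n" if w: "w \<in> wtm W n" for w n k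
 proof (induction k)
  case (Suc k)
  let ?x = "(shift_op (Lm W 0) n ^^ k) w"
  have x: "?x \<in> wtm W n" using Suc by blast
  have sx: "shift_op (Lm W 0) n ?x = Lm W 0 ?x - L0_semisimple_part W ?x"
   unfolding shift_op_def L0_semisimple_part_eq[OF gm x] ..
  have "Lm W 0 ?x \<in> wtm W n" using gm_L_wt[OF gm _ x, of 0] by simp
  then have "shift_op (Lm W 0) n ?x \<in> wtm W n"
   unfolding shift_op_def[of "Lm W 0" n ?x]
   by (rule csub_diff[OF ds_summand[OF gm_wt_ds[OF gm]] _
      csub_scale[OF ds_summand[OF gm_wt_ds[OF gm]] x]])
  then show ?case using Suc sx by (simp only: funpow.simps o_apply)
 qed (use w in simp)
 then have "\<forall>n. \<forall>w\<in>wtm W n. (shift_op (Lm W 0) n ^^ K) w = 0"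
  using K(2) gm_wt_subset[OF gm] by fastforce
 then show ?thesis using K(1) by blast
qed

lemma in_category_nilpotent:
 assumes C: "module_category ss V C" and N: "in_category V C N"
 shows "\<exists>K>0. \<forall>n. \<forall>w\<in>wtm N n. (shift_op (Lm N 0) n ^^ K) w = 0"
proof -
 have gm: "generalized_module V N" using N by (simp add: in_category_def)
 obtain M f where M: "M \<in> C" and f: "module_map N M f" "bij_betw f (carr N) (carr M)"
  using N unfolding in_category_def isomorphic_modules_def by blast
 obtain K where K: "K > 0" "\<forall>n. \<forall>w\<in>wtm M n. (shift_op (Lm M 0) n ^^ K) w = 0"
  using category_nilpotent[OF C M] by blast
 have "(shift_op (Lm N 0) n ^^ K) w = 0" if w: "w \<in> wtm N n" for w n
 proof -
  have wc: "w \<in> carr N" by (rule gm_wt_subset[OF gm w])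
  have "f ((shift_op (Lm N 0) n ^^ K) w) = f 0"
   unfolding module_map_shift_pow[OF f(1) gm wc] lin_zero[OF mm_linear[OF f(1)] gm_zero[OF gm]]
   using K(2) module_map_wt[OF f(1) gm w] by blast
  then show ?thesis
   using bij_betw_imp_inj_on[OF f(2)] gm_shift_pow_in[OF gm wc] gm_zero[OF gm] by (metis inj_onD)
 qed
 then show ?thesis using K(1) by blast
qed

text \<open>
  Preservation of the grading by the map is what keeps the pullback in the contragredient.
\<close>

lemma contragredient_pullback:
 assumes f: "module_map W M f" and W: "generalized_module V W" and x: "x \<in> carr (contragredient V M)"
 shows "(\<lambda>w. if w \<in> carr W then x (f w) else 0) \<in> carr (contragredient V W)"
 using x
proof (induction rule: contragredient_induct)
 case zero
 have "(\<lambda>w. if w \<in> carr W then 0 (f w) else 0) = (0 :: _ => complex)" by (rule ext) simp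
 then show ?case unfolding contragredient_carr by (simp only: complex_vector.span_zero)
next
 case (add \<beta> n x y)
 have "(\<lambda>w. if w \<in> carr W then x (f w) else 0) \<in> contragredient_piece W \<beta> n"
 proof -
  have "(\<lambda>w. if w \<in> carr W then x (f w) else 0) \<in> dual1 (carr W)"
   using dual1_linear[OF piece_dual1[OF add(1)]] mm_linear[OF f] gm_add[OF W] gm_scale[OF W]
   unfolding dual1_def linear_map_on_def by simp
  moreover have "x (f w) = 0" if "w \<in> grm W \<gamma>" "w \<in> wtm W m" "(\<gamma>, m) \<noteq> (- \<beta>, n)" for w \<gamma> m
   by (rule piece_vanish[OF add(1) module_map_gr[OF f that(1)] module_map_wt[OF f W that(2)] that(3)])
  ultimately show ?thesis unfolding contragredient_piece_def by auto
 qed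
 then have "(\<lambda>w. if w \<in> carr W then x (f w) else 0) \<in> carr (contragredient V W)"
  using piece_subset by blast
 then have "(\<lambda>w. if w \<in> carr W then x (f w) else 0) + (\<lambda>w. if w \<in> carr W then y (f w) else 0) \<in> carr (contragredient V W)"
  using add(3) complex_vector.span_add unfolding contragredient_carr by blast
 moreover have "(\<lambda>w. if w \<in> carr W then x (f w) else 0) + (\<lambda>w. if w \<in> carr W then y (f w) else 0) =
  (\<lambda>w. if w \<in> carr W then (x + y) (f w) else 0)" by (rule ext) simp
 ultimately show ?case by simp
qed

text \<open>
  By the universal property every intertwining map factors through the tensor product, so a single
  intertwining map exhausts $\mathcal{D}_{P(z)}(W_1,W_2)$.
\<close>

lemma D_space_eq_image:
 assumes T: "is_tensor_product V C z W1 W2 T0 B" and T0: "generalized_module V T0"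
 shows "D_space V C z W1 W2 = transpose2 W1 W2 B ` carr (contragredient V T0)"
proof (intro equalityI subsetI)
 fix \<nu> assume "\<nu> \<in> transpose2 W1 W2 B ` carr (contragredient V T0)"
 then show "\<nu> \<in> D_space V C z W1 W2" using T unfolding D_space_def is_tensor_product_def by blast
next
 fix \<nu> assume "\<nu> \<in> D_space V C z W1 W2"
 then obtain W I x where W: "W \<in> C" and I: "intertwining_map V z W W1 W2 I"
  and x: "x \<in> carr (contragredient V W)" and \<nu>: "\<nu> = transpose2 W1 W2 I x" unfolding D_space_def by blast
 obtain \<eta> where \<eta>: "module_map T0 W \<eta>" "\<forall>w1\<in>carr W1. \<forall>w2\<in>carr W2. \<forall>n. I w1 w2 n = \<eta> (B w1 w2 n)"
  using T W I unfolding is_tensor_product_def by blast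
 have B: "intertwining_map V z T0 W1 W2 B" using T by (simp add: is_tensor_product_def)
 have "\<nu> = transpose2 W1 W2 B (\<lambda>w. if w \<in> carr T0 then x (\<eta> w) else 0)"
 proof (rule ext, rule ext)
  fix w1 w2
  show "\<nu> w1 w2 = transpose2 W1 W2 B (\<lambda>w. if w \<in> carr T0 then x (\<eta> w) else 0) w1 w2"
  proof (cases "w1 \<in> carr W1 \<and> w2 \<in> carr W2")
   case True
   then have w: "w1 \<in> carr W1" "w2 \<in> carr W2" by auto
   show ?thesis unfolding \<nu> transpose2_apply[OF w]
    by (rule pairing_cong) (use \<eta>(2) w completion_carr[OF T0 im_completion[OF B w]] in simp)
  next
   case False
   then have "w1 \<notin> carr W1 \<or> w2 \<notin> carr W2" by blast
   then show ?thesis by (simp only: \<nu> transpose2_outside)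
  qed
 qed
 then show "\<nu> \<in> transpose2 W1 W2 B ` carr (contragredient V T0)"
  using contragredient_pullback[OF \<eta>(1) T0 x] by blast
qed

section \<open>Images of modules in spaces of forms\<close>

text \<open>
  A space \<open>D\<close> of forms that is the image of a generalized module \<open>N\<close> under a map compatible with the
  actions of type $P(z)$.  It is applied to $\mathcal{D}_{P(z)}(W_1,W_2)$, \<open>N\<close> being the
  contragredient of the tensor product.  The facts on weights, degrees and truncation that are
  needed on \<open>D\<close> are lifted to \<open>N\<close>.
\<close>

locale form_image = sgva A V
 for A :: "'g::ab_group_add set" and V :: "('v::complex_vector, 'g) valg" +
 fixes z :: complex and W1 :: "('v, 'g, 'a::complex_vector) vmod" and W2 :: "('v, 'g, 'b::complex_vector) vmod"
  and N :: "('v, 'g, 'n::complex_vector) vmod" and f :: "'n => 'a => 'b => complex" and K :: nat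
  and D :: "('a => 'b => complex) set"
 assumes W1: "generalized_module V W1" and W2: "generalized_module V W2" and N: "generalized_module V N"
  and f_linear: "linear_map_on (carr N) (dual2 (carr W1) (carr W2)) f"
  and f_act: "\<And>v m x. x \<in> carr N ==> f (act N v m x) = P_act V z W1 W2 v m (f x)"
  and f_L: "\<And>j x. j \<in> {-1,0,1} ==> x \<in> carr N ==> f (Lm N j x) = P_L z W1 W2 j (f x)"
  and f_gr: "\<And>\<beta> x. x \<in> grm N \<beta> ==> f x \<in> tensor_dual_gr W1 W2 \<beta>"
  and K: "K > 0" "\<And>n x. x \<in> wtm N n ==> (shift_op (Lm N 0) n ^^ K) x = 0"
  and D: "D = f ` carr N"
begin

abbreviation "L \<equiv> P_L z W1 W2 0"
abbreviation "PD \<equiv> P_module V z W1 W2 D"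

sublocale form_operator L by (rule form_operator_P_L)

lemma f_add: "x \<in> carr N ==> y \<in> carr N ==> f (x + y) = f x + f y"
 and f_scale: "x \<in> carr N ==> f (c *\<^sub>C x) = c *\<^sub>C f x"
 by (rule lin_add[OF f_linear], assumption+) (rule lin_scale[OF f_linear])

lemma f_sum: "(\<And>i. i \<in> I ==> g i \<in> carr N) ==> f (\<Sum>i\<in>I. g i) = (\<Sum>i\<in>I. f (g i))"
 by (rule lin_sum[OF f_linear gm_subspace[OF N]])

lemma f_zero: "f 0 = 0" using lin_zero[OF f_linear gm_zero[OF N]] .

lemma D_dual2: "\<nu> \<in> D ==> \<nu> \<in> dual2 (carr W1) (carr W2)"
 using lin_in[OF f_linear] D by blast

lemma D_subspace: "csubspace D"
 unfolding complex_vector.subspace_def D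
proof (intro conjI ballI allI)
 show "0 \<in> f ` carr N" using f_zero gm_zero[OF N] by (metis imageI)
 show "x + y \<in> f ` carr N" if "x \<in> f ` carr N" "y \<in> f ` carr N" for x y
  using that by (elim imageE) (simp only: f_add[symmetric], rule imageI, rule gm_add[OF N])
 show "c *\<^sub>C x \<in> f ` carr N" if "x \<in> f ` carr N" for c x
  using that by (elim imageE) (simp only: f_scale[symmetric], rule imageI, rule gm_scale[OF N])
qed

lemma f_shift: "x \<in> carr N ==> f (shift_op (Lm N 0) n x) = shift_op L n (f x)"
 unfolding shift_op_def
 using lin_diff[OF f_linear gm_subspace[OF N] gm_L_in[OF N, of 0 x] gm_scale[OF N, of x]] f_L[of 0 x] f_scale[of x]
 by simp

lemma f_shift_pow: "x \<in> carr N ==> f ((shift_op (Lm N 0) n ^^ k) x) = (shift_op L n ^^ k) (f x)"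
 by (induction k) (simp_all only: funpow.simps id_apply o_apply f_shift gm_shift_pow_in[OF N])

lemma f_wt: "x \<in> wtm N n ==> (shift_op L n ^^ K) (f x) = 0"
 using f_shift_pow[OF gm_wt_subset[OF N], where k = K and n = n and x = x] K(2)[of x n] f_zero by simp

lemma D_wt_lift:
 assumes \<nu>: "\<nu> \<in> D" and k: "(shift_op L n ^^ k) \<nu> = 0"
 shows "\<exists>x\<in>wtm N n. f x = \<nu>"
proof -
 obtain x where x: "x \<in> carr N" "\<nu> = f x" using \<nu> D by blast
 note ds = gm_wt_ds[OF N]
 let ?I = "insert n {m. component (wtm N) m x \<noteq> 0}"
 have I: "finite ?I" using component_finite[OF ds x(1)] by simp
 have c: "component (wtm N) m x \<in> wtm N m" for m by (rule component_in[OF ds x(1)])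
 have cc: "component (wtm N) m x \<in> carr N" for m by (rule gm_wt_subset[OF N c])
 have "x = (\<Sum>m\<in>?I. component (wtm N) m x)" by (rule component_sum[OF ds x(1) I]) simp
 then have "f x = f (\<Sum>m\<in>?I. component (wtm N) m x)" by (rule arg_cong)
 also have "\<dots> = (\<Sum>m\<in>?I. f (component (wtm N) m x))" by (rule f_sum[OF cc])
 finally have s: "\<nu> = (\<Sum>m\<in>?I. f (component (wtm N) m x))" using x(2) by (simp only:)
 define g where "g = (\<lambda>m. f (component (wtm N) m x) - (if m = n then \<nu> else 0))"
 have "(\<Sum>m\<in>?I. g m) = \<nu> - (\<Sum>m\<in>?I. if m = n then \<nu> else 0)"
  unfolding g_def sum_subtractf s[symmetric] ..
 also have "\<dots> = 0" using I by (simp only: sum.delta' sum.delta insertI1 if_True diff_self)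
 finally have g0: "(\<Sum>m\<in>?I. g m) = 0" .
 have "g n = 0"
 proof (rule gen_eigenvectors_independent[OF I _ g0])
  fix m assume "m \<in> ?I"
  show "\<exists>k. (shift_op L m ^^ k) (g m) = 0"
  proof (cases "m = n")
   case True
   have "(shift_op L n ^^ (K + k)) (f (component (wtm N) n x)) = 0" by (rule shift_pow_mono[OF f_wt[OF c]]) simp
   moreover have "(shift_op L n ^^ (K + k)) \<nu> = 0" by (rule shift_pow_mono[OF k]) simp
   ultimately have "(shift_op L n ^^ (K + k)) (f (component (wtm N) n x) + (-1) *\<^sub>C \<nu>) = 0"
    by (simp only: shift_pow_add shift_pow_scale complex_vector.scale_zero_right add_0_left)
   then have "(shift_op L m ^^ (K + k)) (g m) = 0"
    unfolding g_def True by (simp only: complex_vector.scale_minus_left scaleC_one diff_conv_add_uminus if_True refl)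
   then show ?thesis by blast
  next
   case False
   then have "g m = f (component (wtm N) m x)" by (simp only: g_def if_False diff_0_right)
   then show ?thesis using f_wt[OF c] by metis
  qed
 qed simp
 then have "f (component (wtm N) n x) = \<nu>" unfolding g_def by (simp only: if_True refl right_minus_eq)
 then show ?thesis using c by blast
qed

lemma D_hom_lift:
 assumes \<nu>: "\<nu> \<in> D" and k: "(shift_op L n ^^ k) \<nu> = 0" and gr: "\<nu> \<in> tensor_dual_gr W1 W2 \<beta>"
 shows "\<exists>x. x \<in> grm N \<beta> \<and> x \<in> wtm N n \<and> f x = \<nu>"
proof -
 obtain x where x: "x \<in> wtm N n" "f x = \<nu>" using D_wt_lift[OF \<nu> k] by blast
 have xc: "x \<in> carr N" by (rule gm_wt_subset[OF N x(1)])
 note ds = gm_gr_ds[OF N]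
 let ?B = "insert \<beta> {\<beta>. component (grm N) \<beta> x \<noteq> 0}"
 have B: "finite ?B" using component_finite[OF ds xc] by simp
 have c: "component (grm N) \<beta> x \<in> grm N \<beta>" for \<beta> by (rule component_in[OF ds xc])
 have "x = (\<Sum>\<beta>\<in>?B. component (grm N) \<beta> x)" by (rule component_sum[OF ds xc B]) simp
 then have "f x = f (\<Sum>\<beta>\<in>?B. component (grm N) \<beta> x)" by (rule arg_cong)
 also have "\<dots> = (\<Sum>\<beta>\<in>?B. f (component (grm N) \<beta> x))" by (rule f_sum[OF gm_gr_subset[OF N c]])
 finally have s: "(\<Sum>\<beta>\<in>?B. f (component (grm N) \<beta> x)) = \<nu>" using x(2) by (simp only:)
 have "(\<Sum>\<beta>\<in>?B. f (component (grm N) \<beta> x)) = (if \<beta> \<in> ?B then f (component (grm N) \<beta> x) else 0)"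
  by (rule tensor_dual_gr_component[OF W1 W2 B f_gr[OF c]]) (unfold s, rule gr)
 then have "f (component (grm N) \<beta> x) = \<nu>" unfolding s by (simp only: insertI1 if_True)
 then show ?thesis using c gm_wt_gr_component[OF N x(1)] by blast
qed

lemma D_nilpotent:
 assumes \<nu>: "\<nu> \<in> D" and k: "(shift_op L n ^^ k) \<nu> = 0"
 shows "(shift_op L n ^^ K) \<nu> = 0"
 using D_wt_lift[OF assms] f_wt by blast

lemma D_bound:
 "\<exists>K0::int. \<forall>k<K0. \<forall>\<nu>\<in>D. \<nu> \<in> tensor_dual_gr W1 W2 \<beta> --> (shift_op L (n + of_int k) ^^ K) \<nu> = 0 --> \<nu> = 0"
proof -
 obtain K0 :: int where K0: "\<forall>k<K0. grm N \<beta> \<inter> wtm N (n + of_int k) = {0}" using gm_bound[OF N] by blast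
 show ?thesis
 proof (intro exI allI ballI impI)
  fix k \<nu> assume "k < K0" "\<nu> \<in> D" "\<nu> \<in> tensor_dual_gr W1 W2 \<beta>" "(shift_op L (n + of_int k) ^^ K) \<nu> = 0"
  then obtain x where x: "x \<in> grm N \<beta>" "x \<in> wtm N (n + of_int k)" "f x = \<nu>" using D_hom_lift by blast
  then have "x \<in> {0}" using K0 \<open>k < K0\<close> by blast
  then show "\<nu> = 0" using x(3) f_zero by (simp only: singleton_iff)
 qed
qed

lemma f_opp:
 assumes x: "x \<in> carr N"
 shows "opp_coeff V PD v q (f x) = f (opp_coeff V N v q x)"
proof -
 let ?E = "{e. opp_vec V v e \<noteq> 0}"
 have E: "finite ?E" "\<And>e. e \<notin> ?E ==> opp_vec V v e = 0" by (rule opp_vec_finite) simp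
 have "opp_coeff V PD v q (f x) = Sum_any (\<lambda>m. f (act N (opp_vec V v (q - m - 1)) m x))"
  by (simp only: opp_coeff_def P_module_def vmod.simps f_act[OF x])
 also have "\<dots> = (\<Sum>e\<in>?E. f (act N (opp_vec V v e) (q - e - 1) x))"
  by (rule Sum_any_opp[where a = "\<lambda>v m. f (act N v m x)", OF _ E]) (simp only: gm_act_v_0[OF N x] f_zero)
 also have "\<dots> = f (\<Sum>e\<in>?E. act N (opp_vec V v e) (q - e - 1) x)"
  by (rule f_sum[symmetric]) (rule gm_act_in[OF N x])
 also have "\<dots> = f (opp_coeff V N v q x)" by (subst opp_coeff_sum[OF N x E]) simp_all
 finally show ?thesis .
qed

lemma opp_in_D: "\<nu> \<in> D ==> opp_coeff V PD v q \<nu> \<in> D"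
proof -
 assume "\<nu> \<in> D"
 then obtain x where x: "x \<in> carr N" "\<nu> = f x" using D by blast
 have "f (opp_coeff V N v q x) \<in> D" unfolding D by (rule imageI[OF opp_coeff_in[OF N x(1)]])
 then show ?thesis unfolding x(2) f_opp[OF x(1)] .
qed

lemma opp_shift_pow:
 assumes v: "v \<in> grv V \<alpha> \<inter> wtv V h" and \<nu>: "\<nu> \<in> D"
 shows "(shift_op L (n + of_int (s + 1 - h)) ^^ k) (opp_coeff V PD v (- s - 1) \<nu>) = opp_coeff V PD v (- s - 1) ((shift_op L n ^^ k) \<nu>)"
proof -
 obtain x where x: "x \<in> carr N" "\<nu> = f x" using \<nu> D by blast
 let ?E = "{e. opp_vec V v e \<noteq> 0}"
 have E: "finite ?E" "\<And>e. e \<notin> ?E ==> opp_vec V v e = 0" by (rule opp_vec_finite) simp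
 have "(shift_op (Lm N 0) (n + of_int (s + 1 - h)) ^^ k) (opp_coeff V N v (- s - 1) x) =
   opp_coeff V N v (- s - 1) ((shift_op (Lm N 0) n ^^ k) x)"
 proof -
  have "(shift_op (Lm N 0) (n + of_int (s + 1 - h)) ^^ k) (\<Sum>e\<in>?E. act N (opp_vec V v e) (- s - 1 - e - 1) x) =
   (\<Sum>e\<in>?E. (shift_op (Lm N 0) (n + of_int (s + 1 - h)) ^^ k) (act N (opp_vec V v e) (- s - 1 - e - 1) x))"
   by (rule lin_sum[OF gm_shift_pow_linear[OF N] gm_subspace[OF N] gm_act_in[OF N x(1)]])
  also have "\<dots> = (\<Sum>e\<in>?E. act N (opp_vec V v e) (- s - 1 - e - 1) ((shift_op (Lm N 0) n ^^ k) x))"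
  proof (rule sum.cong[OF refl])
   fix e
   have "s + 1 - h = - h - e - (- s - 1 - e - 1) - 1" by simp
   then show "(shift_op (Lm N 0) (n + of_int (s + 1 - h)) ^^ k) (act N (opp_vec V v e) (- s - 1 - e - 1) x) =
    act N (opp_vec V v e) (- s - 1 - e - 1) ((shift_op (Lm N 0) n ^^ k) x)"
    using gm_act_shift_pow[OF N hom_L0[OF opp_vec_in[OF v]] x(1)] by metis
  qed
  moreover have "opp_coeff V N v (- s - 1) y = (\<Sum>e\<in>?E. act N (opp_vec V v e) (- s - 1 - e - 1) y)" if "y \<in> carr N" for y
   by (rule opp_coeff_sum[OF N that E])
  ultimately show ?thesis using x(1) gm_shift_pow_in[OF N x(1)] by (simp only:)
 qed
 then show ?thesis
  unfolding x(2) f_shift_pow[OF x(1), symmetric] f_opp[OF x(1)] f_opp[OF gm_shift_pow_in[OF N x(1)]]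
   f_shift_pow[OF opp_coeff_in[OF N x(1)], symmetric] by (rule arg_cong)
qed

lemma opp_gr:
 assumes v: "v \<in> grv V \<alpha> \<inter> wtv V h" and \<nu>: "\<nu> \<in> D" "\<nu> \<in> tensor_dual_gr W1 W2 \<beta>" "(shift_op L n ^^ k) \<nu> = 0"
 shows "opp_coeff V PD v q \<nu> \<in> tensor_dual_gr W1 W2 (\<alpha> + \<beta>)"
proof -
 obtain x where x: "x \<in> grm N \<beta>" "f x = \<nu>" using D_hom_lift[OF \<nu>(1,3,2)] by blast
 have xc: "x \<in> carr N" by (rule gm_gr_subset[OF N x(1)])
 have "opp_coeff V N v q x = (\<Sum>e | opp_vec V v e \<noteq> 0. act N (opp_vec V v e) (q - e - 1) x)"
  by (rule opp_coeff_sum[OF N xc opp_vec_finite]) simp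
 also have "\<dots> \<in> grm N (\<alpha> + \<beta>)"
  by (rule csub_sum[OF ds_summand[OF gm_gr_ds[OF N]]])
    (rule gm_act_gr[OF N _ x(1)], use opp_vec_in[OF v] in blast)
 finally show ?thesis using f_opp[OF xc] f_gr x(2) by metis
qed

lemma L_in_D: "j \<in> {-1,0,1} ==> \<nu> \<in> D ==> P_L z W1 W2 j \<nu> \<in> D"
 unfolding D by (elim imageE) (simp only: f_L[symmetric], rule imageI, rule gm_L_in[OF N])

lemma L_shift_pow:
 assumes j: "j \<in> {-1,0,1}" and \<nu>: "\<nu> \<in> D"
 shows "(shift_op L (n - of_int j) ^^ k) (P_L z W1 W2 j \<nu>) = P_L z W1 W2 j ((shift_op L n ^^ k) \<nu>)"
proof -
 obtain x where x: "x \<in> carr N" "\<nu> = f x" using \<nu> D by blast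
 show ?thesis
  unfolding x(2) f_L[OF j x(1), symmetric] f_shift_pow[OF gm_L_in[OF N j x(1)], symmetric] f_shift_pow[OF x(1), symmetric]
   f_L[OF j gm_shift_pow_in[OF N x(1)], symmetric]
  by (rule arg_cong[OF gm_L_shift_pow[OF N j x(1)]])
qed

lemma shift_pow_in_D: "\<nu> \<in> D ==> (shift_op L n ^^ k) \<nu> \<in> D"
 unfolding D by (elim imageE) (simp only: f_shift_pow[symmetric], rule imageI, rule gm_shift_pow_in[OF N])

abbreviation "T \<equiv> contragredient V PD"

lemma T_linear: "w \<in> carr T ==> linear_map_on D UNIV w"
 using contragredient_linear[of w V PD] by (simp add: P_module_def)

lemma T_support:
 assumes "w \<in> carr T"
 shows "\<exists>F. finite F \<and> (\<forall>n. n \<notin> F --> (\<forall>\<gamma>. \<forall>\<nu>\<in>D. \<nu> \<in> tensor_dual_gr W1 W2 \<gamma> --> (shift_op L n ^^ K) \<nu> = 0 --> w \<nu> = 0))"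
proof -
 obtain F where F: "finite F" "\<forall>n. n \<notin> F --> (\<forall>\<gamma>. \<forall>\<nu>\<in>grm PD \<gamma> \<inter> wtm PD n. w \<nu> = 0)"
  using contragredient_gr_finite_support[OF assms] by blast
 have "\<nu> \<in> grm PD \<gamma> \<inter> wtm PD n" if "\<nu> \<in> D" "\<nu> \<in> tensor_dual_gr W1 W2 \<gamma>" "(shift_op L n ^^ K) \<nu> = 0" for \<nu> \<gamma> n
 proof -
  have "wtm PD n = {\<nu> \<in> D. \<exists>k. (shift_op L n ^^ k) \<nu> = 0}" "grm PD \<gamma> = D \<inter> tensor_dual_gr W1 W2 \<gamma>"
   by (simp_all only: wtm_def gen_eigenspace_def P_module_def vmod.simps)
  then show ?thesis using that by blast
 qed
 with F show ?thesis by (intro exI[of _ F] conjI allI impI ballI) blast+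
qed

lemma T_act: "\<nu> \<in> D ==> act T v m w \<nu> = w (opp_coeff V PD v (- m - 1) \<nu>)"
 and T_L: "\<nu> \<in> D ==> Lm T j w \<nu> = w (P_L z W1 W2 (- j) \<nu>)"
 by (simp_all add: contragredient_act contragredient_Lm P_module_def)

end

section \<open>Binomial series\<close>

text \<open>
  The expansion of $(x+y)^k$ for an integer \<open>k\<close>, in the convention for binomials of formal
  variables.
\<close>

lemma binomial_series_powi:
 fixes x y :: complex
 assumes "norm y < norm x"
 shows "((\<lambda>j::nat. (of_int k gchoose j) * y ^ j * x powi (k - int j)) has_sum (x + y) powi k) UNIV" (is ?A)
  and "(\<lambda>j::nat. norm ((of_int k gchoose j) * y ^ j * x powi (k - int j))) summable_on UNIV" (is ?B)
proof -
 have x: "x \<noteq> 0" using assms by auto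
 define q where "q = y / x"
 have q: "norm q < 1" using assms x by (simp add: q_def norm_divide)
 have q1: "1 + q \<noteq> 0"
  using q by (metis add.inverse_inverse add_eq_0_iff2 less_irrefl norm_minus_cancel norm_one)
 have eq: "(of_int k gchoose j) * y ^ j * x powi (k - int j) = x powi k * ((of_int k gchoose j) * q ^ j)" for j
  using x by (simp add: q_def power_divide power_int_diff)
 have "(\<lambda>j. (of_int k gchoose j) * q ^ j) sums (1 + q) powr (of_int k)" by (rule gen_binomial_complex[OF q])
 then have s: "(\<lambda>j. (of_int k gchoose j) * q ^ j) sums (1 + q) powi k"
  using q1 by (auto simp: powr_of_int power_int_def power_inverse split: if_splits)
 obtain r where r: "norm q < r" "r < 1" using dense[OF q] by blast
 have "summable (\<lambda>j. (of_int k gchoose j) * (of_real r :: complex) ^ j)"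
  by (rule sums_summable[OF gen_binomial_complex]) (use r order_le_less_trans[OF norm_ge_zero r(1)] in simp)
 then have ns: "summable (\<lambda>j. norm ((of_int k gchoose j) * q ^ j))"
  by (rule powser_insidea) (use r in auto)
 have "((\<lambda>j. (of_int k gchoose j) * q ^ j) has_sum (1 + q) powi k) UNIV"
  by (rule norm_summable_imp_has_sum[OF ns s])
 then have "((\<lambda>j. x powi k * ((of_int k gchoose j) * q ^ j)) has_sum x powi k * (1 + q) powi k) UNIV"
  by (rule has_sum_cmult_right)
 moreover have "x powi k * (1 + q) powi k = (x + y) powi k"
  using x by (simp add: power_int_mult_distrib[symmetric] q_def distrib_left)
 ultimately show ?A by (simp only: eq)
 have "(\<lambda>j. norm (x powi k) * norm ((of_int k gchoose j) * q ^ j)) summable_on UNIV"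
  by (intro summable_on_cmult_right summable_nonneg_imp_summable_on[OF ns]) auto
 then show ?B by (simp only: eq norm_mult)
qed

lemma gbinomial_swap: "(a gchoose j) * (a - of_nat j gchoose i) = (a gchoose i) * (a - of_nat i gchoose j)"
 for a :: complex
proof -
 have e: "(of_nat (i + j) gchoose j :: complex) = of_nat (i + j) gchoose i"
  unfolding binomial_gbinomial[symmetric] using binomial_symmetric[of i "i + j"] by simp
 have 1: "(a gchoose (i + j)) * (of_nat (i + j) gchoose j) = (a gchoose j) * (a - of_nat j gchoose i)"
  using gbinomial_trinomial_revision[of j "i + j" a] by (simp del: of_nat_add)
 have 2: "(a gchoose (i + j)) * (of_nat (i + j) gchoose i) = (a gchoose i) * (a - of_nat i gchoose j)"
  using gbinomial_trinomial_revision[of i "i + j" a] by (simp del: of_nat_add)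
 show ?thesis using 1 2 unfolding e by (rule trans[OF sym])
qed

text \<open>
  The coefficients that arise from inserting the commutator formula with the number \<open>z1\<close> into a
  column with the number \<open>z2\<close>.
\<close>

lemma column_coefficient:
 fixes z1 z2 :: complex
 assumes "norm z2 < norm z1"
 shows "((\<lambda>j::nat. ((of_int b gchoose j) * (- z2) ^ j) * bin z1 (b - int j) i) has_sum bin (z1 - z2) b i) UNIV"
  and "(\<lambda>j::nat. norm (((of_int b gchoose j) * (- z2) ^ j) * bin z1 (b - int j) i)) summable_on UNIV"
proof -
 have eq: "((of_int b gchoose j) * (- z2) ^ j) * bin z1 (b - int j) i =
   (of_int b gchoose i) * ((of_int (b - int i) gchoose j) * (- z2) ^ j * z1 powi (b - int i - int j))" for j
  using gbinomial_swap[of "of_int b" j i]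
  by (simp add: bin_def algebra_simps)
 have n: "norm (- z2) < norm z1" using assms by simp
 show "((\<lambda>j::nat. ((of_int b gchoose j) * (- z2) ^ j) * bin z1 (b - int j) i) has_sum bin (z1 - z2) b i) UNIV"
  unfolding eq using has_sum_cmult_right[OF binomial_series_powi(1)[OF n, of "b - int i"], of "of_int b gchoose i"]
  by (simp add: bin_def)
 show "(\<lambda>j::nat. norm (((of_int b gchoose j) * (- z2) ^ j) * bin z1 (b - int j) i)) summable_on UNIV"
  unfolding eq norm_mult[of "of_int b gchoose i"]
  by (rule summable_on_cmult_right[OF binomial_series_powi(2)[OF n]])
qed

text \<open>
  The coefficients that arise from inserting the opposite action with the number \<open>z0\<close> into a row
  with the number \<open>z2\<close>.  The factor $s^c$ accommodates $e^{tL(0)}$, which acts on weights shifted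
  by \<open>c\<close>.
\<close>

lemma row_coefficient:
 fixes z0 z2 :: complex
 assumes "norm z0 < norm z2"
 shows "((\<lambda>c::nat. bin z2 a c * bin z0 (int c) i) has_sum bin (z2 + z0) a i) UNIV"
  and "norm (s * z0) < norm z2 ==> (\<lambda>c::nat. norm (s ^ c * (bin z2 a c * bin z0 (int c) i))) summable_on UNIV"
proof -
 have eq: "bin z2 a (c + i) * bin z0 (int (c + i)) i =
   (of_int a gchoose i) * ((of_int (a - int i) gchoose c) * z0 ^ c * z2 powi (a - int i - int c))" for c
  using gbinomial_trinomial_revision[of i "c + i" "of_int a :: complex"]
  by (simp add: bin_def algebra_simps power_int_def binomial_gbinomial)
 have zero: "bin z2 a c * bin z0 (int c) i = 0" if "c < i" for c
  using that by (simp add: bin_def binomial_gbinomial[symmetric])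
 have bij: "bij_betw (\<lambda>c. c + i) UNIV {i..}"
  by (rule bij_betw_byWitness[where f' = "\<lambda>c. c - i"]) auto
 have "((\<lambda>c. bin z2 a (c + i) * bin z0 (int (c + i)) i) has_sum bin (z2 + z0) a i) UNIV"
  unfolding eq using has_sum_cmult_right[OF binomial_series_powi(1)[OF assms, of "a - int i"], of "of_int a gchoose i"]
  by (simp add: bin_def)
 then have "((\<lambda>c. bin z2 a c * bin z0 (int c) i) has_sum bin (z2 + z0) a i) {i..}"
  using has_sum_reindex_bij_betw[OF bij, of "\<lambda>c. bin z2 a c * bin z0 (int c) i"] by blast
 then show "((\<lambda>c::nat. bin z2 a c * bin z0 (int c) i) has_sum bin (z2 + z0) a i) UNIV"
  by (rule has_sum_cong_neutral[THEN iffD1, rotated -1]) (use zero in auto)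
 assume s: "norm (s * z0) < norm z2"
 have "(\<lambda>c. norm (s ^ (c + i) * (bin z2 a (c + i) * bin z0 (int (c + i)) i))) =
   (\<lambda>c. norm (s ^ i * (of_int a gchoose i)) * norm ((of_int (a - int i) gchoose c) * (s * z0) ^ c * z2 powi (a - int i - int c)))"
  unfolding eq by (rule ext) (simp add: norm_mult norm_power power_add power_mult_distrib mult_ac)
 moreover have "(\<lambda>c. norm (s ^ i * (of_int a gchoose i)) * norm ((of_int (a - int i) gchoose c) * (s * z0) ^ c * z2 powi (a - int i - int c))) summable_on UNIV"
  by (rule summable_on_cmult_right[OF binomial_series_powi(2)[OF s]])
 ultimately have "(\<lambda>c. norm (s ^ (c + i) * (bin z2 a (c + i) * bin z0 (int (c + i)) i))) summable_on UNIV"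
  by (simp only:)
 then have "(\<lambda>c. norm (s ^ c * (bin z2 a c * bin z0 (int c) i))) summable_on {i..}"
  using summable_on_reindex_bij_betw[OF bij, of "\<lambda>c. norm (s ^ c * (bin z2 a c * bin z0 (int c) i))"] by blast
 then show "(\<lambda>c::nat. norm (s ^ c * (bin z2 a c * bin z0 (int c) i))) summable_on UNIV"
  by (rule summable_on_cong_neutral[THEN iffD1, rotated -1]) (use zero in auto)
qed

lemma has_sum_product:
 fixes B :: "'i => complex" and c :: "'j => complex"
 assumes B: "(B has_sum S) UNIV" "(\<lambda>n. norm (B n)) summable_on UNIV"
  and c: "(c has_sum C) UNIV" "(\<lambda>j. norm (c j)) summable_on UNIV"
 shows "((\<lambda>(n, j). B n * c j) has_sum S * C) (UNIV \<times> UNIV)"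
  and "(\<lambda>(n, j). norm (B n * c j)) summable_on (UNIV \<times> UNIV)"
proof -
 have "(\<lambda>p. norm ((\<lambda>(n, j). B n * c j) p)) summable_on (UNIV \<times> UNIV)"
  by (subst Infinite_Sum.abs_summable_on_Sigma_iff)
    (use B(2) c(2) in \<open>auto simp: norm_mult abs_mult infsum_cmult_right' intro!: summable_on_cmult_right summable_on_cmult_left\<close>)
 then show abs: "(\<lambda>(n, j). norm (B n * c j)) summable_on (UNIV \<times> UNIV)" by (simp add: case_prod_unfold)
 show "((\<lambda>(n, j). B n * c j) has_sum S * C) (UNIV \<times> UNIV)"
 proof (rule has_sum_SigmaI)
  show "((\<lambda>j. case (n, j) of (n, j) => B n * c j) has_sum B n * C) UNIV" for n
   using has_sum_cmult_right[OF c(1), of "B n"] by simp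
  show "((\<lambda>n. B n * C) has_sum S * C) UNIV" by (rule has_sum_cmult_left[OF B(1)])
  show "(\<lambda>(n, j). B n * c j) summable_on UNIV \<times> UNIV"
   by (rule Infinite_Sum.abs_summable_summable) (use abs in \<open>simp add: case_prod_unfold\<close>)
 qed
qed

lemma has_sum_diff:
 fixes f g :: "'i => 'b::topological_ab_group_add"
 assumes "(f has_sum a) A" "(g has_sum b) A"
 shows "((\<lambda>x. f x - g x) has_sum a - b) A"
 using has_sum_add[OF assms(1), of "\<lambda>x. - g x" "- b"] assms(2) by (simp add: has_sum_uminus)

lemma has_sum_translate:
 fixes c :: "'a::ab_group_add"
 assumes "(f has_sum s) UNIV"
 shows "((\<lambda>n. f (n + c)) has_sum s) UNIV"
proof -
 have "bij_betw (\<lambda>n. n + c) UNIV UNIV" by (rule bij_betw_byWitness[where f' = "\<lambda>n. n - c"]) auto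
 from has_sum_reindex_bij_betw[OF this, of f s] assms show ?thesis by blast
qed

section \<open>Vectors of a completion representing functionals\<close>

context
 fixes V :: "('v::complex_vector, 'g::ab_group_add) valg" and W :: "('v, 'g, 'w::complex_vector) vmod" and \<gamma> :: 'g and n :: complex
 assumes W: "generalized_module V W"
begin

text \<open>
  A basis of the finite-dimensional space $W^{(\gamma)}_{[n]}$ and its dual basis.
\<close>

lemma piece_basis:
 obtains B e where "finite B" "B \<subseteq> grm W \<gamma> \<inter> wtm W n" "\<And>b. b \<in> B ==> e b \<in> contragredient_piece W (- \<gamma>) n"
  "\<And>s. s \<in> grm W \<gamma> \<inter> wtm W n ==> s = (\<Sum>b\<in>B. e b s *\<^sub>C b)"
  "\<And>x w. x \<in> contragredient_piece W (- \<gamma>) n ==> x w = (\<Sum>b\<in>B. x b * e b w)"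
proof -
 let ?S = "grm W \<gamma> \<inter> wtm W n"
 have S: "csubspace ?S" by (rule ds_summand[OF gm_grwt_ds[OF W]])
 obtain B where B: "B \<subseteq> ?S" "complex_vector.independent B" "?S \<subseteq> cspan B"
  using complex_vector.maximal_independent_subset[of ?S] by metis
 obtain F where F: "finite F" "?S \<subseteq> cspan F" using gm_fin_dim[OF W, of \<gamma> n] by (auto simp: fin_dim_def)
 have finB: "finite B" using complex_vector.independent_span_bound[OF F(1) B(2)] B(1) F(2) by blast
 have span: "cspan B = ?S" using complex_vector.span_minimal[OF B(1) S] B(3) by blast
 define P where "P = (\<lambda>w. component (wtm W) n (component (grm W) \<gamma> w))"
 have gr: "component (grm W) \<gamma> w \<in> grm W \<gamma>" if "w \<in> carr W" for w by (rule component_in[OF gm_gr_ds[OF W] that])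
 have P_S: "P w \<in> ?S" if w: "w \<in> carr W" for w
 proof -
  let ?y = "component (grm W) \<gamma> w"
  have "component (wtm W) n ?y = component (\<lambda>n. grm W \<gamma> \<inter> wtm W n) n ?y"
  proof -
   let ?c = "\<lambda>n. component (\<lambda>n. grm W \<gamma> \<inter> wtm W n) n ?y"
   let ?I = "{k. ?c k \<noteq> 0}"
   have fin: "finite ?I" by (rule component_finite[OF gm_grwt_ds[OF W] gr[OF w]])
   have c: "?c k \<in> wtm W k" for k using component_in[OF gm_grwt_ds[OF W] gr[OF w], of k] by blast
   have "?y = (\<Sum>k\<in>?I. ?c k)" by (rule component_sum[OF gm_grwt_ds[OF W] gr[OF w] fin]) simp
   then have "component (wtm W) n ?y = component (wtm W) n (\<Sum>k\<in>?I. ?c k)" by (rule arg_cong)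
   also have "\<dots> = (if n \<in> ?I then ?c n else 0)" by (rule component_of_sum[OF gm_wt_ds[OF W] fin c])
   finally show ?thesis by auto
  qed
  then show ?thesis unfolding P_def using component_in[OF gm_grwt_ds[OF W] gr[OF w], of n] by simp
 qed
 have P_linear: "P (x + y) = P x + P y" "P (c *\<^sub>C x) = c *\<^sub>C P x" if "x \<in> carr W" "y \<in> carr W" for x y c
  using that gm_gr_subset[OF W gr] lin_add[OF component_linear[OF gm_gr_ds[OF W]]]
   lin_add[OF component_linear[OF gm_wt_ds[OF W]]] lin_scale[OF component_linear[OF gm_gr_ds[OF W]]]
   lin_scale[OF component_linear[OF gm_wt_ds[OF W]]] by (simp_all add: P_def)
 have P_hom: "P w = (if (\<beta>, m) = (\<gamma>, n) then w else 0)" if "w \<in> grm W \<beta>" "w \<in> wtm W m" for w \<beta> m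
  using component_of_summand[OF gm_gr_ds[OF W] that(1), of \<gamma>] component_of_summand[OF gm_wt_ds[OF W] that(2), of n]
   lin_zero[OF component_linear[OF gm_wt_ds[OF W]] gm_zero[OF W], of n] by (auto simp: P_def)
 define e where "e = (\<lambda>b w. if w \<in> carr W then complex_vector.representation B (P w) b else 0)"
 have e_piece: "e b \<in> contragredient_piece W (- \<gamma>) n" for b
 proof -
  have "e b \<in> dual1 (carr W)"
   unfolding dual1_def linear_map_on_def e_def
   using P_S span gm_add[OF W] gm_scale[OF W] P_linear
    complex_vector.representation_add[OF B(2)] complex_vector.representation_scale[OF B(2)] by simp
  moreover have "e b w = 0" if "w \<in> grm W \<beta>" "w \<in> wtm W m" "(\<beta>, m) \<noteq> (- (- \<gamma>), n)" for w \<beta> m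
   using P_hom[OF that(1,2)] that(3) fun_cong[OF complex_vector.representation_zero, of B b] by (auto simp: e_def)
  ultimately show ?thesis unfolding contragredient_piece_def by blast
 qed
 have rep: "s = (\<Sum>b\<in>B. complex_vector.representation B s b *\<^sub>C b)" if "s \<in> ?S" for s
  using complex_vector.sum_representation_eq[OF B(2) _ finB, of s] that span by simp
 show ?thesis
 proof (rule that[OF finB B(1) e_piece])
  fix s assume s: "s \<in> ?S"
  have "P s = s" using P_hom[of s \<gamma> n] s by simp
  then show "s = (\<Sum>b\<in>B. e b s *\<^sub>C b)" using rep[OF s] s gm_wt_subset[OF W] by (auto simp: e_def)
 next
  fix x w assume x: "x \<in> contragredient_piece W (- \<gamma>) n"
  note lin = dual1_linear[OF piece_dual1[OF x]]
  show "x w = (\<Sum>b\<in>B. x b * e b w)"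
  proof (cases "w \<in> carr W")
   case True
   have bc: "b \<in> carr W" if "b \<in> B" for b using that B(1) gm_wt_subset[OF W] by blast
   have "x w = x (P w)"
   proof (rule linear_eq_on_hom[OF W lin _ _ True])
    show "linear_map_on (carr W) UNIV (\<lambda>w. x (P w))"
    proof -
     have Pc: "P w \<in> carr W" if "w \<in> carr W" for w using P_S[OF that] gm_wt_subset[OF W] by blast
     show ?thesis unfolding linear_map_on_def
      by (intro conjI ballI allI UNIV_I)
       (simp_all only: P_linear lin_add[OF lin Pc Pc] lin_scale[OF lin Pc])
    qed
    show "x w = x (P w)" if "w \<in> grm W \<beta>" "w \<in> wtm W m" for \<beta> m w
     using P_hom[OF that] piece_vanish[OF x that] lin_zero[OF lin gm_zero[OF W]] by auto
   qed
   also have "\<dots> = x (\<Sum>b\<in>B. complex_vector.representation B (P w) b *\<^sub>C b)" by (rule arg_cong[OF rep[OF P_S[OF True]]])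
   also have "\<dots> = (\<Sum>b\<in>B. x (complex_vector.representation B (P w) b *\<^sub>C b))"
    by (rule lin_sum[OF lin gm_subspace[OF W]]) (rule gm_scale[OF W bc])
   also have "\<dots> = (\<Sum>b\<in>B. x b * e b w)"
    using True lin_scale[OF lin bc] by (intro sum.cong) (simp_all add: e_def mult.commute)
   finally show ?thesis .
  next
   case False
   then show ?thesis using dual1_outside[OF piece_dual1[OF x]] by (simp add: e_def)
  qed
 qed
qed

lemma represent_functional:
 assumes add: "\<And>x y. x \<in> carr (contragredient V W) ==> y \<in> carr (contragredient V W) ==> \<phi> (x + y) = \<phi> x + \<phi> y"
  and scale: "\<And>c x. x \<in> carr (contragredient V W) ==> \<phi> (c *\<^sub>C x) = c * \<phi> x"
 shows "\<exists>s. s \<in> grm W \<gamma> \<and> s \<in> wtm W n \<and> (\<forall>x\<in>contragredient_piece W (- \<gamma>) n. x s = (\<phi> x :: complex))"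
proof -
 obtain B e where B: "finite B" "B \<subseteq> grm W \<gamma> \<inter> wtm W n" and e: "\<And>b. b \<in> B ==> e b \<in> contragredient_piece W (- \<gamma>) n"
  and x_eq: "\<And>x w. x \<in> contragredient_piece W (- \<gamma>) n ==> x w = (\<Sum>b\<in>B. x b * e b w)"
  by (rule piece_basis) blast
 have ec: "e b \<in> carr (contragredient V W)" if "b \<in> B" for b using e[OF that] piece_subset by blast
 have sub: "csubspace (carr (contragredient V W))" unfolding contragredient_carr by (rule complex_vector.subspace_span)
 have lin: "linear_map_on (carr (contragredient V W)) UNIV \<phi>" unfolding linear_map_on_def using add scale by simp
 define s where "s = (\<Sum>b\<in>B. \<phi> (e b) *\<^sub>C b)"
 have s: "s \<in> grm W \<gamma> \<inter> wtm W n" unfolding s_def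
  by (rule csub_sum[OF ds_summand[OF gm_grwt_ds[OF W]]])
    (use B(2) csub_scale[OF ds_summand[OF gm_grwt_ds[OF W]]] in blast)
 have "x s = \<phi> x" if x: "x \<in> contragredient_piece W (- \<gamma>) n" for x
 proof -
  note xl = dual1_linear[OF piece_dual1[OF x]]
  have bc: "b \<in> carr W" if "b \<in> B" for b using that B(2) gm_wt_subset[OF W] by blast
  have "x = (\<Sum>b\<in>B. x b *\<^sub>C e b)"
   by (rule ext) (simp only: sum_fun_apply scaleC_fun_apply scaleC_complex, rule x_eq[OF x])
  then have "\<phi> x = \<phi> (\<Sum>b\<in>B. x b *\<^sub>C e b)" by (rule arg_cong)
  also have "\<dots> = (\<Sum>b\<in>B. \<phi> (x b *\<^sub>C e b))"
   by (rule lin_sum[OF lin sub]) (rule csub_scale[OF sub ec])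
  also have "\<dots> = (\<Sum>b\<in>B. x (\<phi> (e b) *\<^sub>C b))"
   by (rule sum.cong[OF refl]) (simp only: scale[OF ec] lin_scale[OF xl bc] scaleC_complex mult.commute)
  also have "\<dots> = x s" unfolding s_def
   by (rule lin_sum[OF xl gm_subspace[OF W], symmetric]) (rule gm_scale[OF W bc])
  finally show ?thesis by simp
 qed
 then show ?thesis using s by blast
qed

end

lemma completion_eqI:
 assumes W: "generalized_module V W" and u: "u \<in> completion W" "u' \<in> completion W"
  and eq: "\<And>x. x \<in> carr (contragredient V W) ==> pairing x u = pairing x u'"
 shows "u = u'"
proof (rule ext)
 fix n
 let ?d = "u n - u' n"
 have dw: "?d \<in> wtm W n"
  by (rule csub_diff[OF ds_summand[OF gm_wt_ds[OF W]] completion_wt[OF u(1)] completion_wt[OF u(2)]])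
 have dc: "?d \<in> carr W" by (rule gm_wt_subset[OF W dw])
 have "component (grm W) \<gamma> ?d = 0" for \<gamma>
 proof -
  let ?c = "component (grm W) \<gamma> ?d"
  have cS: "?c \<in> grm W \<gamma> \<inter> wtm W n"
   using component_in[OF gm_gr_ds[OF W] dc, of \<gamma>] gm_wt_gr_component[OF W dw] by blast
  obtain B e where B: "finite B" and e: "\<And>b. b \<in> B ==> e b \<in> contragredient_piece W (- \<gamma>) n"
   and s_eq: "\<And>s. s \<in> grm W \<gamma> \<inter> wtm W n ==> s = (\<Sum>b\<in>B. e b s *\<^sub>C b)"
   by (rule piece_basis[OF W, of \<gamma> n]) blast
  have "e b ?c = 0" if b: "b \<in> B" for b
  proof -
   note lin = dual1_linear[OF piece_dual1[OF e[OF b]]]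
   have ec: "e b \<in> carr (contragredient V W)" using e[OF b] piece_subset by blast
   have van: "e b w = 0" if "w \<in> wtm W m" "m \<noteq> n" for w m
    by (rule linear_zero_on_wt[OF W lin _ that(1)]) (use piece_vanish[OF e[OF b]] that(2) in blast)
   have "pairing (e b) y = e b (y n)" if "y \<in> completion W" for y
    unfolding pairing_def by (rule Sum_any_single) (rule van[OF completion_wt[OF that]])
   then have "e b (u n) = e b (u' n)" using eq[OF ec] u by simp
   then have "e b ?d = 0" using lin_diff[OF lin gm_subspace[OF W] completion_carr[OF W u(1)] completion_carr[OF W u(2)]] by simp
   moreover have "e b ?d = e b ?c"
   proof -
    let ?I = "insert \<gamma> {\<beta>. component (grm W) \<beta> ?d \<noteq> 0}"
    have I: "finite ?I" using component_finite[OF gm_gr_ds[OF W] dc] by simp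
    have gr: "component (grm W) \<beta> ?d \<in> grm W \<beta>" for \<beta> by (rule component_in[OF gm_gr_ds[OF W] dc])
    have "?d = (\<Sum>\<beta>\<in>?I. component (grm W) \<beta> ?d)" by (rule component_sum[OF gm_gr_ds[OF W] dc I]) simp
    then have "e b ?d = e b (\<Sum>\<beta>\<in>?I. component (grm W) \<beta> ?d)" by (rule arg_cong)
    also have "\<dots> = (\<Sum>\<beta>\<in>?I. e b (component (grm W) \<beta> ?d))"
     by (rule lin_sum[OF lin gm_subspace[OF W] gm_gr_subset[OF W gr]])
    also have "\<dots> = (\<Sum>\<beta>\<in>{\<gamma>}. e b (component (grm W) \<beta> ?d))"
    proof (rule sum.mono_neutral_right[OF I])
     show "\<forall>\<beta>\<in>?I - {\<gamma>}. e b (component (grm W) \<beta> ?d) = 0"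
     proof
      fix \<beta> assume "\<beta> \<in> ?I - {\<gamma>}"
      then have "(\<beta>, n) \<noteq> (- (- \<gamma>), n)" by simp
      then show "e b (component (grm W) \<beta> ?d) = 0"
       by (rule piece_vanish[OF e[OF b] gr gm_wt_gr_component[OF W dw]])
     qed
    qed simp
    finally show ?thesis by simp
   qed
   ultimately show ?thesis by simp
  qed
  then have "(\<Sum>b\<in>B. e b ?c *\<^sub>C b) = 0" by (intro sum.neutral) simp
  then show ?thesis using s_eq[OF cS] by simp
 qed
 then have "?d = 0" using component_sum[OF gm_gr_ds[OF W] dc, of "{}"] by simp
 then show "u n = u' n" by simp
qed

text \<open>
  The degrees are restricted to a finite set since a homogeneous space $W_{[n]}$ may contain vectors
  of infinitely many degrees, while the component of weight \<open>n\<close> of an element of the completion has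
  only finitely many.
\<close>

lemma completion_representing:
 assumes W: "generalized_module V W"
  and add: "\<And>x y. x \<in> carr (contragredient V W) ==> y \<in> carr (contragredient V W) ==> \<phi> (x + y) = \<phi> x + \<phi> y"
  and scale: "\<And>c x. x \<in> carr (contragredient V W) ==> \<phi> (c *\<^sub>C x) = c * \<phi> x"
  and G: "finite G" "\<And>\<gamma> n x. \<gamma> \<notin> G ==> x \<in> contragredient_piece W (- \<gamma>) n ==> \<phi> x = 0"
 shows "\<exists>u\<in>completion W. \<forall>x\<in>carr (contragredient V W). pairing x u = (\<phi> x :: complex)"
proof -
 have "\<exists>s. s \<in> grm W \<gamma> \<and> s \<in> wtm W n \<and> (\<forall>x\<in>contragredient_piece W (- \<gamma>) n. x s = \<phi> x)" for \<gamma> n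
  by (rule represent_functional[OF W add scale])
 then obtain s where s: "\<And>\<gamma> n. s \<gamma> n \<in> grm W \<gamma>" "\<And>\<gamma> n. s \<gamma> n \<in> wtm W n"
  "\<And>\<gamma> n x. x \<in> contragredient_piece W (- \<gamma>) n ==> x (s \<gamma> n) = \<phi> x" by metis
 define u where "u = (\<lambda>n. \<Sum>\<gamma>\<in>G. s \<gamma> n)"
 have "(\<Sum>\<gamma>\<in>G. s \<gamma> n) \<in> wtm W n" for n
  by (rule csub_sum[OF ds_summand[OF gm_wt_ds[OF W]] s(2)])
 then have u: "u \<in> completion W" by (simp add: completion_def u_def)
 have piece: "pairing x u = \<phi> x" if x: "x \<in> contragredient_piece W \<beta> n" for x \<beta> n
 proof -
  note lin = dual1_linear[OF piece_dual1[OF x]]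
  have van: "x (s \<gamma> m) = 0" if "(\<gamma>, m) \<noteq> (- \<beta>, n)" for \<gamma> m
   by (rule piece_vanish[OF x s(1) s(2) that])
  have xu: "x (u m) = (\<Sum>\<gamma>\<in>G. x (s \<gamma> m))" for m unfolding u_def
   by (rule lin_sum[OF lin gm_subspace[OF W] gm_wt_subset[OF W s(2)]])
  have "pairing x u = x (u n)" unfolding pairing_def
   by (rule Sum_any_single) (use van in \<open>simp add: xu\<close>)
  also have "\<dots> = (\<Sum>\<gamma>\<in>G. if \<gamma> = - \<beta> then \<phi> x else 0)"
   unfolding xu
  proof (rule sum.cong[OF refl])
   fix \<gamma> show "x (s \<gamma> n) = (if \<gamma> = - \<beta> then \<phi> x else 0)"
    using van[of \<gamma> n] s(3)[of x "- \<beta>" n] x by auto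
  qed
  also have "\<dots> = \<phi> x" using G(1) G(2)[of "- \<beta>" x n] x by auto
  finally show ?thesis .
 qed
 have "pairing x u = \<phi> x" if "x \<in> carr (contragredient V W)" for x
  using that
 proof (induction rule: contragredient_induct)
  case zero
  have z: "0 \<in> carr (contragredient V W)" unfolding contragredient_carr by (rule complex_vector.span_zero)
  have "\<phi> (0 *\<^sub>C 0) = 0" using scale[OF z, of 0] by simp
  then have "\<phi> 0 = 0" by (simp only: complex_vector.scale_zero_left)
  then show ?case using lin_zero[OF pairing_linear_left[OF W u] z] by (simp only:)
 next
  case (add \<beta> n f g)
  have fc: "f \<in> carr (contragredient V W)" using add(1) piece_subset by blast
  have "pairing (f + g) u = pairing f u + pairing g u"
   by (rule lin_add[OF pairing_linear_left[OF W u] fc add(2)])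
  also have "\<dots> = \<phi> f + \<phi> g" by (simp only: piece[OF add(1)] add(3))
  also have "\<dots> = \<phi> (f + g)" by (rule assms(2)[OF fc add(2), symmetric])
  finally show ?case .
 qed
 then show ?thesis using u by blast
qed

section \<open>Products of intertwining maps\<close>

text \<open>
  The product of $I_1$ and $I_2$ under the hypothesis that it converges.
\<close>

locale intertwining_product = sgva A V
 for A :: "'g::ab_group_add set" and V :: "('v::complex_vector, 'g) valg" +
 fixes W1 :: "('v, 'g, 'a::complex_vector) vmod" and W2 :: "('v, 'g, 'b::complex_vector) vmod"
  and W3 :: "('v, 'g, 'c::complex_vector) vmod" and W4 :: "('v, 'g, 'd::complex_vector) vmod"
  and M1 :: "('v, 'g, 'm::complex_vector) vmod" and z1 z2 :: complex and I1 I2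
 assumes W1: "generalized_module V W1" and W2: "generalized_module V W2" and W3: "generalized_module V W3"
  and W4: "generalized_module V W4" and M1: "generalized_module V M1" and N4: "generalized_module V (contragredient V W4)"
  and I1: "intertwining_map V z1 W4 W1 M1 I1" and I2: "intertwining_map V z2 M1 W2 W3 I2"
  and z: "norm z2 < norm z1"
  and conv: "\<And>x w1 w2 w3. x \<in> carr (contragredient V W4) ==> w1 \<in> carr W1 ==> w2 \<in> carr W2 ==> w3 \<in> carr W3 ==>
    (\<lambda>n. norm (pairing x (I1 w1 (I2 w2 w3 n)))) summable_on UNIV"
begin

abbreviation "N4 \<equiv> contragredient V W4"

text \<open>
  The matrix coefficient of the product, as an absolutely convergent sum.
\<close>

definition prod_value where "prod_value x w1 w2 w3 = (\<Sum>\<^sub>\<infinity>n. pairing x (I1 w1 (I2 w2 w3 n)))"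

lemma prod_has_sum:
 "x \<in> carr N4 ==> w1 \<in> carr W1 ==> w2 \<in> carr W2 ==> w3 \<in> carr W3 ==>
   ((\<lambda>n. pairing x (I1 w1 (I2 w2 w3 n))) has_sum prod_value x w1 w2 w3) UNIV"
 unfolding prod_value_def by (rule has_sum_infsum[OF abs_summable_summable[OF conv]])

lemma I2_in: "w2 \<in> carr W2 ==> w3 \<in> carr W3 ==> I2 w2 w3 n \<in> carr M1"
 by (rule completion_carr[OF M1 im_completion[OF I2]])

lemma I1_in: "w1 \<in> carr W1 ==> m \<in> carr M1 ==> I1 w1 m \<in> completion W4"
 by (rule im_completion[OF I1])

lemma psi_linear:
 assumes x: "x \<in> carr N4" and w1: "w1 \<in> carr W1"
 shows "linear_map_on (carr M1) UNIV (\<lambda>m. pairing x (I1 w1 m))"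
proof -
 note l = pairing_linear[OF W4 x] and i = im_linear2[OF I1 w1]
 show ?thesis unfolding linear_map_on_def
 proof (intro conjI ballI allI UNIV_I)
  show "pairing x (I1 w1 (m + m')) = pairing x (I1 w1 m) + pairing x (I1 w1 m')" if "m \<in> carr M1" "m' \<in> carr M1" for m m'
   unfolding lin_add[OF i that] by (rule lin_add[OF l I1_in[OF w1 that(1)] I1_in[OF w1 that(2)]])
  show "pairing x (I1 w1 (c *\<^sub>C m)) = c *\<^sub>C pairing x (I1 w1 m)" if "m \<in> carr M1" for m c
   unfolding lin_scale[OF i that] by (rule lin_scale[OF l I1_in[OF w1 that]])
 qed
qed

lemma prod_valueI:
 assumes "\<And>n. pairing x (I1 w1 (I2 w2 w3 n)) = g n" "(g has_sum s) UNIV"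
 shows "prod_value x w1 w2 w3 = s"
 unfolding prod_value_def assms(1) by (rule infsumI[OF assms(2)])

lemma prod_value_add_x:
 assumes "x \<in> carr N4" "y \<in> carr N4" "w1 \<in> carr W1" "w2 \<in> carr W2" "w3 \<in> carr W3"
 shows "prod_value (x + y) w1 w2 w3 = prod_value x w1 w2 w3 + prod_value y w1 w2 w3"
 by (rule prod_valueI[OF lin_add[OF pairing_linear_left[OF W4 I1_in[OF assms(3) I2_in[OF assms(4,5)]]] assms(1,2)]])
  (intro has_sum_add prod_has_sum assms)

lemma prod_value_scale_x:
 assumes "x \<in> carr N4" "w1 \<in> carr W1" "w2 \<in> carr W2" "w3 \<in> carr W3"
 shows "prod_value (c *\<^sub>C x) w1 w2 w3 = c * prod_value x w1 w2 w3"
 by (rule prod_valueI[OF lin_scale[OF pairing_linear_left[OF W4 I1_in[OF assms(2) I2_in[OF assms(3,4)]]] assms(1)]])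
  (unfold scaleC_complex, intro has_sum_cmult_right prod_has_sum assms)

lemma prod_value_add_1:
 assumes "x \<in> carr N4" "w1 \<in> carr W1" "w1' \<in> carr W1" "w2 \<in> carr W2" "w3 \<in> carr W3"
 shows "prod_value x (w1 + w1') w2 w3 = prod_value x w1 w2 w3 + prod_value x w1' w2 w3"
proof (rule prod_valueI)
 show "pairing x (I1 (w1 + w1') (I2 w2 w3 n)) = pairing x (I1 w1 (I2 w2 w3 n)) + pairing x (I1 w1' (I2 w2 w3 n))" for n
  unfolding lin_add[OF im_linear1[OF I1 I2_in[OF assms(4,5)]] assms(2,3)]
  by (rule lin_add[OF pairing_linear[OF W4 assms(1)] I1_in[OF assms(2) I2_in[OF assms(4,5)]] I1_in[OF assms(3) I2_in[OF assms(4,5)]]])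
qed (intro has_sum_add prod_has_sum assms)

lemma prod_value_add_2:
 assumes "x \<in> carr N4" "w1 \<in> carr W1" "w2 \<in> carr W2" "w2' \<in> carr W2" "w3 \<in> carr W3"
 shows "prod_value x w1 (w2 + w2') w3 = prod_value x w1 w2 w3 + prod_value x w1 w2' w3"
proof (rule prod_valueI)
 show "pairing x (I1 w1 (I2 (w2 + w2') w3 n)) = pairing x (I1 w1 (I2 w2 w3 n)) + pairing x (I1 w1 (I2 w2' w3 n))" for n
  unfolding lin_add[OF im_linear1[OF I2 assms(5)] assms(3,4)] plus_fun_apply
  by (rule lin_add[OF psi_linear[OF assms(1,2)] I2_in[OF assms(3,5)] I2_in[OF assms(4,5)]])
qed (intro has_sum_add prod_has_sum assms)

lemma prod_value_add_3:
 assumes "x \<in> carr N4" "w1 \<in> carr W1" "w2 \<in> carr W2" "w3 \<in> carr W3" "w3' \<in> carr W3"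
 shows "prod_value x w1 w2 (w3 + w3') = prod_value x w1 w2 w3 + prod_value x w1 w2 w3'"
proof (rule prod_valueI)
 show "pairing x (I1 w1 (I2 w2 (w3 + w3') n)) = pairing x (I1 w1 (I2 w2 w3 n)) + pairing x (I1 w1 (I2 w2 w3' n))" for n
  unfolding lin_add[OF im_linear2[OF I2 assms(3)] assms(4,5)] plus_fun_apply
  by (rule lin_add[OF psi_linear[OF assms(1,2)] I2_in[OF assms(3,4)] I2_in[OF assms(3,5)]])
qed (intro has_sum_add prod_has_sum assms)

lemma prod_value_scale_3:
 assumes "x \<in> carr N4" "w1 \<in> carr W1" "w2 \<in> carr W2" "w3 \<in> carr W3"
 shows "prod_value x w1 w2 (c *\<^sub>C w3) = c * prod_value x w1 w2 w3"
proof (rule prod_valueI)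
 show "pairing x (I1 w1 (I2 w2 (c *\<^sub>C w3) n)) = c * pairing x (I1 w1 (I2 w2 w3 n))" for n
  unfolding lin_scale[OF im_linear2[OF I2 assms(3)] assms(4)] scaleC_fun_apply
  using lin_scale[OF psi_linear[OF assms(1,2)] I2_in[OF assms(3,4)]] by simp
qed (intro has_sum_cmult_right prod_has_sum assms)

lemma prod_value_gr:
 assumes x: "x \<in> grm N4 \<beta>" and w: "w1 \<in> grm W1 \<beta>1" "w2 \<in> grm W2 \<beta>2" "w3 \<in> grm W3 \<beta>3"
  and ne: "\<beta>1 + (\<beta>2 + \<beta>3) \<noteq> - \<beta>"
 shows "prod_value x w1 w2 w3 = 0"
proof -
 have "pairing x (I1 w1 (I2 w2 w3 n)) = 0" for n
  unfolding pairing_def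
  by (simp add: contragredient_gr_vanish[OF W4 x im_gr[OF I1 w(1) im_gr[OF I2 w(2,3)]] ne])
 then show ?thesis by (simp add: prod_value_def)
qed

text \<open>
  Functionals on the contragredient that vanish outside finitely many degrees.
\<close>

definition gr_supported :: "(('d => complex) => complex) => bool" where
 "gr_supported \<phi> \<longleftrightarrow> (\<exists>G. finite G \<and> (\<forall>\<gamma> n x. \<gamma> \<notin> G --> x \<in> contragredient_piece W4 (- \<gamma>) n --> \<phi> x = 0))"

lemma gr_supported_add:
 assumes "gr_supported \<phi>" "gr_supported \<psi>" and eq: "\<And>x. x \<in> carr N4 ==> \<omega> x = \<phi> x + \<psi> x"
 shows "gr_supported \<omega>"
proof -
 obtain G where G: "finite G" "\<And>\<gamma> n x. \<gamma> \<notin> G ==> x \<in> contragredient_piece W4 (- \<gamma>) n ==> \<phi> x = 0"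
  using assms(1) unfolding gr_supported_def by blast
 obtain G' where G': "finite G'" "\<And>\<gamma> n x. \<gamma> \<notin> G' ==> x \<in> contragredient_piece W4 (- \<gamma>) n ==> \<psi> x = 0"
  using assms(2) unfolding gr_supported_def by blast
 have "\<omega> x = 0" if g: "\<gamma> \<notin> G \<union> G'" and x: "x \<in> contragredient_piece W4 (- \<gamma>) n" for \<gamma> n x
 proof -
  have "x \<in> carr N4" using x piece_subset(1) by blast
  then show ?thesis using eq G(2)[OF _ x] G'(2)[OF _ x] g by simp
 qed
 moreover have "finite (G \<union> G')" using G(1) G'(1) by simp
 ultimately show ?thesis unfolding gr_supported_def by blast
qed

lemma prod_value_gr_supported:
 assumes w: "w1 \<in> carr W1" "w2 \<in> carr W2" "w3 \<in> carr W3"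
 shows "gr_supported (\<lambda>x. prod_value x w1 w2 w3)"
proof (rule ds_induct[OF gm_gr_ds[OF W3] w(3)])
 fix \<beta>3 w3 assume w3: "w3 \<in> grm W3 \<beta>3"
 show "gr_supported (\<lambda>x. prod_value x w1 w2 w3)"
 proof (rule ds_induct[OF gm_gr_ds[OF W2] w(2)])
  fix \<beta>2 w2 assume w2: "w2 \<in> grm W2 \<beta>2"
  show "gr_supported (\<lambda>x. prod_value x w1 w2 w3)"
  proof (rule ds_induct[OF gm_gr_ds[OF W1] w(1)])
   fix \<beta>1 w1 assume w1: "w1 \<in> grm W1 \<beta>1"
   have "prod_value x w1 w2 w3 = 0" if "\<gamma> \<notin> {\<beta>1 + (\<beta>2 + \<beta>3)}" "x \<in> contragredient_piece W4 (- \<gamma>) n" for \<gamma> n x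
   proof (rule prod_value_gr[OF _ w1 w2 w3])
    show "x \<in> grm N4 (- \<gamma>)" using that(2) piece_subset by blast
    show "\<beta>1 + (\<beta>2 + \<beta>3) \<noteq> - (- \<gamma>)" using that(1) by simp
   qed
   then show "gr_supported (\<lambda>x. prod_value x w1 w2 w3)" unfolding gr_supported_def by blast
  next
   fix u v assume u: "u \<in> carr W1" "v \<in> carr W1" "gr_supported (\<lambda>x. prod_value x u w2 w3)" "gr_supported (\<lambda>x. prod_value x v w2 w3)"
   show "gr_supported (\<lambda>x. prod_value x (u + v) w2 w3)"
    by (rule gr_supported_add[OF u(3,4)]) (rule prod_value_add_1[OF _ u(1,2) gm_gr_subset[OF W2 w2] gm_gr_subset[OF W3 w3]])
  qed
 next
  fix u v assume u: "u \<in> carr W2" "v \<in> carr W2" "gr_supported (\<lambda>x. prod_value x w1 u w3)" "gr_supported (\<lambda>x. prod_value x w1 v w3)"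
  show "gr_supported (\<lambda>x. prod_value x w1 (u + v) w3)"
   by (rule gr_supported_add[OF u(3,4)]) (rule prod_value_add_2[OF _ w(1) u(1,2) gm_gr_subset[OF W3 w3]])
 qed
next
 fix u v assume u: "u \<in> carr W3" "v \<in> carr W3" "gr_supported (\<lambda>x. prod_value x w1 w2 u)" "gr_supported (\<lambda>x. prod_value x w1 w2 v)"
 show "gr_supported (\<lambda>x. prod_value x w1 w2 (u + v))"
  by (rule gr_supported_add[OF u(3,4)]) (rule prod_value_add_3[OF _ w(1,2) u(1,2)])
qed

text \<open>
  This also shows that the element of the completion that defines the product exists and is unique.
\<close>

lemma pairing_product_map:
 assumes w: "w1 \<in> carr W1" "w2 \<in> carr W2" "w3 \<in> carr W3" and x: "x \<in> carr N4"
 shows "pairing x (product_map V W4 I1 I2 w1 w2 w3) = prod_value x w1 w2 w3"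
proof -
 obtain G where G: "finite G" "\<And>\<gamma> n x. \<gamma> \<notin> G ==> x \<in> contragredient_piece W4 (- \<gamma>) n ==> prod_value x w1 w2 w3 = 0"
  using prod_value_gr_supported[OF w] unfolding gr_supported_def by blast
 have ex: "\<exists>u\<in>completion W4. \<forall>x\<in>carr N4. pairing x u = prod_value x w1 w2 w3"
  by (rule completion_representing[OF W4 _ _ G(1)]) (rule prod_value_add_x[OF _ _ w] prod_value_scale_x[OF _ w] G(2); assumption)+
 obtain u where u: "u \<in> completion W4" "\<forall>x\<in>carr N4. pairing x u = prod_value x w1 w2 w3"
  using ex by blast
 have "product_map V W4 I1 I2 w1 w2 w3 = u"
  unfolding product_map_def
 proof (rule the_equality)
  show "u \<in> completion W4 \<and> (\<forall>w4'\<in>carr N4. pairing w4' u = (\<Sum>\<^sub>\<infinity>n. pairing w4' (I1 w1 (I2 w2 w3 n))))"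
   using u unfolding prod_value_def by blast
  show "u' = u" if "u' \<in> completion W4 \<and> (\<forall>w4'\<in>carr N4. pairing w4' u' = (\<Sum>\<^sub>\<infinity>n. pairing w4' (I1 w1 (I2 w2 w3 n))))" for u'
   by (rule completion_eqI[OF W4]) (use that u in \<open>simp_all add: prod_value_def\<close>)
 qed
 then show ?thesis using u(2) x by simp
qed

lemma psi_sum:
 assumes x: "x \<in> carr N4" and w1: "w1 \<in> carr W1" and g: "\<And>i. i \<in> I ==> g i \<in> carr M1" and y: "y \<in> carr M1"
 shows "pairing x (I1 w1 ((\<Sum>i\<in>I. c i *\<^sub>C g i) + y)) = (\<Sum>i\<in>I. c i * pairing x (I1 w1 (g i))) + pairing x (I1 w1 y)"
proof -
 note l = psi_linear[OF x w1]
 have s: "(\<Sum>i\<in>I. c i *\<^sub>C g i) \<in> carr M1" by (rule gm_sum[OF M1]) (rule gm_scale[OF M1 g])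
 have "pairing x (I1 w1 ((\<Sum>i\<in>I. c i *\<^sub>C g i) + y)) = pairing x (I1 w1 (\<Sum>i\<in>I. c i *\<^sub>C g i)) + pairing x (I1 w1 y)"
  by (rule lin_add[OF l s y])
 also have "pairing x (I1 w1 (\<Sum>i\<in>I. c i *\<^sub>C g i)) = (\<Sum>i\<in>I. pairing x (I1 w1 (c i *\<^sub>C g i)))"
  by (rule lin_sum[OF l gm_subspace[OF M1]]) (rule gm_scale[OF M1 g])
 also have "\<dots> = (\<Sum>i\<in>I. c i * pairing x (I1 w1 (g i)))"
  by (rule sum.cong[OF refl]) (simp only: lin_scale[OF l g] scaleC_complex)
 finally show ?thesis .
qed

lemma adjoint_commutator:
 assumes x: "x \<in> carr N4" and w1: "w1 \<in> carr W1" and m: "m \<in> carr M1"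
  and M: "\<And>c. c \<ge> int M ==> act W1 v c w1 = 0"
 shows "pairing (opp_coeff V N4 v (- a - 1) x) (I1 w1 m) =
  (\<Sum>i<M. bin z1 a i * pairing x (I1 (act W1 v (int i) w1) m)) + pairing x (I1 w1 (act M1 v a m))"
 using pairing_extend_act[OF W4 N4 I1_in[OF w1 m] x, of v a]
  im_commutator_pairing[OF I1 W1 M1 W4 N4 w1 m x M, where a = a] by simp

text \<open>
  The commutator formula for \<open>I1\<close>, followed by the one for \<open>I2\<close>.
\<close>

lemma prod_value_row:
 assumes v: "Lv V 0 v = of_int h *\<^sub>C v"
  and x: "x \<in> carr N4" and w: "w1 \<in> carr W1" "w2 \<in> carr W2" "w3 \<in> carr W3"
  and M1': "\<And>c. c \<ge> int M ==> act W1 v c w1 = 0" and M2': "\<And>c. c \<ge> int M' ==> act W2 v c w2 = 0"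
 shows "prod_value (opp_coeff V N4 v (- a - 1) x) w1 w2 w3 =
  (\<Sum>i<M. bin z1 a i * prod_value x (act W1 v (int i) w1) w2 w3) +
  ((\<Sum>i<M'. bin z2 a i * prod_value x w1 (act W2 v (int i) w2) w3) + prod_value x w1 w2 (act W3 v a w3))"
proof -
 let ?c = "of_int (h - a - 1) :: complex"
 have tm: "pairing (opp_coeff V N4 v (- a - 1) x) (I1 w1 (I2 w2 w3 n)) =
   (\<Sum>i<M. bin z1 a i * pairing x (I1 (act W1 v (int i) w1) (I2 w2 w3 n))) +
   ((\<Sum>i<M'. bin z2 a i * pairing x (I1 w1 (I2 (act W2 v (int i) w2) w3 (n + ?c)))) + pairing x (I1 w1 (I2 w2 (act W3 v a w3) (n + ?c))))" for n
 proof -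
  have "act M1 v a (I2 w2 w3 n) = extend_op M1 (act M1 v a) (I2 w2 w3) (n + ?c)"
   by (subst extend_op_act_hom[OF M1 im_completion[OF I2 w(2,3)] v]) simp
  also have "\<dots> = (\<Sum>i<M'. bin z2 a i *\<^sub>C I2 (act W2 v (int i) w2) w3 (n + ?c)) + I2 w2 (act W3 v a w3) (n + ?c)"
   by (rule im_commutator[OF I2 W2 W3 w(2,3) M2'])
  finally have e: "act M1 v a (I2 w2 w3 n) = \<dots>" .
  have "pairing x (I1 w1 (act M1 v a (I2 w2 w3 n))) =
   (\<Sum>i<M'. bin z2 a i * pairing x (I1 w1 (I2 (act W2 v (int i) w2) w3 (n + ?c)))) + pairing x (I1 w1 (I2 w2 (act W3 v a w3) (n + ?c)))"
   unfolding e by (rule psi_sum[OF x w(1) I2_in[OF gm_act_in[OF W2 w(2)] w(3)] I2_in[OF w(2) gm_act_in[OF W3 w(3)]]])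
  moreover have "pairing (opp_coeff V N4 v (- a - 1) x) (I1 w1 (I2 w2 w3 n)) =
   (\<Sum>i<M. bin z1 a i * pairing x (I1 (act W1 v (int i) w1) (I2 w2 w3 n))) + pairing x (I1 w1 (act M1 v a (I2 w2 w3 n)))"
   by (rule adjoint_commutator[OF x w(1) I2_in[OF w(2,3)]]) (rule M1')
  ultimately show ?thesis by (simp only:)
 qed
 have "((\<lambda>n. (\<Sum>i<M. bin z1 a i * pairing x (I1 (act W1 v (int i) w1) (I2 w2 w3 n))) +
   ((\<Sum>i<M'. bin z2 a i * pairing x (I1 w1 (I2 (act W2 v (int i) w2) w3 (n + ?c)))) + pairing x (I1 w1 (I2 w2 (act W3 v a w3) (n + ?c)))))
   has_sum (\<Sum>i<M. bin z1 a i * prod_value x (act W1 v (int i) w1) w2 w3) +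
  ((\<Sum>i<M'. bin z2 a i * prod_value x w1 (act W2 v (int i) w2) w3) + prod_value x w1 w2 (act W3 v a w3))) UNIV"
  by (intro has_sum_add has_sum_sum has_sum_cmult_right prod_has_sum
     has_sum_translate[where f = "\<lambda>n. pairing x (I1 w1 (I2 _ _ n))"] x w gm_act_in[OF W1] gm_act_in[OF W2] gm_act_in[OF W3] finite_lessThan)
 then have "((\<lambda>n. pairing (opp_coeff V N4 v (- a - 1) x) (I1 w1 (I2 w2 w3 n))) has_sum
   (\<Sum>i<M. bin z1 a i * prod_value x (act W1 v (int i) w1) w2 w3) +
  ((\<Sum>i<M'. bin z2 a i * prod_value x w1 (act W2 v (int i) w2) w3) + prod_value x w1 w2 (act W3 v a w3))) UNIV"
  by (simp only: tm)
 with prod_has_sum[OF opp_coeff_in[OF N4 x] w] show ?thesis by (rule has_sum_unique)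
qed

text \<open>
  The double series over \<open>(n, j)\<close> of the terms \<open>T n j\<close> is summed in two ways.  Moving $v_{b-j}$ to the
  left by the commutator formula of \<open>I1\<close> gives the first form of the sum; collecting the terms in which
  the outcome of $v_{b-j}$ has a fixed weight in \<open>M1\<close> gives the components of a column for \<open>I2\<close>.
\<close>

lemma prod_value_column:
 assumes v: "Lv V 0 v = of_int h *\<^sub>C v"
  and x: "x \<in> carr N4" and w: "w1 \<in> carr W1" "w2 \<in> carr W2" "w3 \<in> carr W3"
  and M1': "\<And>c. c \<ge> int M ==> act W1 v c w1 = 0" and M3': "\<And>c. c \<ge> int M' ==> act W3 v c w3 = 0"
  and J: "\<And>j. j \<ge> J ==> opp_coeff V N4 v (- (b - int j) - 1) x = 0"
 shows "(\<Sum>j<J. ((of_int b gchoose j) * (- z2) ^ j) * prod_value (opp_coeff V N4 v (- (b - int j) - 1) x) w1 w2 w3) =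
  (\<Sum>i<M. bin (z1 - z2) b i * prod_value x (act W1 v (int i) w1) w2 w3) +
  (prod_value x w1 (act W2 v b w2) w3 + (\<Sum>i<M'. bin (- z2) b i * prod_value x w1 w2 (act W3 v (int i) w3)))"
proof -
 define g where "g = (\<lambda>j. (of_int b gchoose j) * (- z2) ^ j :: complex)"
 define adj where "adj = (\<lambda>j. opp_coeff V N4 v (- (b - int j) - 1) x)"
 have adj: "adj j \<in> carr N4" for j unfolding adj_def by (rule opp_coeff_in[OF N4 x])
 define T where "T = (\<lambda>n j. g j * pairing x (I1 w1 (act M1 v (b - int j) (I2 w2 w3 n))))"
 define S where "S = (\<Sum>j<J. prod_value (adj j) w1 w2 w3 * g j) -
  (\<Sum>i<M. prod_value x (act W1 v (int i) w1) w2 w3 * bin (z1 - z2) b i)"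
 have m: "I2 w2 w3 n \<in> carr M1" for n by (rule I2_in[OF w(2,3)])
 have T_eq: "T n j = (\<Sum>j'<J. pairing (adj j') (I1 w1 (I2 w2 w3 n)) * (if j = j' then g j' else 0)) -
   (\<Sum>i<M. pairing x (I1 (act W1 v (int i) w1) (I2 w2 w3 n)) * (g j * bin z1 (b - int j) i))" for n j
 proof -
  have "(\<Sum>j'<J. pairing (adj j') (I1 w1 (I2 w2 w3 n)) * (if j = j' then g j' else 0)) = g j * pairing (adj j) (I1 w1 (I2 w2 w3 n))"
  proof (cases "j < J")
   case True
   have "(\<Sum>j'<J. pairing (adj j') (I1 w1 (I2 w2 w3 n)) * (if j = j' then g j' else 0)) =
     (\<Sum>j'<J. if j = j' then g j' * pairing (adj j') (I1 w1 (I2 w2 w3 n)) else 0)"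
    by (rule sum.cong) auto
   then show ?thesis using True by simp
  next
   case False
   then have "adj j = 0" using J[of j] by (simp only: adj_def not_less)
   then have "pairing (adj j) (I1 w1 (I2 w2 w3 n)) = 0"
    using lin_zero[OF pairing_linear_left[OF W4 I1_in[OF w(1) m]] gm_zero[OF N4]] by (simp only:)
   moreover have "(\<Sum>j'<J. pairing (adj j') (I1 w1 (I2 w2 w3 n)) * (if j = j' then g j' else 0)) = 0"
    using False by (intro sum.neutral) auto
   ultimately show ?thesis by simp
  qed
  moreover have "pairing x (I1 w1 (act M1 v (b - int j) (I2 w2 w3 n))) = pairing (adj j) (I1 w1 (I2 w2 w3 n)) -
    (\<Sum>i<M. bin z1 (b - int j) i * pairing x (I1 (act W1 v (int i) w1) (I2 w2 w3 n)))"
   unfolding adj_def using adjoint_commutator[OF x w(1) m M1', where a = "b - int j"] by simp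
  ultimately show ?thesis unfolding T_def by (simp add: right_diff_distrib sum_distrib_left mult_ac)
 qed
 have one: "((\<lambda>j. if j = j' then g j' else 0) has_sum g j') UNIV" "(\<lambda>j. norm (if j = j' then g j' else 0)) summable_on UNIV" for j' :: nat
 proof -
  show "((\<lambda>j. if j = j' then g j' else 0) has_sum g j') UNIV"
   by (rule has_sum_finite_neutralI[of "{j'}"]) auto
  have "((\<lambda>j. norm (if j = j' then g j' else 0)) has_sum norm (g j')) UNIV"
   by (rule has_sum_finite_neutralI[of "{j'}"]) auto
  then show "(\<lambda>j. norm (if j = j' then g j' else 0)) summable_on UNIV" by (rule has_sum_imp_summable)
 qed
 have cc: "((\<lambda>j. g j * bin z1 (b - int j) i) has_sum bin (z1 - z2) b i) UNIV"
  "(\<lambda>j. norm (g j * bin z1 (b - int j) i)) summable_on UNIV" for i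
  unfolding g_def by (rule column_coefficient[OF z])+
 have "((\<lambda>p. (\<Sum>j'<J. (\<lambda>(n, j). pairing (adj j') (I1 w1 (I2 w2 w3 n)) * (if j = j' then g j' else 0)) p) -
   (\<Sum>i<M. (\<lambda>(n, j). pairing x (I1 (act W1 v (int i) w1) (I2 w2 w3 n)) * (g j * bin z1 (b - int j) i)) p)) has_sum S) (UNIV \<times> UNIV)"
  unfolding S_def
  by (intro has_sum_diff has_sum_sum finite_lessThan has_sum_product(1) one prod_has_sum conv adj x w gm_act_in[OF W1 w(1)] cc)
 then have "((\<lambda>(n, j). T n j) has_sum S) (UNIV \<times> UNIV)"
  by (simp add: T_eq case_prod_unfold)
 moreover have bij: "bij_betw (\<lambda>(n, j). (n - of_int (h - (b - int j) - 1), j)) (UNIV \<times> UNIV) (UNIV \<times> UNIV :: (complex \<times> nat) set)"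
  by (rule bij_betw_byWitness[where f' = "\<lambda>(n, j). (n + of_int (h - (b - int j) - 1), j)"]) auto
 ultimately have "((\<lambda>p. (\<lambda>(n, j). T n j) ((\<lambda>(n, j). (n - of_int (h - (b - int j) - 1), j)) p)) has_sum S) (UNIV \<times> UNIV)"
  using has_sum_reindex_bij_betw[OF bij, of "\<lambda>(n, j). T n j" S] by blast
 then have T': "((\<lambda>(n, j). T (n - of_int (h - (b - int j) - 1)) j) has_sum S) (UNIV \<times> UNIV)"
  by (simp add: case_prod_unfold)
 define R where "R = (\<lambda>n. pairing x (I1 w1 (I2 (act W2 v b w2) w3 n)) + (\<Sum>i<M'. bin (- z2) b i * pairing x (I1 w1 (I2 w2 (act W3 v (int i) w3) n))))"
 have "((\<lambda>j. T (n - of_int (h - (b - int j) - 1)) j) has_sum R n) UNIV" for n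
 proof -
  obtain N :: nat where N: "\<And>i. i \<ge> N ==> I2 w2 w3 (n - of_int (h - b - 1) - of_nat i) = 0"
   using im_trunc[OF I2 w(2,3), of "n - of_int (h - b - 1)"] by blast
  have N': "I2 w2 w3 (n - of_int (h - (b - int i) - 1)) = 0" if "i \<ge> N" for i
   using N[OF that] by (simp add: algebra_simps)
  let ?m = "\<lambda>i. act M1 v (b - int i) (I2 w2 w3 (n - of_int (h - (b - int i) - 1)))"
  have mc: "?m i \<in> carr M1" for i by (rule gm_act_in[OF M1 m])
  have "(\<Sum>i<N. g i * pairing x (I1 w1 (?m i))) = pairing x (I1 w1 ((\<Sum>i<N. g i *\<^sub>C ?m i) + 0))"
   unfolding psi_sum[OF x w(1) mc gm_zero[OF M1]] using lin_zero[OF psi_linear[OF x w(1)] gm_zero[OF M1]] by simp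
  also have "(\<Sum>i<N. g i *\<^sub>C ?m i) + 0 = (\<Sum>i<M'. bin (- z2) b i *\<^sub>C I2 w2 (act W3 v (int i) w3) n) + I2 (act W2 v b w2) w3 n"
   using im_column[OF I2 W2 W3 M1 w(2,3) v M3' N'] by (simp add: g_def add.commute)
  also have "pairing x (I1 w1 \<dots>) = R n"
   unfolding psi_sum[OF x w(1) I2_in[OF w(2) gm_act_in[OF W3 w(3)]] I2_in[OF gm_act_in[OF W2 w(2)] w(3)]] R_def
   by (rule add.commute)
  finally have "(\<Sum>i<N. T (n - of_int (h - (b - int i) - 1)) i) = R n" unfolding T_def .
  moreover have "T (n - of_int (h - (b - int i) - 1)) i = 0" if "i \<notin> {..<N}" for i
   using N'[of i] that lin_zero[OF psi_linear[OF x w(1)] gm_zero[OF M1]] by (simp add: T_def gm_act_0[OF M1])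
  ultimately show ?thesis by (intro has_sum_finite_neutralI[of "{..<N}"]) auto
 qed
 then have R1: "(R has_sum S) UNIV" using has_sum_SigmaD[OF T', of R] by simp
 have "(R has_sum prod_value x w1 (act W2 v b w2) w3 + (\<Sum>i<M'. bin (- z2) b i * prod_value x w1 w2 (act W3 v (int i) w3))) UNIV"
  unfolding R_def
  by (intro has_sum_add has_sum_sum has_sum_cmult_right prod_has_sum x w gm_act_in[OF W2] gm_act_in[OF W3] finite_lessThan)
 then have "S = prod_value x w1 (act W2 v b w2) w3 + (\<Sum>i<M'. bin (- z2) b i * prod_value x w1 w2 (act W3 v (int i) w3))"
  by (rule has_sum_unique[OF R1])
 then show ?thesis unfolding S_def adj_def g_def by (simp add: algebra_simps)
qed

lemma prod_value_L:
 assumes j: "j \<in> {-1,0,1}" and x: "x \<in> carr N4" and w: "w1 \<in> carr W1" "w2 \<in> carr W2" "w3 \<in> carr W3"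
 shows "prod_value (Lm N4 (- j) x) w1 w2 w3 = ((\<Sum>i = 0..nat (j + 1). (of_nat (nat (j + 1) choose i) * z2 ^ i) * prod_value x w1 (Lm W2 (j - int i) w2) w3) +
    prod_value x w1 w2 (Lm W3 j w3)) +
   (\<Sum>i = 0..nat (j + 1). (of_nat (nat (j + 1) choose i) * z1 ^ i) * prod_value x (Lm W1 (j - int i) w1) w2 w3)"
  (is "_ = ?R")
proof -
 let ?J = "{0..nat (j + 1)}" and ?c = "- of_int j :: complex"
 have ji: "j - int i \<in> {-1,0,1}" if "i \<in> ?J" for i using that j by auto
 have mj: "- j \<in> {-1,0,1}" using j by auto
 have m: "I2 w2 w3 n \<in> carr M1" for n by (rule I2_in[OF w(2,3)])
 have tm: "pairing (Lm N4 (- j) x) (I1 w1 (I2 w2 w3 n)) =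
  ((\<Sum>i\<in>?J. (of_nat (nat (j + 1) choose i) * z2 ^ i) * pairing x (I1 w1 (I2 (Lm W2 (j - int i) w2) w3 (n + ?c)))) +
   pairing x (I1 w1 (I2 w2 (Lm W3 j w3) (n + ?c)))) +
  (\<Sum>i\<in>?J. (of_nat (nat (j + 1) choose i) * z1 ^ i) * pairing x (I1 (Lm W1 (j - int i) w1) (I2 w2 w3 n)))" for n
 proof -
  have "Lm M1 j (I2 w2 w3 n) = extend_op M1 (Lm M1 j) (I2 w2 w3) (n + ?c)"
   by (subst extend_op_L[OF M1 im_completion[OF I2 w(2,3)] j]) simp
  also have "\<dots> = (\<Sum>i\<in>?J. (of_nat (nat (j + 1) choose i) * z2 ^ i) *\<^sub>C I2 (Lm W2 (j - int i) w2) w3 (n + ?c)) + I2 w2 (Lm W3 j w3) (n + ?c)"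
   by (subst im_L[OF I2 j w(2,3)]) (rule add.commute)
  finally have e: "Lm M1 j (I2 w2 w3 n) = \<dots>" .
  have "pairing x (I1 w1 (Lm M1 j (I2 w2 w3 n))) =
   (\<Sum>i\<in>?J. (of_nat (nat (j + 1) choose i) * z2 ^ i) * pairing x (I1 w1 (I2 (Lm W2 (j - int i) w2) w3 (n + ?c)))) +
   pairing x (I1 w1 (I2 w2 (Lm W3 j w3) (n + ?c)))"
   unfolding e by (rule psi_sum[OF x w(1) I2_in[OF gm_L_in[OF W2 ji w(2)] w(3)] I2_in[OF w(2) gm_L_in[OF W3 j w(3)]]])
  then show ?thesis unfolding im_L_pairing[OF I1 W1 M1 W4 j w(1) m x] by simp
 qed
 have "((\<lambda>n. ((\<Sum>i\<in>?J. (of_nat (nat (j + 1) choose i) * z2 ^ i) * pairing x (I1 w1 (I2 (Lm W2 (j - int i) w2) w3 (n + ?c)))) +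
   pairing x (I1 w1 (I2 w2 (Lm W3 j w3) (n + ?c)))) +
  (\<Sum>i\<in>?J. (of_nat (nat (j + 1) choose i) * z1 ^ i) * pairing x (I1 (Lm W1 (j - int i) w1) (I2 w2 w3 n)))) has_sum ?R) UNIV"
  by (intro has_sum_add has_sum_sum has_sum_cmult_right prod_has_sum finite_atLeastAtMost
     has_sum_translate[where f = "\<lambda>n. pairing x (I1 w1 (I2 _ _ n))"] x w gm_L_in[OF W1 ji] gm_L_in[OF W2 ji] gm_L_in[OF W3 j])
 then have "((\<lambda>n. pairing (Lm N4 (- j) x) (I1 w1 (I2 w2 w3 n))) has_sum ?R) UNIV" by (simp only: tm)
 with prod_has_sum[OF gm_L_in[OF N4 mj x] w] show ?thesis by (rule has_sum_unique)
qed

end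

section \<open>Objects included in the dual of a tensor product\<close>

lemma Sum_any_image:
 fixes g :: "'i => 'a::ab_group_add" and h :: "'a => 'b::ab_group_add"
 assumes "finite B" "\<And>b. b \<notin> B ==> g b = 0" "h 0 = 0" "h (\<Sum>b\<in>B. g b) = (\<Sum>b\<in>B. h (g b))"
 shows "Sum_any (\<lambda>b. h (g b)) = h (Sum_any g)"
proof -
 have "Sum_any (\<lambda>b. h (g b)) = (\<Sum>b\<in>B. h (g b))"
  by (rule Sum_any_superset[OF assms(1)]) (simp add: assms(2,3))
 also have "\<dots> = h (Sum_any g)" using Sum_any_superset[OF assms(1), of g] assms(2,4) by simp
 finally show ?thesis .
qed

lemma Sum_any_int_sum:
 fixes g :: "'e => int => 'a::ab_group_add"
 assumes "finite E" "\<And>e. e \<in> E ==> finite {c. g e c \<noteq> 0}"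
 shows "Sum_any (\<lambda>c. \<Sum>e\<in>E. g e c) = (\<Sum>e\<in>E. Sum_any (g e))"
proof -
 let ?B = "\<Union>e\<in>E. {c. g e c \<noteq> 0}"
 have B: "finite ?B" using assms by simp
 have "Sum_any (\<lambda>c. \<Sum>e\<in>E. g e c) = (\<Sum>c\<in>?B. \<Sum>e\<in>E. g e c)"
  by (rule Sum_any_superset[OF B]) (auto intro!: sum.neutral)
 also have "\<dots> = (\<Sum>e\<in>E. \<Sum>c\<in>?B. g e c)" by (rule sum.swap)
 also have "\<dots> = (\<Sum>e\<in>E. Sum_any (g e))"
  by (rule sum.cong[OF refl]) (rule Sum_any_superset[OF B, symmetric], auto)
 finally show ?thesis .
qed

lemma finite_delta_den: "(\<And>c. c \<ge> N ==> g c = 0) ==> finite {c. delta_den z b c *\<^sub>C g c \<noteq> 0}"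
proof (rule finite_subset[of _ "{0..N}"])
 assume g: "\<And>c. c \<ge> N ==> g c = 0"
 show "{c. delta_den z b c *\<^sub>C g c \<noteq> 0} \<subseteq> {0..N}"
 proof
  fix c assume c: "c \<in> {c. delta_den z b c *\<^sub>C g c \<noteq> 0}"
  have "0 \<le> c" using c delta_den_neg[of c z b] by (cases "c < 0") auto
  moreover have "c \<le> N" using c g[of c] by (cases "N \<le> c") auto
  ultimately show "c \<in> {0..N}" by simp
 qed
qed simp

lemma finite_delta_fst_neg: "(\<And>c. c \<ge> N ==> g c = 0) ==> finite {c. delta_fst_neg z b c *\<^sub>C g c \<noteq> 0}"
proof (rule finite_subset[of _ "{0..N}"])
 assume g: "\<And>c. c \<ge> N ==> g c = 0"
 show "{c. delta_fst_neg z b c *\<^sub>C g c \<noteq> 0} \<subseteq> {0..N}"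
 proof
  fix c assume c: "c \<in> {c. delta_fst_neg z b c *\<^sub>C g c \<noteq> 0}"
  have "0 \<le> c" using c delta_fst_neg_neg[of c z b] by (cases "c < 0") auto
  moreover have "c \<le> N" using c g[of c] by (cases "N \<le> c") auto
  ultimately show "c \<in> {0..N}" by simp
 qed
qed simp

lemma finite_delta_snd: "(\<And>c. c \<le> N ==> g c = 0) ==> finite {c. delta_snd z a c *\<^sub>C g c \<noteq> 0}"
proof (rule finite_subset[of _ "{N..- a - 1}"])
 assume g: "\<And>c. c \<le> N ==> g c = 0"
 show "{c. delta_snd z a c *\<^sub>C g c \<noteq> 0} \<subseteq> {N..- a - 1}"
 proof
  fix c assume c: "c \<in> {c. delta_snd z a c *\<^sub>C g c \<noteq> 0}"
  have "c \<le> - a - 1" using c delta_snd_neg[of a c z] by (cases "c > - a - 1") auto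
  moreover have "N \<le> c" using c g[of c] by (cases "c \<le> N") auto
  ultimately show "c \<in> {N..- a - 1}" by simp
 qed
qed simp

text \<open>
  Compatibility of the inverse with the grading is not part of bijectivity; it follows from the
  uniqueness of homogeneous components.
\<close>

lemma module_map_inverse:
 assumes g: "module_map W M g" and W: "generalized_module V W" and M: "generalized_module V M"
  and bij: "bij_betw g (carr W) (carr M)"
 shows "module_map M W (inv_into (carr W) g)"
proof -
 let ?h = "inv_into (carr W) g"
 note lin = mm_linear[OF g]
 have h: "?h m \<in> carr W" "g (?h m) = m" if "m \<in> carr M" for m
  using bij that by (auto simp: bij_betw_def inv_into_into f_inv_into_f)
 have eq: "?h m = w" if "w \<in> carr W" "g w = m" for m w
  using bij that by (auto simp: bij_betw_def)
 show ?thesis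
  unfolding module_map_def linear_map_on_def
 proof (intro conjI ballI allI)
  show "?h x \<in> carr W" if "x \<in> carr M" for x by (rule h(1)[OF that])
  show "?h (x + y) = ?h x + ?h y" if "x \<in> carr M" "y \<in> carr M" for x y
   by (rule eq[OF gm_add[OF W h(1)[OF that(1)] h(1)[OF that(2)]]])
    (simp only: lin_add[OF lin h(1)[OF that(1)] h(1)[OF that(2)]] h(2)[OF that(1)] h(2)[OF that(2)])
  show "?h (c *\<^sub>C x) = c *\<^sub>C ?h x" if "x \<in> carr M" for c x
   by (rule eq[OF gm_scale[OF W h(1)[OF that]]]) (simp only: lin_scale[OF lin h(1)[OF that]] h(2)[OF that])
  show "?h (act M v m x) = act W v m (?h x)" if "x \<in> carr M" for v m x
   by (rule eq[OF gm_act_in[OF W h(1)[OF that]]]) (simp only: module_map_act[OF g h(1)[OF that]] h(2)[OF that])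
  show "?h (Lm M j x) = Lm W j (?h x)" if "j \<in> {-1,0,1}" "x \<in> carr M" for j x
   by (rule eq[OF gm_L_in[OF W that(1) h(1)[OF that(2)]]]) (simp only: module_map_L[OF g that(1) h(1)[OF that(2)]] h(2)[OF that(2)])
  fix \<beta> x assume x: "x \<in> grm M \<beta>"
  note xc = gm_gr_subset[OF M x]
  let ?c = "\<lambda>\<gamma>. component (grm W) \<gamma> (?h x)"
  let ?I = "insert \<beta> {\<gamma>. ?c \<gamma> \<noteq> 0}"
  have I: "finite ?I" using component_finite[OF gm_gr_ds[OF W] h(1)[OF xc]] by simp
  have c: "?c \<gamma> \<in> grm W \<gamma>" for \<gamma> by (rule component_in[OF gm_gr_ds[OF W] h(1)[OF xc]])
  have hx: "?h x = (\<Sum>\<gamma>\<in>?I. ?c \<gamma>)" by (rule component_sum[OF gm_gr_ds[OF W] h(1)[OF xc] I]) simp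
  have "x = g (\<Sum>\<gamma>\<in>?I. ?c \<gamma>)" using h(2)[OF xc] hx by simp
  also have "\<dots> = (\<Sum>\<gamma>\<in>?I. g (?c \<gamma>))"
   by (rule lin_sum[OF lin gm_subspace[OF W] gm_gr_subset[OF W c]])
  finally have xs: "x = (\<Sum>\<gamma>\<in>?I. g (?c \<gamma>))" .
  have "component (grm M) \<beta> x = g (?c \<beta>)"
   by (subst xs) (use component_of_sum[OF gm_gr_ds[OF M] I module_map_gr[OF g c], of \<beta>] in simp)
  then have "x = g (?c \<beta>)" using component_of_summand[OF gm_gr_ds[OF M] x, of \<beta>] by simp
  then have "?h x = ?c \<beta>" using eq[OF gm_gr_subset[OF W c]] by metis
  then show "?h x \<in> grm W \<beta>" using c by metis
 qed
qed

context sgva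
begin

lemma extend_op_trunc:
 assumes W: "generalized_module V W" and u: "u \<in> completion W" and tr: "\<And>n. \<exists>N::nat. \<forall>m\<ge>N. u (n - of_nat m) = 0"
 shows "\<exists>K. \<forall>s\<le>K. extend_op W (act W v s) u n = 0"
proof (induction v rule: va_hom_induct)
 case (hom \<alpha> h v)
 obtain N :: nat where N: "\<forall>m\<ge>N. u (n - of_int h + 1 - of_nat m) = 0" using tr by blast
 have "extend_op W (act W v s) u n = 0" if s: "s \<le> - int N" for s
 proof -
  have "n - of_int (h - s - 1) = n - of_int h + 1 - of_nat (nat (- s))" using s by simp
  moreover have "nat (- s) \<ge> N" using s by simp
  ultimately have "u (n - of_int (h - s - 1)) = 0" using N by (simp only:)
  then show ?thesis by (simp only: extend_op_act_hom[OF W u hom_L0[OF hom]] gm_act_0[OF W])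
 qed
 then show ?case by blast
next
 case (add v w)
 then obtain K K' where "\<forall>s\<le>K. extend_op W (act W v s) u n = 0" "\<forall>s\<le>K'. extend_op W (act W w s) u n = 0" by blast
 then have "\<forall>s\<le>min K K'. extend_op W (act W (v + w) s) u n = 0" by (simp add: extend_op_act_v_add[OF W u])
 then show ?case by blast
qed

lemma extend_op_module_map:
 assumes P: "generalized_module V P" and Q: "generalized_module V Q" and k: "module_map P Q k" and u: "u \<in> completion P"
 shows "(\<lambda>n. k (u n)) \<in> completion Q"
  and "extend_op Q (act Q v s) (\<lambda>n. k (u n)) n = k (extend_op P (act P v s) u n)"
  and "j \<in> {-1,0,1} ==> extend_op Q (Lm Q j) (\<lambda>n. k (u n)) n = k (extend_op P (Lm P j) u n)"
proof -
 show ku: "(\<lambda>n. k (u n)) \<in> completion Q"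
  unfolding completion_def using module_map_wt[OF k P completion_wt[OF u]] by blast
 show "extend_op Q (act Q v s) (\<lambda>n. k (u n)) n = k (extend_op P (act P v s) u n)"
 proof (induction v rule: va_hom_induct)
  case (hom \<alpha> h v)
  show ?case
   unfolding extend_op_act_hom[OF Q ku hom_L0[OF hom]] extend_op_act_hom[OF P u hom_L0[OF hom]]
   by (rule module_map_act[OF k completion_carr[OF P u], symmetric])
 next
  case (add v w)
  show ?case
   unfolding extend_op_act_v_add[OF Q ku] extend_op_act_v_add[OF P u] add
   by (rule lin_add[OF mm_linear[OF k] completion_carr[OF P extend_op_act_completion[OF P u]]
      completion_carr[OF P extend_op_act_completion[OF P u]], symmetric])
 qed
 show "extend_op Q (Lm Q j) (\<lambda>n. k (u n)) n = k (extend_op P (Lm P j) u n)" if j: "j \<in> {-1,0,1}"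
  unfolding extend_op_L[OF Q ku j] extend_op_L[OF P u j]
  by (rule module_map_L[OF k j completion_carr[OF P u], symmetric])
qed

lemma intertwining_map_transport:
 assumes I: "intertwining_map V z P W1 W2 I" and k: "module_map P Q k"
  and P: "generalized_module V P" and Q: "generalized_module V Q"
  and W1: "generalized_module V W1" and W2: "generalized_module V W2"
 shows "intertwining_map V z Q W1 W2 (\<lambda>w1 w2 n. k (I w1 w2 n))"
proof -
 note lin = mm_linear[OF k]
 have k0: "k 0 = 0" by (rule lin_zero[OF lin gm_zero[OF P]])
 have Ic: "I w1 w2 n \<in> carr P" if "w1 \<in> carr W1" "w2 \<in> carr W2" for w1 w2 n
  by (rule completion_carr[OF P im_completion[OF I that]])
 have ksum: "Sum_any (\<lambda>b. c b *\<^sub>C k (x b)) = k (Sum_any (\<lambda>b. c b *\<^sub>C x b))"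
  if "finite {b. c b *\<^sub>C x b \<noteq> 0}" and x: "\<And>b. x b \<in> carr P" for c :: "int => complex" and x
 proof -
  have "Sum_any (\<lambda>b. c b *\<^sub>C k (x b)) = Sum_any (\<lambda>b. k (c b *\<^sub>C x b))"
   by (simp only: lin_scale[OF lin x])
  also have "\<dots> = k (Sum_any (\<lambda>b. c b *\<^sub>C x b))"
   by (rule Sum_any_image[where h = k, OF that(1) _ k0])
    (simp, rule lin_sum[OF lin gm_subspace[OF P]], rule gm_scale[OF P x])
  finally show ?thesis .
 qed
 have sc: "Sum_any (\<lambda>b. c b *\<^sub>C x b) \<in> carr P" if "\<And>b. x b \<in> carr P" for c :: "int => complex" and x
  unfolding Sum_any.expand_set by (rule gm_sum[OF P]) (rule gm_scale[OF P that])
 show ?thesis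
  unfolding intertwining_map_def
 proof (intro conjI ballI allI)
  show "linear_map_on (carr W1) (completion Q) (\<lambda>w1 n. k (I w1 w2 n))" if w2: "w2 \<in> carr W2" for w2
   unfolding linear_map_on_def
  proof (intro conjI ballI allI)
   show "(\<lambda>n. k (I x w2 n)) \<in> completion Q" if "x \<in> carr W1" for x
    by (rule extend_op_module_map(1)[OF P Q k im_completion[OF I that w2]])
   show "(\<lambda>n. k (I (x + y) w2 n)) = (\<lambda>n. k (I x w2 n)) + (\<lambda>n. k (I y w2 n))" if x: "x \<in> carr W1" "y \<in> carr W1" for x y
    unfolding lin_add[OF im_linear1[OF I w2] x]
    by (rule ext) (simp only: plus_fun_apply lin_add[OF lin Ic[OF x(1) w2] Ic[OF x(2) w2]])
   show "(\<lambda>n. k (I (c *\<^sub>C x) w2 n)) = c *\<^sub>C (\<lambda>n. k (I x w2 n))" if x: "x \<in> carr W1" for c x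
    unfolding lin_scale[OF im_linear1[OF I w2] x]
    by (rule ext) (simp only: scaleC_fun_apply lin_scale[OF lin Ic[OF x w2]])
  qed
  show "linear_map_on (carr W2) (completion Q) (\<lambda>w2 n. k (I w1 w2 n))" if w1: "w1 \<in> carr W1" for w1
   unfolding linear_map_on_def
  proof (intro conjI ballI allI)
   show "(\<lambda>n. k (I w1 x n)) \<in> completion Q" if "x \<in> carr W2" for x
    by (rule extend_op_module_map(1)[OF P Q k im_completion[OF I w1 that]])
   show "(\<lambda>n. k (I w1 (x + y) n)) = (\<lambda>n. k (I w1 x n)) + (\<lambda>n. k (I w1 y n))" if x: "x \<in> carr W2" "y \<in> carr W2" for x y
    unfolding lin_add[OF im_linear2[OF I w1] x]
    by (rule ext) (simp only: plus_fun_apply lin_add[OF lin Ic[OF w1 x(1)] Ic[OF w1 x(2)]])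
   show "(\<lambda>n. k (I w1 (c *\<^sub>C x) n)) = c *\<^sub>C (\<lambda>n. k (I w1 x n))" if x: "x \<in> carr W2" for c x
    unfolding lin_scale[OF im_linear2[OF I w1] x]
    by (rule ext) (simp only: scaleC_fun_apply lin_scale[OF lin Ic[OF w1 x]])
  qed
  show "k (I w1 w2 n) \<in> grm Q (\<beta> + \<gamma>)" if "w1 \<in> grm W1 \<beta>" "w2 \<in> grm W2 \<gamma>" for \<beta> \<gamma> n w1 w2
   by (rule module_map_gr[OF k im_gr[OF I that]])
  fix w1 w2 assume w: "w1 \<in> carr W1" "w2 \<in> carr W2"
  note u = im_completion[OF I w]
  show "\<exists>N::nat. \<forall>m\<ge>N. k (I w1 w2 (n - of_nat m)) = 0" for n
  proof -
   obtain N :: nat where "\<forall>m\<ge>N. I w1 w2 (n - of_nat m) = 0" using im_trunc[OF I w] by blast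
   then show ?thesis using k0 by (intro exI[of _ N]) simp
  qed
  show "extend_op Q (Lm Q j) (\<lambda>n. k (I w1 w2 n)) n = k (I w1 (Lm W2 j w2) n) +
    (\<Sum>i = 0..nat (j + 1). (of_nat (nat (j + 1) choose i) * z ^ i) *\<^sub>C k (I (Lm W1 (j - int i) w1) w2 n))" if j: "j \<in> {-1,0,1}" for j n
  proof -
   have ji: "j - int i \<in> {-1,0,1}" if "i \<in> {0..nat (j + 1)}" for i using that j by auto
   have c1: "I w1 (Lm W2 j w2) n \<in> carr P" by (rule Ic[OF w(1) gm_L_in[OF W2 j w(2)]])
   have c2: "I (Lm W1 (j - int i) w1) w2 n \<in> carr P" if "i \<in> {0..nat (j + 1)}" for i
    by (rule Ic[OF gm_L_in[OF W1 ji[OF that] w(1)] w(2)])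
   let ?S = "\<Sum>i = 0..nat (j + 1). (of_nat (nat (j + 1) choose i) * z ^ i) *\<^sub>C I (Lm W1 (j - int i) w1) w2 n"
   have "k ?S = (\<Sum>i = 0..nat (j + 1). k ((of_nat (nat (j + 1) choose i) * z ^ i) *\<^sub>C I (Lm W1 (j - int i) w1) w2 n))"
    by (rule lin_sum[OF lin gm_subspace[OF P] gm_scale[OF P c2]])
   also have "\<dots> = (\<Sum>i = 0..nat (j + 1). (of_nat (nat (j + 1) choose i) * z ^ i) *\<^sub>C k (I (Lm W1 (j - int i) w1) w2 n))"
    by (rule sum.cong[OF refl]) (rule lin_scale[OF lin c2])
   finally have kS: "k ?S = \<dots>" .
   show ?thesis
    unfolding extend_op_module_map(3)[OF P Q k u j] im_L[OF I j w] kS[symmetric]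
    by (rule lin_add[OF lin c1 gm_sum[OF P gm_scale[OF P c2]]])
  qed
  show "Sum_any (\<lambda>b. delta_snd z p b *\<^sub>C extend_op Q (act Q v (b - q - 1)) (\<lambda>n. k (I w1 w2 n)) n) =
    Sum_any (\<lambda>c. delta_den z q c *\<^sub>C k (I (act W1 v (c - p - 1) w1) w2 n)) +
    Sum_any (\<lambda>c. delta_fst_neg z p c *\<^sub>C k (I w1 (act W2 v (c - q - 1) w2) n))" for v n p q
  proof -
   obtain K where K: "\<forall>s\<le>K. extend_op P (act P v s) (I w1 w2) n = 0" using extend_op_trunc[OF P u im_trunc[OF I w]] by blast
   obtain N1 where N1: "\<forall>m\<ge>N1. act W1 v m w1 = 0" using gm_trunc[OF W1 w(1)] by blast
   obtain N2 where N2: "\<forall>m\<ge>N2. act W2 v m w2 = 0" using gm_trunc[OF W2 w(2)] by blast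
   have f1: "finite {b. delta_snd z p b *\<^sub>C extend_op P (act P v (b - q - 1)) (I w1 w2) n \<noteq> 0}"
    by (rule finite_delta_snd[of "K + q + 1"]) (use K in simp)
   have f2: "finite {c. delta_den z q c *\<^sub>C I (act W1 v (c - p - 1) w1) w2 n \<noteq> 0}"
    by (rule finite_delta_den[of "N1 + p + 1"]) (use N1 im_zero1[OF I w(2) gm_zero[OF W1]] in simp)
   have f3: "finite {c. delta_fst_neg z p c *\<^sub>C I w1 (act W2 v (c - q - 1) w2) n \<noteq> 0}"
    by (rule finite_delta_fst_neg[of "N2 + q + 1"]) (use N2 im_zero2[OF I w(1) gm_zero[OF W2]] in simp)
   have c1: "extend_op P (act P v s) (I w1 w2) n \<in> carr P" for s
    by (rule completion_carr[OF P extend_op_act_completion[OF P u]])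
   note c2 = Ic[OF gm_act_in[OF W1 w(1)] w(2)] and c3 = Ic[OF w(1) gm_act_in[OF W2 w(2)]]
   show ?thesis
    unfolding extend_op_module_map(2)[OF P Q k u] ksum[OF f1 c1] ksum[OF f2 c2] ksum[OF f3 c3] im_jacobi[OF I w]
    by (rule lin_add[OF lin sc[OF c2] sc[OF c3]])
  qed
 qed
qed

text \<open>
  The compatibility condition for the opposite vectors of \<open>v\<close>, summed over these, is the Jacobi
  identity for the opposite action of \<open>v\<close>.
\<close>

lemma compatible_jacobi:
 assumes U1: "generalized_module V U1" and U2: "generalized_module V U2" and \<nu>: "\<nu> \<in> dual2 (carr U1) (carr U2)"
  and c: "P_compatible V z U1 U2 \<nu>" and u: "u1 \<in> carr U1" "u2 \<in> carr U2"
 shows "Sum_any (\<lambda>b. delta_snd z p b * P_opp z U1 U2 \<nu> u1 u2 v (b - q - 1)) =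
  Sum_any (\<lambda>c. delta_den z q c * \<nu> (act U1 v (c - p - 1) u1) u2) +
  Sum_any (\<lambda>c. delta_fst_neg z p c * \<nu> u1 (act U2 v (c - q - 1) u2))"
proof -
 let ?E = "{e. opp_vec V v e \<noteq> 0}"
 have E: "finite ?E" "\<And>e. e \<notin> ?E ==> opp_vec V v e = 0" using opp_vec_finite by auto
 define y where "y = opp_vec V v"
 note lin1 = dual2_linear1[OF \<nu> u(2)] and lin2 = dual2_linear2[OF \<nu> u(1)]
 have \<nu>0: "\<nu> 0 u2 = 0" "\<nu> u1 0 = 0"
  using lin_zero[OF lin1 gm_zero[OF U1]] lin_zero[OF lin2 gm_zero[OF U2]] .
 have 1: "(\<Sum>e\<in>?E. P_first_term V z U1 (y e) \<nu> u1 u2 (e - q) p) =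
   Sum_any (\<lambda>c. delta_den z q c * \<nu> (act U1 v (c - p - 1) u1) u2)"
 proof -
  define X where "X = (\<lambda>v d. Sum_any (\<lambda>c. delta_den z (d + q) c * \<nu> (act U1 v (c - p - 1) u1) u2))"
  have X_add: "X (v + w) d = X v d + X w d" for v w d
  proof -
   obtain N where N: "\<forall>m\<ge>N. act U1 v m u1 = 0" using gm_trunc[OF U1 u(1)] by blast
   obtain N' where N': "\<forall>m\<ge>N'. act U1 w m u1 = 0" using gm_trunc[OF U1 u(1)] by blast
   have f: "finite {c. delta_den z (d + q) c * \<nu> (act U1 v (c - p - 1) u1) u2 \<noteq> 0}"
    using finite_delta_den[of "N + p + 1" "\<lambda>c. \<nu> (act U1 v (c - p - 1) u1) u2" z "d + q"] N \<nu>0 by simp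
   have f': "finite {c. delta_den z (d + q) c * \<nu> (act U1 w (c - p - 1) u1) u2 \<noteq> 0}"
    using finite_delta_den[of "N' + p + 1" "\<lambda>c. \<nu> (act U1 w (c - p - 1) u1) u2" z "d + q"] N' \<nu>0 by simp
   show ?thesis unfolding X_def Sum_any.distrib[OF f f', symmetric]
    by (simp only: gm_act_v_add[OF U1 u(1)] lin_add[OF lin1 gm_act_in[OF U1 u(1)] gm_act_in[OF U1 u(1)]] distrib_left)
  qed
  have X0: "X 0 d = 0" for d unfolding X_def by (simp add: gm_act_v_0[OF U1 u(1)] \<nu>0)
  have "P_first_term V z U1 (y e) \<nu> u1 u2 (e - q) p = Sum_any (\<lambda>f. X (opp_vec V (y e) f) (f - e))" for e
  proof -
   let ?F = "{f. opp_vec V (y e) f \<noteq> 0}"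
   have F: "finite ?F" "\<And>f. f \<notin> ?F ==> opp_vec V (y e) f = 0" using opp_vec_finite by auto
   have "P_first_term V z U1 (y e) \<nu> u1 u2 (e - q) p =
    (\<Sum>f\<in>?F. Sum_any (\<lambda>c. delta_den z (f - (e - q)) c * \<nu> (act U1 (opp_vec V (y e) f) (c - p - 1) u1) u2))"
    by (rule P_first_term_eq[OF U1 U2 \<nu> u F(1)]) (rule F(2))
   also have "\<dots> = (\<Sum>f\<in>?F. X (opp_vec V (y e) f) (f - e))"
    unfolding X_def by (simp add: algebra_simps)
   also have "\<dots> = Sum_any (\<lambda>f. X (opp_vec V (y e) f) (f - e))"
    by (rule Sum_any_superset[OF F(1), symmetric]) (subst F(2), assumption, rule X0)
   finally show ?thesis .
  qed
  then have "(\<Sum>e\<in>?E. P_first_term V z U1 (y e) \<nu> u1 u2 (e - q) p) = X v 0"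
   unfolding y_def using sum_opp_opp[of X, OF X_add E] by simp
  then show ?thesis by (simp add: X_def)
 qed
 have 2: "(\<Sum>e\<in>?E. Sum_any (\<lambda>c. delta_fst_neg z p c * \<nu> u1 (opp_coeff V U2 (y e) (e - q + c) u2))) =
   Sum_any (\<lambda>c. delta_fst_neg z p c * \<nu> u1 (act U2 v (c - q - 1) u2))"
 proof -
  have f: "finite {c. delta_fst_neg z p c * \<nu> u1 (opp_coeff V U2 (y e) (e - q + c) u2) \<noteq> 0}" for e
  proof -
   obtain N where N: "\<forall>q'\<ge>N. opp_coeff V U2 (y e) q' u2 = 0" using opp_coeff_trunc[OF U2 u(2)] by blast
   show ?thesis
    using finite_delta_fst_neg[of "N - e + q" "\<lambda>c. \<nu> u1 (opp_coeff V U2 (y e) (e - q + c) u2)" z p] N \<nu>0 by simp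
  qed
  have "(\<Sum>e\<in>?E. delta_fst_neg z p c * \<nu> u1 (opp_coeff V U2 (y e) (e - q + c) u2)) = delta_fst_neg z p c * \<nu> u1 (act U2 v (c - q - 1) u2)" for c
  proof -
   have "(\<Sum>e\<in>?E. \<nu> u1 (opp_coeff V U2 (y e) (e - q + c) u2)) = \<nu> u1 (\<Sum>e\<in>?E. opp_coeff V U2 (y e) (e - q + c) u2)"
    by (rule lin_sum[OF lin2 gm_subspace[OF U2] opp_coeff_in[OF U2 u(2)], symmetric])
   also have "\<dots> = \<nu> u1 (act U2 v (c - q - 1) u2)"
    using opp_coeff_opp[OF U2 u(2) E, of "c - q"] by (simp add: y_def add.commute add_diff_eq)
   finally show ?thesis by (simp add: sum_distrib_left[symmetric])
  qed
  then show ?thesis unfolding Sum_any_int_sum[OF E(1) f, symmetric] by simp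
 qed
 have 3: "(\<Sum>e\<in>?E. Sum_any (\<lambda>b. delta_snd z p b * P_act V z U1 U2 (y e) (- (e - q + b) - 1) \<nu> u1 u2)) =
   Sum_any (\<lambda>b. delta_snd z p b * P_opp z U1 U2 \<nu> u1 u2 v (b - q - 1))"
 proof -
  have f: "finite {b. delta_snd z p b * P_act V z U1 U2 (y e) (- (e - q + b) - 1) \<nu> u1 u2 \<noteq> 0}" for e
  proof -
   obtain N where N: "\<forall>m\<ge>N. P_act V z U1 U2 (y e) m \<nu> = 0" using c unfolding P_compatible_def by blast
   show ?thesis
    using finite_delta_snd[of "- N - e + q - 1" "\<lambda>b. P_act V z U1 U2 (y e) (- (e - q + b) - 1) \<nu> u1 u2" z p] N by simp
  qed
  have "(\<Sum>e\<in>?E. delta_snd z p b * P_act V z U1 U2 (y e) (- (e - q + b) - 1) \<nu> u1 u2) = delta_snd z p b * P_opp z U1 U2 \<nu> u1 u2 v (b - q - 1)" for b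
  proof -
   have e: "- (b - q - 1) - e - 2 = - (e - q + b) - 1" for e by simp
   have "(\<Sum>e\<in>?E. P_act V z U1 U2 (y e) (- (b - q - 1) - e - 2) \<nu> u1 u2) = P_opp z U1 U2 \<nu> u1 u2 v (b - q - 1)"
    unfolding y_def by (rule opp_sum_P_act[OF U1 U2 \<nu> u E(1)]) (rule E(2))
   then show ?thesis by (simp only: e sum_distrib_left[symmetric])
  qed
  then show ?thesis unfolding Sum_any_int_sum[OF E(1) f, symmetric] by simp
 qed
 have "P_first_term V z U1 (y e) \<nu> u1 u2 (e - q) p + Sum_any (\<lambda>c. delta_fst_neg z p c * \<nu> u1 (opp_coeff V U2 (y e) (e - q + c) u2)) =
   Sum_any (\<lambda>b. delta_snd z p b * P_act V z U1 U2 (y e) (- (e - q + b) - 1) \<nu> u1 u2)" for e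
  using c u unfolding P_compatible_def by blast
 then have "(\<Sum>e\<in>?E. P_first_term V z U1 (y e) \<nu> u1 u2 (e - q) p) + (\<Sum>e\<in>?E. Sum_any (\<lambda>c. delta_fst_neg z p c * \<nu> u1 (opp_coeff V U2 (y e) (e - q + c) u2))) =
   (\<Sum>e\<in>?E. Sum_any (\<lambda>b. delta_snd z p b * P_act V z U1 U2 (y e) (- (e - q + b) - 1) \<nu> u1 u2))"
  by (simp only: sum.distrib[symmetric])
 then show ?thesis unfolding 1 2 3 by simp
qed


text \<open>
  In the next lemmas \<open>M\<close> is a module with a module map \<open>h\<close> to a space \<open>S\<close> of compatible forms; it is
  applied to an isomorphism.
\<close>

context
 fixes z :: complex and W1 :: "('v, 'g, 'a::complex_vector) vmod" and W2 :: "('v, 'g, 'b::complex_vector) vmod"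
  and S :: "('a => 'b => complex) set" and M :: "('v, 'g, 'm::complex_vector) vmod" and h :: "'m => 'a => 'b => complex" and K :: nat
 assumes W1: "generalized_module V W1" and W2: "generalized_module V W2" and M: "generalized_module V M"
  and PS: "generalized_module V (P_module V z W1 W2 S)"
  and h: "module_map M (P_module V z W1 W2 S) h"
  and dual: "\<And>\<nu>. \<nu> \<in> S ==> \<nu> \<in> dual2 (carr W1) (carr W2)"
  and comp: "\<And>\<nu>. \<nu> \<in> S ==> P_compatible V z W1 W2 \<nu>"
  and N: "generalized_module V (contragredient V M)"
  and K: "\<And>n w. w \<in> wtm M n ==> (shift_op (Lm M 0) n ^^ K) w = 0"
begin

text \<open>
  The intertwining map that sends $(w_1,w_2)$ to the element of the completion of \<open>M'\<close> given by
  evaluation of the forms \<open>h m\<close> at $(w_1,w_2)$; its component of weight \<open>n\<close> is evaluation after projection.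
\<close>

definition evaluation_map where
 "evaluation_map w1 w2 n = (\<lambda>m. if m \<in> carr M then h (component (wtm M) n m) w1 w2 else 0)"

abbreviation "J \<equiv> evaluation_map"

lemma h_S: "m \<in> carr M ==> h m \<in> S"
 using lin_in[OF mm_linear[OF h]] by (simp add: P_module_def)

lemma h_dual2: "m \<in> carr M ==> h m \<in> dual2 (carr W1) (carr W2)"
 by (rule dual[OF h_S])

lemma h_add: "m \<in> carr M ==> m' \<in> carr M ==> h (m + m') = h m + h m'"
 and h_scale: "m \<in> carr M ==> h (c *\<^sub>C m) = c *\<^sub>C h m"
 using lin_add[OF mm_linear[OF h]] lin_scale[OF mm_linear[OF h]] by blast+

lemma comp_in: "m \<in> carr M ==> component (wtm M) n m \<in> carr M"
 by (rule gm_wt_subset[OF M component_in[OF gm_wt_ds[OF M]]])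

lemma J_wt: "m \<in> wtm M n' ==> J w1 w2 n m = (if n = n' then h m w1 w2 else 0)"
proof -
 assume m: "m \<in> wtm M n'"
 have "h 0 = 0" by (rule lin_zero[OF mm_linear[OF h] gm_zero[OF M]])
 then have "h 0 w1 w2 = 0" by simp
 then show ?thesis
  unfolding evaluation_map_def using component_of_summand[OF gm_wt_ds[OF M] m, of n] gm_wt_subset[OF M m] by simp
qed

lemma J_dual1:
 "J w1 w2 n \<in> dual1 (carr M)"
proof -
 note cl = component_linear[OF gm_wt_ds[OF M], of n]
 have "linear_map_on (carr M) UNIV (J w1 w2 n)"
  unfolding linear_map_on_def evaluation_map_def
  using gm_add[OF M] gm_scale[OF M] lin_add[OF cl] lin_scale[OF cl] h_add[OF comp_in comp_in] h_scale[OF comp_in] by simp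
 then show ?thesis unfolding dual1_def evaluation_map_def by simp
qed

lemma J_piece:
 assumes w: "w1 \<in> grm W1 \<beta>1" "w2 \<in> grm W2 \<beta>2"
 shows "J w1 w2 n \<in> contragredient_piece M (\<beta>1 + \<beta>2) n"
proof -
 have "J w1 w2 n m = 0" if "(\<gamma>, n') \<noteq> (- (\<beta>1 + \<beta>2), n)" "m \<in> grm M \<gamma>" "m \<in> wtm M n'" for \<gamma> n' m
 proof (cases "n = n'")
  case True
  then have "\<gamma> \<noteq> - (\<beta>1 + \<beta>2)" using that(1) by blast
  then have "\<beta>1 + \<beta>2 \<noteq> - \<gamma>" by (metis minus_minus)
  moreover have "h m \<in> tensor_dual_gr W1 W2 \<gamma>" using module_map_gr[OF h that(2)] by (simp add: P_module_def)
  ultimately have "h m w1 w2 = 0" using tensor_dual_gr_vanish w by blast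
  then show ?thesis by (simp add: J_wt[OF that(3)])
 qed (simp add: J_wt[OF that(3)])
 then show ?thesis unfolding contragredient_piece_def using J_dual1 by blast
qed

lemma J_add1: "w1 \<in> carr W1 ==> w1' \<in> carr W1 ==> w2 \<in> carr W2 ==> J (w1 + w1') w2 n = J w1 w2 n + J w1' w2 n"
 by (rule ext) (auto simp: evaluation_map_def lin_add[OF dual2_linear1[OF h_dual2[OF comp_in]]])
lemma J_scale1: "w1 \<in> carr W1 ==> w2 \<in> carr W2 ==> J (c *\<^sub>C w1) w2 n = c *\<^sub>C J w1 w2 n"
 by (rule ext) (auto simp: evaluation_map_def lin_scale[OF dual2_linear1[OF h_dual2[OF comp_in]]])
lemma J_add2: "w1 \<in> carr W1 ==> w2 \<in> carr W2 ==> w2' \<in> carr W2 ==> J w1 (w2 + w2') n = J w1 w2 n + J w1 w2' n"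
 by (rule ext) (auto simp: evaluation_map_def lin_add[OF dual2_linear2[OF h_dual2[OF comp_in]]])
lemma J_scale2: "w1 \<in> carr W1 ==> w2 \<in> carr W2 ==> J w1 (c *\<^sub>C w2) n = c *\<^sub>C J w1 w2 n"
 by (rule ext) (auto simp: evaluation_map_def lin_scale[OF dual2_linear2[OF h_dual2[OF comp_in]]])

lemma J_induct:
 assumes w: "w1 \<in> carr W1" "w2 \<in> carr W2"
  and hom: "\<And>w1 w2 \<beta>1 \<beta>2. w1 \<in> grm W1 \<beta>1 ==> w2 \<in> grm W2 \<beta>2 ==> P (J w1 w2)"
  and add: "\<And>f g. P f ==> P g ==> P (f + g)"
 shows "P (J w1 w2)"
proof (rule ds_induct[OF gm_gr_ds[OF W1] w(1)])
 fix \<beta>1 w1 assume w1: "w1 \<in> grm W1 \<beta>1"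
 show "P (J w1 w2)"
 proof (rule ds_induct[OF gm_gr_ds[OF W2] w(2)])
  show "P (J w1 w2)" if "w2 \<in> grm W2 \<beta>2" for \<beta>2 w2 by (rule hom[OF w1 that])
  fix x y assume xy: "x \<in> carr W2" "y \<in> carr W2" and P: "P (J w1 x)" "P (J w1 y)"
  have "J w1 (x + y) = J w1 x + J w1 y"
   by (rule ext) (simp only: plus_fun_apply[of "J w1 x"] J_add2[OF gm_gr_subset[OF W1 w1] xy])
  then show "P (J w1 (x + y))" using add[OF P] by (simp only:)
 qed
next
 fix x y assume xy: "x \<in> carr W1" "y \<in> carr W1" and P: "P (J x w2)" "P (J y w2)"
 have "J (x + y) w2 = J x w2 + J y w2"
  by (rule ext) (simp only: plus_fun_apply[of "J x w2"] J_add1[OF xy w(2)])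
 then show "P (J (x + y) w2)" using add[OF P] by (simp only:)
qed

lemma J_completion:
 assumes w: "w1 \<in> carr W1" "w2 \<in> carr W2"
 shows "J w1 w2 \<in> completion (contragredient V M)"
proof (rule J_induct[OF w])
 show "J w1 w2 \<in> completion (contragredient V M)" if "w1 \<in> grm W1 \<beta>1" "w2 \<in> grm W2 \<beta>2" for w1 w2 \<beta>1 \<beta>2
  unfolding completion_def using contragredient_piece_wt[OF M K J_piece[OF that]] by blast
 show "f + g \<in> completion (contragredient V M)" if "f \<in> completion (contragredient V M)" "g \<in> completion (contragredient V M)" for f g
  by (rule csub_add[OF csubspace_completion[OF N] that])
qed

lemma J_trunc:
 assumes w: "w1 \<in> carr W1" "w2 \<in> carr W2"
 shows "\<exists>Na::nat. \<forall>m\<ge>Na. J w1 w2 (n - of_nat m) = 0"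
proof (rule J_induct[OF w])
 fix w1 w2 \<beta>1 \<beta>2 assume w: "w1 \<in> grm W1 \<beta>1" "w2 \<in> grm W2 \<beta>2"
 obtain K0 :: int where K0: "\<forall>k<K0. grm M (- (\<beta>1 + \<beta>2)) \<inter> wtm M (n + of_int k) = {0}"
  using gm_bound[OF M] by blast
 have "J w1 w2 (n - of_nat m) = 0" if m: "m \<ge> nat (1 - K0)" for m
 proof (rule ext)
  fix x
  let ?J = "J w1 w2 (n - of_nat m)"
  note lin = dual1_linear[OF J_dual1[of w1 w2 "n - of_nat m"]]
  have "?J x = 0" if x: "x \<in> carr M"
  proof (rule linear_eq_on_hom[OF M lin _ _ x, of "\<lambda>_. 0"])
   show "linear_map_on (carr M) UNIV (\<lambda>_. 0 :: complex)" by (simp add: linear_map_on_def)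
   fix \<gamma> n' y assume y: "y \<in> grm M \<gamma>" "y \<in> wtm M n'"
   show "?J y = 0"
   proof (cases "(\<gamma>, n') = (- (\<beta>1 + \<beta>2), n - of_nat m)")
    case True
    have "n - of_nat m = n + of_int (- int m)" "- int m < K0" using m by auto
    then have "grm M (- (\<beta>1 + \<beta>2)) \<inter> wtm M (n - of_nat m) = {0}" using K0 by (simp only:)
    then have "y = 0" using y True by blast
    then show ?thesis using lin_zero[OF lin gm_zero[OF M]] by (simp only:)
   next
    case False
    then show ?thesis using piece_vanish[OF J_piece[OF w] y] by blast
   qed
  qed
  moreover have "?J x = 0" if "x \<notin> carr M" by (rule dual1_outside[OF J_dual1 that])
  ultimately show "?J x = 0 x" by auto
 qed
 then show "\<exists>Na::nat. \<forall>m\<ge>Na. J w1 w2 (n - of_nat m) = 0" by blast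
next
 fix f g :: "complex => 'm => complex"
 assume "\<exists>Na::nat. \<forall>m\<ge>Na. f (n - of_nat m) = 0" "\<exists>Na::nat. \<forall>m\<ge>Na. g (n - of_nat m) = 0"
 then obtain N1 N2 :: nat where N12: "\<And>m. m \<ge> N1 ==> f (n - of_nat m) = 0" "\<And>m. m \<ge> N2 ==> g (n - of_nat m) = 0" by blast
 have "(f + g) (n - of_nat m) = 0" if "m \<ge> max N1 N2" for m
  using N12(1)[of m] N12(2)[of m] that by (simp add: plus_fun_apply[of f])
 then show "\<exists>Na::nat. \<forall>m\<ge>Na. (f + g) (n - of_nat m) = 0" by blast
qed

lemma J_extend_act:
 assumes w: "w1 \<in> carr W1" "w2 \<in> carr W2" and m: "m \<in> wtm M n"
 shows "extend_op (contragredient V M) (act (contragredient V M) v s) (J w1 w2) n m = P_opp z W1 W2 (h m) w1 w2 v s"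
proof (induction v rule: va_hom_induct)
 case (hom \<alpha> k v)
 note u = J_completion[OF w] and mc = gm_wt_subset[OF M m]
 let ?y = "opp_coeff V M v (- s - 1) m"
 note yeq = opp_coeff_eq[OF M mc, of v "- s - 1"]
 have y: "?y \<in> wtm M (n - of_int (k - s - 1))"
  unfolding yeq
 proof (rule csub_sum[OF ds_summand[OF gm_wt_ds[OF M]]])
  fix e
  have "act M (opp_vec V v e) (- s - 1 - e - 1) m \<in> wtm M (n + of_int (- k - e - (- s - 1 - e - 1) - 1))"
   by (rule gm_act_wt[OF M hom_L0[OF opp_vec_in[OF hom]] m])
  moreover have "- k - e - (- s - 1 - e - 1) - 1 = - (k - s - 1)" by simp
  ultimately show "act M (opp_vec V v e) (- s - 1 - e - 1) m \<in> wtm M (n - of_int (k - s - 1))"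
   by (metis diff_conv_add_uminus of_int_minus)
 qed
 have "extend_op (contragredient V M) (act (contragredient V M) v s) (J w1 w2) n m = J w1 w2 (n - of_int (k - s - 1)) ?y"
  unfolding extend_op_act_hom[OF N u hom_L0[OF hom]] contragredient_act using mc by simp
 also have "\<dots> = h ?y w1 w2" unfolding J_wt[OF y] by simp
 also have "h ?y = opp_coeff V (P_module V z W1 W2 S) v (- s - 1) (h m)"
 proof -
  have hm: "h m \<in> carr (P_module V z W1 W2 S)" by (rule lin_in[OF mm_linear[OF h] mc])
  have "h ?y = (\<Sum>e | opp_vec V v e \<noteq> 0. h (act M (opp_vec V v e) (- s - 1 - e - 1) m))"
   unfolding yeq by (rule lin_sum[OF mm_linear[OF h] gm_subspace[OF M] gm_act_in[OF M mc]])
  also have "\<dots> = (\<Sum>e | opp_vec V v e \<noteq> 0. act (P_module V z W1 W2 S) (opp_vec V v e) (- s - 1 - e - 1) (h m))"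
   by (simp only: module_map_act[OF h mc])
  also have "\<dots> = opp_coeff V (P_module V z W1 W2 S) v (- s - 1) (h m)"
   by (rule opp_coeff_eq[OF PS hm, symmetric])
  finally show ?thesis .
 qed
 also have "\<dots> w1 w2 = P_opp z W1 W2 (h m) w1 w2 v s"
  by (rule opp_coeff_P_module[OF W1 W2 h_dual2[OF mc] w])
 finally show ?case .
next
 case (add v v')
 show ?case
  unfolding extend_op_act_v_add[OF N J_completion[OF w]] plus_fun_apply add
  by (rule P_opp_add[OF W1 W2 h_dual2[OF gm_wt_subset[OF M m]] w, symmetric])
qed

lemma completion_contragredient_eqI:
 assumes "f \<in> wtm (contragredient V M) n" "g \<in> wtm (contragredient V M) n" "\<And>m. m \<in> wtm M n ==> f m = g m"
 shows "f = g"
proof (rule ext)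
 fix x
 note fd = contragredient_dual1[OF gm_wt_subset[OF N assms(1)]] and gd = contragredient_dual1[OF gm_wt_subset[OF N assms(2)]]
 have "f x = g x" if x: "x \<in> carr M"
 proof (rule linear_eq_on_hom[OF M dual1_linear[OF fd] dual1_linear[OF gd] _ x])
  fix \<gamma> n' w assume w: "w \<in> grm M \<gamma>" "w \<in> wtm M n'"
  show "f w = g w"
  proof (cases "n' = n")
   case True then show ?thesis using w(2) assms(3) by blast
  next
   case False
   then show ?thesis using contragredient_wt_vanish[OF M assms(1) w(2)] contragredient_wt_vanish[OF M assms(2) w(2)] by simp
  qed
 qed
 then show "f x = g x" using dual1_outside[OF fd] dual1_outside[OF gd] by (cases "x \<in> carr M") auto
qed

lemma Sum_any_fun_apply:
 fixes g :: "int => 'm => complex"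
 assumes f: "finite {c. a c *\<^sub>C g c \<noteq> 0}"
 shows "Sum_any (\<lambda>c. a c *\<^sub>C g c) m = Sum_any (\<lambda>c. a c * g c m)"
proof -
 have z: "a c * g c m = 0" if "c \<notin> {c. a c *\<^sub>C g c \<noteq> 0}" for c
 proof -
  have "a c *\<^sub>C g c = 0" using that by blast
  from fun_cong[OF this, of m] show ?thesis by (simp only: scaleC_fun_apply scaleC_complex zero_fun_apply)
 qed
 have "Sum_any (\<lambda>c. a c * g c m) = (\<Sum>c\<in>{c. a c *\<^sub>C g c \<noteq> 0}. a c * g c m)"
  by (rule Sum_any_superset[OF f z])
 also have "\<dots> = Sum_any (\<lambda>c. a c *\<^sub>C g c) m"
  unfolding Sum_any.expand_set sum_fun_apply by (simp only: scaleC_fun_apply scaleC_complex)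
 finally show ?thesis by simp
qed

lemma J_intertwining: "intertwining_map V z (contragredient V M) W1 W2 J"
 unfolding intertwining_map_def
proof (intro conjI ballI allI)
 let ?C = "contragredient V M"
 show "linear_map_on (carr W1) (completion ?C) (\<lambda>w1. J w1 w2)" if w2: "w2 \<in> carr W2" for w2
  unfolding linear_map_on_def
 proof (intro conjI ballI allI)
  show "J x w2 \<in> completion ?C" if "x \<in> carr W1" for x by (rule J_completion[OF that w2])
  show "J (x + y) w2 = J x w2 + J y w2" if "x \<in> carr W1" "y \<in> carr W1" for x y
   by (rule ext) (simp only: plus_fun_apply[of "J x w2"] J_add1[OF that w2])
  show "J (c *\<^sub>C x) w2 = c *\<^sub>C J x w2" if "x \<in> carr W1" for c x
   by (rule ext) (simp only: scaleC_fun_apply[of c "J x w2"] J_scale1[OF that w2])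
 qed
 show "linear_map_on (carr W2) (completion ?C) (J w1)" if w1: "w1 \<in> carr W1" for w1
  unfolding linear_map_on_def
 proof (intro conjI ballI allI)
  show "J w1 x \<in> completion ?C" if "x \<in> carr W2" for x by (rule J_completion[OF w1 that])
  show "J w1 (x + y) = J w1 x + J w1 y" if "x \<in> carr W2" "y \<in> carr W2" for x y
   by (rule ext) (simp only: plus_fun_apply[of "J w1 x"] J_add2[OF w1 that])
  show "J w1 (c *\<^sub>C x) = c *\<^sub>C J w1 x" if "x \<in> carr W2" for c x
   by (rule ext) (simp only: scaleC_fun_apply[of c "J w1 x"] J_scale2[OF w1 that])
 qed
 show "J w1 w2 n \<in> grm ?C (\<beta> + \<gamma>)" if "w1 \<in> grm W1 \<beta>" "w2 \<in> grm W2 \<gamma>" for \<beta> \<gamma> n w1 w2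
  using J_piece[OF that] piece_subset(2) by blast
 fix w1 w2 assume w: "w1 \<in> carr W1" "w2 \<in> carr W2"
 note u = J_completion[OF w]
 have J01: "J 0 w2 n = 0" for n using J_scale1[OF w, of 0 n] by (simp only: complex_vector.scale_zero_left)
 have J02: "J w1 0 n = 0" for n using J_scale2[OF w, of 0 n] by (simp only: complex_vector.scale_zero_left)
 show "\<exists>Na::nat. \<forall>m\<ge>Na. J w1 w2 (n - of_nat m) = 0" for n by (rule J_trunc[OF w])
 have wt_sub: "csubspace (wtm ?C n)" for n by (rule ds_summand[OF gm_wt_ds[OF N]])
 show "extend_op ?C (Lm ?C j) (J w1 w2) n = J w1 (Lm W2 j w2) n +
    (\<Sum>i = 0..nat (j + 1). (of_nat (nat (j + 1) choose i) * z ^ i) *\<^sub>C J (Lm W1 (j - int i) w1) w2 n)" (is "?L = ?R") if j: "j \<in> {-1,0,1}" for j n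
 proof (rule completion_contragredient_eqI)
  have ji: "j - int i \<in> {-1,0,1}" if "i \<in> {0..nat (j + 1)}" for i using that j by auto
  have mj: "- j \<in> {-1,0,1}" using j by auto
  show "?L \<in> wtm ?C n" by (rule completion_wt[OF extend_op_L_completion[OF N u j]])
  show "?R \<in> wtm ?C n"
   by (intro csub_add[OF wt_sub] csub_sum[OF wt_sub] csub_scale[OF wt_sub]
     completion_wt[OF J_completion] gm_L_in[OF W1 ji] gm_L_in[OF W2 j] w)
  fix m assume m: "m \<in> wtm M n"
  note mc = gm_wt_subset[OF M m]
  have Lm: "Lm M (- j) m \<in> wtm M (n + of_int j)" using gm_L_wt[OF M mj m] by simp
  have "?L m = J w1 w2 (n + of_int j) (Lm M (- j) m)"
   unfolding extend_op_L[OF N u j] contragredient_Lm using mc by simp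
  also have "\<dots> = h (Lm M (- j) m) w1 w2" by (simp add: J_wt[OF Lm])
  also have "h (Lm M (- j) m) = P_L z W1 W2 (- j) (h m)"
   using module_map_L[OF h mj mc] by (simp add: P_module_def)
  also have "\<dots> w1 w2 = ?R m"
   unfolding plus_fun_apply sum_fun_apply scaleC_fun_apply J_wt[OF m] P_L_def using w by (simp add: add.commute)
  finally show "?L m = ?R m" .
 qed
 show "Sum_any (\<lambda>b. delta_snd z p b *\<^sub>C extend_op ?C (act ?C v (b - q - 1)) (J w1 w2) n) =
    Sum_any (\<lambda>c. delta_den z q c *\<^sub>C J (act W1 v (c - p - 1) w1) w2 n) +
    Sum_any (\<lambda>c. delta_fst_neg z p c *\<^sub>C J w1 (act W2 v (c - q - 1) w2) n)" (is "?L = ?R1 + ?R2") for v n p q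
 proof (rule completion_contragredient_eqI)
  obtain Ka where Ka: "\<forall>s\<le>Ka. extend_op ?C (act ?C v s) (J w1 w2) n = 0" using extend_op_trunc[OF N u J_trunc[OF w]] by blast
  obtain N1 where N1: "\<forall>m\<ge>N1. act W1 v m w1 = 0" using gm_trunc[OF W1 w(1)] by blast
  obtain N2 where N2: "\<forall>m\<ge>N2. act W2 v m w2 = 0" using gm_trunc[OF W2 w(2)] by blast
  have f1: "finite {b. delta_snd z p b *\<^sub>C extend_op ?C (act ?C v (b - q - 1)) (J w1 w2) n \<noteq> 0}"
   by (rule finite_delta_snd[of "Ka + q + 1"]) (use Ka in simp)
  have f2: "finite {c. delta_den z q c *\<^sub>C J (act W1 v (c - p - 1) w1) w2 n \<noteq> 0}"
   by (rule finite_delta_den[of "N1 + p + 1"]) (use N1 J01 in simp)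
  have f3: "finite {c. delta_fst_neg z p c *\<^sub>C J w1 (act W2 v (c - q - 1) w2) n \<noteq> 0}"
   by (rule finite_delta_fst_neg[of "N2 + q + 1"]) (use N2 J02 in simp)
  have wt: "Sum_any (\<lambda>b. c b *\<^sub>C x b) \<in> wtm ?C n" if "\<And>b. x b \<in> wtm ?C n" for c :: "int => complex" and x
   unfolding Sum_any.expand_set by (rule csub_sum[OF wt_sub]) (rule csub_scale[OF wt_sub that])
  show "?L \<in> wtm ?C n" by (rule wt[OF completion_wt[OF extend_op_act_completion[OF N u]]])
  show "?R1 + ?R2 \<in> wtm ?C n"
   by (rule csub_add[OF wt_sub wt[OF completion_wt[OF J_completion[OF gm_act_in[OF W1 w(1)] w(2)]]]
      wt[OF completion_wt[OF J_completion[OF w(1) gm_act_in[OF W2 w(2)]]]]])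
  fix m assume m: "m \<in> wtm M n"
  note mc = gm_wt_subset[OF M m]
  show "?L m = (?R1 + ?R2) m"
   unfolding plus_fun_apply Sum_any_fun_apply[OF f1] Sum_any_fun_apply[OF f2] Sum_any_fun_apply[OF f3] J_extend_act[OF w m]
   unfolding J_wt[OF m] compatible_jacobi[OF W1 W2 h_dual2[OF mc] comp[OF h_S[OF mc]] w] by simp
 qed
qed

lemma contragredient_evaluation:
 assumes m: "m \<in> carr M"
 shows "(\<lambda>f. if f \<in> carr (contragredient V M) then f m else 0) \<in> carr (contragredient V (contragredient V M))"
proof (rule gm_hom_induct[OF M m])
 let ?C = "contragredient V M"
 fix \<beta> n w assume w: "w \<in> grm M \<beta>" "w \<in> wtm M n"
 have "(\<lambda>f. if f \<in> carr ?C then f w else 0) \<in> contragredient_piece ?C \<beta> n"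
 proof -
  have "(\<lambda>f. if f \<in> carr ?C then f w else 0) \<in> dual1 (carr ?C)"
   unfolding dual1_def linear_map_on_def using gm_add[OF N] gm_scale[OF N] by simp
  moreover have "f w = 0" if "(\<gamma>, k) \<noteq> (- \<beta>, n)" "f \<in> grm ?C \<gamma>" "f \<in> wtm ?C k" for \<gamma> k f
   using contragredient_gr_vanish[OF M that(2) w(1)] contragredient_wt_vanish[OF M that(3) w(2)] that(1) by fastforce
  ultimately show ?thesis unfolding contragredient_piece_def by simp
 qed
 then show "(\<lambda>f. if f \<in> carr ?C then f w else 0) \<in> carr (contragredient V ?C)"
  using piece_subset(1) by blast
next
 let ?C = "contragredient V M"
 fix x y assume xy: "x \<in> carr M" "y \<in> carr M"
  and ev: "(\<lambda>f. if f \<in> carr ?C then f x else 0) \<in> carr (contragredient V ?C)" "(\<lambda>f. if f \<in> carr ?C then f y else 0) \<in> carr (contragredient V ?C)"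
 have "csubspace (carr (contragredient V ?C))"
  unfolding contragredient_carr[of V ?C] by (rule complex_vector.subspace_span)
 then have "(\<lambda>f. if f \<in> carr ?C then f x else 0) + (\<lambda>f. if f \<in> carr ?C then f y else 0) \<in> carr (contragredient V ?C)"
  by (rule csub_add[OF _ ev])
 moreover have "(\<lambda>f. if f \<in> carr ?C then f x else 0) + (\<lambda>f. if f \<in> carr ?C then f y else 0) = (\<lambda>f. if f \<in> carr ?C then f (x + y) else 0)"
  by (rule ext) (simp add: plus_fun_apply lin_add[OF contragredient_linear xy])
 ultimately show "(\<lambda>f. if f \<in> carr ?C then f (x + y) else 0) \<in> carr (contragredient V ?C)" by (simp only:)
qed

text \<open>
  The form \<open>h m\<close> is the image under the transpose of the functional on \<open>M'\<close> that evaluates at \<open>m\<close>,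
  carried over to the module \<open>Q\<close>.
\<close>

lemma included_transpose:
 assumes Q: "generalized_module V Q" and k: "module_map (contragredient V M) Q k" and bij: "bij_betw k (carr (contragredient V M)) (carr Q)"
  and m: "m \<in> carr M"
 shows "\<exists>x\<in>carr (contragredient V Q). transpose2 W1 W2 (\<lambda>w1 w2 n. k (J w1 w2 n)) x = h m"
proof -
 let ?C = "contragredient V M" and ?ki = "inv_into (carr (contragredient V M)) k"
 define x where "x = (\<lambda>y. if y \<in> carr Q then (\<lambda>f. if f \<in> carr ?C then f m else 0) (?ki y) else 0)"
 have x: "x \<in> carr (contragredient V Q)"
  unfolding x_def by (rule contragredient_pullback[OF module_map_inverse[OF k N Q bij] Q contragredient_evaluation[OF m]])
 have xk: "x (k f) = f m" if "f \<in> carr ?C" for f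
 proof -
  have "?ki (k f) = f" using bij that by (auto simp: bij_betw_def)
  then show ?thesis using lin_in[OF mm_linear[OF k] that] that by (simp add: x_def)
 qed
 have "transpose2 W1 W2 (\<lambda>w1 w2 n. k (J w1 w2 n)) x w1 w2 = h m w1 w2" if w: "w1 \<in> carr W1" "w2 \<in> carr W2" for w1 w2
 proof -
  let ?I = "{n. component (wtm M) n m \<noteq> 0}"
  have h0: "h 0 = 0" by (rule lin_zero[OF mm_linear[OF h] gm_zero[OF M]])
  have "transpose2 W1 W2 (\<lambda>w1 w2 n. k (J w1 w2 n)) x w1 w2 = Sum_any (\<lambda>n. h (component (wtm M) n m) w1 w2)"
  proof -
   have "transpose2 W1 W2 (\<lambda>w1 w2 n. k (J w1 w2 n)) x w1 w2 = pairing x (\<lambda>n. k (J w1 w2 n))"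
    by (rule transpose2_apply[OF w])
   also have "\<dots> = Sum_any (\<lambda>n. J w1 w2 n m)"
    unfolding pairing_def by (simp only: xk[OF completion_carr[OF N J_completion[OF w]]])
   finally show ?thesis using m by (simp add: evaluation_map_def)
  qed
  also have "\<dots> = (\<Sum>n\<in>?I. h (component (wtm M) n m) w1 w2)"
   by (rule Sum_any_superset[OF component_finite[OF gm_wt_ds[OF M] m]]) (use h0 in simp)
  also have "\<dots> = (\<Sum>n\<in>?I. h (component (wtm M) n m)) w1 w2" by (simp only: sum_fun_apply)
  also have "(\<Sum>n\<in>?I. h (component (wtm M) n m)) = h (\<Sum>n\<in>?I. component (wtm M) n m)"
   by (rule lin_sum[OF mm_linear[OF h] gm_subspace[OF M] comp_in[OF m], symmetric])
  also have "(\<Sum>n\<in>?I. component (wtm M) n m) = m"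
   by (rule component_sum[OF gm_wt_ds[OF M] m component_finite[OF gm_wt_ds[OF M] m], symmetric]) simp
  finally show ?thesis .
 qed
 moreover have "transpose2 W1 W2 (\<lambda>w1 w2 n. k (J w1 w2 n)) x w1 w2 = h m w1 w2" if "w1 \<notin> carr W1 \<or> w2 \<notin> carr W2" for w1 w2
  using transpose2_outside[OF that] dual2_outside[OF h_dual2[OF m] that] by simp
 ultimately have "transpose2 W1 W2 (\<lambda>w1 w2 n. k (J w1 w2 n)) x = h m" by (intro ext) blast
 then show ?thesis using x by blast
qed

end

text \<open>
  The contragredient of a member of the category that is isomorphic to \<open>S\<close> is again isomorphic to a
  member, and the evaluation map, carried over to the latter, realizes every form in \<open>S\<close>.
\<close>

lemma included_object_subset_D_space:
 fixes W1 W2 :: "('v, 'g, 'u::complex_vector) vmod" and C :: "('v, 'g, 'u) vmod set"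
 assumes C: "module_category ss V C" and W: "W1 \<in> C" "W2 \<in> C" and inc: "included_object V C z W1 W2 S"
 shows "S \<subseteq> D_space V C z W1 W2"
proof
 fix \<nu> assume \<nu>: "\<nu> \<in> S"
 let ?PS = "P_module V z W1 W2 S"
 note W1 = category_generalized_module[OF C W(1)] and W2 = category_generalized_module[OF C W(2)]
 have ds: "doubly_graded_subspace False z W1 W2 S" and cat: "in_category V C ?PS" and comp: "\<And>\<nu>. \<nu> \<in> S ==> P_compatible V z W1 W2 \<nu>"
  using inc unfolding included_object_def by blast+
 have PS: "generalized_module V ?PS" using cat unfolding in_category_def by blast
 have carr: "carr ?PS = S" by (simp add: P_module_def)
 obtain M g where M: "M \<in> C" and g: "module_map ?PS M g" "bij_betw g (carr ?PS) (carr M)"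
  using cat unfolding in_category_def isomorphic_modules_def by blast
 note gM = category_generalized_module[OF C M]
 let ?h = "inv_into (carr ?PS) g"
 have h: "module_map M ?PS ?h" by (rule module_map_inverse[OF g(1) PS gM g(2)])
 have N: "in_category V C (contragredient V M)" by (rule category_contragredient[OF C M])
 then have gN: "generalized_module V (contragredient V M)" unfolding in_category_def by blast
 obtain Q k where Q: "Q \<in> C" and k: "module_map (contragredient V M) Q k" "bij_betw k (carr (contragredient V M)) (carr Q)"
  using N unfolding in_category_def isomorphic_modules_def by blast
 note gQ = category_generalized_module[OF C Q]
 obtain K where K: "\<And>n w. w \<in> wtm M n ==> (shift_op (Lm M 0) n ^^ K) w = 0"
  using category_nilpotent[OF C M] by blast
 have dual: "\<nu> \<in> dual2 (carr W1) (carr W2)" if "\<nu> \<in> S" for \<nu>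
 proof (rule ds_induct[OF ds[unfolded doubly_graded_subspace_def] that])
  show "x \<in> dual2 (carr W1) (carr W2)" if "x \<in> (case i of (\<beta>, n) => S \<inter> tensor_dual_piece False z W1 W2 \<beta> n)" for i x
   using that by (auto simp: tensor_dual_piece_def gen_eigenspace_def split: prod.splits intro: tensor_dual_gr_dual2)
  show "x + y \<in> dual2 (carr W1) (carr W2)" if "x \<in> dual2 (carr W1) (carr W2)" "y \<in> dual2 (carr W1) (carr W2)" for x y
   by (rule csub_add[OF csubspace_dual2 that])
 qed
 have gm: "g \<nu> \<in> carr M" and hg: "?h (g \<nu>) = \<nu>"
  using g(2) \<nu> carr by (auto simp: bij_betw_def)
 note ctx = W1 W2 gM PS h dual comp gN K
 have I: "intertwining_map V z Q W1 W2 (\<lambda>w1 w2 n. k (evaluation_map M ?h w1 w2 n))"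
  by (rule intertwining_map_transport[OF J_intertwining k(1) gN gQ W1 W2]) (rule ctx; assumption)+
 obtain x where x: "x \<in> carr (contragredient V Q)" "transpose2 W1 W2 (\<lambda>w1 w2 n. k (evaluation_map M ?h w1 w2 n)) x = ?h (g \<nu>)"
  using included_transpose[OF W1 W2 gM PS h _ _ gN _ gQ k gm] dual comp K by blast
 show "\<nu> \<in> D_space V C z W1 W2"
  unfolding D_space_def
 proof (intro CollectI exI conjI)
  show "\<nu> = transpose2 W1 W2 (\<lambda>w1 w2 n. k (evaluation_map M ?h w1 w2 n)) x" using x(2) hg by simp
 qed (rule Q I x(1))+
qed

end

section \<open>A Pascal recursion\<close>

text \<open>
  A function of two integers that satisfies the recursion of Pascal's triangle is determined by its
  values on the two axes.
\<close>

lemma pascal_unique: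
 fixes E :: "int => int => complex"
 assumes rec: "\<And>a b. E (a + 1) b = E a (b + 1) + z * E a b" and z: "z \<noteq> 0"
  and row: "\<And>a. E a 0 = 0" and col: "\<And>b. E 0 b = 0"
 shows "E a b = 0"
proof -
 have up: "E a (int m) = 0" for a m
 proof (induction m arbitrary: a)
  case (Suc m)
  then show ?case using rec[of a "int m"] by (simp add: add.commute)
 qed (simp add: row)
 have down: "E a (- int m) = 0" for a m
 proof (induction m arbitrary: a)
  case (Suc m)
  have IH: "E a (- int (Suc m) + 1) = 0" for a using Suc[of a] by simp
  have step: "E (a + 1) (- int (Suc m)) = z * E a (- int (Suc m))" for a using rec[of a "- int (Suc m)"] IH[of a] by simp
  have pos: "E (int k) (- int (Suc m)) = 0" for k
  proof (induction k)
   case (Suc k)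
   then show ?case using step[of "int k"] by (simp add: add.commute)
  qed (use col in simp)
  have neg: "E (- int k) (- int (Suc m)) = 0" for k
  proof (induction k)
   case (Suc k)
   have "- int (Suc k) + 1 = - int k" by simp
   then have "z * E (- int (Suc k)) (- int (Suc m)) = 0" using step[of "- int (Suc k)"] Suc by metis
   then show ?case using z by simp
  qed (use col in simp)
  show ?case using pos[of "nat a"] neg[of "nat (- a)"] by (cases "a \<ge> 0") auto
 qed (simp add: row)
 show ?thesis using up[of a "nat b"] down[of a "nat (- b)"] by (cases "b \<ge> 0") auto
qed

lemma bin_0: "bin z a 0 = z powi a" by (simp add: bin_def)

lemma bin_Suc: "z \<noteq> 0 ==> bin z (a + 1) (Suc c) = z * bin z a (Suc c) + bin z a c"
proof -
 assume z: "z \<noteq> 0"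
 have "z * z powi (a - int (Suc c)) = z powi (a - int c)"
  using power_int_add[of z 1 "a - int (Suc c)"] z by simp
 moreover have "(of_int (a + 1) gchoose Suc c :: complex) = (of_int a gchoose c) + (of_int a gchoose Suc c)"
  using gbinomial_Suc_Suc[of "of_int a :: complex" c] by (simp add: add.commute)
 moreover have "a + 1 - int (Suc c) = a - int c" by simp
 ultimately show ?thesis by (simp only: bin_def) (simp add: algebra_simps)
qed

lemma Sum_any_nat: "(\<And>c. c \<ge> M ==> g c = 0) ==> Sum_any g = (\<Sum>c<M. g c)" for g :: "nat => 'a::comm_monoid_add"
 by (rule Sum_any_superset) auto

lemma bin_sum_rec:
 assumes z: "z \<noteq> 0" and C: "\<And>s. s \<ge> N ==> C s = 0"
 shows "Sum_any (\<lambda>c. bin z (a + 1) c * C (b + int c)) =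
  Sum_any (\<lambda>c. bin z a c * C (b + 1 + int c)) + z * Sum_any (\<lambda>c. bin z a c * C (b + int c))"
proof -
 let ?M = "nat (N - b)"
 have C0: "C (b + int c) = 0" if "c \<ge> ?M" for c by (rule C) (use that in linarith)
 have C1: "C (b + 1 + int c) = 0" if "c \<ge> ?M" for c by (rule C) (use that in linarith)
 have "Sum_any (\<lambda>c. bin z (a + 1) c * C (b + int c)) = (\<Sum>c<Suc ?M. bin z (a + 1) c * C (b + int c))"
  by (rule Sum_any_nat) (simp add: C0)
 also have "\<dots> = bin z (a + 1) 0 * C b + (\<Sum>c<?M. bin z (a + 1) (Suc c) * C (b + 1 + int c))"
  by (simp add: sum.lessThan_Suc_shift add.assoc del: sum.lessThan_Suc)
 also have "\<dots> = z * (bin z a 0 * C b) + (\<Sum>c<?M. z * (bin z a (Suc c) * C (b + 1 + int c)) + bin z a c * C (b + 1 + int c))"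
  unfolding bin_Suc[OF z] using z by (simp add: bin_0 power_int_add algebra_simps)
 also have "\<dots> = z * (bin z a 0 * C b + (\<Sum>c<?M. bin z a (Suc c) * C (b + 1 + int c))) + (\<Sum>c<?M. bin z a c * C (b + 1 + int c))"
  by (simp add: sum.distrib sum_distrib_left distrib_left)
 also have "bin z a 0 * C b + (\<Sum>c<?M. bin z a (Suc c) * C (b + 1 + int c)) = (\<Sum>c<Suc ?M. bin z a c * C (b + int c))"
  by (simp add: sum.lessThan_Suc_shift add.assoc del: sum.lessThan_Suc)
 also have "\<dots> = Sum_any (\<lambda>c. bin z a c * C (b + int c))"
  by (rule Sum_any_nat[symmetric]) (simp add: C0)
 also have "(\<Sum>c<?M. bin z a c * C (b + 1 + int c)) = Sum_any (\<lambda>c. bin z a c * C (b + 1 + int c))"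
  by (rule Sum_any_nat[symmetric]) (simp add: C1)
 finally show ?thesis by simp
qed

lemma gchoose_sum_rec:
 fixes z :: complex
 assumes A: "\<And>s. s \<le> N ==> A s = 0"
 shows "Sum_any (\<lambda>c. (of_int b gchoose c) * (- z) ^ c * A (a + 1 + b - int c)) =
  Sum_any (\<lambda>c. (of_int (b + 1) gchoose c) * (- z) ^ c * A (a + (b + 1) - int c)) +
  z * Sum_any (\<lambda>c. (of_int b gchoose c) * (- z) ^ c * A (a + b - int c))"
proof -
 let ?M = "nat (a + b - N)" and ?G = "\<lambda>b c. (of_int b gchoose c) * (- z) ^ c"
 have A0: "A (a + b - int c) = 0" if "c \<ge> ?M" for c by (rule A) (use that in linarith)
 have A1: "A (a + 1 + b - int c) = 0" "A (a + (b + 1) - int c) = 0" if "c \<ge> Suc ?M" for c by (rule A, use that in linarith)+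
 have G: "?G (b + 1) (Suc c) = ?G b (Suc c) - z * ?G b c" for c
  using gbinomial_Suc_Suc[of "of_int b :: complex" c] by (simp add: algebra_simps)
 have ix: "a + (b + 1) - int (Suc c) = a + b - int c" "a + 1 + b - int (Suc c) = a + b - int c" for c by simp_all
 have ix0: "a + (b + 1) - int 0 = a + b + 1" "a + 1 + b - int 0 = a + b + 1" by simp_all
 have "Sum_any (\<lambda>c. ?G (b + 1) c * A (a + (b + 1) - int c)) = (\<Sum>c<Suc ?M. ?G (b + 1) c * A (a + (b + 1) - int c))"
  by (rule Sum_any_nat) (simp add: A1)
 also have "\<dots> = A (a + b + 1) + (\<Sum>c<?M. ?G (b + 1) (Suc c) * A (a + b - int c))"
  unfolding sum.lessThan_Suc_shift ix ix0 by (simp only: gbinomial_0 power_0 mult_1_left)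
 also have "\<dots> = A (a + b + 1) + (\<Sum>c<?M. ?G b (Suc c) * A (a + b - int c)) - z * (\<Sum>c<?M. ?G b c * A (a + b - int c))"
  unfolding G by (simp add: left_diff_distrib sum_subtractf sum_distrib_left mult.assoc)
 also have "A (a + b + 1) + (\<Sum>c<?M. ?G b (Suc c) * A (a + b - int c)) = (\<Sum>c<Suc ?M. ?G b c * A (a + 1 + b - int c))"
  unfolding sum.lessThan_Suc_shift ix ix0 by (simp only: gbinomial_0 power_0 mult_1_left)
 also have "\<dots> = Sum_any (\<lambda>c. ?G b c * A (a + 1 + b - int c))"
  by (rule Sum_any_nat[symmetric]) (simp add: A1)
 also have "(\<Sum>c<?M. ?G b c * A (a + b - int c)) = Sum_any (\<lambda>c. ?G b c * A (a + b - int c))"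
  by (rule Sum_any_nat[symmetric]) (simp add: A0)
 finally show ?thesis by simp
qed

lemma pascal_identity:
 fixes A B C :: "int => complex"
 assumes z: "z \<noteq> 0" and A: "\<And>s. s \<le> NA ==> A s = 0" and B: "\<And>s. s \<ge> NB ==> B s = 0" and C: "\<And>s. s \<ge> NC ==> C s = 0"
  and row: "\<And>a. Sum_any (\<lambda>c. bin z a c * C (int c)) = A a - B a"
  and col: "\<And>b. C b = Sum_any (\<lambda>c. (of_int b gchoose c) * (- z) ^ c * A (b - int c)) - Sum_any (\<lambda>c. bin (- z) b c * B (int c))"
 shows "Sum_any (\<lambda>c. bin z a c * C (b + int c)) =
  Sum_any (\<lambda>c. (of_int b gchoose c) * (- z) ^ c * A (a + b - int c)) - Sum_any (\<lambda>c. bin (- z) b c * B (a + int c))"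
proof -
 define X where "X = (\<lambda>a b. Sum_any (\<lambda>c. bin z a c * C (b + int c)))"
 define Y where "Y = (\<lambda>a b. Sum_any (\<lambda>c. (of_int b gchoose c) * (- z) ^ c * A (a + b - int c)))"
 define Z where "Z = (\<lambda>a b. Sum_any (\<lambda>c. bin (- z) b c * B (a + int c)))"
 have one: "bin y 0 c = (if c = 0 then 1 else 0)" for y c
  by (cases c) (simp_all add: bin_def gbinomial_0_left)
 have one': "(0 gchoose c :: complex) * y = (if c = 0 then y else 0)" for y c by (cases c) simp_all
 have X: "X (a + 1) b = X a (b + 1) + z * X a b" for a b unfolding X_def by (rule bin_sum_rec[OF z C])
 have Y: "Y (a + 1) b = Y a (b + 1) + z * Y a b" for a b unfolding Y_def by (rule gchoose_sum_rec[OF A])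
 have mz: "- z \<noteq> 0" using z by simp
 have Z: "Z (a + 1) b = Z a (b + 1) + z * Z a b" for a b
 proof -
  have "Z a (b + 1) = Z (a + 1) b + (- z) * Z a b" unfolding Z_def by (rule bin_sum_rec[OF mz B])
  then show ?thesis by simp
 qed
 have "X a b - Y a b + Z a b = 0"
 proof (rule pascal_unique[where E = "\<lambda>a b. X a b - Y a b + Z a b", OF _ z])
  show "X (a + 1) b - Y (a + 1) b + Z (a + 1) b = X a (b + 1) - Y a (b + 1) + Z a (b + 1) + z * (X a b - Y a b + Z a b)" for a b
   unfolding X Y Z by (simp add: algebra_simps)
  show "X a 0 - Y a 0 + Z a 0 = 0" for a
  proof -
   have "Y a 0 = A a" unfolding Y_def by (subst Sum_any_nat[of 1]) (simp_all add: gbinomial_0_left)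
   moreover have "Z a 0 = B a" unfolding Z_def by (subst Sum_any_nat[of 1]) (simp_all add: one)
   ultimately show ?thesis using row[of a] by (simp add: X_def)
  qed
  show "X 0 b - Y 0 b + Z 0 b = 0" for b
  proof -
   have "X 0 b = C b" unfolding X_def by (subst Sum_any_nat[of 1]) (simp_all add: one)
   then show ?thesis using col[of b] by (simp add: Y_def Z_def)
  qed
 qed
 then have "X a b = Y a b - Z a b" by (simp add: algebra_simps)
 then show ?thesis by (simp only: X_def Y_def Z_def)
qed

text \<open>
  The identities $J(a,b)$ for the sequences $A_s=\widetilde G(w)(v^*_sx,w_3)$,
  $B_s=\widetilde G(w)(x,v_sw_3)$ and $C_s=\widetilde G(v_sw)(x,w_3)$.  The sums are truncated at any
  sufficiently large \<open>M\<close>, which makes the relation visibly additive.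
\<close>

definition pascal_relation :: "complex => (int => complex) => (int => complex) => (int => complex) => bool" where
 "pascal_relation z A B C \<longleftrightarrow> (\<exists>N. (\<forall>s\<le>- N. A s = 0) \<and> (\<forall>s\<ge>N. B s = 0 \<and> C s = 0) \<and>
   (\<forall>a b M. M \<ge> nat (N + \<bar>a\<bar> + \<bar>b\<bar>) --> (\<Sum>c<M. bin z a c * C (b + int c)) =
    (\<Sum>c<M. (of_int b gchoose c) * (- z) ^ c * A (a + b - int c)) - (\<Sum>c<M. bin (- z) b c * B (a + int c))))"

lemma pascal_relationI:
 assumes z: "z \<noteq> 0" and A: "\<And>s. s \<le> NA ==> A s = 0" and B: "\<And>s. s \<ge> NB ==> B s = 0" and C: "\<And>s. s \<ge> NC ==> C s = 0"
  and row: "\<And>a. Sum_any (\<lambda>c. bin z a c * C (int c)) = A a - B a"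
  and col: "\<And>b. C b = Sum_any (\<lambda>c. (of_int b gchoose c) * (- z) ^ c * A (b - int c)) - Sum_any (\<lambda>c. bin (- z) b c * B (int c))"
 shows "pascal_relation z A B C"
proof -
 define N where "N = max (- NA) (max NB NC)"
 have N: "A s = 0" if "s \<le> - N" for s using that by (intro A) (simp add: N_def)
 have N': "B s = 0" "C s = 0" if "s \<ge> N" for s using that by (auto intro!: B C simp: N_def)
 have "(\<Sum>c<M. bin z a c * C (b + int c)) = (\<Sum>c<M. (of_int b gchoose c) * (- z) ^ c * A (a + b - int c)) - (\<Sum>c<M. bin (- z) b c * B (a + int c))"
  if M: "M \<ge> nat (N + \<bar>a\<bar> + \<bar>b\<bar>)" for a b M
 proof -
  have "A (a + b - int c) = 0" "B (a + int c) = 0" "C (b + int c) = 0" if "c \<ge> M" for c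
   using M that by (intro N N'; linarith)+
  then have "Sum_any (\<lambda>c. bin z a c * C (b + int c)) = (\<Sum>c<M. bin z a c * C (b + int c))"
   "Sum_any (\<lambda>c. (of_int b gchoose c) * (- z) ^ c * A (a + b - int c)) = (\<Sum>c<M. (of_int b gchoose c) * (- z) ^ c * A (a + b - int c))"
   "Sum_any (\<lambda>c. bin (- z) b c * B (a + int c)) = (\<Sum>c<M. bin (- z) b c * B (a + int c))"
   by (auto intro!: Sum_any_nat)
  moreover have "Sum_any (\<lambda>c. bin z a c * C (b + int c)) =
    Sum_any (\<lambda>c. (of_int b gchoose c) * (- z) ^ c * A (a + b - int c)) - Sum_any (\<lambda>c. bin (- z) b c * B (a + int c))"
   by (rule pascal_identity[OF z A B C row col])
  ultimately show ?thesis by simp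
 qed
 then show ?thesis unfolding pascal_relation_def using N N' by blast
qed

lemma pascal_relation_add:
 assumes "pascal_relation z A B C" "pascal_relation z A' B' C'"
 shows "pascal_relation z (\<lambda>s. A s + A' s) (\<lambda>s. B s + B' s) (\<lambda>s. C s + C' s)"
proof -
 let ?P = "\<lambda>N A B C. (\<forall>s\<le>- N. A s = 0) \<and> (\<forall>s\<ge>N. B s = 0 \<and> C s = 0) \<and>
   (\<forall>a b M. M \<ge> nat (N + \<bar>a\<bar> + \<bar>b\<bar>) --> (\<Sum>c<M. bin z a c * C (b + int c)) =
    (\<Sum>c<M. (of_int b gchoose c) * (- z) ^ c * A (a + b - int c)) - (\<Sum>c<M. bin (- z) b c * B (a + int c)))"
 obtain N where N: "?P N A B C" using assms(1) unfolding pascal_relation_def by blast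
 obtain N' where N': "?P N' A' B' C'" using assms(2) unfolding pascal_relation_def by blast
 have "?P (max N N') (\<lambda>s. A s + A' s) (\<lambda>s. B s + B' s) (\<lambda>s. C s + C' s)"
 proof (intro conjI allI impI)
  show "A s + A' s = 0" if "s \<le> - max N N'" for s using N N' that by simp
  show "B s + B' s = 0" "C s + C' s = 0" if "s \<ge> max N N'" for s using N N' that by auto
  fix a b M assume M: "M \<ge> nat (max N N' + \<bar>a\<bar> + \<bar>b\<bar>)"
  then have "M \<ge> nat (N + \<bar>a\<bar> + \<bar>b\<bar>)" "M \<ge> nat (N' + \<bar>a\<bar> + \<bar>b\<bar>)" by linarith+
  then show "(\<Sum>c<M. bin z a c * (C (b + int c) + C' (b + int c))) =
    (\<Sum>c<M. (of_int b gchoose c) * (- z) ^ c * (A (a + b - int c) + A' (a + b - int c))) - (\<Sum>c<M. bin (- z) b c * (B (a + int c) + B' (a + int c)))"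
   using N N' by (simp add: distrib_left sum.distrib)
 qed
 then show ?thesis unfolding pascal_relation_def by blast
qed

section \<open>Families of forms with an expansion\<close>

lemma Sum_any_has_sum: "finite {i. g i \<noteq> 0} ==> (g has_sum Sum_any g) UNIV" for g :: "'i => complex"
 by (rule has_sum_finite_neutralI[of "{i. g i \<noteq> 0}"]) (auto simp: Sum_any.expand_set)

lemma summable_translate:
 fixes f :: "'a::ab_group_add => real"
 assumes "f summable_on UNIV"
 shows "(\<lambda>n. f (n + c)) summable_on UNIV"
 using has_sum_imp_summable[OF has_sum_translate[OF has_sum_infsum[OF assms]]] .

lemma norm_summable_sum:
 fixes g :: "'i => 'n => complex"
 assumes "\<And>i. i \<in> I ==> (\<lambda>n. norm (g i n)) summable_on A"
 shows "(\<lambda>n. norm (\<Sum>i\<in>I. c i * g i n)) summable_on A"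
proof (rule Infinite_Sum.abs_summable_on_comparison_test')
 show "(\<lambda>n. \<Sum>i\<in>I. norm (c i) * norm (g i n)) summable_on A"
  by (rule summable_on_sum) (rule summable_on_cmult_right[OF assms])
 show "norm (\<Sum>i\<in>I. c i * g i n) \<le> (\<Sum>i\<in>I. norm (c i) * norm (g i n))" for n
  by (rule order_trans[OF norm_sum]) (simp add: norm_mult)
qed

lemma norm_summable_add:
 fixes f g :: "'n => complex"
 assumes "(\<lambda>n. norm (f n)) summable_on A" "(\<lambda>n. norm (g n)) summable_on A"
 shows "(\<lambda>n. norm (f n + g n)) summable_on A"
 by (rule Infinite_Sum.abs_summable_on_comparison_test'[OF summable_on_add[OF assms]]) (rule norm_triangle_ineq)

text \<open>
  The double series that underlies a row, with absolute convergence for the parameter $s=e^t$ and the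
  value for $s=1$.
\<close>

lemma double_row:
 fixes X :: "nat => 'n => complex" and Y :: "nat => 'n => complex" and M M' :: nat and a :: int and s z z2 :: complex
 assumes X: "\<And>c. (X c has_sum SX c) UNIV" "\<And>c. (\<lambda>n. norm (X c n)) summable_on UNIV" "\<And>c. c \<ge> M ==> X c = (\<lambda>n. 0)"
  and Y: "\<And>i. (Y i has_sum SY i) UNIV" "\<And>i. (\<lambda>n. norm (Y i n)) summable_on UNIV"
  and zz: "norm z < norm z2" and z: "norm (s * z) < norm z2"
 defines "T \<equiv> \<lambda>(n, c). s ^ c * bin z2 a c * X c n + (\<Sum>i<M'. Y i n * (s ^ c * (bin z2 a c * bin z (int c) i)))"
 shows "(\<lambda>p. norm (T p)) summable_on (UNIV \<times> UNIV)"
  and "s = 1 ==> (T has_sum (\<Sum>c<M. bin z2 a c * SX c) + (\<Sum>i<M'. SY i * bin (z2 + z) a i)) (UNIV \<times> UNIV)"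
proof -
 let ?d = "\<lambda>c' c. if c = c' then s ^ c' * bin z2 a c' else (0 :: complex)"
 have T: "T p = (\<Sum>c'<M. (\<lambda>(n, c). X c' n * ?d c' c) p) + (\<Sum>i<M'. 1 * (\<lambda>(n, c). Y i n * (s ^ c * (bin z2 a c * bin z (int c) i))) p)" for p
 proof (cases p)
  case (Pair n c)
  have "(\<Sum>c'<M. X c' n * ?d c' c) = s ^ c * bin z2 a c * X c n"
  proof (cases "c < M")
   case True
   have "(\<Sum>c'<M. X c' n * ?d c' c) = (\<Sum>c'<M. if c = c' then s ^ c' * bin z2 a c' * X c' n else 0)"
    by (rule sum.cong) auto
   then show ?thesis using True by simp
  next
   case False
   then have "(\<Sum>c'<M. X c' n * ?d c' c) = 0" by (intro sum.neutral) auto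
   then show ?thesis using False X(3)[of c] by simp
  qed
  then show ?thesis unfolding T_def Pair by simp
 qed
 have one: "(?d c' has_sum s ^ c' * bin z2 a c') UNIV" "(\<lambda>c. norm (?d c' c)) summable_on UNIV" for c'
 proof -
  show "(?d c' has_sum s ^ c' * bin z2 a c') UNIV" by (rule has_sum_finite_neutralI[of "{c'}"]) auto
  have "((\<lambda>c. norm (?d c' c)) has_sum norm (s ^ c' * bin z2 a c')) UNIV" by (rule has_sum_finite_neutralI[of "{c'}"]) auto
  then show "(\<lambda>c. norm (?d c' c)) summable_on UNIV" by (rule has_sum_imp_summable)
 qed
 have cs: "(\<lambda>c. norm (s ^ c * (bin z2 a c * bin z (int c) i))) summable_on UNIV" for i
  by (rule row_coefficient(2)[OF zz z])
 have ch: "((\<lambda>c. s ^ c * (bin z2 a c * bin z (int c) i)) has_sum infsum (\<lambda>c. s ^ c * (bin z2 a c * bin z (int c) i)) UNIV) UNIV" for i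
  by (rule has_sum_infsum[OF Infinite_Sum.abs_summable_summable[OF cs]])
 show "(\<lambda>p. norm (T p)) summable_on (UNIV \<times> UNIV)"
  unfolding T
 proof (rule norm_summable_add)
  have 1: "(\<lambda>p. norm (\<Sum>c'<M. 1 * (\<lambda>(n, c). X c' n * ?d c' c) p)) summable_on (UNIV \<times> UNIV)"
  proof (rule norm_summable_sum)
   show "(\<lambda>p. norm ((\<lambda>(n, c). X c' n * ?d c' c) p)) summable_on (UNIV \<times> UNIV)" for c'
    using has_sum_product(2)[OF X(1,2) one] by (simp add: case_prod_unfold)
  qed
  then show "(\<lambda>p. norm (\<Sum>c'<M. (\<lambda>(n, c). X c' n * ?d c' c) p)) summable_on (UNIV \<times> UNIV)" by (simp only: mult_1_left)
  show "(\<lambda>p. norm (\<Sum>i<M'. 1 * (\<lambda>(n, c). Y i n * (s ^ c * (bin z2 a c * bin z (int c) i))) p)) summable_on (UNIV \<times> UNIV)"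
  proof (rule norm_summable_sum)
   show "(\<lambda>p. norm ((\<lambda>(n, c). Y i n * (s ^ c * (bin z2 a c * bin z (int c) i))) p)) summable_on (UNIV \<times> UNIV)" for i
    using has_sum_product(2)[OF Y(1,2) ch cs] by (simp add: case_prod_unfold)
  qed
 qed
 assume s: "s = 1"
 have r: "((\<lambda>c. s ^ c * (bin z2 a c * bin z (int c) i)) has_sum bin (z2 + z) a i) UNIV" for i
  using row_coefficient(1)[OF zz, of a i] s by simp
 have "((\<lambda>p. (\<Sum>c'<M. (\<lambda>(n, c). X c' n * ?d c' c) p) + (\<Sum>i<M'. (\<lambda>(n, c). Y i n * (s ^ c * (bin z2 a c * bin z (int c) i))) p)) has_sum
   (\<Sum>c'<M. SX c' * (s ^ c' * bin z2 a c')) + (\<Sum>i<M'. SY i * bin (z2 + z) a i)) (UNIV \<times> UNIV)"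
  by (intro has_sum_add has_sum_sum has_sum_product(1)[OF X(1,2) one] has_sum_product(1)[OF Y(1,2) r cs])
 then show "(T has_sum (\<Sum>c<M. bin z2 a c * SX c) + (\<Sum>i<M'. SY i * bin (z2 + z) a i)) (UNIV \<times> UNIV)"
  unfolding T[abs_def] using s by (simp add: mult.commute)
qed

context form_image
begin

lemma opp_linear: "linear_map_on D D (opp_coeff V PD v q)"
proof -
 note l = opp_coeff_linear[OF N, of v q]
 show ?thesis unfolding linear_map_on_def
 proof (intro conjI ballI allI)
  show "opp_coeff V PD v q x \<in> D" if "x \<in> D" for x by (rule opp_in_D[OF that])
  fix x assume "x \<in> D"
  then obtain x' where x: "x = f x'" "x' \<in> carr N" unfolding D by blast
  show "opp_coeff V PD v q (c *\<^sub>C x) = c *\<^sub>C opp_coeff V PD v q x" for c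
   unfolding x(1) f_scale[OF x(2), symmetric] f_opp[OF x(2)] f_opp[OF gm_scale[OF N x(2)]] lin_scale[OF l x(2)]
   by (rule f_scale[OF opp_coeff_in[OF N x(2)]])
  fix y assume "y \<in> D"
  then obtain y' where y: "y = f y'" "y' \<in> carr N" unfolding D by blast
  show "opp_coeff V PD v q (x + y) = opp_coeff V PD v q x + opp_coeff V PD v q y"
   unfolding x(1) y(1) f_add[OF x(2) y(2), symmetric] f_opp[OF x(2)] f_opp[OF y(2)] f_opp[OF gm_add[OF N x(2) y(2)]]
    lin_add[OF l x(2) y(2)]
   by (rule f_add[OF opp_coeff_in[OF N x(2)] opp_coeff_in[OF N y(2)]])
 qed
qed

lemma D_zero: "0 \<in> D" by (rule complex_vector.subspace_0[OF D_subspace])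

lemma opp_zero: "opp_coeff V PD v q 0 = 0" by (rule lin_zero[OF opp_linear D_zero])

lemma opp_v_add: "\<nu> \<in> D ==> opp_coeff V PD (v + v') q \<nu> = opp_coeff V PD v q \<nu> + opp_coeff V PD v' q \<nu>"
proof -
 assume "\<nu> \<in> D"
 then obtain x where x: "\<nu> = f x" "x \<in> carr N" unfolding D by blast
 show ?thesis
  unfolding x(1) f_opp[OF x(2)] opp_coeff_v_add[OF N x(2)]
  by (rule f_add[OF opp_coeff_in[OF N x(2)] opp_coeff_in[OF N x(2)]])
qed

lemma csubspace_nil: "csubspace {\<nu>. (shift_op L n ^^ k) \<nu> = 0}"
 unfolding complex_vector.subspace_def using shift_pow_zero shift_pow_add shift_pow_scale by simp

text \<open>
  \<open>\<theta>\<close> is a family in \<open>D\<close>, with \<open>\<theta> n\<close> of generalized weight \<open>n\<close>, whose sum converges absolutely to \<open>F\<close> at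
  all pairs of vectors, and whose sum after application of $e^{tL'(0)}$ converges absolutely for small
  \<open>t\<close>, in a neighborhood that does not depend on the vectors.
\<close>

definition expands :: "(real => 'a => 'b => complex) => ('a => 'b => complex) => bool" where
 "expands \<theta> F \<longleftrightarrow> (\<forall>n. \<theta> n \<in> D) \<and> (\<forall>n. (shift_op L (of_real n) ^^ K) (\<theta> n) = 0) \<and>
   (\<exists>\<delta>>0. \<forall>u1\<in>carr W1. \<forall>u2\<in>carr W2. \<forall>t. norm t < \<delta> -->
    (\<lambda>n. norm (exp_act L K (of_real n) t (\<theta> n) u1 u2)) summable_on UNIV) \<and>
   (\<forall>u1\<in>carr W1. \<forall>u2\<in>carr W2. ((\<lambda>n. \<theta> n u1 u2) has_sum F u1 u2) UNIV)"

lemma expandsI: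
 assumes "\<And>n. \<theta> n \<in> D" "\<And>n. (shift_op L (of_real n) ^^ K) (\<theta> n) = 0" "\<delta> > 0"
  "\<And>u1 u2 t. u1 \<in> carr W1 ==> u2 \<in> carr W2 ==> norm t < \<delta> ==> (\<lambda>n. norm (exp_act L K (of_real n) t (\<theta> n) u1 u2)) summable_on UNIV"
  "\<And>u1 u2. u1 \<in> carr W1 ==> u2 \<in> carr W2 ==> ((\<lambda>n. \<theta> n u1 u2) has_sum F u1 u2) UNIV"
 shows "expands \<theta> F"
 unfolding expands_def using assms by blast

lemma expands_D: "expands \<theta> F ==> \<theta> n \<in> D"
 and expands_nil: "expands \<theta> F ==> (shift_op L (of_real n) ^^ K) (\<theta> n) = 0"
 and expands_has_sum: "expands \<theta> F ==> u1 \<in> carr W1 ==> u2 \<in> carr W2 ==> ((\<lambda>n. \<theta> n u1 u2) has_sum F u1 u2) UNIV"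
 unfolding expands_def by blast+

lemma expands_summable:
 assumes "expands \<theta> F"
 obtains \<delta> where "\<delta> > 0" "\<And>u1 u2 t. u1 \<in> carr W1 ==> u2 \<in> carr W2 ==> norm t < \<delta> ==>
   (\<lambda>n. norm (exp_act L K (of_real n) t (\<theta> n) u1 u2)) summable_on UNIV"
 using assms unfolding expands_def by blast

lemma expands_norm_summable:
 assumes "expands \<theta> F" "u1 \<in> carr W1" "u2 \<in> carr W2"
 shows "(\<lambda>n. norm (\<theta> n u1 u2)) summable_on UNIV"
proof -
 obtain \<delta> where \<delta>: "\<delta> > 0" "\<And>u1 u2 t. u1 \<in> carr W1 ==> u2 \<in> carr W2 ==> norm t < \<delta> ==>
   (\<lambda>n. norm (exp_act L K (of_real n) t (\<theta> n) u1 u2)) summable_on UNIV" using expands_summable[OF assms(1)] by blast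
 have "(\<lambda>n. norm (exp_act L K (of_real n) 0 (\<theta> n) u1 u2)) summable_on UNIV" by (rule \<delta>(2)[OF assms(2,3)]) (use \<delta>(1) in simp)
 then show ?thesis by (simp only: exp_act_0[OF K(1)])
qed

lemma expands_cong:
 assumes "expands \<theta> F" "\<And>u1 u2. u1 \<in> carr W1 ==> u2 \<in> carr W2 ==> F u1 u2 = F' u1 u2"
 shows "expands \<theta> F'"
 using assms unfolding expands_def by simp

lemma exp_act_combination:
 assumes "finite I"
 shows "exp_act L K n t (\<Sum>i\<in>I. c i *\<^sub>C g i) u1 u2 = (\<Sum>i\<in>I. c i * exp_act L K n t (g i) u1 u2)"
 using assms
proof (induction I)
 case empty
 have "exp_act L K n t (0 *\<^sub>C 0) u1 u2 = 0" by (simp only: exp_act_scale mult_zero_left)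
 then show ?case by (simp only: complex_vector.scale_zero_left sum.empty)
next
 case (insert i I)
 show ?case unfolding sum.insert[OF insert(1,2)] exp_act_add exp_act_scale insert(3) ..
qed

lemma expands_combination:
 assumes I: "finite I" and e: "\<And>i. i \<in> I ==> expands (\<theta> i) (F i)"
 shows "expands (\<lambda>n. \<Sum>i\<in>I. c i *\<^sub>C \<theta> i n) (\<lambda>u1 u2. \<Sum>i\<in>I. c i * F i u1 u2)"
proof -
 have "\<exists>\<delta>>0. \<forall>i\<in>I. \<forall>u1\<in>carr W1. \<forall>u2\<in>carr W2. \<forall>t. norm t < \<delta> -->
    (\<lambda>n. norm (exp_act L K (of_real n) t (\<theta> i n) u1 u2)) summable_on UNIV"
  using I e
 proof (induction I)
  case empty
  then show ?case by (intro exI[of _ 1]) simp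
 next
  case (insert i I)
  then obtain \<delta> where \<delta>: "\<delta> > 0" "\<forall>i\<in>I. \<forall>u1\<in>carr W1. \<forall>u2\<in>carr W2. \<forall>t. norm t < \<delta> -->
    (\<lambda>n. norm (exp_act L K (of_real n) t (\<theta> i n) u1 u2)) summable_on UNIV" by blast
  obtain \<delta>' where \<delta>': "\<delta>' > 0" "\<And>u1 u2 t. u1 \<in> carr W1 ==> u2 \<in> carr W2 ==> norm t < \<delta>' ==>
   (\<lambda>n. norm (exp_act L K (of_real n) t (\<theta> i n) u1 u2)) summable_on UNIV" using expands_summable[OF insert(4)[of i]] by blast
  show ?case using \<delta> \<delta>' by (intro exI[of _ "min \<delta> \<delta>'"]) simp
 qed
 then obtain \<delta> where \<delta>: "\<delta> > 0" "\<And>i u1 u2 t. i \<in> I ==> u1 \<in> carr W1 ==> u2 \<in> carr W2 ==> norm t < \<delta> ==>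
    (\<lambda>n. norm (exp_act L K (of_real n) t (\<theta> i n) u1 u2)) summable_on UNIV" by blast
 note ex = exp_act_combination[OF I]
 show ?thesis
 proof (rule expandsI[OF _ _ \<delta>(1)])
  show "(\<Sum>i\<in>I. c i *\<^sub>C \<theta> i n) \<in> D" for n
   by (rule csub_sum[OF D_subspace]) (rule csub_scale[OF D_subspace expands_D[OF e]])
  have "(\<Sum>i\<in>I. c i *\<^sub>C \<theta> i n) \<in> {\<nu>. (shift_op L (of_real n) ^^ K) \<nu> = 0}" for n
   by (rule csub_sum[OF csubspace_nil]) (rule csub_scale[OF csubspace_nil], use expands_nil[OF e] in blast)
  then show "(shift_op L (of_real n) ^^ K) (\<Sum>i\<in>I. c i *\<^sub>C \<theta> i n) = 0" for n by blast
  show "(\<lambda>n. norm (exp_act L K (of_real n) t (\<Sum>i\<in>I. c i *\<^sub>C \<theta> i n) u1 u2)) summable_on UNIV"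
   if "u1 \<in> carr W1" "u2 \<in> carr W2" "norm t < \<delta>" for u1 u2 t
   unfolding ex by (rule norm_summable_sum) (rule \<delta>(2)[OF _ that])
  show "((\<lambda>n. (\<Sum>i\<in>I. c i *\<^sub>C \<theta> i n) u1 u2) has_sum (\<Sum>i\<in>I. c i * F i u1 u2)) UNIV"
   if "u1 \<in> carr W1" "u2 \<in> carr W2" for u1 u2
   unfolding sum_fun_apply scaleC_fun_apply scaleC_complex
   by (rule has_sum_sum) (rule has_sum_cmult_right[OF expands_has_sum[OF e that]])
 qed
qed

lemma expands_add:
 assumes "expands \<theta> F" "expands \<theta>' F'"
 shows "expands (\<lambda>n. \<theta> n + \<theta>' n) (\<lambda>u1 u2. F u1 u2 + F' u1 u2)"
 using expands_combination[of "{True, False}" "\<lambda>b. if b then \<theta> else \<theta>'" "\<lambda>b. if b then F else F'" "\<lambda>_. 1"] assms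
 by (simp add: complex_vector.scale_one del: plus_fun_apply)

lemma expands_scale:
 assumes "expands \<theta> F"
 shows "expands (\<lambda>n. c *\<^sub>C \<theta> n) (\<lambda>u1 u2. c * F u1 u2)"
 using expands_combination[of "{()}" "\<lambda>_. \<theta>" "\<lambda>_. F" "\<lambda>_. c"] assms by simp

lemma expands_diff:
 assumes "expands \<theta> F" "expands \<theta>' F'"
 shows "expands (\<lambda>n. \<theta> n - \<theta>' n) (\<lambda>u1 u2. F u1 u2 - F' u1 u2)"
proof -
 have "expands (\<lambda>n. \<theta> n + (- 1) *\<^sub>C \<theta>' n) (\<lambda>u1 u2. F u1 u2 + (- 1) * F' u1 u2)"
  by (rule expands_add[OF assms(1) expands_scale[OF assms(2)]])
 moreover have "\<theta> n + (- 1) *\<^sub>C \<theta>' n = \<theta> n - \<theta>' n" for n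
  by (simp only: complex_vector.scale_minus_left complex_vector.scale_one diff_conv_add_uminus)
 ultimately show ?thesis by simp
qed

lemma expands_vanish:
 assumes e: "expands \<theta> F" and P: "P1 \<subseteq> carr W1" "P2 \<subseteq> carr W2"
  and st: "\<And>u. u \<in> P1 ==> Lm W1 0 u \<in> P1" "\<And>u. u \<in> P1 ==> Lm W1 (- 1) u \<in> P1" "\<And>u. u \<in> P2 ==> Lm W2 0 u \<in> P2"
  and F: "\<And>u1 u2. u1 \<in> P1 ==> u2 \<in> P2 ==> F u1 u2 = 0" and u: "u1 \<in> P1" "u2 \<in> P2"
 shows "\<theta> n u1 u2 = 0"
proof -
 obtain \<delta> where \<delta>: "\<delta> > 0" "\<And>u1 u2 t. u1 \<in> carr W1 ==> u2 \<in> carr W2 ==> norm t < \<delta> ==>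
   (\<lambda>n. norm (exp_act L K (of_real n) t (\<theta> n) u1 u2)) summable_on UNIV" using expands_summable[OF e] by blast
 have Lf: "L \<nu> u1 u2 = \<nu> u1 (Lm W2 0 u2) + \<nu> (Lm W1 0 u1) u2 + z * \<nu> (Lm W1 (- 1) u1) u2" if "u1 \<in> P1" "u2 \<in> P2" for \<nu> u1 u2
  using that P by (auto simp: P_L_def)
 show ?thesis
 proof (rule expansion_unique[OF st Lf K(1) \<delta>(1) expands_nil[OF e] _ _ u])
  show "(\<lambda>n. norm (exp_act L K (of_real n) t (\<theta> n) u1 u2)) summable_on UNIV" if "u1 \<in> P1" "u2 \<in> P2" "norm t < \<delta>" for u1 u2 t
   by (rule \<delta>(2)) (use that P in auto)
  show "((\<lambda>n. \<theta> n u1 u2) has_sum 0) UNIV" if "u1 \<in> P1" "u2 \<in> P2" for u1 u2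
  proof -
   have "u1 \<in> carr W1" "u2 \<in> carr W2" using that P by auto
   from expands_has_sum[OF e this] show ?thesis by (simp only: F[OF that])
  qed
 qed
qed

lemma expands_unique:
 assumes e: "expands \<theta> F" "expands \<theta>' F'" and F: "\<And>u1 u2. u1 \<in> carr W1 ==> u2 \<in> carr W2 ==> F u1 u2 = F' u1 u2"
 shows "\<theta> n = \<theta>' n"
proof -
 have "\<theta> n u1 u2 = \<theta>' n u1 u2" for u1 u2
 proof (cases "u1 \<in> carr W1 \<and> u2 \<in> carr W2")
  case True
  have "(\<theta> n - \<theta>' n) u1 u2 = 0"
   by (rule expands_vanish[OF expands_diff[OF e] subset_refl subset_refl, where n = n])
    (use True F gm_L_in[OF W1] gm_L_in[OF W2] in auto)
  then show ?thesis by simp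
 next
  case False
  then show ?thesis using dual2_outside[OF D_dual2[OF expands_D[OF e(1)]]] dual2_outside[OF D_dual2[OF expands_D[OF e(2)]]] by metis
 qed
 then show ?thesis by (intro ext)
qed

lemma expands_gr:
 assumes e: "expands \<theta> F"
  and F: "\<And>\<beta>1 \<beta>2 u1 u2. \<beta>1 + \<beta>2 \<noteq> - \<beta> ==> u1 \<in> grm W1 \<beta>1 ==> u2 \<in> grm W2 \<beta>2 ==> F u1 u2 = 0"
 shows "\<theta> n \<in> tensor_dual_gr W1 W2 \<beta>"
proof (rule tensor_dual_grI[OF D_dual2[OF expands_D[OF e]]])
 fix \<beta>1 \<beta>2 u1 u2 assume ne: "\<beta>1 + \<beta>2 \<noteq> - \<beta>" and u: "u1 \<in> grm W1 \<beta>1" "u2 \<in> grm W2 \<beta>2"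
 show "\<theta> n u1 u2 = 0"
  by (rule expands_vanish[OF e, of "grm W1 \<beta>1" "grm W2 \<beta>2"])
   (use gm_gr_subset[OF W1] gm_gr_subset[OF W2] gm_L_gr[OF W1] gm_L_gr[OF W2] F[OF ne] u in auto)
qed

lemma exp_operator:
 assumes \<nu>: "\<nu> \<in> D" and sh: "\<And>k. (shift_op L (n + d) ^^ k) (Op \<nu>) = Op ((shift_op L n ^^ k) \<nu>)"
  and eq: "\<And>\<nu>. \<nu> \<in> D ==> Op \<nu> u1 u2 = (\<Sum>i\<in>I. c i * \<nu> (x i) (y i))"
 shows "exp_act L K (n + d) t (Op \<nu>) u1 u2 = exp (d * t) * (\<Sum>i\<in>I. c i * exp_act L K n t \<nu> (x i) (y i))"
proof -
 let ?S = "\<lambda>k. (shift_op L n ^^ k) \<nu>"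
 have "(\<Sum>k<K. t ^ k * ((\<Sum>i\<in>I. c i * ?S k (x i) (y i)) / fact k)) = (\<Sum>k<K. \<Sum>i\<in>I. c i * (t ^ k * (?S k (x i) (y i) / fact k)))"
  by (simp add: sum_distrib_left sum_divide_distrib algebra_simps)
 also have "\<dots> = (\<Sum>i\<in>I. c i * (\<Sum>k<K. t ^ k * (?S k (x i) (y i) / fact k)))"
  by (subst sum.swap) (simp only: sum_distrib_left)
 finally have "exp_act L K (n + d) t (Op \<nu>) u1 u2 = exp ((n + d) * t) * (\<Sum>i\<in>I. c i * (\<Sum>k<K. t ^ k * (?S k (x i) (y i) / fact k)))"
  unfolding exp_act_def sh by (simp only: eq[OF shift_pow_in_D[OF \<nu>]])
 also have "\<dots> = exp (d * t) * (\<Sum>i\<in>I. c i * exp_act L K n t \<nu> (x i) (y i))"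
 proof -
  have "exp ((n + d) * t) = exp (d * t) * exp (n * t)" by (subst mult.commute[of "exp (d * t)"]) (simp only: distrib_right exp_add)
  then show ?thesis unfolding exp_act_def by (simp add: sum_distrib_left mult_ac)
 qed
 finally show ?thesis .
qed

text \<open>
  An operator that raises the weight by \<open>d\<close> and is given by finite sums of operators on the arguments
  maps expansions to expansions.
\<close>

lemma expands_operator:
 fixes d :: real
 assumes e: "expands \<theta> F" and D: "\<And>\<nu>. \<nu> \<in> D ==> Op \<nu> \<in> D"
  and sh: "\<And>n k \<nu>. \<nu> \<in> D ==> (shift_op L (n + of_real d) ^^ k) (Op \<nu>) = Op ((shift_op L n ^^ k) \<nu>)"
  and Op0: "Op 0 = 0"
  and eq: "\<And>u1 u2. u1 \<in> carr W1 ==> u2 \<in> carr W2 ==> \<exists>I c x y. finite I \<and> (\<forall>i\<in>I. x i \<in> carr W1 \<and> y i \<in> carr W2) \<and>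
    (\<forall>\<nu>\<in>D. Op \<nu> u1 u2 = (\<Sum>i\<in>(I::nat set). c i * \<nu> (x i) (y i))) \<and> F' u1 u2 = (\<Sum>i\<in>I. c i * F (x i) (y i))"
 shows "expands (\<lambda>k. Op (\<theta> (k - d))) F'"
proof -
 obtain \<delta> where \<delta>: "\<delta> > 0" "\<And>u1 u2 t. u1 \<in> carr W1 ==> u2 \<in> carr W2 ==> norm t < \<delta> ==>
   (\<lambda>n. norm (exp_act L K (of_real n) t (\<theta> n) u1 u2)) summable_on UNIV" using expands_summable[OF e] by blast
 have k: "of_real k = of_real (k - d) + (of_real d :: complex)" for k by simp
 show ?thesis
 proof (rule expandsI[OF D[OF expands_D[OF e]] _ \<delta>(1)])
  show "(shift_op L (of_real n) ^^ K) (Op (\<theta> (n - d))) = 0" for n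
   unfolding k[of n] sh[OF expands_D[OF e]] expands_nil[OF e] by (rule Op0)
  fix u1 u2 assume u: "u1 \<in> carr W1" "u2 \<in> carr W2"
  obtain I :: "nat set" and c x y where I: "finite I" "\<And>i. i \<in> I ==> x i \<in> carr W1" "\<And>i. i \<in> I ==> y i \<in> carr W2"
   "\<And>\<nu>. \<nu> \<in> D ==> Op \<nu> u1 u2 = (\<Sum>i\<in>I. c i * \<nu> (x i) (y i))" "F' u1 u2 = (\<Sum>i\<in>I. c i * F (x i) (y i))"
   using eq[OF u] by blast
  show "(\<lambda>n. norm (exp_act L K (of_real n) t (Op (\<theta> (n - d))) u1 u2)) summable_on UNIV" if t: "norm t < \<delta>" for t
  proof -
   have ex: "exp_act L K (of_real n) t (Op (\<theta> (n - d))) u1 u2 =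
     (\<Sum>i\<in>I. (exp (of_real d * t) * c i) * exp_act L K (of_real (n + - d)) t (\<theta> (n + - d)) (x i) (y i))" for n
    unfolding k[of n] using exp_operator[OF expands_D[OF e] sh[OF expands_D[OF e]] I(4), where n = "of_real (n - d)" and t = t]
    by (simp only: sum_distrib_left mult.assoc diff_conv_add_uminus)
   show ?thesis unfolding ex
   proof (rule norm_summable_sum)
    fix i assume i: "i \<in> I"
    show "(\<lambda>n. norm (exp_act L K (of_real (n + - d)) t (\<theta> (n + - d)) (x i) (y i))) summable_on UNIV"
     by (rule summable_translate[where f = "\<lambda>n. norm (exp_act L K (of_real n) t (\<theta> n) (x i) (y i))", OF \<delta>(2)[OF I(2)[OF i] I(3)[OF i] t]])
   qed
  qed
  have "((\<lambda>n. \<Sum>i\<in>I. c i * \<theta> (n + - d) (x i) (y i)) has_sum (\<Sum>i\<in>I. c i * F (x i) (y i))) UNIV"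
  proof (rule has_sum_sum, rule has_sum_cmult_right)
   fix i assume i: "i \<in> I"
   show "((\<lambda>n. \<theta> (n + - d) (x i) (y i)) has_sum F (x i) (y i)) UNIV"
    by (rule has_sum_translate[where f = "\<lambda>n. \<theta> n (x i) (y i)", OF expands_has_sum[OF e I(2)[OF i] I(3)[OF i]]])
  qed
  then show "((\<lambda>n. Op (\<theta> (n - d)) u1 u2) has_sum F' u1 u2) UNIV"
   by (simp only: I(4)[OF expands_D[OF e]] I(5) diff_conv_add_uminus)
 qed
qed


lemma P_opp_eq_sum:
 assumes F0: "F 0 u2 = 0" and M: "\<And>c. c \<ge> int M ==> act W1 v c u1 = 0"
 shows "P_opp z W1 W2 F u1 u2 v s = F u1 (act W2 v s u2) + (\<Sum>i<M. bin z s i * F (act W1 v (int i) u1) u2)"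
 unfolding P_opp_def using Sum_any_delta_den[of M "\<lambda>c. F (act W1 v c u1) u2" z "- s - 1"] M F0 by simp

lemma expands_zero_left:
 assumes e: "expands \<theta> F" and u: "u2 \<in> carr W2"
 shows "F 0 u2 = 0"
proof -
 have "\<theta> n 0 u2 = 0" for n
  by (rule lin_zero[OF dual2_linear1[OF D_dual2[OF expands_D[OF e]] u] gm_zero[OF W1]])
 then have "((\<lambda>n::real. 0) has_sum F 0 u2) UNIV" using expands_has_sum[OF e gm_zero[OF W1] u] by simp
 then show ?thesis using has_sum_unique has_sum_0 by metis
qed

lemma expands_zero_right:
 assumes e: "expands \<theta> F" and u: "u1 \<in> carr W1"
 shows "F u1 0 = 0"
proof -
 have "\<theta> n u1 0 = 0" for n
  by (rule lin_zero[OF dual2_linear2[OF D_dual2[OF expands_D[OF e]] u] gm_zero[OF W2]])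
 then have "((\<lambda>n::real. 0) has_sum F u1 0) UNIV" using expands_has_sum[OF e u gm_zero[OF W2]] by simp
 then show ?thesis using has_sum_unique has_sum_0 by metis
qed

text \<open>
  The opposite action of the component $v_s$ on forms.
\<close>

abbreviation "opp v s \<equiv> opp_coeff V PD v (- s - 1)"

lemma opp_apply:
 assumes \<nu>: "\<nu> \<in> D" and u: "u1 \<in> carr W1" "u2 \<in> carr W2" and M: "\<And>c. c \<ge> int M ==> act W1 v c u1 = 0"
 shows "opp v s \<nu> u1 u2 = (\<Sum>i<Suc M. (if i < M then bin z s i else 1) *
   \<nu> (if i < M then act W1 v (int i) u1 else u1) (if i < M then u2 else act W2 v s u2))"
proof -
 have "opp v s \<nu> u1 u2 = \<nu> u1 (act W2 v s u2) + (\<Sum>i<M. bin z s i * \<nu> (act W1 v (int i) u1) u2)"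
  unfolding opp_coeff_P_module[OF W1 W2 D_dual2[OF \<nu>] u] by (rule P_opp_eq[OF W1 W2 D_dual2[OF \<nu>] u M])
 then show ?thesis by simp
qed

lemma expands_opp:
 assumes v: "v \<in> grv V \<alpha> \<inter> wtv V h" and e: "expands \<theta> F"
 shows "expands (\<lambda>k. opp v s (\<theta> (k - of_int (s + 1 - h)))) (\<lambda>u1 u2. P_opp z W1 W2 F u1 u2 v s)"
proof (rule expands_operator[OF e, where Op = "opp v s" and d = "of_int (s + 1 - h)"])
 show "opp v s \<nu> \<in> D" if "\<nu> \<in> D" for \<nu> by (rule opp_in_D[OF that])
 show "(shift_op L (n + of_real (of_int (s + 1 - h))) ^^ k) (opp v s \<nu>) = opp v s ((shift_op L n ^^ k) \<nu>)" if "\<nu> \<in> D" for n k \<nu>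
  using opp_shift_pow[OF v that, where n = n and s = s and k = k] by simp
 show "opp v s 0 = 0" by (rule opp_zero)
 fix u1 u2 assume u: "u1 \<in> carr W1" "u2 \<in> carr W2"
 obtain M :: nat where M: "\<And>c. c \<ge> int M ==> act W1 v c u1 = 0"
  using gm_trunc_finite[OF W1 u(1), of "{v}"] by blast
 let ?c = "\<lambda>i. if i < M then bin z s i else 1" and ?x = "\<lambda>i. if i < M then act W1 v (int i) u1 else u1"
  and ?y = "\<lambda>i. if i < M then u2 else act W2 v s u2"
 have eqF: "P_opp z W1 W2 F u1 u2 v s = F u1 (act W2 v s u2) + (\<Sum>i<M. bin z s i * F (act W1 v (int i) u1) u2)"
  by (rule P_opp_eq_sum[where F = F and ?u2.0 = u2, OF expands_zero_left[OF e u(2)]]) (rule M)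
 show "\<exists>I c x y. finite I \<and> (\<forall>i\<in>I. x i \<in> carr W1 \<and> y i \<in> carr W2) \<and>
    (\<forall>\<nu>\<in>D. opp v s \<nu> u1 u2 = (\<Sum>i\<in>(I::nat set). c i * \<nu> (x i) (y i))) \<and> P_opp z W1 W2 F u1 u2 v s = (\<Sum>i\<in>I. c i * F (x i) (y i))"
 proof (intro exI[of _ "{..<Suc M}"] exI[of _ ?c] exI[of _ ?x] exI[of _ ?y] conjI ballI)
  show "finite {..<Suc M}" by simp
  show "?x i \<in> carr W1" for i using u gm_act_in[OF W1] by simp
  show "?y i \<in> carr W2" for i using u gm_act_in[OF W2] by simp
  show "opp v s \<nu> u1 u2 = (\<Sum>i<Suc M. ?c i * \<nu> (?x i) (?y i))" if "\<nu> \<in> D" for \<nu> by (rule opp_apply[OF that u M])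
  show "P_opp z W1 W2 F u1 u2 v s = (\<Sum>i<Suc M. ?c i * F (?x i) (?y i))"
   using eqF by simp
 qed
qed

lemma expands_L:
 assumes j: "j \<in> {-1,0,1}" and e: "expands \<theta> F"
 shows "expands (\<lambda>k. P_L z W1 W2 (- j) (\<theta> (k - of_int j))) (P_L z W1 W2 (- j) F)"
proof (rule expands_operator[OF e, where Op = "P_L z W1 W2 (- j)" and d = "of_int j"])
 have mj: "- j \<in> {-1,0,1}" using j by auto
 interpret j: form_operator "P_L z W1 W2 (- j)" by (rule form_operator_P_L)
 show "P_L z W1 W2 (- j) \<nu> \<in> D" if "\<nu> \<in> D" for \<nu> by (rule L_in_D[OF mj that])
 show "(shift_op L (n + of_real (of_int j)) ^^ k) (P_L z W1 W2 (- j) \<nu>) = P_L z W1 W2 (- j) ((shift_op L n ^^ k) \<nu>)" if "\<nu> \<in> D" for n k \<nu>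
  using L_shift_pow[OF mj that, where n = n and k = k] by simp
 have "P_L z W1 W2 (- j) (0 *\<^sub>C 0) = 0 *\<^sub>C P_L z W1 W2 (- j) 0" by (rule j.L_scale)
 then show "P_L z W1 W2 (- j) 0 = 0" by (simp only: complex_vector.scale_zero_left)
 fix u1 u2 assume u: "u1 \<in> carr W1" "u2 \<in> carr W2"
 have extra: "(\<Sum>i<Suc m. (if i < m then a i else 1) * \<nu> (if i < m then x i else u1) (if i < m then u2 else y)) = \<nu> u1 y + (\<Sum>i<m. a i * \<nu> (x i) u2)"
  for m a x y and \<nu> :: "'a => 'b => complex" by simp
 let ?M = "Suc (nat (j + 1))"
 let ?c = "\<lambda>i. if i < ?M then of_nat (nat (j + 1) choose i) * z ^ i else 1" and ?x = "\<lambda>i. if i < ?M then Lm W1 (j - int i) u1 else u1"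
  and ?y = "\<lambda>i. if i < ?M then u2 else Lm W2 j u2"
 have PL: "P_L z W1 W2 (- j) \<nu> u1 u2 = (\<Sum>i<Suc ?M. ?c i * \<nu> (?x i) (?y i))" for \<nu>
 proof -
  have s: "{0..nat (j + 1)} = {..<?M}" by auto
  have "P_L z W1 W2 (- j) \<nu> u1 u2 = \<nu> u1 (Lm W2 j u2) + (\<Sum>i<?M. of_nat (nat (j + 1) choose i) * z ^ i * \<nu> (Lm W1 (j - int i) u1) u2)"
   unfolding P_L_def minus_minus s[symmetric] using u by (simp add: add.commute)
  also have "\<dots> = (\<Sum>i<Suc ?M. ?c i * \<nu> (?x i) (?y i))" by (rule extra[symmetric])
  finally show ?thesis .
 qed
 show "\<exists>I c x y. finite I \<and> (\<forall>i\<in>I. x i \<in> carr W1 \<and> y i \<in> carr W2) \<and>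
    (\<forall>\<nu>\<in>D. P_L z W1 W2 (- j) \<nu> u1 u2 = (\<Sum>i\<in>(I::nat set). c i * \<nu> (x i) (y i))) \<and> P_L z W1 W2 (- j) F u1 u2 = (\<Sum>i\<in>I. c i * F (x i) (y i))"
 proof (intro exI[of _ "{..<Suc ?M}"] exI[of _ ?c] exI[of _ ?x] exI[of _ ?y] conjI ballI)
  show "finite {..<Suc ?M}" by simp
  show "?x i \<in> carr W1" for i
  proof (cases "i < ?M")
   case True
   then have "j - int i \<in> {-1,0,1}" using j by auto
   then show ?thesis using u gm_L_in[OF W1] True by simp
  qed (use u in simp)
  show "?y i \<in> carr W2" for i using u gm_L_in[OF W2 j] by simp
 qed (rule PL)+
qed

text \<open>
  A family of fixed degree vanishes in sufficiently low weights of a coset of the integers.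
\<close>

lemma D_vanish_below:
 assumes \<theta>: "\<And>n. \<theta> n \<in> D" "\<And>n. (shift_op L (of_real n) ^^ K) (\<theta> n) = 0" "\<And>n. \<theta> n \<in> tensor_dual_gr W1 W2 \<beta>"
 shows "\<exists>M::nat. \<forall>c\<ge>M. \<theta> (k - of_int (int c + 1 - h)) = 0"
proof -
 obtain K0 :: int where K0: "\<forall>k'<K0. \<forall>\<nu>\<in>D. \<nu> \<in> tensor_dual_gr W1 W2 \<beta> -->
   (shift_op L (of_real (k - of_int (1 - h)) + of_int k') ^^ K) \<nu> = 0 --> \<nu> = 0" using D_bound by blast
 have "\<theta> (k - of_int (int c + 1 - h)) = 0" if c: "c \<ge> nat (1 - K0)" for c
 proof -
  have "(of_real (k - of_int (int c + 1 - h)) :: complex) = of_real (k - of_int (1 - h)) + of_int (- int c)" by simp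
  moreover have "- int c < K0" using c by linarith
  ultimately show ?thesis using K0 \<theta> by metis
 qed
 then show ?thesis by blast
qed

text \<open>
  The component of weight \<open>k\<close> of $\sum_c\binom{a}{c}z_2^{a-c}\,v^{opp}_c\theta$, where $v^{opp}_c$ denotes the
  opposite action of $v_c$, which raises the weight by $c+1-h$ if \<open>v\<close> has weight \<open>h\<close>.
\<close>

definition row_family where
 "row_family z2 v h a \<theta> k = Sum_any (\<lambda>c::nat. bin z2 a c *\<^sub>C opp v (int c) (\<theta> (k - of_int (int c + 1 - h))))"

text \<open>
  The form to which a row of expansions converges: the sum of
  $\binom{a}{c}z_2^{a-c}F(u_1,v_cu_2)$ and $\binom{a}{c}(z_2+z)^{a-c}F(v_cu_1,u_2)$ over \<open>c\<close>.
\<close>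

definition row_form where
 "row_form z2 v a F u1 u2 = Sum_any (\<lambda>c. delta_den z2 (- a - 1) c * F u1 (act W2 v c u2)) +
   Sum_any (\<lambda>c. delta_den (z2 + z) (- a - 1) c * F (act W1 v c u1) u2)"

lemma row_form_eq:
 assumes "F 0 u2 = 0" "F u1 0 = 0" "\<And>c. c \<ge> int M ==> act W1 v c u1 = 0" "\<And>c. c \<ge> int M' ==> act W2 v c u2 = 0"
 shows "row_form z2 v a F u1 u2 = (\<Sum>c<M'. bin z2 a c * F u1 (act W2 v (int c) u2)) + (\<Sum>i<M. bin (z2 + z) a i * F (act W1 v (int i) u1) u2)"
 unfolding row_form_def
 using Sum_any_delta_den[of M' "\<lambda>c. F u1 (act W2 v c u2)" z2 "- a - 1"]
  Sum_any_delta_den[of M "\<lambda>c. F (act W1 v c u1) u2" "z2 + z" "- a - 1"] assms by simp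

lemma row_family_eq:
 assumes M: "\<And>c. c \<ge> M ==> \<theta> (k - of_int (int c + 1 - h)) = 0"
 shows "row_family z2 v h a \<theta> k = (\<Sum>c<M. bin z2 a c *\<^sub>C opp v (int c) (\<theta> (k - of_int (int c + 1 - h))))"
 unfolding row_family_def
proof (rule Sum_any_nat)
 fix c assume c: "c \<ge> M"
 show "bin z2 a c *\<^sub>C opp v (int c) (\<theta> (k - of_int (int c + 1 - h))) = 0"
  unfolding M[OF c] opp_zero by (rule complex_vector.scale_zero_right)
qed

text \<open>
  The series over the weights and over \<open>c\<close> converges absolutely, also after application of
  $e^{tL'(0)}$, as long as $|e^tz|<|z_2|$; this holds for small \<open>t\<close>.  For each weight the sum over \<open>c\<close> is
  finite because the family has a fixed degree.
\<close>

lemma expands_row: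
 assumes v: "v \<in> grv V \<alpha> \<inter> wtv V h" and e: "expands \<theta> F" and gr: "\<And>n. \<theta> n \<in> tensor_dual_gr W1 W2 \<beta>"
  and z2: "norm z < norm z2"
 shows "expands (row_family z2 v h a \<theta>) (row_form z2 v a F)"
proof -
 let ?d = "\<lambda>c::nat. int c + 1 - h"
 let ?E = "\<lambda>t n. exp_act L K (of_real n) t (\<theta> n)" and ?R = "row_family z2 v h a \<theta>"
  and ?s = "\<lambda>k c. (k - of_int (?d c), c)"
 let ?X = "\<lambda>t k. exp_act L K (of_real k) t (?R k)"
 have "\<exists>M::nat. \<forall>c\<ge>M. \<theta> (k - of_int (?d c)) = 0" for k
  by (rule D_vanish_below[OF expands_D[OF e] expands_nil[OF e] gr])
 then obtain M where M: "\<And>k c. c \<ge> M k ==> \<theta> (k - of_int (?d c)) = 0" by metis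
 have R: "?R k = (\<Sum>c<M k. bin z2 a c *\<^sub>C opp v (int c) (\<theta> (k - of_int (?d c))))" for k
  by (rule row_family_eq) (rule M)
 obtain \<delta>1 where \<delta>1: "\<delta>1 > 0" "\<And>u1 u2 t. u1 \<in> carr W1 ==> u2 \<in> carr W2 ==> norm t < \<delta>1 ==>
   (\<lambda>n. norm (?E t n u1 u2)) summable_on UNIV" using expands_summable[OF e] by blast
 have "((\<lambda>t::complex. norm (exp t * z)) \<longlongrightarrow> norm (exp 0 * z)) (at 0)"
  by (intro tendsto_intros)
 then have "eventually (\<lambda>t. norm (exp t * z) < norm z2) (at 0)"
  by (rule order_tendstoD(2)) (use z2 in simp)
 then obtain \<delta>2 where \<delta>2: "\<delta>2 > 0" "\<And>t. t \<noteq> 0 ==> norm t < \<delta>2 ==> norm (exp t * z) < norm z2"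
  unfolding eventually_at by (auto simp: dist_norm)
 have small: "norm (exp t * z) < norm z2" if "norm t < \<delta>2" for t
  using \<delta>2(2)[OF _ that] z2 by (cases "t = 0") auto
 define \<delta> where "\<delta> = min \<delta>1 \<delta>2"
 have \<delta>: "\<delta> > 0" using \<delta>1(1) \<delta>2(1) by (simp add: \<delta>_def)
 define H where "H = (\<lambda>u1 u2 M1 t (n::real, c::nat). exp t ^ c * bin z2 a c * ?E t n u1 (act W2 v (int c) u2) +
   (\<Sum>i<M1. ?E t n (act W1 v (int i) u1) u2 * (exp t ^ c * (bin z2 a c * bin z (int c) i))))"
 have exH: "?X t k u1 u2 = (\<Sum>c<M k. exp (of_int (1 - h) * t) * H u1 u2 M1 t (?s k c))"
  and H0: "c \<ge> M k ==> H u1 u2 M1 t (?s k c) = 0"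
  if u: "u1 \<in> carr W1" "u2 \<in> carr W2" and M1: "\<And>c. c \<ge> int M1 ==> act W1 v c u1 = 0" for k t u1 u2 M1 c
 proof -
  have tm: "exp_act L K (of_real k) t (opp v (int c) (\<theta> (k - of_int (?d c)))) u1 u2 * bin z2 a c =
    exp (of_int (1 - h) * t) * H u1 u2 M1 t (?s k c)" for c
  proof -
   let ?n = "k - of_int (?d c)"
   have k: "of_real k = of_real ?n + (of_int (?d c) :: complex)" by simp
   have ed: "exp (of_int (?d c) * t) = exp (of_int (1 - h) * t) * exp t ^ c"
    by (simp add: exp_add[symmetric] exp_of_nat_mult[symmetric] algebra_simps)
   have "exp_act L K (of_real k) t (opp v (int c) (\<theta> ?n)) u1 u2 =
     exp (of_int (?d c) * t) * (\<Sum>i<Suc M1. (if i < M1 then bin z (int c) i else 1) *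
      exp_act L K (of_real ?n) t (\<theta> ?n) (if i < M1 then act W1 v (int i) u1 else u1) (if i < M1 then u2 else act W2 v (int c) u2))"
    unfolding k by (rule exp_operator[OF expands_D[OF e] opp_shift_pow[OF v expands_D[OF e]] opp_apply[OF _ u M1]])
   then show ?thesis unfolding ed by (simp add: H_def algebra_simps sum_distrib_left)
  qed
  have "?X t k u1 u2 = (\<Sum>c<M k. bin z2 a c * exp_act L K (of_real k) t (opp v (int c) (\<theta> (k - of_int (?d c)))) u1 u2)"
   unfolding R exp_act_combination[OF finite_lessThan] ..
  then show "?X t k u1 u2 = (\<Sum>c<M k. exp (of_int (1 - h) * t) * H u1 u2 M1 t (?s k c))"
   by (simp only: mult.commute[of "bin z2 a _"] tm)
  assume c: "c \<ge> M k"
  have "exp_act L K n t (0 *\<^sub>C 0) x y = 0" for n x y by (simp only: exp_act_scale mult_zero_left)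
  then have "exp_act L K n t 0 x y = 0" for n x y by (simp only: complex_vector.scale_zero_left)
  then have e0: "exp_act L K n t 0 x y = 0" for n x y .
  show "H u1 u2 M1 t (?s k c) = 0" unfolding H_def prod.case M[OF c] e0 by simp
 qed
 have bij: "bij_betw (\<lambda>(k::real, c::nat). (?s k c)) (UNIV \<times> UNIV) (UNIV \<times> UNIV)"
  by (rule bij_betw_byWitness[where f' = "\<lambda>(n, c). (n + of_int (?d c), c)"]) auto
 have trunc: "\<exists>M1 M2. (\<forall>c\<ge>int M1. act W1 v c u1 = 0) \<and> (\<forall>c\<ge>int M2. act W2 v c u2 = 0)" if u: "u1 \<in> carr W1" "u2 \<in> carr W2" for u1 u2
  using gm_trunc_finite[OF W1 u(1), of "{v}"] gm_trunc_finite[OF W2 u(2), of "{v}"] by blast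
 have E0: "?E t n u1 0 = 0" if "u1 \<in> carr W1" for n t u1
  unfolding exp_act_def
  using lin_zero[OF dual2_linear2[OF D_dual2[OF shift_pow_in_D[OF expands_D[OF e]]] that] gm_zero[OF W2]] by simp
 show ?thesis
 proof (rule expandsI[OF _ _ \<delta>])
  show "?R k \<in> D" for k unfolding R
   by (rule csub_sum[OF D_subspace]) (rule csub_scale[OF D_subspace opp_in_D[OF expands_D[OF e]]])
  show "(shift_op L (of_real k) ^^ K) (?R k) = 0" for k
  proof -
   have "opp v (int c) (\<theta> (k - of_int (?d c))) \<in> {\<nu>. (shift_op L (of_real k) ^^ K) \<nu> = 0}" for c
    using expands_nil[OF expands_opp[OF v e, of "int c"], of k] by simp
   then have "?R k \<in> {\<nu>. (shift_op L (of_real k) ^^ K) \<nu> = 0}" unfolding R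
    by (intro csub_sum[OF csubspace_nil] csub_scale[OF csubspace_nil])
   then show ?thesis by blast
  qed
  fix u1 u2 assume u: "u1 \<in> carr W1" "u2 \<in> carr W2"
  obtain M1 M2 where M1: "\<And>c. c \<ge> int M1 ==> act W1 v c u1 = 0" and M2: "\<And>c. c \<ge> int M2 ==> act W2 v c u2 = 0"
   using trunc[OF u] by blast
  show "(\<lambda>k. norm (?X t k u1 u2)) summable_on UNIV" if t: "norm t < \<delta>" for t
  proof -
   have t1: "norm t < \<delta>1" and t2: "norm t < \<delta>2" using t by (auto simp: \<delta>_def)
   have ss: "(\<lambda>n. norm (?E t n x y)) summable_on UNIV" if "x \<in> carr W1" "y \<in> carr W2" for x y
    by (rule \<delta>1(2)[OF that t1])
   have hs: "((\<lambda>n. ?E t n x y) has_sum infsum (\<lambda>n. ?E t n x y) UNIV) UNIV" if "x \<in> carr W1" "y \<in> carr W2" for x y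
    by (rule has_sum_infsum[OF Infinite_Sum.abs_summable_summable[OF ss[OF that]]])
   have "(\<lambda>p. norm (H u1 u2 M1 t p)) summable_on (UNIV \<times> UNIV)"
    unfolding H_def
    by (rule double_row(1)[where M = M2 and X = "\<lambda>c n. ?E t n u1 (act W2 v (int c) u2)"
       and Y = "\<lambda>i n. ?E t n (act W1 v (int i) u1) u2", OF hs ss _ hs ss z2 small[OF t2]])
     (use u gm_act_in[OF W1] gm_act_in[OF W2] M2 E0 in simp_all)
   then have "(\<lambda>p. norm (H u1 u2 M1 t ((\<lambda>(k, c). ?s k c) p))) summable_on (UNIV \<times> UNIV)"
    using summable_on_reindex_bij_betw[OF bij, of "\<lambda>p. norm (H u1 u2 M1 t p)"] by blast
   then have "(\<lambda>p. norm ((\<lambda>(k, c). H u1 u2 M1 t (?s k c)) p)) summable_on (UNIV \<times> UNIV)"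
    by (simp only: case_prod_unfold)
   then have "(\<lambda>k. norm (infsum (\<lambda>c. norm ((\<lambda>(k, c). H u1 u2 M1 t (?s k c)) (k, c))) UNIV)) summable_on UNIV"
    using Infinite_Sum.abs_summable_on_Sigma_iff[of "\<lambda>(k, c). H u1 u2 M1 t (?s k c)" UNIV "\<lambda>_. UNIV"] by blast
   then have inner: "(\<lambda>k. norm (infsum (\<lambda>c. norm (H u1 u2 M1 t (?s k c))) UNIV)) summable_on UNIV" by simp
   show ?thesis
   proof (rule Infinite_Sum.abs_summable_on_comparison_test'[OF summable_on_cmult_right[OF inner, of "norm (exp (of_int (1 - h) * t))"]])
    fix k
    have "infsum (\<lambda>c. norm (H u1 u2 M1 t (?s k c))) UNIV = (\<Sum>c<M k. norm (H u1 u2 M1 t (?s k c)))"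
     by (rule infsumI, rule has_sum_finite_neutralI[of "{..<M k}"]) (use H0[OF u M1] in auto)
    moreover have "norm (?X t k u1 u2) \<le>
      norm (exp (of_int (1 - h) * t)) * (\<Sum>c<M k. norm (H u1 u2 M1 t (?s k c)))"
    proof -
     have "?X t k u1 u2 = exp (of_int (1 - h) * t) * (\<Sum>c<M k. H u1 u2 M1 t (?s k c))"
      unfolding sum_distrib_left by (rule exH[OF u]) (rule M1)
     then have "norm (?X t k u1 u2) = norm (exp (of_int (1 - h) * t)) * norm (\<Sum>c<M k. H u1 u2 M1 t (?s k c))"
      by (simp only: norm_mult)
     also have "\<dots> \<le> norm (exp (of_int (1 - h) * t)) * (\<Sum>c<M k. norm (H u1 u2 M1 t (?s k c)))"
      by (rule mult_left_mono[OF norm_sum norm_ge_zero])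
     finally show ?thesis .
    qed
    ultimately show "norm (?X t k u1 u2) \<le>
      norm (exp (of_int (1 - h) * t)) * norm (infsum (\<lambda>c. norm (H u1 u2 M1 t (?s k c))) UNIV)"
     by (simp add: sum_nonneg)
   qed
  qed
  have hs: "((\<lambda>n. ?E 0 n x y) has_sum F x y) UNIV" "(\<lambda>n. norm (?E 0 n x y)) summable_on UNIV"
   if "x \<in> carr W1" "y \<in> carr W2" for x y
   using expands_has_sum[OF e that] expands_norm_summable[OF e that] by (simp_all only: exp_act_0[OF K(1)])
  have "(H u1 u2 M1 0 has_sum (\<Sum>c<M2. bin z2 a c * F u1 (act W2 v (int c) u2)) + (\<Sum>i<M1. F (act W1 v (int i) u1) u2 * bin (z2 + z) a i)) (UNIV \<times> UNIV)"
   unfolding H_def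
   by (rule double_row(2)[where M = M2 and X = "\<lambda>c n. ?E 0 n u1 (act W2 v (int c) u2)"
       and Y = "\<lambda>i n. ?E 0 n (act W1 v (int i) u1) u2", OF hs _ hs z2])
    (use u z2 gm_act_in[OF W1] gm_act_in[OF W2] M2 E0 in simp_all)
  then have "((\<lambda>p. H u1 u2 M1 0 ((\<lambda>(k, c). ?s k c) p)) has_sum row_form z2 v a F u1 u2) (UNIV \<times> UNIV)"
  proof -
   assume HS: "(H u1 u2 M1 0 has_sum (\<Sum>c<M2. bin z2 a c * F u1 (act W2 v (int c) u2)) + (\<Sum>i<M1. F (act W1 v (int i) u1) u2 * bin (z2 + z) a i)) (UNIV \<times> UNIV)"
   have "row_form z2 v a F u1 u2 = (\<Sum>c<M2. bin z2 a c * F u1 (act W2 v (int c) u2)) + (\<Sum>i<M1. bin (z2 + z) a i * F (act W1 v (int i) u1) u2)"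
    by (rule row_form_eq[where F = F and ?u1.0 = u1 and ?u2.0 = u2, OF expands_zero_left[OF e u(2)] expands_zero_right[OF e u(1)]]) (rule M1 M2; assumption)+
   then have "(H u1 u2 M1 0 has_sum row_form z2 v a F u1 u2) (UNIV \<times> UNIV)" using HS by (simp only: mult.commute[of "bin (z2 + z) a _"])
   then show ?thesis using has_sum_reindex_bij_betw[OF bij, of "H u1 u2 M1 0"] by blast
  qed
  then have HS: "((\<lambda>(k, c). H u1 u2 M1 0 (?s k c)) has_sum row_form z2 v a F u1 u2) (UNIV \<times> UNIV)"
   by (simp add: case_prod_unfold)
  show "((\<lambda>k. ?R k u1 u2) has_sum row_form z2 v a F u1 u2) UNIV"
  proof (rule has_sum_SigmaD[OF HS])
   fix k :: real
   have "?R k u1 u2 = (\<Sum>c<M k. H u1 u2 M1 0 (?s k c))"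
   proof -
    have "exp_act L K (of_real k) 0 (?R k) u1 u2 = (\<Sum>c<M k. exp (of_int (1 - h) * 0) * H u1 u2 M1 0 (?s k c))"
     by (rule exH[OF u]) (rule M1)
    then show ?thesis by (simp add: exp_act_0[OF K(1)])
   qed
   then show "((\<lambda>c. (\<lambda>(k, c). H u1 u2 M1 0 (?s k c)) (k, c)) has_sum ?R k u1 u2) UNIV"
    by (intro has_sum_finite_neutralI[of "{..<M k}"]) (use H0[OF u M1] in auto)
  qed
 qed
qed

end

section \<open>Functionals on the space of forms\<close>

context form_image
begin

text \<open>
  Linear functionals on \<open>D\<close> that vanish on homogeneous forms of all but finitely many weights.  The
  elements of the contragredient are of this kind, and composition with the opposite action or with
  $L'_{P(z)}(j)$ preserves it; so the sums over weights that occur below are finite without it having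
  to be known that the contragredient is a module.
\<close>

definition good_functional :: "(('a => 'b => complex) => complex) => bool" where
 "good_functional u \<longleftrightarrow> linear_map_on D UNIV u \<and>
   (\<exists>F. finite F \<and> (\<forall>n. n \<notin> F --> (\<forall>\<gamma>. \<forall>\<nu>\<in>D. \<nu> \<in> tensor_dual_gr W1 W2 \<gamma> --> (shift_op L n ^^ K) \<nu> = 0 --> u \<nu> = 0)))"

lemma good_linear: "good_functional u ==> linear_map_on D UNIV u"
 unfolding good_functional_def by blast

lemma good_zero: "good_functional u ==> u 0 = 0"
 by (rule lin_zero[OF good_linear D_zero])

lemma good_T: "w \<in> carr T ==> good_functional w"
 unfolding good_functional_def using T_linear T_support by blast

lemma good_add:
 assumes "good_functional u" "good_functional u'"
 shows "good_functional (\<lambda>\<nu>. u \<nu> + u' \<nu>)"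
proof -
 obtain F where F: "finite F" "\<And>n \<gamma> \<nu>. n \<notin> F ==> \<nu> \<in> D ==> \<nu> \<in> tensor_dual_gr W1 W2 \<gamma> ==> (shift_op L n ^^ K) \<nu> = 0 ==> u \<nu> = 0"
  using assms(1) unfolding good_functional_def by blast
 obtain F' where F': "finite F'" "\<And>n \<gamma> \<nu>. n \<notin> F' ==> \<nu> \<in> D ==> \<nu> \<in> tensor_dual_gr W1 W2 \<gamma> ==> (shift_op L n ^^ K) \<nu> = 0 ==> u' \<nu> = 0"
  using assms(2) unfolding good_functional_def by blast
 have "linear_map_on D UNIV (\<lambda>\<nu>. u \<nu> + u' \<nu>)"
  using good_linear[OF assms(1)] good_linear[OF assms(2)] unfolding linear_map_on_def by (simp add: distrib_left)
 moreover have "u \<nu> + u' \<nu> = 0" if n: "n \<notin> F \<union> F'" and \<nu>: "\<nu> \<in> D" "\<nu> \<in> tensor_dual_gr W1 W2 \<gamma>" "(shift_op L n ^^ K) \<nu> = 0" for n \<gamma> \<nu>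
  using F(2)[OF _ \<nu>] F'(2)[OF _ \<nu>] n by simp
 moreover have "finite (F \<union> F')" using F(1) F'(1) by simp
 ultimately show ?thesis unfolding good_functional_def by blast
qed

lemma good_operator:
 fixes d :: complex
 assumes u: "good_functional u" and lin: "linear_map_on D D Op"
  and gr: "\<And>\<nu> \<gamma> n. \<nu> \<in> D ==> \<nu> \<in> tensor_dual_gr W1 W2 \<gamma> ==> (shift_op L n ^^ K) \<nu> = 0 ==> \<exists>\<gamma>'. Op \<nu> \<in> tensor_dual_gr W1 W2 \<gamma>'"
  and sh: "\<And>\<nu> n. \<nu> \<in> D ==> (shift_op L (n + d) ^^ K) (Op \<nu>) = Op ((shift_op L n ^^ K) \<nu>)"
 shows "good_functional (\<lambda>\<nu>. u (Op \<nu>))"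
proof -
 obtain F where F: "finite F" "\<And>n \<gamma> \<nu>. n \<notin> F ==> \<nu> \<in> D ==> \<nu> \<in> tensor_dual_gr W1 W2 \<gamma> ==> (shift_op L n ^^ K) \<nu> = 0 ==> u \<nu> = 0"
  using u unfolding good_functional_def by blast
 have inD: "Op \<nu> \<in> D" if "\<nu> \<in> D" for \<nu> by (rule lin_in[OF lin that])
 have "linear_map_on D UNIV (\<lambda>\<nu>. u (Op \<nu>))"
  unfolding linear_map_on_def
 proof (intro conjI ballI allI UNIV_I)
  show "u (Op (x + y)) = u (Op x) + u (Op y)" if "x \<in> D" "y \<in> D" for x y
   unfolding lin_add[OF lin that] by (rule lin_add[OF good_linear[OF u] inD[OF that(1)] inD[OF that(2)]])
  show "u (Op (c *\<^sub>C x)) = c *\<^sub>C u (Op x)" if "x \<in> D" for c x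
   unfolding lin_scale[OF lin that] by (rule lin_scale[OF good_linear[OF u] inD[OF that]])
 qed
 moreover have "finite ((\<lambda>n. n - d) ` F)" using F(1) by simp
 moreover have "u (Op \<nu>) = 0" if n: "n \<notin> (\<lambda>n. n - d) ` F" and \<nu>: "\<nu> \<in> D" "\<nu> \<in> tensor_dual_gr W1 W2 \<gamma>" "(shift_op L n ^^ K) \<nu> = 0" for n \<gamma> \<nu>
 proof -
  have nF: "n + d \<notin> F" using n by force
  obtain \<gamma>' where g: "Op \<nu> \<in> tensor_dual_gr W1 W2 \<gamma>'" using gr[OF \<nu>] by blast
  have "(shift_op L (n + d) ^^ K) (Op \<nu>) = 0"
   unfolding sh[OF \<nu>(1)] \<nu>(3) by (rule lin_zero[OF lin D_zero])
  then show ?thesis by (rule F(2)[OF nF inD[OF \<nu>(1)] g])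
 qed
 ultimately show ?thesis unfolding good_functional_def by blast
qed

lemma good_opp:
 assumes u: "good_functional u"
 shows "good_functional (\<lambda>\<nu>. u (opp v s \<nu>))"
proof (induction v rule: va_hom_induct)
 case (hom \<alpha> h v)
 show ?case
 proof (rule good_operator[OF u opp_linear])
  show "\<exists>\<gamma>'. opp v s \<nu> \<in> tensor_dual_gr W1 W2 \<gamma>'" if "\<nu> \<in> D" "\<nu> \<in> tensor_dual_gr W1 W2 \<gamma>" "(shift_op L n ^^ K) \<nu> = 0" for \<nu> \<gamma> n
   using opp_gr[OF hom that] by blast
  show "(shift_op L (n + of_int (s + 1 - h)) ^^ K) (opp v s \<nu>) = opp v s ((shift_op L n ^^ K) \<nu>)" if "\<nu> \<in> D" for \<nu> n
   by (rule opp_shift_pow[OF hom that])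
 qed
next
 case (add v v')
 have "good_functional (\<lambda>\<nu>. u (opp v s \<nu>) + u (opp v' s \<nu>))" by (rule good_add[OF add])
 moreover have "u (opp (v + v') s \<nu>) = u (opp v s \<nu>) + u (opp v' s \<nu>)" if "\<nu> \<in> D" for \<nu>
  unfolding opp_v_add[OF that] by (rule lin_add[OF good_linear[OF u] opp_in_D[OF that] opp_in_D[OF that]])
 ultimately show ?case
  unfolding good_functional_def linear_map_on_def
  by (simp add: csub_add[OF D_subspace] csub_scale[OF D_subspace])
qed

lemma P_L_gr:
 assumes j: "j \<in> {-1,0,1}" and \<nu>: "\<nu> \<in> D" "\<nu> \<in> tensor_dual_gr W1 W2 \<gamma>" "(shift_op L n ^^ k) \<nu> = 0"
 shows "P_L z W1 W2 j \<nu> \<in> tensor_dual_gr W1 W2 \<gamma>"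
proof -
 obtain x where x: "x \<in> grm N \<gamma>" "x \<in> wtm N n" "f x = \<nu>" using D_hom_lift[OF \<nu>(1,3,2)] by blast
 show ?thesis
  unfolding x(3)[symmetric] f_L[OF j gm_wt_subset[OF N x(2)], symmetric] by (rule f_gr[OF gm_L_gr[OF N j x(1)]])
qed

lemma P_L_linear:
 assumes j: "j \<in> {-1,0,1}"
 shows "linear_map_on D D (P_L z W1 W2 j)"
proof -
 interpret j: form_operator "P_L z W1 W2 j" by (rule form_operator_P_L)
 show ?thesis unfolding linear_map_on_def using L_in_D[OF j] j.L_add j.L_scale by blast
qed

lemma good_L:
 assumes u: "good_functional u" and j: "j \<in> {-1,0,1}"
 shows "good_functional (\<lambda>\<nu>. u (P_L z W1 W2 j \<nu>))"
proof (rule good_operator[OF u P_L_linear[OF j]])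
 show "\<exists>\<gamma>'. P_L z W1 W2 j \<nu> \<in> tensor_dual_gr W1 W2 \<gamma>'" if "\<nu> \<in> D" "\<nu> \<in> tensor_dual_gr W1 W2 \<gamma>" "(shift_op L n ^^ K) \<nu> = 0" for \<nu> \<gamma> n
  using P_L_gr[OF j that] by blast
 show "(shift_op L (n + - of_int j) ^^ K) (P_L z W1 W2 j \<nu>) = P_L z W1 W2 j ((shift_op L n ^^ K) \<nu>)" if "\<nu> \<in> D" for \<nu> n
  using L_shift_pow[OF j that] by simp
qed

text \<open>
  The truncation holds uniformly on \<open>D\<close>, so the component $v_mw$ is \<open>0\<close> as an element of the
  contragredient for large \<open>m\<close>.
\<close>

lemma T_trunc:
 assumes w: "w \<in> carr T"
 shows "\<exists>N. \<forall>m\<ge>N. \<forall>\<nu>\<in>D. w (opp v m \<nu>) = 0"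
proof (induction v rule: va_hom_induct)
 case (hom \<alpha> h v)
 show ?case
  using w
 proof (induction w rule: contragredient_induct)
  case zero
  then show ?case by simp
 next
  case (add \<beta> n g w)
  obtain N1 where N1: "\<forall>m\<ge>N1. \<forall>\<nu>\<in>D. w (opp v m \<nu>) = 0" using add(3) by blast
  obtain K0 :: int where K0: "\<forall>k<K0. \<forall>\<nu>\<in>D. \<nu> \<in> tensor_dual_gr W1 W2 (- \<beta> - \<alpha>) -->
    (shift_op L (n + of_int (h - 1) + of_int k) ^^ K) \<nu> = 0 --> \<nu> = 0" using D_bound by blast
  have gT: "g \<in> carr T" using add(1) piece_subset by blast
  have gl: "linear_map_on D UNIV g" by (rule T_linear[OF gT])
  have "g (opp v m \<nu>) = 0" if m: "m \<ge> 1 - K0" and \<nu>: "\<nu> \<in> D" for m \<nu>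
  proof -
   obtain y where y: "\<nu> = f y" "y \<in> carr N" using \<nu> unfolding D by blast
   have "g (opp v m (f y)) = 0"
   proof (rule gm_hom_induct[OF N y(2)])
    fix \<gamma> k y assume y: "y \<in> grm N \<gamma>" "y \<in> wtm N k"
    have fD: "f y \<in> D" unfolding D using gm_wt_subset[OF N y(2)] by blast
    have fg: "f y \<in> tensor_dual_gr W1 W2 \<gamma>" by (rule f_gr[OF y(1)])
    have nil: "(shift_op L k ^^ K) (f y) = 0" by (rule f_wt[OF y(2)])
    have oD: "opp v m (f y) \<in> D" by (rule opp_in_D[OF fD])
    have og: "opp v m (f y) \<in> tensor_dual_gr W1 W2 (\<alpha> + \<gamma>)" by (rule opp_gr[OF hom fD fg nil])
    have on: "(shift_op L (k + of_int (m + 1 - h)) ^^ K) (opp v m (f y)) = 0"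
     unfolding opp_shift_pow[OF hom fD] nil by (rule opp_zero)
    show "g (opp v m (f y)) = 0"
    proof (cases "(\<alpha> + \<gamma>, k + of_int (m + 1 - h)) = (- \<beta>, n)")
     case True
     have "\<gamma> = - \<beta> - \<alpha>" using True by (auto simp: algebra_simps)
     moreover have "k = n + of_int (h - 1) + of_int (- m)" using True by auto
     moreover have "- m < K0" using m by simp
     ultimately have "f y = 0" using K0 fD fg nil by metis
     then show ?thesis using lin_zero[OF gl D_zero] by (simp only: opp_zero)
    next
     case False
     have "opp v m (f y) \<in> grm PD (\<alpha> + \<gamma>)" "opp v m (f y) \<in> wtm PD (k + of_int (m + 1 - h))"
      using oD og on by (auto simp: P_module_def wtm_def gen_eigenspace_def)
     then show ?thesis using piece_vanish[OF add(1)] False by blast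
    qed
   next
    fix x y assume x: "x \<in> carr N" "y \<in> carr N" and 0: "g (opp v m (f x)) = 0" "g (opp v m (f y)) = 0"
    have fD: "f x \<in> D" "f y \<in> D" unfolding D using x by blast+
    have "g (opp v m (f (x + y))) = g (opp v m (f x)) + g (opp v m (f y))"
     unfolding f_add[OF x] lin_add[OF opp_linear fD]
     by (rule lin_add[OF gl opp_in_D[OF fD(1)] opp_in_D[OF fD(2)]])
    then show "g (opp v m (f (x + y))) = 0" using 0 by simp
   qed
   then show ?thesis unfolding y(1) .
  qed
  then have "\<forall>m\<ge>max N1 (1 - K0). \<forall>\<nu>\<in>D. (g + w) (opp v m \<nu>) = 0" using N1 by simp
  then show ?case by blast
 qed
next
 case (add v v')
 then obtain N1 N2 where N12: "\<forall>m\<ge>N1. \<forall>\<nu>\<in>D. w (opp v m \<nu>) = 0" "\<forall>m\<ge>N2. \<forall>\<nu>\<in>D. w (opp v' m \<nu>) = 0" by blast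
 have "w (opp (v + v') m \<nu>) = 0" if "m \<ge> max N1 N2" "\<nu> \<in> D" for m \<nu>
  unfolding opp_v_add[OF that(2)] lin_add[OF T_linear[OF w] opp_in_D[OF that(2)] opp_in_D[OF that(2)]]
  using N12 that by simp
 then show ?case by blast
qed

end

section \<open>The expansion of a product\<close>

text \<open>
  The product of intertwining maps together with its expansion by forms in \<open>D\<close>.
\<close>

locale product_expansion =
 form_image A V z0 W1 W2 N f K D + intertwining_product A V W1 W2 W3 W4 M1 z1 z2 I1 I2
 for A :: "'g::ab_group_add set" and V :: "('v::complex_vector, 'g) valg" and z0 z1 z2 :: complex
  and W1 :: "('v, 'g, 'a::complex_vector) vmod" and W2 :: "('v, 'g, 'b::complex_vector) vmod"
  and W3 :: "('v, 'g, 'c::complex_vector) vmod" and W4 :: "('v, 'g, 'd::complex_vector) vmod"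
  and M1 :: "('v, 'g, 'm::complex_vector) vmod"
  and N :: "('v, 'g, 'n::complex_vector) vmod" and f :: "'n => 'a => 'b => complex" and K :: nat
  and D :: "('a => 'b => complex) set" and I1 I2 +
 fixes lam :: "('d => complex) => 'c => real => 'a => 'b => complex"
 assumes z0: "z0 = z1 - z2" "norm z0 < norm z2"
  and lam_expands: "\<And>x w3. x \<in> carr (contragredient V W4) ==> w3 \<in> carr W3 ==> expands (lam x w3) (\<lambda>u1 u2. prod_value x u1 u2 w3)"
begin

lemma z1: "z2 + z0 = z1" using z0(1) by simp
lemma z2: "z2 \<noteq> 0" using z0(2) by auto

lemma lam_add_left:
 assumes "x \<in> carr N4" "y \<in> carr N4" "w3 \<in> carr W3"
 shows "lam (x + y) w3 n = lam x w3 n + lam y w3 n"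
 by (rule expands_unique[OF lam_expands[OF gm_add[OF N4 assms(1,2)] assms(3)]
    expands_add[OF lam_expands[OF assms(1,3)] lam_expands[OF assms(2,3)]]])
  (rule prod_value_add_x[OF assms(1,2) _ _ assms(3)])

lemma lam_add_right:
 assumes "x \<in> carr N4" "w \<in> carr W3" "w' \<in> carr W3"
 shows "lam x (w + w') n = lam x w n + lam x w' n"
 by (rule expands_unique[OF lam_expands[OF assms(1) gm_add[OF W3 assms(2,3)]]
    expands_add[OF lam_expands[OF assms(1,2)] lam_expands[OF assms(1,3)]]])
  (rule prod_value_add_3[OF assms(1) _ _ assms(2,3)])

lemma lam_scale_left:
 assumes "x \<in> carr N4" "w3 \<in> carr W3"
 shows "lam (c *\<^sub>C x) w3 n = c *\<^sub>C lam x w3 n"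
 by (rule expands_unique[OF lam_expands[OF gm_scale[OF N4 assms(1)] assms(2)] expands_scale[OF lam_expands[OF assms]]])
  (rule prod_value_scale_x[OF assms(1) _ _ assms(2)])

lemma lam_scale_right:
 assumes "x \<in> carr N4" "w3 \<in> carr W3"
 shows "lam x (c *\<^sub>C w3) n = c *\<^sub>C lam x w3 n"
 by (rule expands_unique[OF lam_expands[OF assms(1) gm_scale[OF W3 assms(2)]] expands_scale[OF lam_expands[OF assms]]])
  (rule prod_value_scale_3[OF assms(1) _ _ assms(2)])

lemma lam_D: "x \<in> carr N4 ==> w3 \<in> carr W3 ==> lam x w3 n \<in> D"
 by (rule expands_D[OF lam_expands])

lemma lam_gr:
 assumes "x \<in> grm N4 \<beta>" "w3 \<in> grm W3 \<beta>3"
 shows "lam x w3 n \<in> tensor_dual_gr W1 W2 (\<beta> + \<beta>3)"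
proof (rule expands_gr[OF lam_expands[OF gm_gr_subset[OF N4 assms(1)] gm_gr_subset[OF W3 assms(2)]]])
 fix \<beta>1 \<beta>2 u1 u2 assume ne: "\<beta>1 + \<beta>2 \<noteq> - (\<beta> + \<beta>3)" and u: "u1 \<in> grm W1 \<beta>1" "u2 \<in> grm W2 \<beta>2"
 show "prod_value x u1 u2 w3 = 0"
 proof (rule prod_value_gr[OF assms(1) u assms(2)])
  show "\<beta>1 + (\<beta>2 + \<beta>3) \<noteq> - \<beta>"
  proof
   assume "\<beta>1 + (\<beta>2 + \<beta>3) = - \<beta>"
   then have "\<beta>1 + \<beta>2 + \<beta>3 - \<beta>3 = - \<beta> - \<beta>3" by (simp only: add.assoc)
   then have "\<beta>1 + \<beta>2 = - (\<beta> + \<beta>3)" by simp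
   then show False using ne by simp
  qed
 qed
qed

text \<open>
  $\widetilde G$ for an arbitrary functional \<open>u\<close> on forms.
\<close>

definition G where "G u x w3 = Sum_any (\<lambda>n. u (lam x w3 n))"

lemma good_finite:
 assumes u: "good_functional u" and x: "x \<in> carr N4" and w3: "w3 \<in> carr W3"
 shows "finite {n. u (lam x w3 n) \<noteq> 0}"
proof (rule ds_induct[OF gm_gr_ds[OF N4] x])
 fix \<beta> x assume x: "x \<in> grm N4 \<beta>"
 note xc = gm_gr_subset[OF N4 x]
 show "finite {n. u (lam x w3 n) \<noteq> 0}"
 proof (rule ds_induct[OF gm_gr_ds[OF W3] w3])
  fix \<beta>3 w3 assume w3: "w3 \<in> grm W3 \<beta>3"
  note wc = gm_gr_subset[OF W3 w3]
  obtain F where F: "finite F" "\<And>n \<gamma> \<nu>. n \<notin> F ==> \<nu> \<in> D ==> \<nu> \<in> tensor_dual_gr W1 W2 \<gamma> ==> (shift_op L n ^^ K) \<nu> = 0 ==> u \<nu> = 0"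
   using u unfolding good_functional_def by blast
  have "{n. u (lam x w3 n) \<noteq> 0} \<subseteq> of_real -` F"
   using F(2)[OF _ lam_D[OF xc wc] lam_gr[OF x w3] expands_nil[OF lam_expands[OF xc wc]]] by blast
  moreover have "finite ((of_real :: real => complex) -` F)" by (rule finite_vimageI[OF F(1)]) (simp add: inj_on_def)
  ultimately show "finite {n. u (lam x w3 n) \<noteq> 0}" by (rule finite_subset)
 next
  fix w w' assume w: "w \<in> carr W3" "w' \<in> carr W3" and fin: "finite {n. u (lam x w n) \<noteq> 0}" "finite {n. u (lam x w' n) \<noteq> 0}"
  have "u (lam x (w + w') n) = u (lam x w n) + u (lam x w' n)" for n
   unfolding lam_add_right[OF xc w] by (rule lin_add[OF good_linear[OF u] lam_D[OF xc w(1)] lam_D[OF xc w(2)]])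
  then have "{n. u (lam x (w + w') n) \<noteq> 0} \<subseteq> {n. u (lam x w n) \<noteq> 0} \<union> {n. u (lam x w' n) \<noteq> 0}" by auto
  then show "finite {n. u (lam x (w + w') n) \<noteq> 0}" using fin finite_subset by blast
 qed
next
 fix x y assume x: "x \<in> carr N4" "y \<in> carr N4" and fin: "finite {n. u (lam x w3 n) \<noteq> 0}" "finite {n. u (lam y w3 n) \<noteq> 0}"
 have "u (lam (x + y) w3 n) = u (lam x w3 n) + u (lam y w3 n)" for n
  unfolding lam_add_left[OF x w3] by (rule lin_add[OF good_linear[OF u] lam_D[OF x(1) w3] lam_D[OF x(2) w3]])
 then have "{n. u (lam (x + y) w3 n) \<noteq> 0} \<subseteq> {n. u (lam x w3 n) \<noteq> 0} \<union> {n. u (lam y w3 n) \<noteq> 0}" by auto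
 then show "finite {n. u (lam (x + y) w3 n) \<noteq> 0}" using fin finite_subset by blast
qed

lemma G_has_sum:
 "good_functional u ==> x \<in> carr N4 ==> w3 \<in> carr W3 ==> ((\<lambda>n. u (lam x w3 n)) has_sum G u x w3) UNIV"
 unfolding G_def by (rule Sum_any_has_sum[OF good_finite])

lemma G_add_u:
 assumes u: "good_functional u" "good_functional u'" and x: "x \<in> carr N4" "w3 \<in> carr W3"
 shows "G (\<lambda>\<nu>. u \<nu> + u' \<nu>) x w3 = G u x w3 + G u' x w3"
 unfolding G_def by (rule Sum_any.distrib[OF good_finite[OF u(1) x] good_finite[OF u(2) x]])

lemma G_cong: "x \<in> carr N4 ==> w3 \<in> carr W3 ==> (\<And>\<nu>. \<nu> \<in> D ==> u \<nu> = u' \<nu>) ==> G u x w3 = G u' x w3"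
 unfolding G_def using lam_D by simp

lemma G_add_left:
 assumes u: "good_functional u" and x: "x \<in> carr N4" "y \<in> carr N4" and w3: "w3 \<in> carr W3"
 shows "G u (x + y) w3 = G u x w3 + G u y w3"
 unfolding G_def lam_add_left[OF x w3] lin_add[OF good_linear[OF u] lam_D[OF x(1) w3] lam_D[OF x(2) w3]]
 by (rule Sum_any.distrib[OF good_finite[OF u x(1) w3] good_finite[OF u x(2) w3]])

lemma G_add_right:
 assumes u: "good_functional u" and x: "x \<in> carr N4" and w: "w \<in> carr W3" "w' \<in> carr W3"
 shows "G u x (w + w') = G u x w + G u x w'"
 unfolding G_def lam_add_right[OF x w] lin_add[OF good_linear[OF u] lam_D[OF x w(1)] lam_D[OF x w(2)]]
 by (rule Sum_any.distrib[OF good_finite[OF u x w(1)] good_finite[OF u x w(2)]])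

lemma G_scale_left:
 assumes u: "good_functional u" and x: "x \<in> carr N4" and w3: "w3 \<in> carr W3"
 shows "G u (c *\<^sub>C x) w3 = c * G u x w3"
 unfolding G_def lam_scale_left[OF x w3] lin_scale[OF good_linear[OF u] lam_D[OF x w3]] scaleC_complex
 by (rule Sum_any_right_distrib[OF good_finite[OF u x w3], symmetric])

lemma G_scale_right:
 assumes u: "good_functional u" and x: "x \<in> carr N4" and w3: "w3 \<in> carr W3"
 shows "G u x (c *\<^sub>C w3) = c * G u x w3"
 unfolding G_def lam_scale_right[OF x w3] lin_scale[OF good_linear[OF u] lam_D[OF x w3]] scaleC_complex
 by (rule Sum_any_right_distrib[OF good_finite[OF u x w3], symmetric])

lemma G_zero_left: "good_functional u ==> w3 \<in> carr W3 ==> G u 0 w3 = 0"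
 using G_scale_left[OF _ gm_zero[OF N4], of u w3 0] by (simp only: complex_vector.scale_zero_left mult_zero_left)

lemma G_zero_right: "good_functional u ==> x \<in> carr N4 ==> G u x 0 = 0"
 using G_scale_right[OF _ _ gm_zero[OF W3], of u x 0] by (simp only: complex_vector.scale_zero_left mult_zero_left)

text \<open>
  The transpose of the component $v_s$, acting on the contragredient of \<open>W4\<close>.
\<close>

abbreviation "adj v s x \<equiv> opp_coeff V N4 v (- s - 1) x"

lemma adj_in: "x \<in> carr N4 ==> adj v s x \<in> carr N4"
 by (rule opp_coeff_in[OF N4])

lemma lam_row:
 assumes v: "v \<in> grv V \<alpha> \<inter> wtv V h" and x: "x \<in> grm N4 \<beta>" and w3: "w3 \<in> grm W3 \<beta>3"
 shows "lam (adj v a x) w3 k - lam x (act W3 v a w3) k = row_family z2 v h a (lam x w3) k"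
proof -
 note xc = gm_gr_subset[OF N4 x] and wc = gm_gr_subset[OF W3 w3]
 show ?thesis
 proof (rule expands_unique[OF expands_diff[OF lam_expands[OF adj_in[OF xc] wc] lam_expands[OF xc gm_act_in[OF W3 wc]]]
    expands_row[OF v lam_expands[OF xc wc] lam_gr[OF x w3] z0(2)]])
  fix u1 u2 assume u: "u1 \<in> carr W1" "u2 \<in> carr W2"
  obtain M :: nat where M: "\<And>c. c \<ge> int M ==> act W1 v c u1 = 0" using gm_trunc_finite[OF W1 u(1), of "{v}"] by blast
  obtain M' :: nat where M': "\<And>c. c \<ge> int M' ==> act W2 v c u2 = 0" using gm_trunc_finite[OF W2 u(2), of "{v}"] by blast
  let ?F = "\<lambda>u1 u2. prod_value x u1 u2 w3"
  have "row_form z2 v a ?F u1 u2 = (\<Sum>c<M'. bin z2 a c * ?F u1 (act W2 v (int c) u2)) + (\<Sum>i<M. bin (z2 + z0) a i * ?F (act W1 v (int i) u1) u2)"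
   by (rule row_form_eq[where F = ?F, OF expands_zero_left[OF lam_expands[OF xc wc] u(2)] expands_zero_right[OF lam_expands[OF xc wc] u(1)]])
    (rule M M'; assumption)+
  moreover have "prod_value (adj v a x) u1 u2 w3 =
   (\<Sum>i<M. bin z1 a i * ?F (act W1 v (int i) u1) u2) + ((\<Sum>i<M'. bin z2 a i * ?F u1 (act W2 v (int i) u2)) + prod_value x u1 u2 (act W3 v a w3))"
   by (rule prod_value_row[OF hom_L0[OF v] xc u wc]) (rule M M'; assumption)+
  ultimately show "prod_value (adj v a x) u1 u2 w3 - prod_value x u1 u2 (act W3 v a w3) = row_form z2 v a ?F u1 u2"
   by (simp add: z1)
 qed
qed

text \<open>
  The row $J(a,0)$.  The finite double sum over the weight \<open>k\<close> and the index \<open>c\<close> is summed in both orders.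
\<close>

lemma G_row:
 assumes u: "good_functional u" and v: "v \<in> grv V \<alpha> \<inter> wtv V h" and x: "x \<in> grm N4 \<beta>" and w3: "w3 \<in> grm W3 \<beta>3"
 shows "Sum_any (\<lambda>c::nat. bin z2 a c * G (\<lambda>\<nu>. u (opp v (int c) \<nu>)) x w3) = G u (adj v a x) w3 - G u x (act W3 v a w3)"
proof -
 note xc = gm_gr_subset[OF N4 x] and wc = gm_gr_subset[OF W3 w3]
 note e = lam_expands[OF xc wc]
 let ?\<theta> = "lam x w3" and ?d = "\<lambda>c::nat. int c + 1 - h"
 define H where "H = (\<lambda>(k::real, c). bin z2 a c * u (opp v (int c) (?\<theta> (k - of_int (?d c)))))"
 have "\<exists>M::nat. \<forall>c\<ge>M. ?\<theta> (k - of_int (?d c)) = 0" for k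
  by (rule D_vanish_below[OF expands_D[OF e] expands_nil[OF e] lam_gr[OF x w3]])
 then obtain M where M: "\<And>k c. c \<ge> M k ==> ?\<theta> (k - of_int (?d c)) = 0" by metis
 obtain F where F: "finite F" "\<And>n \<gamma> \<nu>. n \<notin> F ==> \<nu> \<in> D ==> \<nu> \<in> tensor_dual_gr W1 W2 \<gamma> ==> (shift_op L n ^^ K) \<nu> = 0 ==> u \<nu> = 0"
  using u unfolding good_functional_def by blast
 let ?F = "(of_real :: real => complex) -` F"
 have finF: "finite ?F" by (rule finite_vimageI[OF F(1)]) (simp add: inj_on_def)
 have supp: "{p. H p \<noteq> 0} \<subseteq> (SIGMA k:?F. {..<M k})"
 proof
  fix p assume p: "p \<in> {p. H p \<noteq> 0}"
  obtain k c where kc: "p = (k, c)" by (cases p)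
  have ne: "u (opp v (int c) (?\<theta> (k - of_int (?d c)))) \<noteq> 0" using p by (auto simp: H_def kc)
  have "c < M k"
  proof (rule ccontr)
   assume "\<not> c < M k"
   then have "?\<theta> (k - of_int (?d c)) = 0" by (intro M) simp
   then show False using ne good_zero[OF u] by (simp only: opp_zero)
  qed
  moreover have "of_real k \<in> F"
  proof (rule ccontr)
   assume "of_real k \<notin> F"
   from F(2)[OF this expands_D[OF expands_opp[OF v e]] opp_gr[OF v expands_D[OF e] lam_gr[OF x w3] expands_nil[OF e]] expands_nil[OF expands_opp[OF v e]]]
   show False using ne by blast
  qed
  ultimately show "p \<in> (SIGMA k:?F. {..<M k})" by (simp add: kc)
 qed
 have finH: "finite {p. H p \<noteq> 0}" by (rule finite_subset[OF supp]) (use finF in simp)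
 define S where "S = Sum_any H"
 have HS: "(H has_sum S) (UNIV \<times> UNIV)" using Sum_any_has_sum[OF finH] by (simp add: S_def)
 have "((\<lambda>k. u (row_family z2 v h a ?\<theta> k)) has_sum S) UNIV"
 proof (rule has_sum_SigmaD[OF HS])
  fix k :: real
  have o: "opp v (int c) (?\<theta> n) \<in> D" for c n by (rule opp_in_D[OF expands_D[OF e]])
  have "row_family z2 v h a ?\<theta> k = (\<Sum>c<M k. bin z2 a c *\<^sub>C opp v (int c) (?\<theta> (k - of_int (?d c))))"
   by (rule row_family_eq) (rule M)
  then have "u (row_family z2 v h a ?\<theta> k) = u (\<Sum>c<M k. bin z2 a c *\<^sub>C opp v (int c) (?\<theta> (k - of_int (?d c))))" by (rule arg_cong)
  also have "\<dots> = (\<Sum>c<M k. u (bin z2 a c *\<^sub>C opp v (int c) (?\<theta> (k - of_int (?d c)))))"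
   by (rule lin_sum[OF good_linear[OF u] D_subspace]) (rule csub_scale[OF D_subspace o])
  also have "\<dots> = (\<Sum>c<M k. H (k, c))"
   by (rule sum.cong[OF refl]) (simp only: lin_scale[OF good_linear[OF u] o] H_def prod.case scaleC_complex)
  finally have eq: "u (row_family z2 v h a ?\<theta> k) = \<dots>" .
  show "((\<lambda>c. H (k, c)) has_sum u (row_family z2 v h a ?\<theta> k)) UNIV"
   unfolding eq by (rule has_sum_finite_neutralI[of "{..<M k}"]) (use supp in auto)
 qed
 moreover have "u (row_family z2 v h a ?\<theta> k) = u (lam (adj v a x) w3 k) - u (lam x (act W3 v a w3) k)" for k
  unfolding lam_row[OF v x w3, symmetric]
  by (rule lin_diff[OF good_linear[OF u] D_subspace lam_D[OF adj_in[OF xc] wc] lam_D[OF xc gm_act_in[OF W3 wc]]])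
 ultimately have "((\<lambda>k. u (lam (adj v a x) w3 k) - u (lam x (act W3 v a w3) k)) has_sum S) UNIV" by simp
 with has_sum_diff[OF G_has_sum[OF u adj_in[OF xc] wc] G_has_sum[OF u xc gm_act_in[OF W3 wc]]]
 have S1: "G u (adj v a x) w3 - G u x (act W3 v a w3) = S" by (rule has_sum_unique)
 have bij: "bij_betw (\<lambda>(c::nat, n::real). (n + of_int (?d c), c)) (UNIV \<times> UNIV) (UNIV \<times> UNIV)"
  by (rule bij_betw_byWitness[where f' = "\<lambda>(k, c). (c, k - of_int (?d c))"]) auto
 have "((\<lambda>p. H ((\<lambda>(c, n). (n + of_int (?d c), c)) p)) has_sum S) (UNIV \<times> UNIV)"
  using has_sum_reindex_bij_betw[OF bij, of H S] HS by blast
 then have H2: "((\<lambda>(c, n). bin z2 a c * u (opp v (int c) (?\<theta> n))) has_sum S) (UNIV \<times> UNIV)"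
  by (simp add: H_def case_prod_unfold)
 have hs: "((\<lambda>c. bin z2 a c * G (\<lambda>\<nu>. u (opp v (int c) \<nu>)) x w3) has_sum S) UNIV"
 proof (rule has_sum_SigmaD[OF H2])
  fix c :: nat
  show "((\<lambda>n. (\<lambda>(c, n). bin z2 a c * u (opp v (int c) (?\<theta> n))) (c, n)) has_sum bin z2 a c * G (\<lambda>\<nu>. u (opp v (int c) \<nu>)) x w3) UNIV"
   unfolding prod.case by (rule has_sum_cmult_right[OF G_has_sum[OF good_opp[OF u] xc wc]])
 qed
 have fin: "finite {c. bin z2 a c * G (\<lambda>\<nu>. u (opp v (int c) \<nu>)) x w3 \<noteq> 0}"
 proof (rule finite_subset)
  show "{c. bin z2 a c * G (\<lambda>\<nu>. u (opp v (int c) \<nu>)) x w3 \<noteq> 0} \<subseteq> snd ` {p. H p \<noteq> 0}"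
  proof
   fix c assume "c \<in> {c. bin z2 a c * G (\<lambda>\<nu>. u (opp v (int c) \<nu>)) x w3 \<noteq> 0}"
   then have ne: "bin z2 a c \<noteq> 0" "G (\<lambda>\<nu>. u (opp v (int c) \<nu>)) x w3 \<noteq> 0" by auto
   have "\<exists>n. u (opp v (int c) (?\<theta> n)) \<noteq> 0"
   proof (rule ccontr)
    assume "\<not> ?thesis"
    then have "G (\<lambda>\<nu>. u (opp v (int c) \<nu>)) x w3 = 0" unfolding G_def by simp
    with ne(2) show False by contradiction
   qed
   then obtain n where "u (opp v (int c) (?\<theta> n)) \<noteq> 0" by blast
   then have "H (n + of_int (?d c), c) \<noteq> 0" using ne(1) by (simp add: H_def)
   then show "c \<in> snd ` {p. H p \<noteq> 0}" by force
  qed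
 qed (use finH in simp)
 show ?thesis unfolding S1 by (rule has_sum_unique[OF Sum_any_has_sum[OF fin] hs])
qed

text \<open>
  The column $J(0,b)$.
\<close>

lemma G_column:
 assumes u: "good_functional u" and v: "v \<in> grv V \<alpha> \<inter> wtv V h" and x: "x \<in> carr N4" and w3: "w3 \<in> carr W3"
 shows "G (\<lambda>\<nu>. u (opp v b \<nu>)) x w3 =
  Sum_any (\<lambda>c. (of_int b gchoose c) * (- z2) ^ c * G u (adj v (b - int c) x) w3) - Sum_any (\<lambda>c. bin (- z2) b c * G u x (act W3 v (int c) w3))"
proof -
 note e = lam_expands[OF x w3]
 let ?g = "\<lambda>j. (of_int b gchoose j) * (- z2) ^ j :: complex"
 obtain Q where Q: "\<forall>q\<ge>Q. opp_coeff V N4 v q x = 0" using opp_coeff_trunc[OF N4 x] by blast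
 define J where "J = nat (Q + b + 1)"
 have J: "adj v (b - int j) x = 0" if "j \<ge> J" for j
 proof -
  have "- (b - int j) - 1 \<ge> Q" using that by (simp add: J_def nat_le_iff)
  then show ?thesis using Q by blast
 qed
 obtain M :: nat where M: "\<And>c. c \<ge> int M ==> act W3 v c w3 = 0" using gm_trunc_finite[OF W3 w3, of "{v}"] by blast
 have ac: "adj v s x \<in> carr N4" for s by (rule adj_in[OF x])
 have wc: "act W3 v s w3 \<in> carr W3" for s by (rule gm_act_in[OF W3 w3])
 let ?\<Theta> = "\<lambda>k. (\<Sum>j<J. ?g j *\<^sub>C lam (adj v (b - int j) x) w3 k) - (\<Sum>i<M. bin (- z2) b i *\<^sub>C lam x (act W3 v (int i) w3) k)"
 have \<Theta>: "?\<Theta> k = opp v b (lam x w3 (k - of_int (b + 1 - h)))" for k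
 proof (rule expands_unique[OF expands_diff[OF expands_combination[OF finite_lessThan lam_expands[OF ac w3]] expands_combination[OF finite_lessThan lam_expands[OF x wc]]]
    expands_opp[OF v e]])
  fix u1 u2 assume uc: "u1 \<in> carr W1" "u2 \<in> carr W2"
  obtain M1 :: nat where M1: "\<And>c. c \<ge> int M1 ==> act W1 v c u1 = 0" using gm_trunc_finite[OF W1 uc(1), of "{v}"] by blast
  let ?F = "\<lambda>u1 u2. prod_value x u1 u2 w3"
  have "P_opp z0 W1 W2 ?F u1 u2 v b = ?F u1 (act W2 v b u2) + (\<Sum>i<M1. bin z0 b i * ?F (act W1 v (int i) u1) u2)"
   by (rule P_opp_eq_sum[where F = ?F, OF expands_zero_left[OF e uc(2)]]) (rule M1)
  moreover have "(\<Sum>j<J. ?g j * prod_value (adj v (b - int j) x) u1 u2 w3) = (\<Sum>i<M1. bin (z1 - z2) b i * ?F (act W1 v (int i) u1) u2) +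
   (?F u1 (act W2 v b u2) + (\<Sum>i<M. bin (- z2) b i * prod_value x u1 u2 (act W3 v (int i) w3)))"
   by (rule prod_value_column[OF hom_L0[OF v] x uc w3]) (rule M1 M J; assumption)+
  ultimately show "(\<Sum>j<J. ?g j * prod_value (adj v (b - int j) x) u1 u2 w3) - (\<Sum>i<M. bin (- z2) b i * prod_value x u1 u2 (act W3 v (int i) w3)) =
   P_opp z0 W1 W2 ?F u1 u2 v b" by (simp add: z0(1))
 qed
 note ul = good_linear[OF u]
 have u\<Theta>: "u (?\<Theta> k) = (\<Sum>j<J. ?g j * u (lam (adj v (b - int j) x) w3 k)) - (\<Sum>i<M. bin (- z2) b i * u (lam x (act W3 v (int i) w3) k))" for k
 proof -
  have s: "u (\<Sum>i\<in>I. c i *\<^sub>C \<nu> i) = (\<Sum>i\<in>I. c i * u (\<nu> i))" if "\<And>i. \<nu> i \<in> D" for I :: "nat set" and c \<nu>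
  proof -
   have "u (\<Sum>i\<in>I. c i *\<^sub>C \<nu> i) = (\<Sum>i\<in>I. u (c i *\<^sub>C \<nu> i))"
    by (rule lin_sum[OF ul D_subspace]) (rule csub_scale[OF D_subspace that])
   then show ?thesis by (simp only: lin_scale[OF ul that] scaleC_complex)
  qed
  have sD: "(\<Sum>i\<in>I. c i *\<^sub>C \<nu> i) \<in> D" if "\<And>i. \<nu> i \<in> D" for I :: "nat set" and c \<nu>
   by (rule csub_sum[OF D_subspace]) (rule csub_scale[OF D_subspace that])
  show ?thesis
   unfolding lin_diff[OF ul D_subspace sD[OF lam_D[OF ac w3]] sD[OF lam_D[OF x wc]]] s[OF lam_D[OF ac w3]] s[OF lam_D[OF x wc]] ..
 qed
 have "((\<lambda>k. u (?\<Theta> k)) has_sum (\<Sum>j<J. ?g j * G u (adj v (b - int j) x) w3) - (\<Sum>i<M. bin (- z2) b i * G u x (act W3 v (int i) w3))) UNIV"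
  unfolding u\<Theta>
  by (intro has_sum_diff has_sum_sum has_sum_cmult_right G_has_sum[OF u ac w3] G_has_sum[OF u x wc])
 moreover have "((\<lambda>k. u (?\<Theta> k)) has_sum G (\<lambda>\<nu>. u (opp v b \<nu>)) x w3) UNIV"
  unfolding \<Theta>
  using has_sum_translate[OF G_has_sum[OF good_opp[OF u] x w3], of v b "- of_int (b + 1 - h)"] by (simp only: diff_conv_add_uminus)
 ultimately have "G (\<lambda>\<nu>. u (opp v b \<nu>)) x w3 = (\<Sum>j<J. ?g j * G u (adj v (b - int j) x) w3) - (\<Sum>i<M. bin (- z2) b i * G u x (act W3 v (int i) w3))"
  using has_sum_unique by blast
 also have "(\<Sum>j<J. ?g j * G u (adj v (b - int j) x) w3) = Sum_any (\<lambda>c. ?g c * G u (adj v (b - int c) x) w3)"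
 proof (rule Sum_any_nat[symmetric])
  fix c assume "c \<ge> J"
  then have "adj v (b - int c) x = 0" by (rule J)
  then have "G u (adj v (b - int c) x) w3 = 0" using G_zero_left[OF u w3] by (simp only:)
  then show "?g c * G u (adj v (b - int c) x) w3 = 0" by simp
 qed
 also have "(\<Sum>i<M. bin (- z2) b i * G u x (act W3 v (int i) w3)) = Sum_any (\<lambda>c. bin (- z2) b c * G u x (act W3 v (int c) w3))"
  by (rule Sum_any_nat[symmetric]) (simp add: M G_zero_right[OF u x])
 finally show ?thesis .
qed

abbreviation "pascal w v x w3 \<equiv> pascal_relation z2 (\<lambda>s. G w (adj v s x) w3) (\<lambda>s. G w x (act W3 v s w3))
 (\<lambda>s. G (\<lambda>\<nu>. w (opp v s \<nu>)) x w3)"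

context
 fixes w assumes w: "w \<in> carr T"
begin

lemma gw: "good_functional w" by (rule good_T[OF w])

lemma G_opp_trunc: "\<exists>N. \<forall>m\<ge>N. \<forall>x\<in>carr N4. \<forall>w3\<in>carr W3. G (\<lambda>\<nu>. w (opp v m \<nu>)) x w3 = 0"
proof -
 obtain N where N: "\<forall>m\<ge>N. \<forall>\<nu>\<in>D. w (opp v m \<nu>) = 0" using T_trunc[OF w] by blast
 then have "\<forall>m\<ge>N. \<forall>x\<in>carr N4. \<forall>w3\<in>carr W3. G (\<lambda>\<nu>. w (opp v m \<nu>)) x w3 = 0" unfolding G_def using lam_D by simp
 then show ?thesis by blast
qed

lemma pascal_hom:
 assumes v: "v \<in> grv V \<alpha> \<inter> wtv V h" and x: "x \<in> grm N4 \<beta>" and w3: "w3 \<in> grm W3 \<beta>3"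
 shows "pascal w v x w3"
proof -
 note xc = gm_gr_subset[OF N4 x] and wc = gm_gr_subset[OF W3 w3]
 obtain NC where NC: "\<forall>m\<ge>NC. \<forall>x\<in>carr N4. \<forall>w3\<in>carr W3. G (\<lambda>\<nu>. w (opp v m \<nu>)) x w3 = 0" using G_opp_trunc by blast
 obtain Q where Q: "\<forall>q\<ge>Q. opp_coeff V N4 v q x = 0" using opp_coeff_trunc[OF N4 xc] by blast
 obtain NB where NB: "\<forall>m\<ge>NB. act W3 v m w3 = 0" using gm_trunc[OF W3 wc] by blast
 show ?thesis
 proof (rule pascal_relationI[where NA = "- Q - 1" and NB = NB and NC = NC, OF z2])
  show "G w (adj v s x) w3 = 0" if "s \<le> - Q - 1" for s
  proof -
   have "- s - 1 \<ge> Q" using that by simp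
   then have "adj v s x = 0" using Q by blast
   then show ?thesis using G_zero_left[OF gw wc] by simp
  qed
  show "G w x (act W3 v s w3) = 0" if "s \<ge> NB" for s using NB that G_zero_right[OF gw xc] by simp
  show "G (\<lambda>\<nu>. w (opp v s \<nu>)) x w3 = 0" if "s \<ge> NC" for s using NC that xc wc by blast
 qed (rule G_row[OF gw v x w3] G_column[OF gw v xc wc])+
qed

lemma pascal_add_v:
 assumes p: "pascal w v x w3" "pascal w v' x w3" and x: "x \<in> carr N4" "w3 \<in> carr W3"
 shows "pascal w (v + v') x w3"
proof -
 have o: "G (\<lambda>\<nu>. w (opp (v + v') s \<nu>)) x w3 = G (\<lambda>\<nu>. w (opp v s \<nu>)) x w3 + G (\<lambda>\<nu>. w (opp v' s \<nu>)) x w3" for s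
  unfolding G_add_u[OF good_opp[OF gw] good_opp[OF gw] x, symmetric]
 proof (rule G_cong[OF x])
  fix \<nu> assume \<nu>: "\<nu> \<in> D"
  show "w (opp (v + v') s \<nu>) = w (opp v s \<nu>) + w (opp v' s \<nu>)"
   unfolding opp_v_add[OF \<nu>] by (rule lin_add[OF good_linear[OF gw] opp_in_D[OF \<nu>] opp_in_D[OF \<nu>]])
 qed
 show ?thesis
  unfolding o opp_coeff_v_add[OF N4 x(1)] gm_act_v_add[OF W3 x(2)] G_add_left[OF gw adj_in[OF x(1)] adj_in[OF x(1)] x(2)]
   G_add_right[OF gw x(1) gm_act_in[OF W3 x(2)] gm_act_in[OF W3 x(2)]]
  by (rule pascal_relation_add[OF p])
qed

lemma pascal_add_left:
 assumes p: "pascal w v x w3" "pascal w v y w3" and x: "x \<in> carr N4" "y \<in> carr N4" and w3: "w3 \<in> carr W3"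
 shows "pascal w v (x + y) w3"
 unfolding G_add_left[OF good_opp[OF gw] x w3] lin_add[OF opp_coeff_linear[OF N4] x] G_add_left[OF gw adj_in[OF x(1)] adj_in[OF x(2)] w3]
  G_add_left[OF gw x gm_act_in[OF W3 w3]]
 by (rule pascal_relation_add[OF p])

lemma pascal_add_right:
 assumes p: "pascal w v x w3" "pascal w v x w3'" and x: "x \<in> carr N4" and w3: "w3 \<in> carr W3" "w3' \<in> carr W3"
 shows "pascal w v x (w3 + w3')"
 unfolding G_add_right[OF good_opp[OF gw] x w3] G_add_right[OF gw adj_in[OF x] w3] lin_add[OF gm_act_linear[OF W3] w3]
  G_add_right[OF gw x gm_act_in[OF W3 w3(1)] gm_act_in[OF W3 w3(2)]]
 by (rule pascal_relation_add[OF p])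

lemma pascal_all:
 assumes x: "x \<in> carr N4" and w3: "w3 \<in> carr W3"
 shows "pascal w v x w3"
proof (induction v rule: va_hom_induct)
 case (hom \<alpha> h v)
 show ?case
 proof (rule ds_induct[OF gm_gr_ds[OF N4] x])
  fix \<beta> x assume x: "x \<in> grm N4 \<beta>"
  show "pascal w v x w3"
   by (rule ds_induct[OF gm_gr_ds[OF W3] w3])
    (rule pascal_hom[OF hom x] pascal_add_right[OF _ _ gm_gr_subset[OF N4 x]]; assumption)+
 qed (rule pascal_add_left[OF _ _ _ _ w3])
qed (rule pascal_add_v[OF _ _ x w3])

lemma intertwines:
 assumes x: "x \<in> carr N4" and w3: "w3 \<in> carr W3"
 shows "delta_mult z2 (\<lambda>m. G_tilde N4 W3 lam (act T v m w)) p q x w3 = tau_Q V z2 N4 W3 v p q (G_tilde N4 W3 lam w) x w3"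
proof -
 define a where "a = - q - 1"
 define b where "b = - p - 1"
 have Gact: "G_tilde N4 W3 lam (act T v m w) x w3 = G (\<lambda>\<nu>. w (opp v m \<nu>)) x w3" if "x \<in> carr N4" "w3 \<in> carr W3" for m x w3
  using that by (simp add: G_tilde_def G_def T_act[OF lam_D[OF that]])
 have Gw: "G_tilde N4 W3 lam w x w3 = G w x w3" if "x \<in> carr N4" "w3 \<in> carr W3" for x w3
  using that by (simp add: G_tilde_def G_def)
 obtain NC where NC: "\<forall>m\<ge>NC. \<forall>x\<in>carr N4. \<forall>w3\<in>carr W3. G (\<lambda>\<nu>. w (opp v m \<nu>)) x w3 = 0" using G_opp_trunc by blast
 have zero: "G_tilde N4 W3 lam (act T v m w) = 0" if m: "m \<ge> NC" for m
 proof (rule ext, rule ext)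
  fix x w3
  show "G_tilde N4 W3 lam (act T v m w) x w3 = 0 x w3"
  proof (cases "x \<in> carr N4 \<and> w3 \<in> carr W3")
   case True
   then have "G (\<lambda>\<nu>. w (opp v m \<nu>)) x w3 = 0" using NC m by blast
   then show ?thesis using Gact True by simp
  next
   case False
   then show ?thesis by (auto simp: G_tilde_def)
  qed
 qed
 obtain N where N: "\<And>s. s \<le> - N ==> G w (adj v s x) w3 = 0" "\<And>s. s \<ge> N ==> G w x (act W3 v s w3) = 0"
  and eq: "\<And>M. M \<ge> nat (N + \<bar>a\<bar> + \<bar>b\<bar>) ==> (\<Sum>c<M. bin z2 a c * G (\<lambda>\<nu>. w (opp v (b + int c) \<nu>)) x w3) =
    (\<Sum>c<M. (of_int b gchoose c) * (- z2) ^ c * G w (adj v (a + b - int c) x) w3) - (\<Sum>c<M. bin (- z2) b c * G w x (act W3 v (a + int c) w3))"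
  using pascal_all[OF x w3, of v] unfolding pascal_relation_def by blast
 define M where "M = max (nat (N + \<bar>a\<bar> + \<bar>b\<bar>)) (nat (NC - b))"
 have M: "int M \<ge> N + \<bar>a\<bar> + \<bar>b\<bar>" "int M \<ge> NC - b" by (auto simp: M_def)
 have ix: "int i - p - 1 = b + int i" "int i - q - 1 = a + int i" "q - (- p - 1 - int i) = - (a + b - int i) - 1" for i
  by (simp_all add: a_def b_def)
 have "delta_mult z2 (\<lambda>m. G_tilde N4 W3 lam (act T v m w)) p q = (\<Sum>i<M. bin z2 (- q - 1) i *\<^sub>C G_tilde N4 W3 lam (act T v (int i - p - 1) w))"
  unfolding delta_mult_def
 proof (rule Sum_any_delta_den)
  fix c assume "c \<ge> int M"
  then have "c - p - 1 \<ge> NC" using b_def M by linarith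
  then show "G_tilde N4 W3 lam (act T v (c - p - 1) w) = 0" by (rule zero)
 qed
 then have "delta_mult z2 (\<lambda>m. G_tilde N4 W3 lam (act T v m w)) p q x w3 = (\<Sum>c<M. bin z2 a c * G (\<lambda>\<nu>. w (opp v (b + int c) \<nu>)) x w3)"
  by (simp only: sum_fun_apply scaleC_fun_apply scaleC_complex Gact[OF x w3] ix a_def)
 also have "\<dots> = (\<Sum>c<M. (of_int b gchoose c) * (- z2) ^ c * G w (adj v (a + b - int c) x) w3) - (\<Sum>c<M. bin (- z2) b c * G w x (act W3 v (a + int c) w3))"
  by (rule eq) (simp add: M_def)
 also have "(\<Sum>c<M. (of_int b gchoose c) * (- z2) ^ c * G w (adj v (a + b - int c) x) w3) =
   Sum_any (\<lambda>b'. delta_snd z2 p b' * G w (opp_coeff V N4 v (q - b') x) w3)"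
 proof -
  have "Sum_any (\<lambda>b'. delta_snd z2 p b' *\<^sub>C G w (opp_coeff V N4 v (q - b') x) w3) =
    (\<Sum>i<M. ((of_int (- p - 1) gchoose i) * (- z2) ^ i) *\<^sub>C G w (opp_coeff V N4 v (q - (- p - 1 - int i)) x) w3)"
  proof (rule Sum_any_delta_snd)
   fix b' assume "b' \<le> - p - 1 - int M"
   then have "- (q - b') - 1 \<le> - N" using M a_def b_def by linarith
   from N(1)[OF this] show "G w (opp_coeff V N4 v (q - b') x) w3 = 0" by simp
  qed
  then show ?thesis by (simp only: ix b_def scaleC_complex)
 qed
 also have "(\<Sum>c<M. bin (- z2) b c * G w x (act W3 v (a + int c) w3)) = Sum_any (\<lambda>c. delta_fst_neg z2 p c * G w x (act W3 v (c - q - 1) w3))"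
 proof -
  have "Sum_any (\<lambda>c. delta_fst_neg z2 p c *\<^sub>C G w x (act W3 v (c - q - 1) w3)) = (\<Sum>i<M. bin (- z2) (- p - 1) i *\<^sub>C G w x (act W3 v (int i - q - 1) w3))"
  proof (rule Sum_any_delta_fst_neg)
   fix c assume "c \<ge> int M"
   then have "c - q - 1 \<ge> N" using M a_def by linarith
   then show "G w x (act W3 v (c - q - 1) w3) = 0" by (rule N(2))
  qed
  then show ?thesis by (simp only: ix b_def scaleC_complex)
 qed
 also have "Sum_any (\<lambda>b'. delta_snd z2 p b' * G w (opp_coeff V N4 v (q - b') x) w3) - Sum_any (\<lambda>c. delta_fst_neg z2 p c * G w x (act W3 v (c - q - 1) w3)) =
   tau_Q V z2 N4 W3 v p q (G_tilde N4 W3 lam w) x w3"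
  unfolding tau_Q_def using x w3 by (simp add: Gw opp_coeff_in[OF N4 x] gm_act_in[OF W3 w3])
 finally show ?thesis .
qed

lemma lam_L:
 assumes j: "j \<in> {-1,0,1}" and x: "x \<in> carr N4" and w3: "w3 \<in> carr W3"
 shows "P_L z0 W1 W2 (- j) (lam x w3 (k - of_int j)) =
  (\<Sum>i\<in>{0..nat (j + 1)}. (of_nat (nat (j + 1) choose i) * (- z2) ^ i) *\<^sub>C lam (Lm N4 (int i - j) x) w3 k) -
  (\<Sum>i\<in>{0..nat (j + 1)}. (of_nat (nat (j + 1) choose i) * (- z2) ^ i) *\<^sub>C lam x (Lm W3 (j - int i) w3) k)"
proof -
 let ?I = "{0..nat (j + 1)}" and ?c = "\<lambda>i. of_nat (nat (j + 1) choose i) * (- z2) ^ i :: complex"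
 have ji: "j - int i \<in> {-1,0,1}" "int i - j \<in> {-1,0,1}" if "i \<in> ?I" for i using that j by auto
 show ?thesis
 proof (rule expands_unique[OF expands_L[OF j lam_expands[OF x w3]] expands_diff[OF expands_combination[OF finite_atLeastAtMost lam_expands[OF gm_L_in[OF N4 ji(2) x] w3]]
     expands_combination[OF finite_atLeastAtMost lam_expands[OF x gm_L_in[OF W3 ji(1) w3]]]]])
  fix u1 u2 assume u: "u1 \<in> carr W1" "u2 \<in> carr W2"
  have one: "prod_value (Lm N4 (int i - j) x) u1 u2 w3 - prod_value x u1 u2 (Lm W3 (j - int i) w3) =
   (\<Sum>k = 0..nat (j - int i + 1). (of_nat (nat (j - int i + 1) choose k) * z2 ^ k) * prod_value x u1 (Lm W2 (j - int i - int k) u2) w3) +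
   (\<Sum>k = 0..nat (j - int i + 1). (of_nat (nat (j - int i + 1) choose k) * z1 ^ k) * prod_value x (Lm W1 (j - int i - int k) u1) u2 w3)" if "i \<in> ?I" for i
   using prod_value_L[OF ji(1)[OF that] x u w3] by simp
  have "(\<Sum>i\<in>?I. ?c i * prod_value (Lm N4 (int i - j) x) u1 u2 w3) - (\<Sum>i\<in>?I. ?c i * prod_value x u1 u2 (Lm W3 (j - int i) w3)) =
   (\<Sum>i\<in>?I. ?c i * (prod_value (Lm N4 (int i - j) x) u1 u2 w3 - prod_value x u1 u2 (Lm W3 (j - int i) w3)))"
   by (simp only: sum_subtractf right_diff_distrib)
  also have "\<dots> = (\<Sum>i\<in>?I. ?c i * ((\<Sum>k = 0..nat (j - int i + 1). (of_nat (nat (j - int i + 1) choose k) * z2 ^ k) * prod_value x u1 (Lm W2 (j - int i - int k) u2) w3) +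
   (\<Sum>k = 0..nat (j - int i + 1). (of_nat (nat (j - int i + 1) choose k) * z1 ^ k) * prod_value x (Lm W1 (j - int i - int k) u1) u2 w3)))"
   by (rule sum.cong[OF refl]) (simp only: one)
  also have "\<dots> = P_L z0 W1 W2 (- j) (\<lambda>u1 u2. prod_value x u1 u2 w3) u1 u2"
   using j u by (elim insertE emptyE) (simp_all add: P_L_def z0(1) numeral_2_eq_2 algebra_simps power2_eq_square)
  finally show "P_L z0 W1 W2 (- j) (\<lambda>u1 u2. prod_value x u1 u2 w3) u1 u2 =
   (\<Sum>i\<in>?I. ?c i * prod_value (Lm N4 (int i - j) x) u1 u2 w3) - (\<Sum>i\<in>?I. ?c i * prod_value x u1 u2 (Lm W3 (j - int i) w3))" by simp
 qed
qed

lemma intertwines_L: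
 assumes j: "j \<in> {-1,0,1}" and x: "x \<in> carr N4" and w3: "w3 \<in> carr W3"
 shows "G_tilde N4 W3 lam (Lm T j w) x w3 = Q_L z2 N4 W3 j (G_tilde N4 W3 lam w) x w3"
proof -
 let ?I = "{0..nat (j + 1)}" and ?c = "\<lambda>i. of_nat (nat (j + 1) choose i) * (- z2) ^ i :: complex"
 have ji: "j - int i \<in> {-1,0,1}" "int i - j \<in> {-1,0,1}" if "i \<in> ?I" for i using that j by auto
 have mj: "- j \<in> {-1,0,1}" using j by auto
 have Gw: "G_tilde N4 W3 lam w x w3 = G w x w3" if "x \<in> carr N4" "w3 \<in> carr W3" for x w3
  using that by (simp add: G_tilde_def G_def)
 have lD: "lam (Lm N4 (int i - j) x) w3 k \<in> D" "lam x (Lm W3 (j - int i) w3) k \<in> D" if "i \<in> ?I" for i k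
  by (rule lam_D[OF gm_L_in[OF N4 ji(2)[OF that] x] w3], rule lam_D[OF x gm_L_in[OF W3 ji(1)[OF that] w3]])
 note ul = good_linear[OF gw]
 have s: "w (\<Sum>i\<in>?I. ?c i *\<^sub>C \<nu> i) = (\<Sum>i\<in>?I. ?c i * w (\<nu> i))" if "\<And>i. i \<in> ?I ==> \<nu> i \<in> D" for \<nu>
 proof -
  have "w (\<Sum>i\<in>?I. ?c i *\<^sub>C \<nu> i) = (\<Sum>i\<in>?I. w (?c i *\<^sub>C \<nu> i))"
   by (rule lin_sum[OF ul D_subspace]) (rule csub_scale[OF D_subspace that])
  also have "\<dots> = (\<Sum>i\<in>?I. ?c i * w (\<nu> i))"
   by (rule sum.cong[OF refl]) (simp only: lin_scale[OF ul that] scaleC_complex)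
  finally show ?thesis .
 qed
 have sD: "(\<Sum>i\<in>?I. ?c i *\<^sub>C \<nu> i) \<in> D" if "\<And>i. i \<in> ?I ==> \<nu> i \<in> D" for \<nu>
  by (rule csub_sum[OF D_subspace]) (rule csub_scale[OF D_subspace that])
 have eq: "w (P_L z0 W1 W2 (- j) (lam x w3 (k - of_int j))) =
   (\<Sum>i\<in>?I. ?c i * w (lam (Lm N4 (int i - j) x) w3 k)) - (\<Sum>i\<in>?I. ?c i * w (lam x (Lm W3 (j - int i) w3) k))" for k
 proof -
  have "w (P_L z0 W1 W2 (- j) (lam x w3 (k - of_int j))) =
   w (\<Sum>i\<in>?I. ?c i *\<^sub>C lam (Lm N4 (int i - j) x) w3 k) - w (\<Sum>i\<in>?I. ?c i *\<^sub>C lam x (Lm W3 (j - int i) w3) k)"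
   unfolding lam_L[OF j x w3] by (rule lin_diff[OF ul D_subspace]) (rule sD, rule lD, assumption)+
  also have "w (\<Sum>i\<in>?I. ?c i *\<^sub>C lam (Lm N4 (int i - j) x) w3 k) = (\<Sum>i\<in>?I. ?c i * w (lam (Lm N4 (int i - j) x) w3 k))"
   by (rule s) (rule lD)
  also have "w (\<Sum>i\<in>?I. ?c i *\<^sub>C lam x (Lm W3 (j - int i) w3) k) = (\<Sum>i\<in>?I. ?c i * w (lam x (Lm W3 (j - int i) w3) k))"
   by (rule s) (rule lD)
  finally show ?thesis .
 qed
 have "((\<lambda>k. w (P_L z0 W1 W2 (- j) (lam x w3 (k + - of_int j)))) has_sum G (\<lambda>\<nu>. w (P_L z0 W1 W2 (- j) \<nu>)) x w3) UNIV"
  by (rule has_sum_translate[where f = "\<lambda>k. w (P_L z0 W1 W2 (- j) (lam x w3 k))", OF G_has_sum[OF good_L[OF gw mj] x w3]])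
 then have "((\<lambda>k. (\<Sum>i\<in>?I. ?c i * w (lam (Lm N4 (int i - j) x) w3 k)) - (\<Sum>i\<in>?I. ?c i * w (lam x (Lm W3 (j - int i) w3) k))) has_sum
   G (\<lambda>\<nu>. w (P_L z0 W1 W2 (- j) \<nu>)) x w3) UNIV"
  by (simp only: diff_conv_add_uminus[symmetric] eq)
 moreover have "((\<lambda>k. (\<Sum>i\<in>?I. ?c i * w (lam (Lm N4 (int i - j) x) w3 k)) - (\<Sum>i\<in>?I. ?c i * w (lam x (Lm W3 (j - int i) w3) k))) has_sum
   (\<Sum>i\<in>?I. ?c i * G w (Lm N4 (int i - j) x) w3) - (\<Sum>i\<in>?I. ?c i * G w x (Lm W3 (j - int i) w3))) UNIV"
 proof (rule has_sum_diff)
  show "((\<lambda>k. \<Sum>i\<in>?I. ?c i * w (lam (Lm N4 (int i - j) x) w3 k)) has_sum (\<Sum>i\<in>?I. ?c i * G w (Lm N4 (int i - j) x) w3)) UNIV"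
   by (rule has_sum_sum, rule has_sum_cmult_right, rule G_has_sum[OF gw gm_L_in[OF N4 ji(2) x] w3])
  show "((\<lambda>k. \<Sum>i\<in>?I. ?c i * w (lam x (Lm W3 (j - int i) w3) k)) has_sum (\<Sum>i\<in>?I. ?c i * G w x (Lm W3 (j - int i) w3))) UNIV"
   by (rule has_sum_sum, rule has_sum_cmult_right, rule G_has_sum[OF gw x gm_L_in[OF W3 ji(1) w3]])
 qed
 ultimately have "G (\<lambda>\<nu>. w (P_L z0 W1 W2 (- j) \<nu>)) x w3 = (\<Sum>i\<in>?I. ?c i * G w (Lm N4 (int i - j) x) w3) - (\<Sum>i\<in>?I. ?c i * G w x (Lm W3 (j - int i) w3))"
  by (rule has_sum_unique)
 also have "\<dots> = Q_L z2 N4 W3 j (G_tilde N4 W3 lam w) x w3"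
  unfolding Q_L_def using x w3
  by (simp add: Gw gm_L_in[OF N4 ji(2) x] gm_L_in[OF W3 ji(1) w3] right_diff_distrib sum_subtractf del: sum.atLeast0_atMost_Suc cong: sum.cong_simp)
 finally show ?thesis using x w3 by (simp add: G_tilde_def G_def T_L[OF lam_D[OF x w3]])
qed

end

lemma G_tilde_linear: "linear_map_on (carr T) (tensor_dual N4 W3) (G_tilde N4 W3 lam)"
 unfolding linear_map_on_def
proof (intro conjI ballI allI)
 have Gw: "G_tilde N4 W3 lam w x w3 = G w x w3" if "x \<in> carr N4" "w3 \<in> carr W3" for w x w3
  using that by (simp add: G_tilde_def G_def)
 have out: "G_tilde N4 W3 lam w x w3 = 0" if "x \<notin> carr N4 \<or> w3 \<notin> carr W3" for w x w3
  using that by (auto simp: G_tilde_def)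
 show "G_tilde N4 W3 lam w \<in> tensor_dual N4 W3" if w: "w \<in> carr T" for w
  unfolding tensor_dual_def
 proof (rule dual2I)
  note gw = good_T[OF w]
  show "linear_map_on (carr N4) UNIV (\<lambda>x. G_tilde N4 W3 lam w x y)" if y: "y \<in> carr W3" for y
   unfolding linear_map_on_def
   by (simp add: Gw y gm_add[OF N4] gm_scale[OF N4] G_add_left[OF gw _ _ y] G_scale_left[OF gw _ y] del: plus_fun_apply scaleC_fun_apply)
  show "linear_map_on (carr W3) UNIV (G_tilde N4 W3 lam w x)" if x: "x \<in> carr N4" for x
   unfolding linear_map_on_def
   by (simp add: Gw x gm_add[OF W3] gm_scale[OF W3] G_add_right[OF gw x] G_scale_right[OF gw x])
 qed (rule out)
 fix w assume w: "w \<in> carr T"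
 show "G_tilde N4 W3 lam (w + w') = G_tilde N4 W3 lam w + G_tilde N4 W3 lam w'" if w': "w' \<in> carr T" for w'
 proof (rule ext, rule ext)
  fix x w3
  show "G_tilde N4 W3 lam (w + w') x w3 = (G_tilde N4 W3 lam w + G_tilde N4 W3 lam w') x w3"
  proof (cases "x \<in> carr N4 \<and> w3 \<in> carr W3")
   case True
   have "G (w + w') x w3 = G (\<lambda>\<nu>. w \<nu> + w' \<nu>) x w3" by (simp add: G_def)
   also have "\<dots> = G w x w3 + G w' x w3" by (rule G_add_u[OF good_T[OF w] good_T[OF w']]) (use True in auto)
   finally show ?thesis using True by (simp add: Gw plus_fun_apply)
  qed (simp add: out)
 qed
 show "G_tilde N4 W3 lam (c *\<^sub>C w) = c *\<^sub>C G_tilde N4 W3 lam w" for c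
 proof (rule ext, rule ext)
  fix x w3
  show "G_tilde N4 W3 lam (c *\<^sub>C w) x w3 = (c *\<^sub>C G_tilde N4 W3 lam w) x w3"
  proof (cases "x \<in> carr N4 \<and> w3 \<in> carr W3")
   case True
   then have "G (c *\<^sub>C w) x w3 = c * G w x w3"
    unfolding G_def scaleC_fun_apply scaleC_complex by (intro Sum_any_right_distrib[symmetric] good_finite[OF good_T[OF w]]) auto
   then show ?thesis using True by (simp add: Gw)
  qed (simp add: out)
 qed
qed

end


text \<open>
  The series of the local grading restriction condition is an expansion in the sense used here: a form
  in \<open>D\<close> of a generalized weight is annihilated by the \<open>K\<close>-th power, and so the exponential series and
  the truncated one are both equal to the action of \<open>exp_act\<close>.
\<close>

lemma (in form_image) lgr_series_expands:
 assumes lgr: "lgr_series ss z W1 W2 F \<theta>" and D: "\<And>n. \<theta> n \<in> D"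
 shows "expands \<theta> F"
proof -
 have nil: "(shift_op L (of_real n) ^^ K) (\<theta> n) = 0" for n
 proof -
  let ?P = "\<lambda>\<beta>. tensor_dual_piece ss z W1 W2 \<beta> (of_real n)" and ?S = "shift_op L (of_real n)"
  let ?X = "{\<nu>. \<exists>k. (?S ^^ k) \<nu> = 0}"
  have "\<theta> n \<in> cspan (\<Union>\<beta>. ?P \<beta>)" using lgr unfolding lgr_series_def by blast
  moreover have "cspan (\<Union>\<beta>. ?P \<beta>) \<subseteq> ?X"
  proof (rule complex_vector.span_minimal)
   show "(\<Union>\<beta>. ?P \<beta>) \<subseteq> ?X"
   proof
    fix \<nu> assume "\<nu> \<in> (\<Union>\<beta>. ?P \<beta>)"
    then obtain \<beta> where \<nu>: "\<nu> \<in> ?P \<beta>" by blast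
    show "\<nu> \<in> ?X"
    proof (cases ss)
     case True
     then have "L \<nu> = of_real n *\<^sub>C \<nu>" using \<nu> by (simp only: tensor_dual_piece_def eigenspace_def if_True mem_Collect_eq)
     then have "shift_op L (of_real n) \<nu> = 0" unfolding shift_op_def by (simp only: diff_self)
     then have "(shift_op L (of_real n) ^^ 1) \<nu> = 0" by (simp only: funpow.simps One_nat_def o_apply id_apply)
     then show ?thesis by blast
    next
     case False
     then show ?thesis using \<nu> by (simp only: tensor_dual_piece_def gen_eigenspace_def if_False mem_Collect_eq)
    qed
   qed
   show "csubspace ?X"
   proof (rule complex_vector.subspaceI)
    show "0 \<in> ?X" using shift_pow_zero by blast
    show "c *\<^sub>C x \<in> ?X" if x: "x \<in> ?X" for c x
    proof -
     obtain k where "(?S ^^ k) x = 0" using x by blast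
     then have "(?S ^^ k) (c *\<^sub>C x) = 0" unfolding shift_pow_scale by (simp only: complex_vector.scale_zero_right)
     then show ?thesis by blast
    qed
    show "x + y \<in> ?X"
     if xy: "x \<in> ?X" "y \<in> ?X" for x y
    proof -
     obtain k l where kl: "(?S ^^ k) x = 0" "(?S ^^ l) y = 0" using xy by blast
     have "(?S ^^ max k l) x = 0" "(?S ^^ max k l) y = 0"
      by (rule shift_pow_mono[OF kl(1) max.cobounded1], rule shift_pow_mono[OF kl(2) max.cobounded2])
     then have "(?S ^^ max k l) (x + y) = 0" unfolding shift_pow_add by (simp only: add_0_right)
     then show ?thesis by blast
    qed
   qed
  qed
  ultimately obtain k where "(?S ^^ k) (\<theta> n) = 0" by blast
  then show ?thesis by (rule D_nilpotent[OF D])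
 qed
 obtain U N0 where U: "open U" "0 \<in> U" and lgrU: "\<And>u1 u2. u1 \<in> carr W1 ==> u2 \<in> carr W2 ==>
   (\<forall>t\<in>U. (\<forall>n. exp_P_L0 z W1 W2 t (\<theta> n) u1 u2 = lgr_term z W1 W2 N0 t \<theta> u1 u2 n) \<and>
       (\<lambda>n. norm (lgr_term z W1 W2 N0 t \<theta> u1 u2 n)) summable_on UNIV) \<and>
   (lgr_term z W1 W2 N0 0 \<theta> u1 u2 has_sum F u1 u2) UNIV"
  using lgr unfolding lgr_series_def by blast
 have ex: "exp_act L K (of_real n) t (\<theta> n) u1 u2 = exp_P_L0 z W1 W2 t (\<theta> n) u1 u2" for n t u1 u2
  unfolding exp_P_L0_def by (rule sums_unique[OF exp_series_sums[OF nil K(1)]])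
 have eq: "exp_act L K (of_real n) t (\<theta> n) u1 u2 = lgr_term z W1 W2 N0 t \<theta> u1 u2 n" if "t \<in> U" "u1 \<in> carr W1" "u2 \<in> carr W2" for n t u1 u2
  using lgrU[OF that(2,3)] that(1) unfolding ex by blast
 obtain \<delta> where \<delta>: "\<delta> > 0" "\<And>t. norm t < \<delta> ==> t \<in> U"
  using U unfolding open_dist by (auto simp: dist_norm)
 show ?thesis
 proof (rule expandsI[OF D nil \<delta>(1)])
  fix u1 u2 assume u: "u1 \<in> carr W1" "u2 \<in> carr W2"
  show "(\<lambda>n. norm (exp_act L K (of_real n) t (\<theta> n) u1 u2)) summable_on UNIV" if "norm t < \<delta>" for t
   unfolding eq[OF \<delta>(2)[OF that] u] using lgrU[OF u] \<delta>(2)[OF that] by blast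
  have "lgr_term z W1 W2 N0 0 \<theta> u1 u2 n = \<theta> n u1 u2" for n
   unfolding eq[OF U(2) u, symmetric] by (rule exp_act_0[OF K(1)])
  then have "lgr_term z W1 W2 N0 0 \<theta> u1 u2 = (\<lambda>n. \<theta> n u1 u2)" by (rule ext)
  then show "((\<lambda>n. \<theta> n u1 u2) has_sum F u1 u2) UNIV" using lgrU[OF u] by simp
 qed
qed

section \<open>The intertwining property\<close>

theorem lemma9p22:
  fixes A :: "'g::ab_group_add set"
    and V :: "('v::complex_vector, 'g) valg"
    and C :: "('v, 'g, 'u::complex_vector) vmod set"
    and ss :: bool
    and W1 W2 W3 W4 M1 :: "('v, 'g, 'u) vmod"
    and z0 z1 z2 :: complex
    and I1 I2 :: "'u \<Rightarrow> 'u \<Rightarrow> complex \<Rightarrow> 'u"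
    and G :: "('u \<Rightarrow> complex) \<Rightarrow> 'u \<Rightarrow> 'u \<Rightarrow> 'u \<Rightarrow> complex"
    and lam :: "('u \<Rightarrow> complex) \<Rightarrow> 'u \<Rightarrow> real \<Rightarrow> 'u \<Rightarrow> 'u \<Rightarrow> complex"
    and T :: "('v, 'g, ('u \<Rightarrow> 'u \<Rightarrow> complex) \<Rightarrow> complex) vmod"
    and Gt :: "(('u \<Rightarrow> 'u \<Rightarrow> complex) \<Rightarrow> complex) \<Rightarrow> ('u \<Rightarrow> complex) \<Rightarrow> 'u \<Rightarrow> complex"
  assumes algebra: "strongly_graded_vertex_algebra A V"
    and category: "module_category ss V C"
    and images: "closed_under_images V C"
    and convergence: "convergence_condition V C"
    and z: "z0 = z1 - z2" "norm z1 > norm z2" "norm z2 > norm z0" "norm z0 > 0"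
    and objects: "W1 \<in> C" "W2 \<in> C" "W3 \<in> C" "W4 \<in> C" "M1 \<in> C"
    and I1: "intertwining_map V z1 W4 W1 M1 I1"
    and I2: "intertwining_map V z2 M1 W2 W3 I2"
    and G: "G = transpose3 W1 W2 W3 (product_map V W4 I1 I2)"
    and tensor_product_exists: "\<exists>T0 B. is_tensor_product V C z0 W1 W2 T0 B"
    and lgr: "\<forall>w4'\<in>carr (contragredient V W4).
                local_grading_restriction ss V z0 W1 W2 W3 (G w4')"
    and lam: "\<forall>w4'\<in>carr (contragredient V W4). \<forall>w3\<in>carr W3.
                lgr_series ss z0 W1 W2 (\<lambda>w1 w2. G w4' w1 w2 w3) (lam w4' w3)"
    and generated: "\<forall>n. \<forall>w4'\<in>carr (contragredient V W4). \<forall>w3\<in>carr W3.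
                \<exists>S. included_object V C z0 W1 W2 S \<and>
                  generalized_submodule V
                    (P_module V z0 W1 W2
                      (P_generated ss V z0 W1 W2
                        (lgr_space ss V z0 W1 W2 (lam w4' w3)) {lam w4' w3 n}))
                    (P_module V z0 W1 W2 S)"
    and T: "T = boxtimes V C z0 W1 W2"
    and Gt: "Gt = G_tilde (contragredient V W4) W3 lam"
  shows
    \<comment> \<open>\<open>Gt\<close> is a well-defined linear map to $(W_4'\otimes W_3)^*$, given by finite sums, which
       intertwines the actions (coefficient of $x_0^p x_1^q$) and the \<open>sl(2)\<close>-actions\<close>
    "(\<forall>w4'\<in>carr (contragredient V W4). \<forall>w3\<in>carr W3. \<forall>n. lam w4' w3 n \<in> D_space V C z0 W1 W2) \<and>
     (\<forall>w\<in>carr T. \<forall>w4'\<in>carr (contragredient V W4). \<forall>w3\<in>carr W3.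
        finite {n. w (lam w4' w3 n) \<noteq> 0}) \<and>
     linear_map_on (carr T) (tensor_dual (contragredient V W4) W3) Gt \<and>
     (\<forall>v p q. \<forall>w\<in>carr T. \<forall>w4'\<in>carr (contragredient V W4). \<forall>w3\<in>carr W3.
        delta_mult z2 (\<lambda>m. Gt (act T v m w)) p q w4' w3 =
        tau_Q V z2 (contragredient V W4) W3 v p q (Gt w) w4' w3) \<and>
     (\<forall>j\<in>{-1,0,1}. \<forall>w\<in>carr T. \<forall>w4'\<in>carr (contragredient V W4). \<forall>w3\<in>carr W3.
        Gt (Lm T j w) w4' w3 = Q_L z2 (contragredient V W4) W3 j (Gt w) w4' w3)"
proof -
 let ?N4 = "contragredient V W4" and ?D = "D_space V C z0 W1 W2"
 have gm: "generalized_module V W" if "W \<in> C" for W by (rule category_generalized_module[OF category that])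
 have gN4: "generalized_module V ?N4"
  using category_contragredient[OF category objects(4)] unfolding in_category_def by blast
 have lamD: "lam x w3 n \<in> ?D" if x: "x \<in> carr ?N4" and w3: "w3 \<in> carr W3" for x w3 n
 proof -
  let ?X = "P_generated ss V z0 W1 W2 (lgr_space ss V z0 W1 W2 (lam x w3)) {lam x w3 n}"
  obtain S where S: "included_object V C z0 W1 W2 S"
   and sub: "generalized_submodule V (P_module V z0 W1 W2 ?X) (P_module V z0 W1 W2 S)"
   using generated x w3 by blast
  have "lam x w3 n \<in> ?X" unfolding P_generated_def by blast
  moreover have "?X \<subseteq> S" using sub unfolding generalized_submodule_def P_module_def by simp
  moreover have "S \<subseteq> ?D"
   by (rule sgva.included_object_subset_D_space[OF sgva.intro[OF algebra] category objects(1,2) S])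
  ultimately show ?thesis by blast
 qed
 obtain T0 B where B: "is_tensor_product V C z0 W1 W2 T0 B" using tensor_product_exists by blast
 have T0: "T0 \<in> C" and Bi: "intertwining_map V z0 T0 W1 W2 B"
  using B unfolding is_tensor_product_def by blast+
 note gT0 = gm[OF T0]
 let ?N = "contragredient V T0" and ?f = "transpose2 W1 W2 B"
 have inN: "in_category V C ?N" by (rule category_contragredient[OF category T0])
 then have gN: "generalized_module V ?N" unfolding in_category_def by blast
 obtain K where K: "K > 0" "\<And>n x. x \<in> wtm ?N n \<Longrightarrow> (shift_op (Lm ?N 0) n ^^ K) x = 0"
  using in_category_nilpotent[OF category inN] by blast
 note s = sgva.intro[OF algebra]
 note tr = Bi gm[OF objects(1)] gm[OF objects(2)] gT0 gN
 have FI: "form_image A V z0 W1 W2 ?N ?f K ?D"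
  by (intro form_image.intro s form_image_axioms.intro gm[OF objects(1)] gm[OF objects(2)] gN K D_space_eq_image[OF B gT0]
    sgva.transpose2_linear[OF s tr] sgva.transpose2_act[OF s tr] sgva.transpose2_L[OF s tr] sgva.transpose2_gr[OF s tr])
 have z20: "norm z2 > 0" using z(3,4) by linarith
 have conv: "(\<lambda>n. norm (pairing x (I1 w1 (I2 w2 w3 n)))) summable_on UNIV"
  if "x \<in> carr ?N4" "w1 \<in> carr W1" "w2 \<in> carr W2" "w3 \<in> carr W3" for x w1 w2 w3
  using convergence[unfolded convergence_condition_def, rule_format, OF objects, of z2 z1 I1 I2] z(2) z20 I1 I2 that by blast
 have IP: "intertwining_product A V W1 W2 W3 W4 M1 z1 z2 I1 I2"
  by (intro intertwining_product.intro s intertwining_product_axioms.intro gm objects gN4 I1 I2 z(2) conv)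
 interpret form_image A V z0 W1 W2 ?N ?f K ?D by (rule FI)
 interpret IP: intertwining_product A V W1 W2 W3 W4 M1 z1 z2 I1 I2 by (rule IP)
 have expands: "expands (lam x w3) (\<lambda>u1 u2. IP.prod_value x u1 u2 w3)" if x: "x \<in> carr ?N4" and w3: "w3 \<in> carr W3" for x w3
 proof (rule expands_cong[OF lgr_series_expands])
  show "lgr_series ss z0 W1 W2 (\<lambda>w1 w2. G x w1 w2 w3) (lam x w3)" using lam x w3 by blast
  show "lam x w3 n \<in> ?D" for n by (rule lamD[OF x w3])
  show "G x u1 u2 w3 = IP.prod_value x u1 u2 w3" if "u1 \<in> carr W1" "u2 \<in> carr W2" for u1 u2
   unfolding G transpose3_def using that w3 IP.pairing_product_map[OF that w3 x] by simp
 qed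
 interpret E: product_expansion A V z0 z1 z2 W1 W2 W3 W4 M1 ?N ?f K ?D I1 I2 lam
  by (intro product_expansion.intro FI IP product_expansion_axioms.intro z(1,3) expands)
 have T': "T = contragredient V (P_module V z0 W1 W2 ?D)" unfolding T boxtimes_def ..
 show ?thesis
  unfolding Gt T'
  using lamD E.good_finite[OF good_T] E.G_tilde_linear E.intertwines E.intertwines_L by blast
qed

end
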